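(* Let $n\ge 1$ and let $\Psi$ be a logarithmic growth function with $\Phi(x)=x\Psi'(x)$. Suppose that there exists a real number $\eta<1/2$ such that $$\Phi''(t)=O\big(t^{-\frac12}[\Phi'(t)]^{1+\eta}\big)\quad\text{when } t\to\infty,$$ and, if $n>1$, also $$\Psi''(t)=O\big(t^{-\frac12}[\Psi'(t)]^{1+\eta}\big)\quad\text{when } t\to\infty .$$ If $\nu$ is a nonnegative Borel measure on $\mathbb{C}^n$, then the following statements are equivalent: (i) $\nu$ is a Carleson measure for $\mathcal{A}^2(\Psi)$; (ii) there is a constant $C>0$ such that $$\int_{\mathbb{C}^n}\frac{|K_\Psi(w,z)|^2}{K_\Psi(z,z)}\,e^{-\Psi(|w|^2)}\,d\nu(w)\le C$$ for every $z$ in $\mathbb{C}^n$; (iii) for every positive number $r$, there is a positive number $C$ such that $\nu(B(z,r))\le C|B(z,r)|$ for every $z$ in $\mathbb{C}^n$; (iv) there exist a $\Psi$-lattice $(a_k)$ and a positive number $C$ such that $\nu(B(a_k,r))\le C|B(a_k,r)|$ for every $k$, where $r$ is the maximal covering radius for $(a_k)$.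
   Context: A logarithmic growth function is a $C^3$-function $\Psi:[0,+\infty)\to[0,+\infty)$ with $\Psi'(x)>0$, $\Psi''(x)\ge 0$, $\Psi'''(x)\ge 0$ for all $x$. Notation: $dV$ is Lebesgue measure on $\mathbb{C}^n$; $d\mu_\Psi(z)=e^{-\Psi(|z|^2)}dV(z)$; $|E|$ is the Lebesgue (Euclidean) volume of $E\subset\mathbb{C}^n$. The Fock space $\mathcal{A}^2(\Psi)$ is the closure of the holomorphic polynomials in $L^2(\mu_\Psi)$; it is a reproducing kernel Hilbert space of entire functions, with reproducing kernel $K_\Psi(z,w)$. $\nu$ is a Carleson measure for $\mathcal{A}^2(\Psi)$ if there is a positive constant $C$ such that $\int_{\mathbb{C}^n}|f(z)|^2e^{-\Psi(|z|^2)}d\nu(z)\le C\int_{\mathbb{C}^n}|f(z)|^2d\mu_\Psi(z)$ for every $f\in\mathcal{A}^2(\Psi)$. Bergman metric and distance: $\beta^2(z,\xi)=\sum_{j,k=1}^n\frac{\partial^2\log K_\Psi(z,z)}{\partial z_j\partial\bar z_k}\xi_j\bar\xi_k$, and $\varrho(z,w)=\inf_\gamma\int_0^1\beta(\gamma(t),\gamma'(t))\,dt$, the infimum being over all piecewise $C^1$-smooth curves $\gamma:[0,1]\to\mathbb{C}^n$ with $\gamma(0)=z$, $\gamma(1)=w$. Bergman ball: $B(z,a)=\{w:\varrho(z,w)<a\}$. A sequence of distinct points $(a_k)$ in $\mathbb{C}^n$ is a $\Psi$-lattice if there exists a positive number $r$ such that the balls $B(a_k,r)$ cover $\mathbb{C}^n$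 and the balls $B(a_k,r/2)$ are mutually disjoint. Such an $r$ is called a covering radius for $(a_k)$; the supremum of all covering radii is again a covering radius, called the maximal covering radius. *)

theory Defs
  imports "HOL-Analysis.Analysis" "HOL-Library.Landau_Symbols"
begin

text \<open>
  Derivative of a function on \<open>[0, \<infinity>)\<close>, one-sided at \<open>0\<close>.
\<close>
definition deriv0 :: "(real \<Rightarrow> real) \<Rightarrow> real \<Rightarrow> real"
  where "deriv0 f x = vector_derivative f (at x within {0..})"

definition log_growth :: "(real \<Rightarrow> real) \<Rightarrow> bool"
  where "log_growth \<Psi> \<longleftrightarrow>
    \<Psi> differentiable_on {0..} \<and>
    deriv0 \<Psi> differentiable_on {0..} \<and>
    deriv0 (deriv0 \<Psi>) differentiable_on {0..} \<and>
    continuous_on {0..} (deriv0 (deriv0 (deriv0 \<Psi>))) \<and>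
    (\<forall>x\<ge>0. \<Psi> x \<ge> 0 \<and> deriv0 \<Psi> x > 0 \<and> deriv0 (deriv0 \<Psi>) x \<ge> 0 \<and>
           deriv0 (deriv0 (deriv0 \<Psi>)) x \<ge> 0)"

definition Phi :: "(real \<Rightarrow> real) \<Rightarrow> real \<Rightarrow> real"
  where "Phi \<Psi> x = x * deriv0 \<Psi> x"

definition fock_measure :: "(real \<Rightarrow> real) \<Rightarrow> (complex ^ 'n) measure"
  where "fock_measure \<Psi> = density lborel (\<lambda>z. ennreal (exp (- \<Psi> ((norm z)\<^sup>2))))"

definition holomorphic_polynomials :: "((complex ^ 'n) \<Rightarrow> complex) set"
  where "holomorphic_polynomials =
    {p. \<exists>(A :: ('n \<Rightarrow> nat) set) c. finite A \<and>
          p = (\<lambda>z. \<Sum>\<alpha>\<in>A. c \<alpha> * (\<Prod>j\<in>UNIV. (z $ j) ^ \<alpha> j))}"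

definition entire :: "((complex ^ 'n) \<Rightarrow> complex) \<Rightarrow> bool"
  where "entire f \<longleftrightarrow>
    (\<forall>z. \<exists>L. (f has_derivative L) (at z) \<and> (\<forall>c v. L (c *s v) = c * L v))"

definition L2 :: "'a measure \<Rightarrow> ('a \<Rightarrow> complex) set"
  where "L2 M = {f \<in> borel_measurable M. (\<integral>\<^sup>+x. ennreal ((norm (f x))\<^sup>2) \<partial>M) < \<infinity>}"

text \<open>
  The elements of the \<open>L\<^sup>2\<close>-closure of the polynomials are classes modulo null sets; each class
  contains exactly one entire function, and it is this representative that we take. The choice
  matters because the functions are evaluated at points and integrated against measures that
  may be singular.
\<close>
definition fock_space :: "(real \<Rightarrow> real) \<Rightarrow> ((complex ^ 'n) \<Rightarrow> complex) set"
  where "fock_space \<Psi> =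
    {f \<in> L2 (fock_measure \<Psi>). entire f \<and>
       (\<forall>\<epsilon>>0. \<exists>p\<in>holomorphic_polynomials.
          (\<integral>\<^sup>+z. ennreal ((norm (f z - p z))\<^sup>2) \<partial>fock_measure \<Psi>) < ennreal \<epsilon>)}"

definition fock_kernel :: "(real \<Rightarrow> real) \<Rightarrow> complex ^ 'n \<Rightarrow> complex ^ 'n \<Rightarrow> complex"
  where "fock_kernel \<Psi> z w =
    (THE g. g \<in> fock_space \<Psi> \<and>
       (\<forall>f\<in>fock_space \<Psi>. f w = (\<integral>u. f u * cnj (g u) \<partial>fock_measure \<Psi>))) z"

definition carleson_measure :: "(real \<Rightarrow> real) \<Rightarrow> (complex ^ 'n) measure \<Rightarrow> bool"
  where "carleson_measure \<Psi> \<nu> \<longleftrightarrow>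
    (\<exists>C>0. \<forall>f\<in>fock_space \<Psi>.
       (\<integral>\<^sup>+z. ennreal ((norm (f z))\<^sup>2 * exp (- \<Psi> ((norm z)\<^sup>2))) \<partial>\<nu>)
       \<le> ennreal C * (\<integral>\<^sup>+z. ennreal ((norm (f z))\<^sup>2) \<partial>fock_measure \<Psi>))"

definition real_partial :: "complex ^ 'n \<Rightarrow> (complex ^ 'n \<Rightarrow> complex) \<Rightarrow> complex ^ 'n \<Rightarrow> complex"
  where "real_partial v u z = vector_derivative (\<lambda>t. u (z + t *\<^sub>R v)) (at 0)"

definition wirtinger :: "'n \<Rightarrow> (complex ^ 'n \<Rightarrow> complex) \<Rightarrow> complex ^ 'n \<Rightarrow> complex"
  where "wirtinger j u z =
    (real_partial (axis j 1) u z - \<i> * real_partial (axis j \<i>) u z) / 2"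

definition wirtinger_bar :: "'n \<Rightarrow> (complex ^ 'n \<Rightarrow> complex) \<Rightarrow> complex ^ 'n \<Rightarrow> complex"
  where "wirtinger_bar j u z =
    (real_partial (axis j 1) u z + \<i> * real_partial (axis j \<i>) u z) / 2"

text \<open>The kernel is real and positive on the diagonal, hence the real part.\<close>
definition bergman_metric :: "(real \<Rightarrow> real) \<Rightarrow> complex ^ 'n \<Rightarrow> complex ^ 'n \<Rightarrow> real"
  where "bergman_metric \<Psi> z \<xi> =
    sqrt (Re (\<Sum>j\<in>UNIV. \<Sum>k\<in>UNIV.
      wirtinger j (wirtinger_bar k (\<lambda>w. complex_of_real (ln (Re (fock_kernel \<Psi> w w))))) z
        * \<xi> $ j * cnj (\<xi> $ k)))"

text \<open>
  Lengths take values in \<open>[0, \<infinity>]\<close>: the library's piecewise \<open>C\<^sup>1\<close> paths may have an unbounded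
  derivative near the exceptional points, so some have infinite length. Such additional paths
  do not affect the infimum.
\<close>
definition bergman_dist :: "(real \<Rightarrow> real) \<Rightarrow> complex ^ 'n \<Rightarrow> complex ^ 'n \<Rightarrow> ennreal"
  where "bergman_dist \<Psi> z w =
    (INF \<gamma>\<in>{\<gamma>. \<gamma> piecewise_C1_differentiable_on {0..1} \<and> \<gamma> 0 = z \<and> \<gamma> 1 = w}.
       \<integral>\<^sup>+t\<in>{0..1}. ennreal (bergman_metric \<Psi> (\<gamma> t) (vector_derivative \<gamma> (at t))) \<partial>lborel)"

definition bergman_ball :: "(real \<Rightarrow> real) \<Rightarrow> complex ^ 'n \<Rightarrow> real \<Rightarrow> (complex ^ 'n) set"
  where "bergman_ball \<Psi> z a = {w. bergman_dist \<Psi> z w < ennreal a}"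

definition covering_radius :: "(real \<Rightarrow> real) \<Rightarrow> (nat \<Rightarrow> complex ^ 'n) \<Rightarrow> real \<Rightarrow> bool"
  where "covering_radius \<Psi> a r \<longleftrightarrow>
    r > 0 \<and> (\<Union>k. bergman_ball \<Psi> (a k) r) = UNIV \<and>
    disjoint_family (\<lambda>k. bergman_ball \<Psi> (a k) (r / 2))"

definition lattice_seq :: "(real \<Rightarrow> real) \<Rightarrow> (nat \<Rightarrow> complex ^ 'n) \<Rightarrow> bool"
  where "lattice_seq \<Psi> a \<longleftrightarrow> inj a \<and> (\<exists>r. covering_radius \<Psi> a r)"

definition max_covering_radius :: "(real \<Rightarrow> real) \<Rightarrow> (nat \<Rightarrow> complex ^ 'n) \<Rightarrow> real"
  where "max_covering_radius \<Psi> a = Sup {r. covering_radius \<Psi> a r}"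

end

theory Submission
  imports Defs "HOL-Complex_Analysis.Cauchy_Integral_Formula"
begin

text \<open>
  Put \<open>P = \<Psi>'\<close>, \<open>R = \<Psi>''\<close> and \<open>Q = \<Phi>' = P + x R\<close>. The growth condition makes \<open>Q\<close> slowly varying: at the
  point \<open>z\<close>, with \<open>x = |z|\<^sup>2\<close>, the weight is up to a holomorphic factor and a bounded factor constant
  on the ellipsoid centred at \<open>z\<close> with semi-axis \<open>Q\<^sup>-\<^sup>1\<^sup>/\<^sup>2\<close> in the direction of \<open>z\<close> and \<open>P\<^sup>-\<^sup>1\<^sup>/\<^sup>2\<close> in the
  directions orthogonal to it. Hence entire functions satisfy a weighted mean value inequality on
  these ellipsoids.

  The kernel is \<open>K(z,w) = F(\<langle>z,w\<rangle>)\<close>, where the Taylor coefficients \<open>c\<^sub>k\<close> of \<open>F\<close> are, up to explicit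
  factors, reciprocals of moments of \<open>e\<^sup>-\<^sup>\<Psi>\<close>. The weights \<open>c\<^sub>k x\<^sup>k / F(x)\<close> are a probability distribution
  of degrees. Convexity of \<open>\<Psi>\<close> in the variable \<open>ln x\<close> and the mean value inequality show that it is
  spread over a window of width \<open>(x Q)\<^sup>1\<^sup>/\<^sup>2\<close> around \<open>\<Phi>(x)\<close>, so that \<open>F(x)\<close> is comparable to
  \<open>e\<^sup>\<Psi> Q P\<^sup>n\<^sup>-\<^sup>1\<close>, its mean gives \<open>(log F)'\<close> comparable to \<open>P\<close>, and its variance gives
  \<open>(x (log F)')'\<close> comparable to \<open>Q\<close>. The Bergman metric is therefore comparable to
  \<open>P |\<xi>|\<^sup>2 + R |\<langle>\<xi>,z\<rangle>|\<^sup>2\<close>, and Bergman balls of fixed radius to the ellipsoids above.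

  Now (i) implies (ii) by testing on \<open>K(\<cdot>,z)\<close>. By Cauchy's estimate \<open>|K(\<cdot>,z)|\<^sup>2 e\<^sup>-\<^sup>\<Psi>\<close> is at least
  \<open>c K(z,z) / |B(z,\<delta>)|\<close> on a small ball \<open>B(z,\<delta>)\<close>, so (ii) gives (iii) for small radii; larger balls are
  covered by a bounded number of small ones. A maximal separated set is a lattice, which gives (iv).
  Finally the mean value inequality on the balls of a lattice, which overlap boundedly often, gives (i).
\<close>

section \<open>The Hermitian product\<close>

text \<open>All local statements use one yardstick, \<open>hh x = sqrt ((1 + x) / Q x)\<close>, the
  order of the change of |z|^2 under a radial move of length 1/sqrt Q. The bound \<eta> < 1/2 is
  what makes 1/sqrt Q Lipschitz in sqrt (1 + x), so that P, Q and 1 + x stay constant up to factors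
  over a small multiple of \<open>hh x\<close>. The main obstacle is the second derivative of log F:
  two-sided bounds for F cannot be differentiated. Reading it as a variance avoids this. Exponential
  moments of the degrees are values of F at x e^s with s small, so the size of F alone bounds the
  variance from above; a set of heavy degrees away from the mean bounds it from below. The first
  derivative is then recovered by integrating the second. No asymptotic expansion of moments is
  made. Upper bounds for F come from point evaluation, lower bounds only require the moments to be
  small on one window of degrees, and bounded x is settled by compactness. The curvature term of the
  metric alone is not compared with \<Psi>''; only the two eigenvalues, across and along z, are
  compared with P and Q.\<close>

definition herm :: "complex ^ 'n \<Rightarrow> complex ^ 'n \<Rightarrow> complex"
  where "herm z w = (\<Sum>j\<in>UNIV. z $ j * cnj (w $ j))"

lemma herm_add_left: "herm (x + y) z = herm x z + herm y z"
  by (simp add: herm_def sum.distrib algebra_simps)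

lemma herm_add_right: "herm z (x + y) = herm z x + herm z y"
  by (simp add: herm_def sum.distrib algebra_simps)

lemma herm_diff_left: "herm (x - y) z = herm x z - herm y z"
  by (simp add: herm_def sum_subtractf algebra_simps)

lemma herm_diff_right: "herm z (x - y) = herm z x - herm z y"
  by (simp add: herm_def sum_subtractf algebra_simps)

lemma herm_scale_left: "herm (c *s x) z = c * herm x z"
  by (simp add: herm_def sum_distrib_left algebra_simps)

lemma herm_scale_right: "herm z (c *s x) = cnj c * herm z x"
  by (simp add: herm_def sum_distrib_left algebra_simps)

lemma scaleR_eq_smult: "r *\<^sub>R x = complex_of_real r *s x"
  by (simp add: vec_eq_iff scaleR_conv_of_real[symmetric])

lemma herm_scaleR_left: "herm (r *\<^sub>R x) z = complex_of_real r * herm x z"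
  by (simp add: scaleR_eq_smult herm_scale_left)

lemma herm_scaleR_right: "herm z (r *\<^sub>R x) = complex_of_real r * herm z x"
  by (simp add: scaleR_eq_smult herm_scale_right)

lemma herm_zero [simp]: "herm 0 z = 0" "herm z 0 = 0"
  by (simp_all add: herm_def)

lemma cnj_herm: "cnj (herm z w) = herm w z"
  by (simp add: herm_def algebra_simps)

lemma Re_herm: "Re (herm z w) = z \<bullet> w"
  by (simp add: herm_def inner_vec_def inner_complex_def)

lemma herm_self: "herm z z = complex_of_real ((norm z)\<^sup>2)"
proof -
  have "Im (herm z z) = 0"
    by (simp add: herm_def algebra_simps)
  moreover have "Re (herm z z) = (norm z)\<^sup>2"
    by (simp add: Re_herm power2_norm_eq_inner)
  ultimately show ?thesis
    by (simp add: complex_eq_iff)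
qed

lemma norm_smult: "norm (c *s x) = norm c * norm x" for x :: "complex ^ 'n"
  by (simp add: norm_vec_def L2_set_right_distrib norm_mult)

text \<open>A unimodular phase makes the product real and nonnegative, and then the Cauchy-Schwarz
  inequality of the real inner product applies through \<open>Re_herm\<close>.\<close>

lemma norm_herm_le: "norm (herm z w) \<le> norm z * norm w"
proof (cases "herm z w = 0")
  case False
  define c where "c = cnj (herm z w) / norm (herm z w)"
  have "norm c = 1"
    using False by (simp add: c_def norm_divide)
  have "c * herm z w = norm (herm z w)"
    using False complex_norm_square[of "herm z w"]
    by (simp add: c_def field_simps power2_eq_square)
  then have "norm (herm z w) = Re (herm (c *s z) w)"
    by (simp add: herm_scale_left)
  also have "\<dots> \<le> norm (c *s z) * norm w"
    by (simp add: Re_herm norm_cauchy_schwarz)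
  also have "\<dots> = norm z * norm w"
    by (simp add: norm_smult \<open>norm c = 1\<close>)
  finally show ?thesis .
qed auto

lemma bounded_linear_herm: "bounded_linear (\<lambda>z. herm z w)"
  by (rule bounded_linear_intro[where K = "norm w"])
    (auto simp: herm_add_left herm_scaleR_left norm_herm_le, simp add: scaleR_conv_of_real)

lemma norm_add_herm:
  "(norm (z + w))\<^sup>2 = (norm z)\<^sup>2 + 2 * Re (herm w z) + (norm w)\<^sup>2"
  by (simp add: Re_herm power2_norm_eq_inner inner_add inner_commute)

lemma continuous_on_herm [continuous_intros]:
  "continuous_on S f \<Longrightarrow> continuous_on S g \<Longrightarrow> continuous_on S (\<lambda>x. herm (f x) (g x))"
  unfolding herm_def by (intro continuous_intros)

lemma continuous_on_smult [continuous_intros]: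
  "continuous_on S f \<Longrightarrow> continuous_on S g \<Longrightarrow> continuous_on S (\<lambda>x. f x *s (g x :: complex ^ 'n))"
  unfolding vector_scalar_mult_def by (intro continuous_intros)

section \<open>Entire functions of several variables\<close>

lemma entire_const: "entire (\<lambda>z. c)"
  unfolding entire_def by (intro allI exI[of _ "\<lambda>_. 0"]) auto

lemma entire_add: "entire f \<Longrightarrow> entire g \<Longrightarrow> entire (\<lambda>z. f z + g z)"
  unfolding entire_def
proof (intro allI)
  fix z
  assume f: "\<forall>z. \<exists>L. (f has_derivative L) (at z) \<and> (\<forall>c v. L (c *s v) = c * L v)"
    and g: "\<forall>z. \<exists>L. (g has_derivative L) (at z) \<and> (\<forall>c v. L (c *s v) = c * L v)"
  obtain L where L: "(f has_derivative L) (at z)" "\<forall>c v. L (c *s v) = c * L v" using f by blast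
  obtain M where M: "(g has_derivative M) (at z)" "\<forall>c v. M (c *s v) = c * M v" using g by blast
  show "\<exists>L. ((\<lambda>z. f z + g z) has_derivative L) (at z) \<and> (\<forall>c v. L (c *s v) = c * L v)"
    by (rule exI[of _ "\<lambda>v. L v + M v"])
      (use L M in \<open>auto intro!: derivative_eq_intros simp: algebra_simps\<close>)
qed

lemma entire_mult: "entire f \<Longrightarrow> entire g \<Longrightarrow> entire (\<lambda>z. f z * g z)"
  unfolding entire_def
proof (intro allI)
  fix z
  assume f: "\<forall>z. \<exists>L. (f has_derivative L) (at z) \<and> (\<forall>c v. L (c *s v) = c * L v)"
    and g: "\<forall>z. \<exists>L. (g has_derivative L) (at z) \<and> (\<forall>c v. L (c *s v) = c * L v)"
  obtain L where L: "(f has_derivative L) (at z)" "\<forall>c v. L (c *s v) = c * L v" using f by blast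
  obtain M where M: "(g has_derivative M) (at z)" "\<forall>c v. M (c *s v) = c * M v" using g by blast
  show "\<exists>L. ((\<lambda>z. f z * g z) has_derivative L) (at z) \<and> (\<forall>c v. L (c *s v) = c * L v)"
    by (rule exI[of _ "\<lambda>v. f z * M v + L v * g z"])
      (use L M in \<open>auto intro!: derivative_eq_intros simp: algebra_simps\<close>)
qed

lemma entire_diff: "entire f \<Longrightarrow> entire g \<Longrightarrow> entire (\<lambda>z. f z - g z)"
  using entire_add[of f "\<lambda>z. (- 1) * g z"] entire_mult[OF entire_const, of g "- 1"] by simp

lemma entire_sum: "(\<And>i. i \<in> I \<Longrightarrow> entire (f i)) \<Longrightarrow> entire (\<lambda>z. \<Sum>i\<in>I. f i z)"
  by (induction I rule: infinite_finite_induct) (auto intro: entire_const entire_add)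

lemma entire_prod: "(\<And>i. i \<in> I \<Longrightarrow> entire (f i)) \<Longrightarrow> entire (\<lambda>z. \<Prod>i\<in>I. f i z)"
  by (induction I rule: infinite_finite_induct) (auto intro: entire_const entire_mult)

lemma entire_power: "entire f \<Longrightarrow> entire (\<lambda>z. f z ^ k)"
  by (induction k) (auto intro: entire_const entire_mult)

lemma entire_nth: "entire (\<lambda>z. z $ j)"
  unfolding entire_def
  by (intro allI exI[of _ "\<lambda>v. v $ j"]) (auto intro!: bounded_linear_imp_has_derivative bounded_linear_vec_nth)

lemma entire_compose_holomorphic:
  assumes "F holomorphic_on UNIV" "entire f"
  shows "entire (\<lambda>z. F (f z))"
  unfolding entire_def
proof
  fix z
  obtain L where L: "(f has_derivative L) (at z)" "\<forall>c v. L (c *s v) = c * L v"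
    using assms(2) unfolding entire_def by blast
  have "(F has_field_derivative deriv F (f z)) (at (f z))"
    using assms(1) by (simp add: holomorphic_derivI)
  then have "(F has_derivative (\<lambda>h. deriv F (f z) * h)) (at (f z))"
    by (simp add: has_field_derivative_def)
  from has_derivative_compose[OF L(1) this] L(2)
  show "\<exists>L. ((\<lambda>z. F (f z)) has_derivative L) (at z) \<and> (\<forall>c v. L (c *s v) = c * L v)"
    by (intro exI[of _ "\<lambda>v. deriv F (f z) * L v"]) auto
qed

lemma entire_herm: "entire (\<lambda>z. herm z w)"
  unfolding entire_def
  by (intro allI exI[of _ "\<lambda>v. herm v w"])
    (auto intro!: bounded_linear_imp_has_derivative bounded_linear_herm simp: herm_scale_left)

lemma entire_compose_affine:
  assumes "entire f" "linear T" "\<And>c v. T (c *s v) = c *s T v"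
  shows "entire (\<lambda>u. f (z + T u))"
  unfolding entire_def
proof
  fix u
  obtain L where L: "(f has_derivative L) (at (z + T u))" "\<forall>c v. L (c *s v) = c * L v"
    using assms(1) unfolding entire_def by blast
  have "((\<lambda>u. z + T u) has_derivative T) (at u)"
    using assms(2) by (auto intro!: derivative_eq_intros bounded_linear_imp_has_derivative
        simp: linear_conv_bounded_linear)
  from has_derivative_compose[OF this L(1)] L(2) assms(3)
  show "\<exists>L. ((\<lambda>u. f (z + T u)) has_derivative L) (at u) \<and> (\<forall>c v. L (c *s v) = c * L v)"
    by (intro exI[of _ "\<lambda>v. L (T v)"]) auto
qed

lemma entire_imp_continuous_on: "entire f \<Longrightarrow> continuous_on S f"
  unfolding entire_def
  by (meson continuous_at_imp_continuous_on has_derivative_continuous)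

lemma entire_imp_borel_measurable: "entire f \<Longrightarrow> f \<in> borel_measurable borel"
  by (simp add: entire_imp_continuous_on borel_measurable_continuous_onI)

text \<open>Complex linearity of the derivative is what survives restriction to a complex line
  through the origin; through such slices the one-variable Cauchy theory becomes available.\<close>

lemma entire_slice_holomorphic:
  assumes "entire f"
  shows "(\<lambda>c. f (c *s u)) holomorphic_on UNIV"
proof -
  have "\<exists>d. ((\<lambda>c. f (c *s u)) has_field_derivative d) (at c)" for c
  proof -
    obtain L where L: "(f has_derivative L) (at (c *s u))" "\<forall>c v. L (c *s v) = c * L v"
      using assms(1) unfolding entire_def by blast
    have "linear (\<lambda>c. c *s u)"
      by (rule linearI) (auto simp: scaleR_eq_smult vector_sadd_rdistrib scaleR_conv_of_real vector_smult_assoc)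
    then have "((\<lambda>c. c *s u) has_derivative (\<lambda>c. c *s u)) (at c)"
      by (intro bounded_linear_imp_has_derivative) (simp add: linear_conv_bounded_linear)
    from has_derivative_compose[OF this L(1)] L(2)
    have "((\<lambda>c. f (c *s u)) has_derivative (\<lambda>c. L u * c)) (at c)"
      by (simp add: mult.commute)
    then show ?thesis
      by (auto simp: has_field_derivative_def)
  qed
  then show ?thesis
    by (simp add: holomorphic_on_def field_differentiable_def)
qed

section \<open>Invariance of Lebesgue measure and the mean value property\<close>

lemma nn_integral_lborel_affine:
  fixes f :: "'a::euclidean_space \<Rightarrow> ennreal"
  assumes [measurable]: "f \<in> borel_measurable borel" and "c \<noteq> 0"
  shows "(\<integral>\<^sup>+x. f x \<partial>lborel) = ennreal (\<bar>c\<bar> ^ DIM('a)) * (\<integral>\<^sup>+x. f (t + c *\<^sub>R x) \<partial>lborel)"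
  by (subst lborel_affine[OF \<open>c \<noteq> 0\<close>, of t])
    (simp add: nn_integral_density nn_integral_distr nn_integral_cmult)

text \<open>Both measures are translation invariant, so computing
  \<open>\<integral>\<integral> 1\<^sub>A(Ux) 1\<^sub>B(y) dx dy\<close> after the shift \<open>y \<mapsto> Ux - y\<close> exchanges the roles of \<open>A\<close> and \<open>B\<close>;
  for \<open>B\<close> the unit ball, which \<open>U\<close> preserves, the factor cancels.\<close>
lemma lborel_distr_isometry:
  fixes U :: "'a::euclidean_space \<Rightarrow> 'a"
  assumes "linear U" and iso: "\<And>x. norm (U x) = norm x"
  shows "distr lborel borel U = lborel"
proof (rule measure_eqI)
  have [measurable]: "U \<in> borel_measurable borel"
    using assms(1) by (intro borel_measurable_continuous_onI linear_continuous_on)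
      (simp add: linear_conv_bounded_linear)
  have "inj U"
    using assms by (simp add: linear_injective_0) (metis norm_eq_zero)
  then have "surj U"
    using assms(1) linear_injective_imp_surjective by blast
  have refl: "(\<integral>\<^sup>+y. f (a - y) \<partial>lborel) = (\<integral>\<^sup>+y. f y \<partial>lborel)"
    if [measurable]: "f \<in> borel_measurable borel" for f :: "'a \<Rightarrow> ennreal" and a
    using nn_integral_lborel_affine[of f "-1" a] by simp
  fix A assume "A \<in> sets (distr lborel borel U)"
  then have A[measurable]: "A \<in> sets borel" by simp
  define B where "B = ball (0::'a) 1"
  have [measurable]: "B \<in> sets borel" by (simp add: B_def)
  have swap: "emeasure lborel (U -` C) * emeasure lborel D
      = (\<integral>\<^sup>+y. \<integral>\<^sup>+x. indicator C (U x) * indicator D (U x - y) \<partial>lborel \<partial>lborel)"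
    if [measurable]: "C \<in> sets borel" "D \<in> sets borel" for C D
  proof -
    have D: "emeasure lborel D = (\<integral>\<^sup>+y. indicator D (U x - y) \<partial>lborel)" for x
      using refl[of "indicator D" "U x"] by simp
    have "U -` C \<in> sets borel"
      using measurable_sets[of U borel borel C] by simp
    then have "emeasure lborel (U -` C) = (\<integral>\<^sup>+x. indicator (U -` C) x \<partial>lborel)"
      by simp
    also have "\<dots> = (\<integral>\<^sup>+x. indicator C (U x) \<partial>lborel)"
      by (intro nn_integral_cong) (auto simp: indicator_def)
    finally have "emeasure lborel (U -` C) * emeasure lborel D
        = (\<integral>\<^sup>+x. indicator C (U x) * emeasure lborel D \<partial>lborel)"
      by (simp add: nn_integral_multc)
    also have "\<dots> = (\<integral>\<^sup>+x. indicator C (U x) * (\<integral>\<^sup>+y. indicator D (U x - y) \<partial>lborel) \<partial>lborel)"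
      by (intro nn_integral_cong arg_cong2[where f="(*)"] D) simp
    also have "\<dots> = (\<integral>\<^sup>+x. \<integral>\<^sup>+y. indicator C (U x) * indicator D (U x - y) \<partial>lborel \<partial>lborel)"
      by (simp add: nn_integral_cmult)
    also have "\<dots> = (\<integral>\<^sup>+y. \<integral>\<^sup>+x. indicator C (U x) * indicator D (U x - y) \<partial>lborel \<partial>lborel)"
      by (rule lborel_pair.Fubini') simp
    finally show ?thesis .
  qed
  have "emeasure lborel (U -` A) * emeasure lborel B
      = (\<integral>\<^sup>+y. \<integral>\<^sup>+x. indicator A (U x) * indicator B (U x - y) \<partial>lborel \<partial>lborel)"
    by (rule swap) auto
  also have "\<dots> = (\<integral>\<^sup>+y. \<integral>\<^sup>+x. indicator A (U x + y) * indicator B (U x) \<partial>lborel \<partial>lborel)"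
  proof (rule nn_integral_cong)
    fix y
    obtain b where b: "y = U b" using \<open>surj U\<close> by auto
    have "U (b + x) = U x + y" for x
      using linear_add[OF assms(1)] b by (simp add: add.commute)
    then show "(\<integral>\<^sup>+x. indicator A (U x) * indicator B (U x - y) \<partial>lborel)
        = (\<integral>\<^sup>+x. indicator A (U x + y) * indicator B (U x) \<partial>lborel)"
      using nn_integral_lborel_affine[of "\<lambda>x. indicator A (U x) * indicator B (U x - y)" 1 b] by simp
  qed
  also have "\<dots> = (\<integral>\<^sup>+y. \<integral>\<^sup>+x. indicator A (U x - y) * indicator B (U x) \<partial>lborel \<partial>lborel)"
    using refl[of "\<lambda>y. \<integral>\<^sup>+x. indicator A (U x + y) * indicator B (U x) \<partial>lborel" 0] by simp
  also have "\<dots> = emeasure lborel (U -` B) * emeasure lborel A"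
    by (subst swap) (auto simp: mult.commute)
  also have "U -` B = B" by (auto simp: B_def iso)
  finally have "emeasure lborel B * emeasure lborel (U -` A) = emeasure lborel B * emeasure lborel A"
    by (simp add: mult.commute)
  moreover have "emeasure lborel B \<noteq> 0" "emeasure lborel B \<noteq> \<infinity>"
    using emeasure_lborel_ball_finite[of "0::'a" 1] open_not_negligible[of B]
    by (auto simp: B_def negligible_iff_emeasure0 emeasure_completion less_top)
  ultimately have "emeasure lborel (U -` A) = emeasure lborel A"
    by (simp add: ennreal_mult_cancel_left)
  then show "emeasure (distr lborel borel U) A = emeasure lborel A"
    by (simp add: emeasure_distr)
qed simp

lemma circle_mean_value:
  assumes "f holomorphic_on UNIV"
  shows "((\<lambda>t. f (exp (2 * of_real pi * \<i> * of_real t))) has_integral f 0) {0..1}"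
proof -
  have "((\<lambda>u. f u / (u - 0)) has_contour_integral (2 * of_real pi * \<i> * f 0)) (circlepath 0 1)"
    by (rule Cauchy_integral_circlepath_simple) (use assms holomorphic_on_subset in auto)
  then have "((\<lambda>t. f (circlepath 0 1 t) / circlepath 0 1 t * vector_derivative (circlepath 0 1) (at t within {0..1}))
     has_integral (2 * of_real pi * \<i> * f 0)) {0..1}"
    by (simp add: has_contour_integral_def)
  then have "((\<lambda>t. (2 * of_real pi * \<i>) * f (exp (2 * of_real pi * \<i> * of_real t)))
     has_integral (2 * of_real pi * \<i> * f 0)) {0..1}"
    by (rule has_integral_eq[rotated])
      (simp add: vector_derivative_circlepath01, simp add: circlepath)
  from has_integral_mult_right[OF this, of "inverse (2 * of_real pi * \<i>)"] show ?thesis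
    by (simp add: field_simps)
qed

lemma linear_smult: "linear (\<lambda>u. c *s u)" for c :: complex
  by (rule linearI) (auto simp: scaleR_eq_smult vector_add_ldistrib vector_smult_assoc mult.commute)

lemma lborel_distr_rotation:
  "norm c = 1 \<Longrightarrow> distr lborel borel (\<lambda>u. c *s u) = (lborel :: (complex ^ 'n) measure)"
  by (intro lborel_distr_isometry linear_smult) (simp add: norm_smult)

lemma borel_measurable_smult [measurable]: "(\<lambda>u. c *s u) \<in> borel_measurable borel" for c :: complex
  by (intro borel_measurable_continuous_onI continuous_intros)

text \<open>Rotation by \<open>e t\<close> preserves \<phi> and Lebesgue measure, so the integral
  equals its average over t in [0, 1]. After Fubini the inner integral is the mean of h over the
  circle through u, which is \<open>h 0\<close>. A general weight is allowed because both indicators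
  of balls and Gaussians are used.\<close>

lemma entire_mean_value:
  fixes h :: "complex ^ 'n \<Rightarrow> complex" and \<phi> :: "complex ^ 'n \<Rightarrow> real"
  assumes h: "entire h" and [measurable]: "\<phi> \<in> borel_measurable borel"
    and inv: "\<And>c u. norm c = 1 \<Longrightarrow> \<phi> (c *s u) = \<phi> u"
    and int: "integrable lborel (\<lambda>u. \<phi> u *\<^sub>R h u)"
  shows "(\<integral>u. \<phi> u *\<^sub>R h u \<partial>lborel) = (\<integral>u. \<phi> u \<partial>lborel) *\<^sub>R h 0"
proof -
  have [measurable]: "h \<in> borel_measurable borel"
    by (rule entire_imp_borel_measurable[OF h])
  define e where "e t = exp (2 * of_real pi * \<i> * of_real t)" for t :: real
  have e1: "norm (e t) = 1" for t
    by (simp add: e_def)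
  have conte: "continuous_on UNIV e"
    unfolding e_def by (intro continuous_intros)
  have conthe: "continuous_on UNIV (\<lambda>p. h (e (fst p) *s snd p))"
    by (intro continuous_on_compose2[OF entire_imp_continuous_on[OF h, of UNIV]] continuous_intros
        continuous_on_compose2[OF conte]) auto
  define G where "G p = indicator {0..1::real} (fst p) *\<^sub>R \<phi> (snd p) *\<^sub>R h (e (fst p) *s snd p)" for p
  have mh: "(\<lambda>p. h (e (fst p) *s snd p)) \<in> borel_measurable (lborel \<Otimes>\<^sub>M lborel)"
    unfolding lborel_prod by (simp add: borel_measurable_continuous_onI[OF conthe])
  have G[measurable]: "G \<in> borel_measurable (lborel \<Otimes>\<^sub>M lborel)"
    unfolding G_def by (intro borel_measurable_scaleR mh) auto
  have rot: "integrable lborel (\<lambda>u. \<phi> u *\<^sub>R h (e t *s u))"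
     "(\<integral>u. \<phi> u *\<^sub>R h (e t *s u) \<partial>lborel) = (\<integral>u. \<phi> u *\<^sub>R h u \<partial>lborel)"
     "(\<integral>u. norm (\<phi> u *\<^sub>R h (e t *s u)) \<partial>lborel) = (\<integral>u. norm (\<phi> u *\<^sub>R h u) \<partial>lborel)" for t
  proof -
    note d = lborel_distr_rotation[OF e1[of t], where 'n='n]
    have *: "\<phi> u *\<^sub>R h (e t *s u) = (\<lambda>u. \<phi> u *\<^sub>R h u) (e t *s u)" for u
      by (simp add: inv e1)
    show "integrable lborel (\<lambda>u. \<phi> u *\<^sub>R h (e t *s u))"
      unfolding * by (rule integrable_distr[where M'=borel]) (auto simp: d int)
    show "(\<integral>u. \<phi> u *\<^sub>R h (e t *s u) \<partial>lborel) = (\<integral>u. \<phi> u *\<^sub>R h u \<partial>lborel)"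
      unfolding * by (subst (2) d[symmetric], subst integral_distr) auto
    have "(\<integral>u. (\<lambda>u. norm (\<phi> u *\<^sub>R h u)) (e t *s u) \<partial>lborel) = (\<integral>u. norm (\<phi> u *\<^sub>R h u) \<partial>lborel)"
      by (subst (2) d[symmetric], subst integral_distr) auto
    then show "(\<integral>u. norm (\<phi> u *\<^sub>R h (e t *s u)) \<partial>lborel) = (\<integral>u. norm (\<phi> u *\<^sub>R h u) \<partial>lborel)"
      by (simp add: inv e1)
  qed
  have intG: "integrable (lborel \<Otimes>\<^sub>M lborel) G"
  proof (rule lborel_pair.Fubini_integrable[OF G])
    have "(\<lambda>t. \<integral>u. norm (G (t, u)) \<partial>lborel)
        = (\<lambda>t. indicator {0..1} t *\<^sub>R (\<integral>u. norm (\<phi> u *\<^sub>R h u) \<partial>lborel))"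
      using rot(3) by (auto simp: G_def fun_eq_iff indicator_def)
    then show "integrable lborel (\<lambda>t. \<integral>u. norm (G (t, u)) \<partial>lborel)"
      by simp
    show "AE t in lborel. integrable lborel (\<lambda>u. G (t, u))"
      unfolding G_def fst_conv snd_conv by (intro AE_I2 integrable_scaleR_right rot)
  qed
  have circ: "(\<integral>t. indicator {0..1} t *\<^sub>R h (e t *s u) \<partial>lborel) = h 0" for u
  proof -
    have "continuous_on {0..1} (\<lambda>t. h (e t *s u))"
      by (intro continuous_on_compose2[OF entire_imp_continuous_on[OF h, of UNIV]] continuous_intros
        continuous_on_compose2[OF conte]) auto
    then have "set_integrable lborel {0..1} (\<lambda>t. h (e t *s u))"
      by (rule borel_integrable_atLeastAtMost')
    from set_borel_integral_eq_integral(2)[OF this]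
    have "(\<integral>t. indicator {0..1} t *\<^sub>R h (e t *s u) \<partial>lborel) = integral {0..1} (\<lambda>t. h (e t *s u))"
      by (simp add: set_lebesgue_integral_def)
    also have "\<dots> = h (0 *s u)"
      using circle_mean_value[OF entire_slice_holomorphic[OF h, of u]]
      by (simp add: e_def integral_unique)
    finally show ?thesis by simp
  qed
  have "(\<integral>u. \<phi> u *\<^sub>R h u \<partial>lborel) = (\<integral>t. indicator {0..1} t *\<^sub>R (\<integral>u. \<phi> u *\<^sub>R h u \<partial>lborel) \<partial>(lborel::real measure))"
    by simp
  also have "\<dots> = (\<integral>t. (\<integral>u. G (t, u) \<partial>lborel) \<partial>lborel)"
    unfolding G_def fst_conv snd_conv
    by (intro Bochner_Integration.integral_cong refl) (simp only: integral_scaleR_right rot)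
  also have "\<dots> = (\<integral>u. (\<integral>t. G (t, u) \<partial>lborel) \<partial>lborel)"
    using lborel_pair.Fubini_integral[of "\<lambda>x y. G (x, y)"] intG by simp
  also have "\<dots> = (\<integral>u. \<phi> u *\<^sub>R h 0 \<partial>lborel)"
  proof (rule Bochner_Integration.integral_cong)
    fix u :: "complex ^ 'n"
    have "(\<integral>t. G (t, u) \<partial>lborel) = (\<integral>t. \<phi> u *\<^sub>R indicator {0..1} t *\<^sub>R h (e t *s u) \<partial>lborel)"
      by (simp add: G_def mult.commute)
    also have "\<dots> = \<phi> u *\<^sub>R h 0"
      by (subst integral_scaleR_right) (simp add: circ)
    finally show "(\<integral>t. G (t, u) \<partial>lborel) = \<phi> u *\<^sub>R h 0" .
  qed simp
  also have "\<dots> = (\<integral>u. \<phi> u \<partial>lborel) *\<^sub>R h 0"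
    by (cases "h 0 = 0") (simp_all add: scaleR_conv_of_real)
  finally show ?thesis .
qed

text \<open>The square of h is again entire, so its mean value identity and the triangle inequality
  for integrals suffice, without subharmonicity. An infinite right-hand side is trivial; a finite
  one supplies the integrability.\<close>

lemma entire_mean_value_square:
  fixes h :: "complex ^ 'n \<Rightarrow> complex" and \<phi> :: "complex ^ 'n \<Rightarrow> real"
  assumes h: "entire h" and [measurable]: "\<phi> \<in> borel_measurable borel"
    and inv: "\<And>c u. norm c = 1 \<Longrightarrow> \<phi> (c *s u) = \<phi> u"
    and nn: "\<And>u. \<phi> u \<ge> 0"
  shows "ennreal ((norm (h 0))\<^sup>2 * (\<integral>u. \<phi> u \<partial>lborel)) \<le> (\<integral>\<^sup>+u. ennreal (\<phi> u * (norm (h u))\<^sup>2) \<partial>lborel)"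
proof (cases "(\<integral>\<^sup>+u. ennreal (\<phi> u * (norm (h u))\<^sup>2) \<partial>lborel) = \<infinity>")
  case False
  have [measurable]: "h \<in> borel_measurable borel"
    by (rule entire_imp_borel_measurable[OF h])
  have i1: "integrable lborel (\<lambda>u. \<phi> u *\<^sub>R (h u)\<^sup>2)"
    using False by (intro integrableI_bounded) (auto simp: norm_power nn less_top)
  have "(norm (h 0))\<^sup>2 * (\<integral>u. \<phi> u \<partial>lborel) = norm (\<integral>u. \<phi> u *\<^sub>R (h u)\<^sup>2 \<partial>lborel)"
    using entire_mean_value[OF entire_power[OF h, of 2] assms(2) inv i1]
    by (simp add: norm_power nn integral_nonneg_AE)
  also have "\<dots> \<le> (\<integral>u. norm (\<phi> u *\<^sub>R (h u)\<^sup>2) \<partial>lborel)"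
    by (rule integral_norm_bound)
  finally have "ennreal ((norm (h 0))\<^sup>2 * (\<integral>u. \<phi> u \<partial>lborel)) \<le> ennreal (\<integral>u. norm (\<phi> u *\<^sub>R (h u)\<^sup>2) \<partial>lborel)"
    by (rule ennreal_leI)
  also have "\<dots> = (\<integral>\<^sup>+u. ennreal (norm (\<phi> u *\<^sub>R (h u)\<^sup>2)) \<partial>lborel)"
    by (rule nn_integral_eq_integral[symmetric]) (use integrable_norm[OF i1] in auto)
  also have "\<dots> = (\<integral>\<^sup>+u. ennreal (\<phi> u * (norm (h u))\<^sup>2) \<partial>lborel)"
    by (simp add: norm_power nn)
  finally show ?thesis .
qed simp

section \<open>Unitary and diagonal changes of variables\<close>

text \<open>\<open>U\<close> is a complex Householder reflection; after a change of phase, \<open>z\<close> has a real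
  \<open>k\<close>-th coordinate, which is what makes the reflection map \<open>axis k 1\<close> to a multiple of \<open>z\<close>.\<close>
lemma unitary_exists:
  fixes z :: "complex ^ 'n" and k :: 'n
  obtains U :: "complex ^ 'n \<Rightarrow> complex ^ 'n" and c :: complex where
    "linear U" "\<And>c v. U (c *s v) = c *s U v" "\<And>x y. herm (U x) (U y) = herm x y"
    "norm c = 1" "z = (c * norm z) *s U (axis k 1)"
proof (cases "z = 0")
  case True
  then show ?thesis
    by (intro that[of id 1]) (auto simp: linear_id)
next
  case False
  define c where "c = (if z $ k = 0 then 1 else z $ k / norm (z $ k))"
  have c: "norm c = 1" by (simp add: c_def norm_divide)
  then have cc: "cnj c * c = 1"
    by (metis complex_norm_square mult.commute of_real_1 one_power2)
  have ck: "cnj c * z $ k = norm (z $ k)"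
    using complex_norm_square[of "z $ k"] by (auto simp: c_def field_simps power2_eq_square)
  define e where "e = (cnj c / norm z) *s z"
  define a :: "complex ^ 'n" where "a = axis k 1"
  have ek: "herm e a = of_real (norm (z $ k) / norm z)"
    using ck by (simp add: e_def a_def herm_def axis_def if_distrib cong: if_cong)
  then have ek': "herm a e = herm e a"
    by (metis cnj_herm complex_cnj_complex_of_real)
  have ee: "herm e e = 1"
    using False c by (simp add: herm_self) (simp add: e_def norm_smult norm_divide)
  have aa: "herm a a = 1"
    by (simp add: a_def herm_def axis_def if_distrib cong: if_cong)
  have ze: "z = (c * norm z) *s e"
    using False cc by (simp add: e_def vector_smult_assoc mult.commute)
  show ?thesis
  proof (cases "a = e")
    case True
    then show ?thesis
      using c ze by (intro that[of id c]) (auto simp: linear_id a_def)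
  next
    case ne: False
    define v where "v = a - e"
    define N where "N = herm v v"
    have N0: "N \<noteq> 0" using ne by (simp add: N_def v_def herm_self)
    have Nc: "cnj N = N" by (simp add: N_def cnj_herm)
    \<comment> \<open>Since \<open>herm a e\<close> is real, |a - e|^2 is twice
      \<open>herm a v\<close>; this turns \<open>U a\<close> into a - v = e.\<close>
    have N: "N = 2 * herm a v"
      using aa ee ek' by (simp add: N_def v_def herm_diff_left herm_diff_right)
    define U where "U x = x - (2 * herm x v / N) *s v" for x
    have "linear U"
      by (rule linearI)
        (auto simp: U_def herm_add_left herm_scale_left scaleR_eq_smult vector_ssub_ldistrib add_divide_distrib
          vector_sadd_rdistrib vector_smult_assoc algebra_simps)
    moreover have "U (c *s x) = c *s U x" for c x
      by (simp add: U_def herm_scale_left vector_ssub_ldistrib vector_smult_assoc algebra_simps)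
    moreover have "herm (U x) (U y) = herm x y" for x y
      using N0 Nc by (simp add: U_def herm_diff_left herm_diff_right herm_scale_left herm_scale_right
          cnj_herm flip: N_def)
    moreover have "U a = e"
      using N N0 by (simp add: U_def v_def)
    ultimately show ?thesis
      using c ze by (intro that[of U c]) (auto simp: a_def)
  qed
qed

definition diag_map :: "'n \<Rightarrow> real \<Rightarrow> real \<Rightarrow> complex ^ 'n \<Rightarrow> complex ^ 'n"
  where "diag_map k a b u = (\<chi> j. (if j = k then a else b) *\<^sub>R u $ j)"

lemma prod_Basis_vec:
  fixes g :: "complex ^ 'n \<Rightarrow> real"
  shows "(\<Prod>b\<in>Basis. g b) = (\<Prod>i\<in>UNIV. g (axis i 1) * g (axis i \<i>))"
proof -
  have B: "(Basis :: (complex ^ 'n) set) = (\<lambda>(i, u). axis i u) ` (UNIV \<times> {1, \<i>})"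
    by (auto simp: Basis_vec_def Basis_complex_def)
  have inj: "inj_on (\<lambda>(i, u). axis i u :: complex ^ 'n) (UNIV \<times> {1, \<i>})"
    by (auto simp: inj_on_def axis_eq_axis)
  have "(\<Prod>b\<in>Basis. g b) = (\<Prod>(i, u)\<in>UNIV \<times> {1, \<i>}. g (axis i u))"
    unfolding B by (subst prod.reindex[OF inj]) (simp add: case_prod_unfold o_def)
  also have "\<dots> = (\<Prod>i\<in>UNIV. \<Prod>u\<in>{1, \<i>}. g (axis i u))"
    by (rule prod.cartesian_product[symmetric])
  finally show ?thesis
    by simp
qed

lemma axis_nth_other: "i \<noteq> j \<Longrightarrow> axis i x $ j = 0"
  by (simp add: axis_def)

text \<open>Each complex coordinate spans the two real directions \<open>axis i 1\<close> and
  \<open>axis i \<i>\<close>, scaled by the same factor; hence the squares in the Jacobian.\<close>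

lemma nn_integral_diag_map:
  fixes f :: "complex ^ 'n \<Rightarrow> ennreal"
  assumes [measurable]: "f \<in> borel_measurable borel" and "a > 0" "b > 0"
  shows "(\<integral>\<^sup>+x. f x \<partial>lborel)
    = ennreal (a\<^sup>2 * (b\<^sup>2) ^ (CARD('n) - 1)) * (\<integral>\<^sup>+u. f (t + diag_map k a b u) \<partial>lborel)"
proof -
  define c where "c e = (if e $ k \<noteq> 0 then a else b)" for e :: "complex ^ 'n"
  have T: "(\<Sum>j\<in>Basis. (c j * (x \<bullet> j)) *\<^sub>R j) = diag_map k a b x" for x
  proof (rule euclidean_eqI)
    fix e :: "complex ^ 'n" assume e: "e \<in> Basis"
    then obtain i u where iu: "e = axis i u" "u \<in> {1, \<i>}"
      by (auto simp: Basis_vec_def Basis_complex_def)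
    have "(\<Sum>j\<in>Basis. (c j * (x \<bullet> j)) *\<^sub>R j) \<bullet> e = c e * (x \<bullet> e)"
      using e by (simp add: inner_sum_left_Basis)
    also have "\<dots> = diag_map k a b x \<bullet> e"
      using iu by (cases "i = k") (auto simp: c_def diag_map_def inner_axis axis_nth axis_nth_other)
    finally show "(\<Sum>j\<in>Basis. (c j * (x \<bullet> j)) *\<^sub>R j) \<bullet> e = diag_map k a b x \<bullet> e" .
  qed
  have c: "c j \<noteq> 0" "c j \<ge> 0" for j using assms by (auto simp: c_def)
  have "(\<Prod>j\<in>Basis. \<bar>c j\<bar>) = (\<Prod>i\<in>UNIV. if i = k then a\<^sup>2 else b\<^sup>2)"
    using assms by (subst prod_Basis_vec) (auto simp: c_def axis_def power2_eq_square intro!: prod.cong)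
  also have "\<dots> = a\<^sup>2 * (\<Prod>i\<in>UNIV - {k}. if i = k then a\<^sup>2 else b\<^sup>2)"
    by (subst prod.remove[of _ k]) auto
  also have "\<dots> = a\<^sup>2 * (\<Prod>i\<in>UNIV - {k}. b\<^sup>2)"
    by (intro arg_cong2[where f="(*)"] prod.cong) auto
  finally have J: "(\<Prod>j\<in>Basis. \<bar>c j\<bar>) = a\<^sup>2 * (b\<^sup>2) ^ (CARD('n) - 1)"
    by (simp add: card_Diff_singleton)
  have cont: "continuous_on UNIV (\<lambda>u. t + diag_map k a b u)"
    unfolding diag_map_def by (intro continuous_intros)
  have [measurable]: "(\<lambda>u. t + diag_map k a b u) \<in> borel_measurable borel"
    by (rule borel_measurable_continuous_onI[OF cont])
  have "lborel = density (distr lborel borel (\<lambda>x. t + diag_map k a b x)) (\<lambda>_. ennreal (a\<^sup>2 * (b\<^sup>2) ^ (CARD('n) - 1)))"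
    using lborel_affine_euclidean[of c t] c by (simp only: T J) simp
  note L = this
  show ?thesis
    by (subst L) (simp add: nn_integral_density nn_integral_distr nn_integral_cmult)
qed

lemma linear_diag_map: "linear (diag_map k a b)"
  by (rule linearI) (auto simp: diag_map_def vec_eq_iff algebra_simps)

lemma diag_map_smult: "diag_map k a b (c *s u) = c *s diag_map k a b u"
  by (simp add: diag_map_def vec_eq_iff)

lemma nn_integral_unitary:
  fixes f :: "complex ^ 'n \<Rightarrow> ennreal" and U :: "complex ^ 'n \<Rightarrow> complex ^ 'n"
  assumes [measurable]: "f \<in> borel_measurable borel" and "linear U" "\<And>x y. herm (U x) (U y) = herm x y"
  shows "(\<integral>\<^sup>+x. f (U x) \<partial>lborel) = (\<integral>\<^sup>+x. f x \<partial>lborel)"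
proof -
  have "norm (U x) = norm x" for x
  proof -
    have "(norm (U x))\<^sup>2 = (norm x)\<^sup>2"
      using assms(3)[of x x] by (simp only: herm_self of_real_eq_iff)
    then show ?thesis by simp
  qed
  then have d: "distr lborel borel U = lborel"
    by (rule lborel_distr_isometry[OF assms(2)])
  have [measurable]: "U \<in> borel_measurable borel"
    using assms(2) by (intro borel_measurable_continuous_onI linear_continuous_on)
      (simp add: linear_conv_bounded_linear)
  show ?thesis
    by (subst (2) d[symmetric], subst nn_integral_distr) auto
qed

lemma norm_diag_map_squared:
  "(norm (diag_map k a b u))\<^sup>2 = a\<^sup>2 * (norm (u $ k))\<^sup>2 + b\<^sup>2 * (\<Sum>j\<in>UNIV - {k}. (norm (u $ j))\<^sup>2)"
proof -
  have n: "(norm x)\<^sup>2 = (\<Sum>j\<in>UNIV. (norm (x $ j))\<^sup>2)" for x :: "complex ^ 'n"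
    by (simp add: norm_vec_def L2_set_def sum_nonneg)
  have "(norm (diag_map k a b u))\<^sup>2 = (norm (diag_map k a b u $ k))\<^sup>2 + (\<Sum>j\<in>UNIV - {k}. (norm (diag_map k a b u $ j))\<^sup>2)"
    unfolding n by (subst sum.remove[of _ k]) auto
  also have "(\<Sum>j\<in>UNIV - {k}. (norm (diag_map k a b u $ j))\<^sup>2) = (\<Sum>j\<in>UNIV - {k}. b\<^sup>2 * (norm (u $ j))\<^sup>2)"
    by (intro sum.cong) (auto simp: diag_map_def power_mult_distrib)
  finally show ?thesis
    by (simp add: diag_map_def sum_distrib_left power_mult_distrib)
qed

lemma norm_vec_squared_split:
  "(norm u)\<^sup>2 = (norm (u $ k))\<^sup>2 + (\<Sum>j\<in>UNIV - {k}. (norm (u $ j))\<^sup>2)" for u :: "complex ^ 'n"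
  using norm_diag_map_squared[of k 1 1 u] by (simp add: diag_map_def)

section \<open>Slow variation of the weight\<close>

text \<open>Derivatives on the half line are one-sided at 0, and x = y must be allowed; hence a form
  relative to \<open>{0..}\<close> whose intermediate point lies in the closed interval.\<close>

lemma mvt_halfline:
  fixes f f' :: "real \<Rightarrow> real"
  assumes "0 \<le> x" "x \<le> y" and "\<And>t. t \<ge> 0 \<Longrightarrow> (f has_real_derivative f' t) (at t within {0..})"
  obtains t where "x \<le> t" "t \<le> y" "f y - f x = f' t * (y - x)"
proof -
  have "\<exists>t\<in>{x..y}. f y - f x = (\<lambda>h. f' t * h) (y - x)"
  proof (rule mvt_very_simple[OF assms(2)])
    fix t assume t: "x \<le> t" "t \<le> y"
    have "(f has_real_derivative f' t) (at t within {x..y})"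
      by (rule DERIV_subset[OF assms(3)]) (use assms(1) t in auto)
    then show "(f has_derivative (\<lambda>h. f' t * h)) (at t within {x..y})"
      by (simp add: has_field_derivative_def)
  qed
  then show ?thesis using that by auto
qed

text \<open>
  \<open>P\<close>, \<open>R\<close>, \<open>Q\<close>, \<open>Q'\<close> are \<open>\<Psi>'\<close>, \<open>\<Psi>''\<close>, \<open>\<Phi>'\<close>, \<open>\<Phi>''\<close>. The last assumption follows from the
  growth condition because \<open>1 + \<eta> < 3/2\<close> and \<open>Q\<close> is bounded below.
\<close>
locale growth =
  fixes \<Psi> P R Q Q' :: "real \<Rightarrow> real" and C1 :: real
  assumes Psi_deriv: "\<And>x. x \<ge> 0 \<Longrightarrow> (\<Psi> has_real_derivative P x) (at x within {0..})"
    and P_deriv: "\<And>x. x \<ge> 0 \<Longrightarrow> (P has_real_derivative R x) (at x within {0..})"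
    and Q_deriv: "\<And>x. x \<ge> 0 \<Longrightarrow> (Q has_real_derivative Q' x) (at x within {0..})"
    and Q_eq: "\<And>x. x \<ge> 0 \<Longrightarrow> Q x = P x + x * R x"
    and P0: "P 0 > 0"
    and R_nonneg: "\<And>x. x \<ge> 0 \<Longrightarrow> R x \<ge> 0"
    and R_mono: "\<And>x y. 0 \<le> x \<Longrightarrow> x \<le> y \<Longrightarrow> R x \<le> R y"
    and Q'_nonneg: "\<And>x. x \<ge> 0 \<Longrightarrow> Q' x \<ge> 0"
    and C1: "C1 > 0"
    and Q'_le: "\<And>x. x \<ge> 0 \<Longrightarrow> sqrt (1 + x) * Q' x \<le> C1 * (Q x * sqrt (Q x))"
begin

definition \<Phi> :: "real \<Rightarrow> real" where "\<Phi> x = x * P x"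
text \<open>Order of the change of |z|^2, where x = |z|^2, under a radial move of length 1/sqrt Q; 1
  + x replaces x so that it does not degenerate at the origin.\<close>

definition hh :: "real \<Rightarrow> real" where "hh x = sqrt ((1 + x) / Q x)"

lemma P_mono: "0 \<le> x \<Longrightarrow> x \<le> y \<Longrightarrow> P x \<le> P y"
  by (rule mvt_halfline[of x y P R, OF _ _ P_deriv]) (auto, metis R_nonneg diff_ge_0_iff_ge mult_nonneg_nonneg order_trans)

lemma P_ge: "x \<ge> 0 \<Longrightarrow> P x \<ge> P 0"
  using P_mono[of 0 x] by simp

lemma P_pos: "x \<ge> 0 \<Longrightarrow> P x > 0"
  using P_ge[of x] P0 by simp

lemma Q_mono: "0 \<le> x \<Longrightarrow> x \<le> y \<Longrightarrow> Q x \<le> Q y"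
  by (rule mvt_halfline[of x y Q Q', OF _ _ Q_deriv]) (auto, metis Q'_nonneg diff_ge_0_iff_ge mult_nonneg_nonneg order_trans)

lemma Q_ge_P: "x \<ge> 0 \<Longrightarrow> Q x \<ge> P x"
  by (simp add: Q_eq R_nonneg)

lemma Q_ge: "x \<ge> 0 \<Longrightarrow> Q x \<ge> P 0"
  using P_ge[of x] Q_ge_P[of x] by simp

lemma Q_pos: "x \<ge> 0 \<Longrightarrow> Q x > 0"
  using Q_ge[of x] P0 by simp

lemma hh_pos: "x \<ge> 0 \<Longrightarrow> hh x > 0"
  using Q_pos[of x] by (simp add: hh_def)

lemma hh_squared: "x \<ge> 0 \<Longrightarrow> (hh x)\<^sup>2 = (1 + x) / Q x"
  using Q_pos[of x] by (simp add: hh_def)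

lemma Phi_deriv:
  assumes "x \<ge> 0" shows "(\<Phi> has_real_derivative Q x) (at x within {0..})"
  unfolding \<Phi>_def using P_deriv[OF assms]
  by (auto intro!: derivative_eq_intros simp: Q_eq[OF assms])

lemma Phi_diff_ge: "0 \<le> x \<Longrightarrow> x \<le> y \<Longrightarrow> (y - x) * Q x \<le> \<Phi> y - \<Phi> x"
  by (rule mvt_halfline[of x y \<Phi> Q, OF _ _ Phi_deriv]) (auto simp: mult.commute[of "y - x"] intro!: mult_right_mono Q_mono)

lemma Phi_nonneg: "x \<ge> 0 \<Longrightarrow> \<Phi> x \<ge> 0"
  using P_pos[of x] by (simp add: \<Phi>_def)

text \<open>The hypothesis says that \<open>Q\<^sup>-\<^sup>1\<^sup>/\<^sup>2\<close>, as a function of \<open>sqrt (1 + x)\<close>, is Lipschitz.\<close>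
lemma inverse_sqrt_Q_diff:
  assumes "0 \<le> x" "x \<le> y"
  shows "1 / sqrt (Q x) - 1 / sqrt (Q y) \<le> C1 * (y - x) / (2 * sqrt (1 + x))"
proof -
  define g where "g t = 1 / sqrt (Q t) + C1 * sqrt (1 + t)" for t
  define g' where "g' t = - (Q' t / (2 * (Q t * sqrt (Q t)))) + C1 / (2 * sqrt (1 + t))" for t
  have g': "(g has_real_derivative g' t) (at t within {0..})" if "t \<ge> 0" for t
    unfolding g_def g'_def using Q_pos[OF that] that
    by (auto intro!: derivative_eq_intros Q_deriv[OF that] simp: field_simps)
  have "g x \<le> g y"
  proof -
    obtain t where t: "x \<le> t" "t \<le> y" "g y - g x = g' t * (y - x)"
      using mvt_halfline[OF assms g'] by blast
    then have t0: "t \<ge> 0" using assms by simp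
    have "Q' t / (2 * (Q t * sqrt (Q t))) \<le> C1 / (2 * sqrt (1 + t))"
      using Q'_le[OF t0] Q_pos[OF t0] t0 by (simp add: field_simps)
    then have "g' t \<ge> 0" by (simp add: g'_def)
    then show ?thesis using t assms by (metis diff_ge_0_iff_ge mult_nonneg_nonneg)
  qed
  then have "1 / sqrt (Q x) - 1 / sqrt (Q y) \<le> C1 * (sqrt (1 + y) - sqrt (1 + x))"
    by (simp add: g_def algebra_simps)
  also have "sqrt (1 + y) - sqrt (1 + x) \<le> (y - x) / (2 * sqrt (1 + x))"
  proof -
    have "(sqrt (1 + y) - sqrt (1 + x))\<^sup>2 \<ge> 0" by simp
    then have "2 * (sqrt (1 + x) * sqrt (1 + y)) \<le> (1 + x) + (1 + y)"
      using assms by (simp add: power2_diff algebra_simps)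
    moreover have "sqrt (1 + x) * sqrt (1 + x) = 1 + x" using assms by simp
    ultimately show ?thesis
      using assms by (simp add: field_simps)
  qed
  then have "C1 * (sqrt (1 + y) - sqrt (1 + x)) \<le> C1 * ((y - x) / (2 * sqrt (1 + x)))"
    using C1 by (intro mult_left_mono) auto
  finally show ?thesis by simp
qed

lemma hh_eq: "hh x = sqrt (1 + x) / sqrt (Q x)"
  by (simp add: hh_def real_sqrt_divide)

text \<open>The first entry lets 1/sqrt Q drop by at most half over a step \<open>e1 * hh x\<close>;
  the second keeps 1 + x constant up to a factor 2.\<close>

definition e1 :: real where "e1 = min (1 / C1) (sqrt (P 0) / 2)"

lemma e1_pos: "e1 > 0"
  using C1 P0 by (simp add: e1_def)

lemma e1_hh: "x \<ge> 0 \<Longrightarrow> e1 * hh x \<le> (1 + x) / 2"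
proof -
  assume x: "x \<ge> 0"
  have "e1 * hh x \<le> sqrt (P 0) / 2 * hh x"
    using hh_pos[OF x] by (intro mult_right_mono) (auto simp: e1_def)
  also have "\<dots> = sqrt (1 + x) * (sqrt (P 0) / sqrt (Q x)) / 2"
    by (simp add: hh_eq mult.commute)
  also have "\<dots> \<le> (1 + x) * 1 / 2"
    using x Q_ge[OF x] Q_pos[OF x] P0 by (intro divide_right_mono mult_mono) (auto simp: real_le_lsqrt power2_eq_square algebra_simps)
  finally show ?thesis by simp
qed

text \<open>The Lipschitz bound allows 1/sqrt Q to fall at most to half its value at x, so sqrt Q at
  most doubles.\<close>

lemma Q_up:
  assumes "0 \<le> x" "x \<le> y" "y - x \<le> e1 * hh x"
  shows "Q y \<le> 4 * Q x"
proof -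
  have q: "sqrt (Q x) > 0" "sqrt (Q y) > 0" "sqrt (1 + x) > 0"
    using assms Q_pos by auto
  have "y - x \<le> 1 / C1 * hh x"
    using assms(3) hh_pos[OF assms(1)] by (intro order_trans[OF assms(3)] mult_right_mono) (auto simp: e1_def)
  then have "C1 * (y - x) \<le> hh x" using C1 by (simp add: field_simps)
  then have "C1 * (y - x) / (2 * sqrt (1 + x)) \<le> hh x / (2 * sqrt (1 + x))"
    using q by (intro divide_right_mono) auto
  also have "\<dots> = 1 / (2 * sqrt (Q x))" using q by (simp add: hh_eq)
  finally have "1 / sqrt (Q x) - 1 / sqrt (Q y) \<le> 1 / (2 * sqrt (Q x))"
    using inverse_sqrt_Q_diff[OF assms(1,2)] by simp
  then have "sqrt (Q y) \<le> 2 * sqrt (Q x)" using q by (simp add: field_simps)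
  then have "(sqrt (Q y))\<^sup>2 \<le> (2 * sqrt (Q x))\<^sup>2" using q by (intro power_mono) auto
  then show ?thesis using assms Q_pos[of x] Q_pos[of y] by (simp add: power_mult_distrib)
qed

lemma Q_down:
  assumes "0 \<le> y" "y \<le> x" "x - y \<le> e1 * hh x"
  shows "Q x \<le> 4 * Q y"
proof -
  have x: "x \<ge> 0" using assms by simp
  have q: "sqrt (Q x) > 0" "sqrt (Q y) > 0" "sqrt (1 + x) > 0" "sqrt (1 + y) > 0"
    using assms Q_pos x by auto
  \<comment> \<open>The Lipschitz bound is anchored at the left endpoint y while the step is
    measured by \<open>hh x\<close>, so 1 + x and 1 + y have to be compared first.\<close>
  have xy: "(1 + x) / 2 \<le> 1 + y" using e1_hh[OF x] assms by simp
  have "sqrt (1 + x) \<le> sqrt (2\<^sup>2 * (1 + y))"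
    by (rule real_sqrt_le_mono) (use xy assms in simp)
  then have s: "sqrt (1 + x) \<le> 2 * sqrt (1 + y)" by (simp only: real_sqrt_mult real_sqrt_abs)
  have "x - y \<le> 1 / C1 * hh x"
    using assms(3) hh_pos[OF x] by (intro order_trans[OF assms(3)] mult_right_mono) (auto simp: e1_def)
  then have "C1 * (x - y) \<le> hh x" using C1 by (simp add: field_simps)
  then have "C1 * (x - y) / (2 * sqrt (1 + y)) \<le> hh x / (2 * sqrt (1 + y))"
    using q by (intro divide_right_mono) auto
  also have "\<dots> \<le> 1 / sqrt (Q x)" using q s by (simp add: hh_eq field_simps)
  finally have "1 / sqrt (Q y) - 1 / sqrt (Q x) \<le> 1 / sqrt (Q x)"
    using inverse_sqrt_Q_diff[OF assms(1,2)] by simp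
  then have "sqrt (Q x) \<le> 2 * sqrt (Q y)" using q by (simp add: field_simps)
  then have "(sqrt (Q x))\<^sup>2 \<le> (2 * sqrt (Q y))\<^sup>2" using q by (intro power_mono) auto
  then show ?thesis using assms Q_pos[of x] Q_pos[of y] by (simp add: power_mult_distrib)
qed

section \<open>Comparison of P, R and Q at the same point\<close>

definition C2 :: real where "C2 = 16 / e1\<^sup>2 + Q 1 / (P 0)\<^sup>2"
definition C4 :: real where "C4 = 2 + 2 * R 1 / P 0"

lemma C2_pos: "C2 > 0" and C4_pos: "C4 > 0"
  using e1_pos P0 Q_pos[of 1] R_nonneg[of 1] by (auto simp: C2_def C4_def add_pos_nonneg)

text \<open>Q is at least Q(x)/4 on an interval of length \<open>e1 * hh x\<close> to the left of x,
  so \<Phi>(x) dominates \<open>hh x * Q x\<close>; as \<Phi> is at most (1 + x) P, squaring gives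
  the claim for x \<ge> 1. \<open>C2\<close> adds the constant for [0, 1], where monotonicity
  suffices.\<close>

lemma Q_le_P: 
  assumes x: "x \<ge> 0" shows "Q x \<le> C2 * ((1 + x) * (P x)\<^sup>2)"
proof (cases "x \<ge> 1")
  case True
  define y where "y = x - e1 * hh x"
  have y: "0 \<le> y" "y \<le> x" "x - y = e1 * hh x"
    using e1_hh[OF x] True e1_pos hh_pos[OF x] by (auto simp: y_def)
  have "e1 / 4 * (hh x * Q x) = (x - y) * (Q x / 4)" by (simp add: y)
  also have "\<dots> \<le> (x - y) * Q y"
    using Q_down[of y x] y by (intro mult_left_mono) auto
  also have "\<dots> \<le> \<Phi> x - \<Phi> y" by (rule Phi_diff_ge) (use y in auto)
  also have "\<dots> \<le> (1 + x) * P x" using Phi_nonneg[of y] y P_pos[OF x] by (simp add: \<Phi>_def algebra_simps)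
  finally have *: "e1 / 4 * (hh x * Q x) \<le> (1 + x) * P x" .
  have "(e1 / 4)\<^sup>2 * ((1 + x) * Q x) = (e1 / 4 * (hh x * Q x))\<^sup>2"
    using Q_pos[OF x] hh_squared[OF x] by (simp only: power_mult_distrib) (simp add: power2_eq_square)
  also have "\<dots> \<le> ((1 + x) * P x)\<^sup>2"
    using * e1_pos hh_pos[OF x] Q_pos[OF x] by (intro power_mono) auto
  finally have "(e1 / 4)\<^sup>2 * Q x * (1 + x) \<le> ((1 + x) * (P x)\<^sup>2) * (1 + x)"
    by (simp add: power2_eq_square algebra_simps)
  then have "(e1 / 4)\<^sup>2 * Q x \<le> (1 + x) * (P x)\<^sup>2" using x by (simp add: mult_le_cancel_right)
  then have "Q x \<le> 16 / e1\<^sup>2 * ((1 + x) * (P x)\<^sup>2)" using e1_pos by (simp add: field_simps power2_eq_square)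
  also have "\<dots> \<le> C2 * ((1 + x) * (P x)\<^sup>2)"
    using x Q_pos[of 1] by (intro mult_right_mono) (auto simp: C2_def)
  finally show ?thesis .
next
  case False
  have "Q x * 1 \<le> Q 1 * ((1 + x) * (P x)\<^sup>2 / (P 0)\<^sup>2)"
  proof (rule mult_mono)
    show "Q x \<le> Q 1" using False x by (intro Q_mono) auto
    have "(P 0)\<^sup>2 \<le> (P x)\<^sup>2" using P_ge[OF x] P0 by (intro power_mono) auto
    moreover have "1 * (P x)\<^sup>2 \<le> (1 + x) * (P x)\<^sup>2" using x by (intro mult_right_mono) auto
    ultimately show "1 \<le> (1 + x) * (P x)\<^sup>2 / (P 0)\<^sup>2" using P0 by (simp add: field_simps)
  qed (use Q_pos[of 1] x in auto)
  also have "\<dots> \<le> C2 * ((1 + x) * (P x)\<^sup>2)"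
    using x e1_pos P0 by (simp add: C2_def distrib_right)
  finally show ?thesis by simp
qed

text \<open>For x \<ge> 1 this is contained in Q = P + x R. Near 0 that identity says nothing about
  R, and the bound uses R 1 and the lower bound P 0 of Q instead.\<close>

lemma R_le_Q: 
  assumes x: "x \<ge> 0" shows "(1 + x) * R x \<le> C4 * Q x"
proof (cases "x \<ge> 1")
  case True
  have "(1 + x) * R x \<le> 2 * (x * R x)" using True mult_right_mono[OF True R_nonneg[OF x]] by (simp add: algebra_simps)
  also have "\<dots> \<le> 2 * Q x" using P_pos[OF x] by (simp add: Q_eq x)
  also have "\<dots> \<le> C4 * Q x" using Q_pos[OF x] P0 R_nonneg[of 1] by (intro mult_right_mono) (auto simp: C4_def)
  finally show ?thesis .
next
  case False
  have "(1 + x) * R x \<le> 2 * R 1" using False x R_mono[of x 1] R_nonneg[OF x] by (intro mult_mono) auto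
  also have "\<dots> \<le> 2 * R 1 / P 0 * Q x"
    using mult_right_mono[OF Q_ge[OF x], of "R 1"] P0 R_nonneg[of 1] by (simp add: field_simps)
  also have "\<dots> \<le> C4 * Q x" using Q_pos[OF x] by (intro mult_right_mono) (auto simp: C4_def)
  finally show ?thesis .
qed

text \<open>A displacement of Euclidean length 1/sqrt P contributes 1/P to |z + d|^2 through its
  square; this is at most of the order of the linear radial term.\<close>

lemma inverse_P_le: "x \<ge> 0 \<Longrightarrow> 1 / P x \<le> sqrt C2 * hh x"
proof -
  assume x: "x \<ge> 0"
  have "sqrt (Q x) \<le> sqrt (C2 * ((1 + x) * (P x)\<^sup>2))"
    using Q_le_P[OF x] by simp
  also have "\<dots> = sqrt C2 * sqrt (1 + x) * P x"
    using P_pos[OF x] by (simp add: real_sqrt_mult)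
  finally show ?thesis
    using P_pos[OF x] Q_pos[OF x] by (simp add: hh_eq field_simps)
qed

lemma P_diff_le:
  assumes "x \<ge> 0" "y \<ge> 0" "\<bar>y - x\<bar> \<le> e1 * hh x"
  shows "\<bar>P y - P x\<bar> \<le> 4 * C4 * \<bar>y - x\<bar> * Q x / (1 + x)"
proof -
  have "\<bar>P y - P x\<bar> \<le> \<bar>y - x\<bar> * (4 * C4 * Q x / (1 + x))"
  proof (cases "x \<le> y")
    case True
    obtain t where t: "x \<le> t" "t \<le> y" "P y - P x = R t * (y - x)"
      using mvt_halfline[OF assms(1) True P_deriv] by blast
    \<comment> \<open>Monotonicity of R moves the estimate to the right endpoint, and
      \<open>Q_up\<close> brings it back to x.\<close>
    have "(1 + x) * R t \<le> (1 + y) * R y"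
      using t assms R_mono[of t y] R_nonneg[of t] by (intro mult_mono) auto
    also have "\<dots> \<le> C4 * Q y" by (rule R_le_Q[OF assms(2)])
    also have "\<dots> \<le> C4 * (4 * Q x)" using Q_up[of x y] True assms C4_pos by (intro mult_left_mono) auto
    finally have "R t \<le> 4 * C4 * Q x / (1 + x)" using assms by (simp add: field_simps)
    moreover have "\<bar>P y - P x\<bar> = R t * \<bar>y - x\<bar>" using t True R_nonneg[of t] assms by (simp add: abs_mult)
    ultimately show ?thesis by (subst mult.commute) (simp only: mult_right_mono abs_ge_zero)
  next
    case False
    then obtain t where t: "y \<le> t" "t \<le> x" "P x - P y = R t * (x - y)"
      using mvt_halfline[OF assms(2) _ P_deriv, of x] by auto
    have "(1 + x) * R t \<le> (1 + x) * R x"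
      using t assms R_mono[of t x] by (intro mult_left_mono) auto
    also have "\<dots> \<le> C4 * Q x" by (rule R_le_Q[OF assms(1)])
    also have "\<dots> \<le> C4 * (4 * Q x)" using assms C4_pos Q_pos[of x] by (intro mult_left_mono) auto
    finally have "R t \<le> 4 * C4 * Q x / (1 + x)" using assms by (simp add: field_simps)
    moreover have "\<bar>P y - P x\<bar> = R t * \<bar>y - x\<bar>" 
      using t False R_nonneg[of t] assms by (subst abs_minus_commute) (simp add: abs_mult)
    ultimately show ?thesis by (subst mult.commute) (simp only: mult_right_mono abs_ge_zero)
  qed
  then show ?thesis by (simp add: algebra_simps)
qed

section \<open>Windows on which the weight functions are constant up to factors\<close>

definition e0 :: real where "e0 = min e1 (1 / (8 * C4 * sqrt C2))"

lemma e0_pos: "e0 > 0" and e0_le_e1: "e0 \<le> e1"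
  using e1_pos C2_pos C4_pos by (auto simp: e0_def)

text \<open>P changes at the rate Q/(1 + x) = 1/hh^2, up to a constant, and 1/hh is at most
  \<open>sqrt C2 * P x\<close>. The second entry of \<open>e0\<close> is chosen so that the total
  change stays below half of P x.\<close>

lemma P_near:
  assumes "x \<ge> 0" "y \<ge> 0" "\<bar>y - x\<bar> \<le> e0 * hh x"
  shows "P y \<le> 2 * P x" "P x \<le> 2 * P y"
proof -
  have h: "hh x > 0" by (rule hh_pos[OF assms(1)])
  have "\<bar>y - x\<bar> \<le> e1 * hh x"
    using assms(3) e0_le_e1 h by (meson mult_right_mono order_trans less_imp_le)
  from P_diff_le[OF assms(1,2) this]
  have "\<bar>P y - P x\<bar> \<le> 4 * C4 * \<bar>y - x\<bar> * (Q x / (1 + x))" by simp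
  also have "Q x / (1 + x) = 1 / (hh x)\<^sup>2" using assms Q_pos[of x] by (simp add: hh_squared)
  also have "4 * C4 * \<bar>y - x\<bar> * (1 / (hh x)\<^sup>2) \<le> 4 * C4 * (1 / (8 * C4 * sqrt C2) * hh x) * (1 / (hh x)\<^sup>2)"
    using assms(3) h C4_pos
    by (intro mult_right_mono mult_left_mono order_trans[OF assms(3)]) (auto simp: e0_def)
  also have "\<dots> = 1 / (sqrt C2 * hh x) / 2" using C4_pos h by (simp add: power2_eq_square)
  also have "\<dots> \<le> P x / 2"
    using inverse_P_le[OF assms(1)] P_pos[OF assms(1)] h C2_pos by (simp add: field_simps)
  finally have "\<bar>P y - P x\<bar> \<le> P x / 2" .
  then show "P y \<le> 2 * P x" "P x \<le> 2 * P y" using P_pos[OF assms(1)] by linarith+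
qed

lemma Q_near:
  assumes "x \<ge> 0" "y \<ge> 0" "\<bar>y - x\<bar> \<le> e0 * hh x"
  shows "Q y \<le> 4 * Q x" "Q x \<le> 4 * Q y"
proof -
  have "\<bar>y - x\<bar> \<le> e1 * hh x"
    using assms(3) e0_le_e1 hh_pos[OF assms(1)] by (meson mult_right_mono order_trans less_imp_le)
  then show "Q y \<le> 4 * Q x" "Q x \<le> 4 * Q y"
    using Q_up[of x y] Q_down[of y x] Q_mono[of x y] Q_mono[of y x] assms Q_pos[of x] Q_pos[of y]
    by (cases "x \<le> y"; simp)+
qed

lemma one_plus_near:
  assumes "x \<ge> 0" "y \<ge> 0" "\<bar>y - x\<bar> \<le> e0 * hh x"
  shows "1 + y \<le> 2 * (1 + x)" "1 + x \<le> 2 * (1 + y)"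
proof -
  have "\<bar>y - x\<bar> \<le> e1 * hh x"
    using assms(3) e0_le_e1 hh_pos[OF assms(1)] by (meson mult_right_mono order_trans less_imp_le)
  then show "1 + y \<le> 2 * (1 + x)" "1 + x \<le> 2 * (1 + y)" using e1_hh[OF assms(1)] by auto
qed

text \<open>The Taylor error is of the order of (Q/(1 + x)) times hh^2, that is, bounded: on this
  window \<Psi> exceeds its tangent by at most a constant.\<close>

lemma Psi_near:
  assumes "x \<ge> 0" "y \<ge> 0" "\<bar>y - x\<bar> \<le> e0 * hh x"
  shows "\<Psi> y \<le> \<Psi> x + P x * (y - x) + 4 * C4 * e0\<^sup>2"
proof -
  have h: "hh x > 0" by (rule hh_pos[OF assms(1)])
  have le: "\<bar>t - x\<bar> \<le> e1 * hh x" if "\<bar>t - x\<bar> \<le> \<bar>y - x\<bar>" for t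
    using that assms(3) e0_le_e1 h by (meson mult_right_mono order_trans less_imp_le)
  obtain t where t: "\<bar>t - x\<bar> \<le> \<bar>y - x\<bar>" "t \<ge> 0" "\<Psi> y - \<Psi> x = P t * (y - x)"
  proof (cases "x \<le> y")
    case True
    then obtain t where "x \<le> t" "t \<le> y" "\<Psi> y - \<Psi> x = P t * (y - x)"
      using mvt_halfline[OF assms(1) _ Psi_deriv, of y] by auto
    then show ?thesis using that[of t] assms by auto
  next
    case False
    then obtain t where "y \<le> t" "t \<le> x" "\<Psi> x - \<Psi> y = P t * (x - y)"
      using mvt_halfline[OF assms(2) _ Psi_deriv, of x] by auto
    then show ?thesis using that[of t] assms False by (auto simp: algebra_simps)
  qed
  have "\<Psi> y - \<Psi> x - P x * (y - x) = (P t - P x) * (y - x)" using t by (simp add: algebra_simps)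
  also have "\<dots> \<le> \<bar>P t - P x\<bar> * \<bar>y - x\<bar>" by (simp add: abs_mult[symmetric])
  also have "\<dots> \<le> (4 * C4 * \<bar>t - x\<bar> * Q x / (1 + x)) * \<bar>y - x\<bar>"
    by (intro mult_right_mono P_diff_le le) (use t assms in auto)
  also have "\<dots> = 4 * C4 * (Q x / (1 + x)) * (\<bar>t - x\<bar> * \<bar>y - x\<bar>)" by simp
  also have "\<dots> \<le> 4 * C4 * (Q x / (1 + x)) * ((e0 * hh x) * (e0 * hh x))"
    using t assms C4_pos Q_pos[of x] by (intro mult_left_mono mult_mono) auto
  also have "\<dots> = 4 * C4 * e0\<^sup>2 * ((Q x / (1 + x)) * (hh x)\<^sup>2)" by (simp add: power2_eq_square)
  also have "\<dots> = 4 * C4 * e0\<^sup>2" using assms Q_pos[of x] by (simp add: hh_squared)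
  finally show ?thesis by simp
qed

section \<open>Ellipsoids adapted to the weight\<close>

text \<open>The index \<open>undefined\<close> is an arbitrary but fixed element of the finite type \<open>'n\<close>.\<close>
definition frame :: "complex ^ 'n \<Rightarrow> complex ^ 'n \<Rightarrow> complex ^ 'n"
  where "frame z = (SOME U. linear U \<and> (\<forall>c v. U (c *s v) = c *s U v) \<and>
    (\<forall>x y. herm (U x) (U y) = herm x y) \<and>
    (\<exists>c. norm c = 1 \<and> z = (c * of_real (norm z)) *s U (axis undefined 1)))"

lemma frame:
  fixes z :: "complex ^ 'n"
  shows linear_frame: "linear (frame z)"
    and frame_smult: "frame z (c *s v) = c *s frame z v"
    and herm_frame: "herm (frame z x) (frame z y) = herm x y"
    and frame_axis: "\<exists>c. norm c = 1 \<and> z = (c * of_real (norm z)) *s frame z (axis undefined 1)"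
proof -
  have "\<exists>U :: complex ^ 'n \<Rightarrow> complex ^ 'n. linear U \<and> (\<forall>c v. U (c *s v) = c *s U v) \<and>
    (\<forall>x y. herm (U x) (U y) = herm x y) \<and>
    (\<exists>c. norm c = 1 \<and> z = (c * of_real (norm z)) *s U (axis undefined 1))"
  proof (rule unitary_exists[of z undefined])
    fix U :: "complex ^ 'n \<Rightarrow> complex ^ 'n" and c :: complex
    assume "linear U" "\<And>c v. U (c *s v) = c *s U v" "\<And>x y. herm (U x) (U y) = herm x y"
      "norm c = 1" "z = (c * of_real (norm z)) *s U (axis undefined 1)"
    then show ?thesis by (intro exI[of _ U] conjI allI exI[of _ c])
  qed
  from someI_ex[OF this] show "linear (frame z)" "frame z (c *s v) = c *s frame z v"
     "herm (frame z x) (frame z y) = herm x y"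
     "\<exists>c. norm c = 1 \<and> z = (c * of_real (norm z)) *s frame z (axis undefined 1)"
    unfolding frame_def by auto
qed

text \<open>Normalised coordinates at z: the distinguished index carries the complex direction of z,
  and the unit ball is mapped onto the adapted ellipsoid moved to the origin.\<close>

definition Tmap :: "complex ^ 'n \<Rightarrow> complex ^ 'n \<Rightarrow> complex ^ 'n"
  where "Tmap z u = frame z (diag_map undefined (1 / sqrt (Q ((norm z)\<^sup>2))) (1 / sqrt (P ((norm z)\<^sup>2))) u)"

text \<open>The real Jacobian of \<open>Tmap z\<close>, each complex axis contributing the square of
  its length.\<close>

definition vol :: "complex ^ 'n \<Rightarrow> real"
  where "vol z = 1 / (Q ((norm z)\<^sup>2) * P ((norm z)\<^sup>2) ^ (CARD('n) - 1))"

definition ell :: "complex ^ 'n \<Rightarrow> real \<Rightarrow> (complex ^ 'n) set"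
  where "ell z e = (\<lambda>u. z + Tmap z u) ` ball 0 e"

lemma vol_pos: "vol z > 0"
  by (simp add: vol_def Q_pos P_pos)

lemma norm_frame: "norm (frame z x) = norm x"
proof -
  have "(norm (frame z x))\<^sup>2 = (norm x)\<^sup>2"
    using herm_frame[of z x x] by (simp only: herm_self of_real_eq_iff)
  then show ?thesis by simp
qed

lemma linear_Tmap: "linear (Tmap z)"
  unfolding Tmap_def using linear_compose[OF linear_diag_map linear_frame] by (simp add: o_def)

lemma Tmap_smult: "Tmap z (c *s u) = c *s Tmap z u"
  by (simp add: Tmap_def diag_map_smult frame_smult)

lemma Tmap_0 [simp]: "Tmap z 0 = 0"
  by (rule linear_0[OF linear_Tmap])

lemma Tmap_measurable [measurable]: "Tmap z \<in> borel_measurable borel"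
  using linear_Tmap[of z] by (intro borel_measurable_continuous_onI linear_continuous_on)
      (simp add: linear_conv_bounded_linear)

lemma nn_integral_Tmap:
  fixes f :: "complex ^ 'n \<Rightarrow> ennreal"
  assumes [measurable]: "f \<in> borel_measurable borel"
  shows "(\<integral>\<^sup>+w. f w \<partial>lborel) = ennreal (vol z) * (\<integral>\<^sup>+u. f (z + Tmap z u) \<partial>lborel)"
proof -
  define a where "a = 1 / sqrt (Q ((norm z)\<^sup>2))"
  define b where "b = 1 / sqrt (P ((norm z)\<^sup>2))"
  have ab: "a > 0" "b > 0" by (auto simp: a_def b_def Q_pos P_pos)
  have [measurable]: "frame z \<in> borel_measurable borel"
    using linear_frame[of z] by (intro borel_measurable_continuous_onI linear_continuous_on)
      (simp add: linear_conv_bounded_linear)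
  have "(\<integral>\<^sup>+w. f w \<partial>lborel) = (\<integral>\<^sup>+w. f (z + w) \<partial>lborel)"
    using nn_integral_lborel_affine[of f 1 z] by simp
  also have "\<dots> = (\<integral>\<^sup>+w. f (z + frame z w) \<partial>lborel)"
    by (rule nn_integral_unitary[symmetric, of "\<lambda>w. f (z + w)"]) (auto simp: linear_frame herm_frame)
  also have "\<dots> = ennreal (a\<^sup>2 * (b\<^sup>2) ^ (CARD('n) - 1)) * (\<integral>\<^sup>+u. f (z + frame z (0 + diag_map undefined a b u)) \<partial>lborel)"
    by (rule nn_integral_diag_map) (use ab in auto)
  also have "a\<^sup>2 * (b\<^sup>2) ^ (CARD('n) - 1) = vol z"
    by (simp add: a_def b_def vol_def power_divide Q_pos P_pos less_imp_le)
  finally show ?thesis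
    by (simp add: Tmap_def a_def b_def)
qed

lemma norm_Tmap_le: "norm (Tmap z u) \<le> norm u / sqrt (P ((norm z)\<^sup>2))"
proof -
  let ?x = "(norm z)\<^sup>2"
  let ?S = "\<Sum>j\<in>UNIV - {undefined}. (norm (u $ j))\<^sup>2"
  have "(norm (Tmap z u))\<^sup>2 = (norm (u $ undefined))\<^sup>2 / Q ?x + ?S / P ?x"
    by (simp add: Tmap_def norm_frame norm_diag_map_squared power_divide Q_pos P_pos less_imp_le)
  also have "\<dots> \<le> (norm (u $ undefined))\<^sup>2 / P ?x + ?S / P ?x"
    by (intro add_mono divide_left_mono) (auto simp: Q_ge_P P_pos Q_pos intro!: sum_nonneg)
  also have "\<dots> = (norm u)\<^sup>2 / P ?x"
    by (simp add: norm_vec_squared_split[of u undefined] add_divide_distrib)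
  also have "\<dots> = (norm u / sqrt (P ?x))\<^sup>2"
    by (simp add: power_divide P_pos less_imp_le)
  finally show ?thesis
    by (rule power2_le_imp_le) (simp add: P_pos less_imp_le)
qed

lemma norm_herm_Tmap:
  "norm (herm (Tmap z u) z) = norm z * norm (u $ undefined) / sqrt (Q ((norm z)\<^sup>2))"
proof -
  obtain c where c: "norm c = 1" "z = (c * of_real (norm z)) *s frame z (axis undefined 1)"
    using frame_axis by blast
  define e where "e = frame z (axis undefined 1)"
  have "herm (Tmap z u) e = diag_map undefined (1 / sqrt (Q ((norm z)\<^sup>2))) (1 / sqrt (P ((norm z)\<^sup>2))) u $ undefined"
    unfolding Tmap_def e_def by (simp add: herm_frame) (simp add: herm_def axis_def if_distrib cong: if_cong)
  also have "\<dots> = (1 / sqrt (Q ((norm z)\<^sup>2))) *\<^sub>R u $ undefined"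
    by (simp add: diag_map_def)
  finally have *: "herm (Tmap z u) e = (1 / sqrt (Q ((norm z)\<^sup>2))) *\<^sub>R u $ undefined" .
  have "herm (Tmap z u) z = herm (Tmap z u) ((c * of_real (norm z)) *s e)"
    using c by (simp add: e_def)
  then show ?thesis
    using c by (simp add: herm_scale_right * norm_mult Q_pos less_imp_le)
qed

lemma norm_herm_Tmap_le: "norm (herm (Tmap z u) z) \<le> hh ((norm z)\<^sup>2) * norm u"
proof -
  have "norm (herm (Tmap z u) z) = (norm z / sqrt (Q ((norm z)\<^sup>2))) * norm (u $ undefined)"
    by (simp add: norm_herm_Tmap)
  also have "\<dots> \<le> hh ((norm z)\<^sup>2) * norm u"
  proof (intro mult_mono)
    have "norm z \<le> sqrt (1 + (norm z)\<^sup>2)" by (rule real_le_rsqrt) simp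
    then show "norm z / sqrt (Q ((norm z)\<^sup>2)) \<le> hh ((norm z)\<^sup>2)"
      unfolding hh_eq by (intro divide_right_mono) (auto simp: Q_pos less_imp_le)
    show "norm (u $ undefined) \<le> norm u" by (rule Finite_Cartesian_Product.norm_nth_le)
  qed (auto simp: hh_pos less_imp_le)
  finally show ?thesis .
qed

lemma bij_Tmap: "inj (Tmap z)" "surj (Tmap z)"
proof -
  have "u = 0" if "Tmap z u = 0" for u
  proof -
    have "norm (diag_map undefined (1 / sqrt (Q ((norm z)\<^sup>2))) (1 / sqrt (P ((norm z)\<^sup>2))) u) = 0"
      using that norm_frame[of z] by (metis Tmap_def norm_zero)
    then show "u = 0"
      by (auto simp: vec_eq_iff diag_map_def split: if_splits)
        (metis Q_pos P_pos less_irrefl norm_ge_zero zero_le_power2)+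
  qed
  then show "inj (Tmap z)" by (simp add: linear_injective_0[OF linear_Tmap])
  then show "surj (Tmap z)" using linear_injective_imp_surjective[OF linear_Tmap] by blast
qed

definition Kell :: real where "Kell = sqrt (3 + 2 * C2 * P 1) + 1"

lemma Kell_pos: "Kell > 0"
  using C2_pos P_pos[of 1] by (auto simp: Kell_def intro!: add_nonneg_pos)

text \<open>Recognises points of an ellipsoid by two quantities that can be integrated along a
  curve: the Euclidean length of the displacement and its product with z.\<close>

lemma Tmap_surj_bound:
  assumes "norm d \<le> t / sqrt (P ((norm z)\<^sup>2))" "norm (herm d z) \<le> t * hh ((norm z)\<^sup>2)" "t > 0"
  obtains u where "d = Tmap z u" "norm u < Kell * t"
proof -
  let ?x = "(norm z)\<^sup>2"
  obtain u where u: "d = Tmap z u" using bij_Tmap(2)[of z] by auto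
  let ?S = "\<Sum>j\<in>UNIV - {undefined}. (norm (u $ j))\<^sup>2"
  have d2: "(norm d)\<^sup>2 = (norm (u $ undefined))\<^sup>2 / Q ?x + ?S / P ?x"
    by (simp add: u Tmap_def norm_frame norm_diag_map_squared power_divide Q_pos P_pos less_imp_le)
  have "(norm d)\<^sup>2 \<le> (t / sqrt (P ?x))\<^sup>2"
    using assms(1) by (rule power_mono) simp
  then have d3: "(norm d)\<^sup>2 \<le> t\<^sup>2 / P ?x" by (simp add: power_divide P_pos less_imp_le)
  have S0: "?S \<ge> 0" by (intro sum_nonneg) auto
  have "?S / P ?x \<le> t\<^sup>2 / P ?x"
    using d2 d3 Q_pos[of ?x] by (smt (verit) divide_nonneg_pos zero_le_power2)
  then have S: "?S \<le> t\<^sup>2" using P_pos[of ?x] by (simp add: divide_le_cancel)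
  \<comment> \<open>For |z| \<ge> 1 the product with z controls the radial coordinate. Near the
    origin it degenerates, but there Q/P is bounded and the length of d alone suffices.\<close>
  have k: "(norm (u $ undefined))\<^sup>2 \<le> (2 + 2 * C2 * P 1) * t\<^sup>2"
  proof (cases "norm z \<ge> 1")
    case True
    have "norm z * norm (u $ undefined) / sqrt (Q ?x) \<le> t * hh ?x"
      using assms(2) by (simp add: u norm_herm_Tmap)
    then have "norm z * norm (u $ undefined) \<le> t * sqrt (1 + ?x)"
      using Q_pos[of ?x] by (simp add: hh_eq field_simps)
    then have "(norm z * norm (u $ undefined))\<^sup>2 \<le> (t * sqrt (1 + ?x))\<^sup>2" by (rule power_mono) simp
    then have "?x * (norm (u $ undefined))\<^sup>2 \<le> t\<^sup>2 * (1 + ?x)" by (simp add: power_mult_distrib)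
    also have "\<dots> \<le> t\<^sup>2 * (2 * ?x)" using True by (intro mult_left_mono) auto
    finally have "?x * (norm (u $ undefined))\<^sup>2 \<le> ?x * (2 * t\<^sup>2)" by (simp add: algebra_simps)
    then have "(norm (u $ undefined))\<^sup>2 \<le> 2 * t\<^sup>2" using True by (subst (asm) mult_le_cancel_left_pos) auto
    also have "\<dots> \<le> (2 + 2 * C2 * P 1) * t\<^sup>2" using C2_pos P_pos[of 1] by (intro mult_right_mono) auto
    finally show ?thesis .
  next
    case False
    then have x1: "?x \<le> 1" by (simp add: power_le_one)
    have "(norm (u $ undefined))\<^sup>2 / Q ?x \<le> t\<^sup>2 / P ?x"
      using d2 d3 S0 P_pos[of ?x] by (smt (verit) divide_nonneg_pos zero_le_power2)
    then have "(norm (u $ undefined))\<^sup>2 \<le> Q ?x / P ?x * t\<^sup>2"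
      using P_pos[of ?x] Q_pos[of ?x] by (simp add: field_simps)
    also have "Q ?x / P ?x \<le> C2 * ((1 + ?x) * P ?x)"
      using Q_le_P[of ?x] P_pos[of ?x] by (simp add: field_simps power2_eq_square)
    also have "C2 * ((1 + ?x) * P ?x) \<le> C2 * (2 * P 1)"
      using x1 C2_pos P_pos[of ?x] P_mono[of ?x 1] by (intro mult_left_mono mult_mono) auto
    also have "\<dots> \<le> 2 + 2 * C2 * P 1" by simp
    finally show ?thesis by (simp add: mult_right_mono)
  qed
  have "(norm u)\<^sup>2 \<le> (3 + 2 * C2 * P 1) * t\<^sup>2"
    using S k by (simp add: norm_vec_squared_split[of u undefined] algebra_simps)
  then have "norm u \<le> sqrt ((3 + 2 * C2 * P 1) * t\<^sup>2)" by (rule real_le_rsqrt)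
  also have "\<dots> = sqrt (3 + 2 * C2 * P 1) * t" using assms(3) by (simp add: real_sqrt_mult)
  also have "\<dots> < Kell * t" using assms(3) by (simp add: Kell_def)
  finally show ?thesis using u that by blast
qed

lemma open_ell: "open (ell z e)"
proof -
  have "ell z e = (+) z ` (Tmap z ` ball 0 e)" by (auto simp: ell_def image_image)
  moreover have "open (Tmap z ` ball 0 e)"
    by (rule open_surjective_linear_image[OF _ linear_Tmap bij_Tmap(2)]) simp
  ultimately show ?thesis by (simp add: open_translation)
qed

lemma ell_iff: "z + Tmap z u \<in> ell z e \<longleftrightarrow> norm u < e"
  using bij_Tmap(1)[of z] by (auto simp: ell_def inj_def) metis

lemma emeasure_ell:
  fixes z :: "complex ^ 'n"
  shows "emeasure lborel (ell z e) = ennreal (vol z * measure lborel (ball (0 :: complex ^ 'n) e))"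
proof -
  have [measurable]: "ell z e \<in> sets borel" by (simp add: open_ell)
  have "emeasure lborel (ell z e) = (\<integral>\<^sup>+w. indicator (ell z e) w \<partial>lborel)" by simp
  also have "\<dots> = ennreal (vol z) * (\<integral>\<^sup>+u. indicator (ell z e) (z + Tmap z u) \<partial>lborel)"
    by (rule nn_integral_Tmap) simp
  also have "(\<lambda>u. indicator (ell z e) (z + Tmap z u)) = (indicator (ball 0 e) :: _ \<Rightarrow> ennreal)"
    by (auto simp: indicator_def ell_iff fun_eq_iff)
  also have "(\<integral>\<^sup>+u. indicator (ball (0 :: complex ^ 'n) e) u \<partial>lborel) = emeasure lborel (ball (0 :: complex ^ 'n) e)" by simp
  also have "\<dots> = ennreal (measure lborel (ball (0 :: complex ^ 'n) e))"
    using emeasure_lborel_ball_finite[of "0 :: complex ^ 'n" e] by (simp add: emeasure_eq_ennreal_measure less_top[symmetric])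
  finally show ?thesis by (simp add: ennreal_mult vol_pos less_imp_le)
qed

section \<open>The local mean value estimate\<close>

text \<open>Chosen so that |.|^2 varies by at most \<open>e0 * hh\<close> on the ellipsoid: 2
  accounts for the linear radial term, \<open>sqrt C2\<close> for the square of the
  displacement.\<close>

definition eps1 :: real where "eps1 = min 1 (e0 / (2 + sqrt C2))"

lemma eps1: "eps1 > 0" "eps1 \<le> 1" "eps1 * (2 + sqrt C2) \<le> e0"
proof -
  have s: "2 + sqrt C2 > 0" using C2_pos by (simp add: add_pos_pos)
  show "eps1 > 0" "eps1 \<le> 1" using e0_pos s by (auto simp: eps1_def)
  have "eps1 \<le> e0 / (2 + sqrt C2)" by (simp add: eps1_def)
  then show "eps1 * (2 + sqrt C2) \<le> e0" using s by (simp add: field_simps)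
qed

lemma norm_Tmap_squared_le:
  "(norm (Tmap z u))\<^sup>2 \<le> (norm u)\<^sup>2 / P ((norm z)\<^sup>2)"
proof -
  have "(norm (Tmap z u))\<^sup>2 \<le> (norm u / sqrt (P ((norm z)\<^sup>2)))\<^sup>2"
    by (rule power_mono[OF norm_Tmap_le]) simp
  then show ?thesis by (simp add: power_divide P_pos less_imp_le)
qed

lemma norm_squared_ell:
  assumes "norm u \<le> eps1"
  shows "\<bar>(norm (z + Tmap z u))\<^sup>2 - (norm z)\<^sup>2\<bar> \<le> norm u * (2 + sqrt C2) * hh ((norm z)\<^sup>2)"
    and "\<bar>(norm (z + Tmap z u))\<^sup>2 - (norm z)\<^sup>2\<bar> \<le> e0 * hh ((norm z)\<^sup>2)"
proof -
  let ?x = "(norm z)\<^sup>2"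
  have "\<bar>(norm (z + Tmap z u))\<^sup>2 - ?x\<bar> = \<bar>2 * Re (herm (Tmap z u) z) + (norm (Tmap z u))\<^sup>2\<bar>"
    by (simp add: norm_add_herm)
  also have "\<dots> \<le> 2 * norm (herm (Tmap z u) z) + (norm (Tmap z u))\<^sup>2"
    using abs_Re_le_cmod[of "herm (Tmap z u) z"] zero_le_power2[of "norm (Tmap z u)"] by linarith
  also have "\<dots> \<le> 2 * (hh ?x * norm u) + (norm u)\<^sup>2 * (sqrt C2 * hh ?x)"
  proof (intro add_mono mult_left_mono norm_herm_Tmap_le)
    have "(norm (Tmap z u))\<^sup>2 \<le> (norm u)\<^sup>2 * (1 / P ?x)" using norm_Tmap_squared_le[of z u] by simp
    also have "\<dots> \<le> (norm u)\<^sup>2 * (sqrt C2 * hh ?x)" by (intro mult_left_mono inverse_P_le) auto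
    finally show "(norm (Tmap z u))\<^sup>2 \<le> (norm u)\<^sup>2 * (sqrt C2 * hh ?x)" .
  qed auto
  also have "(norm u)\<^sup>2 * (sqrt C2 * hh ?x) \<le> (norm u * 1) * (sqrt C2 * hh ?x)"
    unfolding power2_eq_square[of "norm u"] using assms eps1 C2_pos hh_pos[of ?x]
    by (intro mult_right_mono mult_left_mono) auto
  finally show *: "\<bar>(norm (z + Tmap z u))\<^sup>2 - ?x\<bar> \<le> norm u * (2 + sqrt C2) * hh ?x"
    by (simp add: algebra_simps)
  also have "\<dots> \<le> eps1 * (2 + sqrt C2) * hh ?x"
    using assms C2_pos hh_pos[of ?x] by (intro mult_right_mono) auto
  also have "\<dots> \<le> e0 * hh ?x" using eps1(3) hh_pos[of ?x] by (intro mult_right_mono) auto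
  finally show "\<bar>(norm (z + Tmap z u))\<^sup>2 - ?x\<bar> \<le> e0 * hh ?x" .
qed

text \<open>The summand 1 bounds P times the squared displacement, the other is the Taylor error of
  \<Psi>.\<close>

definition C5 :: real where "C5 = 1 + 4 * C4 * e0\<^sup>2"

lemma Psi_ell:
  assumes "norm u \<le> eps1"
  shows "\<Psi> ((norm (z + Tmap z u))\<^sup>2) \<le> \<Psi> ((norm z)\<^sup>2) + 2 * Re (P ((norm z)\<^sup>2) * herm (Tmap z u) z) + C5"
proof -
  let ?x = "(norm z)\<^sup>2" and ?y = "(norm (z + Tmap z u))\<^sup>2"
  have "\<Psi> ?y \<le> \<Psi> ?x + P ?x * (?y - ?x) + 4 * C4 * e0\<^sup>2"
    by (rule Psi_near) (auto simp: norm_squared_ell[OF assms])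
  also have "P ?x * (?y - ?x) = 2 * Re (P ?x * herm (Tmap z u) z) + P ?x * (norm (Tmap z u))\<^sup>2"
    by (simp add: norm_add_herm algebra_simps)
  also have "P ?x * (norm (Tmap z u))\<^sup>2 \<le> P ?x * ((norm u)\<^sup>2 / P ?x)"
    by (intro mult_left_mono norm_Tmap_squared_le) (simp add: P_pos less_imp_le)
  also have "\<dots> = (norm u)\<^sup>2" using P_pos[of ?x] by simp
  also have "(norm u)\<^sup>2 \<le> 1" using assms eps1 by (simp add: power_le_one)
  finally show ?thesis by (simp add: C5_def)
qed

lemma Psi_continuous: "continuous_on UNIV (\<lambda>z :: complex ^ 'n. \<Psi> ((norm z)\<^sup>2))"
proof -
  have "continuous_on {0..} \<Psi>"
    by (rule DERIV_continuous_on[of _ _ P]) (use Psi_deriv in auto)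
  then show ?thesis
    by (rule continuous_on_compose2) (auto intro!: continuous_intros)
qed

lemma Psi_measurable [measurable]: "(\<lambda>z :: complex ^ 'n. \<Psi> ((norm z)\<^sup>2)) \<in> borel_measurable borel"
  by (rule borel_measurable_continuous_onI[OF Psi_continuous])

text \<open>The exponential factor is holomorphic in \<open>u\<close> and cancels the linear part of \<open>\<Psi>\<close> at \<open>|z|\<^sup>2\<close>.\<close>
definition twist :: "complex ^ 'n \<Rightarrow> (complex ^ 'n \<Rightarrow> complex) \<Rightarrow> complex ^ 'n \<Rightarrow> complex"
  where "twist z f u = f (z + Tmap z u) * exp (- (P ((norm z)\<^sup>2) * herm (Tmap z u) z))"

lemma entire_twist: "entire f \<Longrightarrow> entire (twist z f)"
  unfolding twist_def
proof (intro entire_mult)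
  assume "entire f"
  then show "entire (\<lambda>u. f (z + Tmap z u))"
    by (rule entire_compose_affine) (auto simp: linear_Tmap Tmap_smult)
  have "entire (\<lambda>u. herm (0 + Tmap z u) z)"
    by (rule entire_compose_affine[OF entire_herm]) (auto simp: linear_Tmap Tmap_smult)
  then have "entire (\<lambda>u. (- of_real (P ((norm z)\<^sup>2))) * herm (Tmap z u) z)"
    by (intro entire_mult entire_const) simp
  then show "entire (\<lambda>u. exp (- (P ((norm z)\<^sup>2) * herm (Tmap z u) z)))"
    using entire_compose_holomorphic[of exp "\<lambda>u. (- of_real (P ((norm z)\<^sup>2))) * herm (Tmap z u) z"]
    by (simp add: holomorphic_on_exp)
qed

lemma twist_0 [simp]: "twist z f 0 = f z"
  by (simp add: twist_def)

lemma norm_twist_squared: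
  "(norm (twist z f u))\<^sup>2 = (norm (f (z + Tmap z u)))\<^sup>2 * exp (- (2 * Re (P ((norm z)\<^sup>2) * herm (Tmap z u) z)))"
  by (simp add: twist_def norm_mult power_mult_distrib exp_double[symmetric])

lemma norm_twist_le:
  assumes "norm u \<le> eps1"
  shows "(norm (twist z f u))\<^sup>2
    \<le> exp (\<Psi> ((norm z)\<^sup>2) + C5) * ((norm (f (z + Tmap z u)))\<^sup>2 * exp (- \<Psi> ((norm (z + Tmap z u))\<^sup>2)))"
proof -
  have "exp (- (2 * Re (P ((norm z)\<^sup>2) * herm (Tmap z u) z)))
      \<le> exp (\<Psi> ((norm z)\<^sup>2) + C5 + - \<Psi> ((norm (z + Tmap z u))\<^sup>2))"
    using Psi_ell[OF assms, of z] by simp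
  also have "\<dots> = exp (\<Psi> ((norm z)\<^sup>2) + C5) * exp (- \<Psi> ((norm (z + Tmap z u))\<^sup>2))"
    by (rule exp_add)
  finally have *: "exp (- (2 * Re (P ((norm z)\<^sup>2) * herm (Tmap z u) z)))
     \<le> exp (\<Psi> ((norm z)\<^sup>2) + C5) * exp (- \<Psi> ((norm (z + Tmap z u))\<^sup>2))" .
  show ?thesis
    unfolding norm_twist_squared using mult_left_mono[OF *, of "(norm (f (z + Tmap z u)))\<^sup>2"]
    by (simp add: algebra_simps)
qed

text \<open>Mean value inequality for the twisted function on a ball in the normalised coordinates,
  carried back by \<open>Tmap\<close>. The radius stays free because a smaller ellipsoid is needed
  when it has to fit into a Bergman ball.\<close>

lemma local_estimate:
  fixes f :: "complex ^ 'n \<Rightarrow> complex"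
  assumes f: "entire f" and e: "0 < e" "e \<le> eps1"
  shows "ennreal ((norm (f z))\<^sup>2 * exp (- \<Psi> ((norm z)\<^sup>2)) * (vol z * measure lborel (ball (0 :: complex ^ 'n) e)))
    \<le> ennreal (exp C5) * (\<integral>\<^sup>+w. ennreal ((norm (f w))\<^sup>2 * exp (- \<Psi> ((norm w)\<^sup>2))) * indicator (ell z e) w \<partial>lborel)"
proof -
  let ?B = "ball (0 :: complex ^ 'n) e"
  have [measurable]: "f \<in> borel_measurable borel" by (rule entire_imp_borel_measurable[OF f])
  have [measurable]: "ell z e \<in> sets borel" by (simp add: open_ell)
  define G where "G w = ennreal ((norm (f w))\<^sup>2 * exp (- \<Psi> ((norm w)\<^sup>2))) * indicator (ell z e) w" for w
  have [measurable]: "G \<in> borel_measurable borel" unfolding G_def by measurable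
  have "ennreal ((norm (f z))\<^sup>2 * measure lborel ?B) = ennreal ((norm (twist z f 0))\<^sup>2 * (\<integral>u. indicat_real ?B u \<partial>lborel))"
    by simp
  also have "\<dots> \<le> (\<integral>\<^sup>+u. ennreal (indicat_real ?B u * (norm (twist z f u))\<^sup>2) \<partial>lborel)"
    by (rule entire_mean_value_square[OF entire_twist[OF f]])
      (auto simp: norm_smult split: split_indicator intro!: borel_measurable_indicator)
  also have "\<dots> \<le> (\<integral>\<^sup>+u. ennreal (exp (\<Psi> ((norm z)\<^sup>2) + C5)) * G (z + Tmap z u) \<partial>lborel)"
  proof (rule nn_integral_mono)
    fix u
    show "ennreal (indicat_real ?B u * (norm (twist z f u))\<^sup>2) \<le> ennreal (exp (\<Psi> ((norm z)\<^sup>2) + C5)) * G (z + Tmap z u)"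
    proof (cases "norm u < e")
      case True
      then show ?thesis
        using norm_twist_le[of u z f] e
        by (simp add: G_def ell_iff flip: ennreal_mult)
    qed (simp add: indicator_def)
  qed
  also have "\<dots> = ennreal (exp (\<Psi> ((norm z)\<^sup>2) + C5)) * (\<integral>\<^sup>+u. G (z + Tmap z u) \<partial>lborel)"
    by (rule nn_integral_cmult) measurable
  finally have "ennreal (vol z * exp (- \<Psi> ((norm z)\<^sup>2))) * ennreal ((norm (f z))\<^sup>2 * measure lborel ?B)
     \<le> ennreal (vol z * exp (- \<Psi> ((norm z)\<^sup>2))) * (ennreal (exp (\<Psi> ((norm z)\<^sup>2) + C5)) * (\<integral>\<^sup>+u. G (z + Tmap z u) \<partial>lborel))"
    by (rule mult_left_mono) simp
  also have "\<dots> = ennreal (vol z * exp (- \<Psi> ((norm z)\<^sup>2)) * exp (\<Psi> ((norm z)\<^sup>2) + C5)) * (\<integral>\<^sup>+u. G (z + Tmap z u) \<partial>lborel)"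
    by (simp add: mult.assoc[symmetric] ennreal_mult'' flip: ennreal_mult)
  also have "vol z * exp (- \<Psi> ((norm z)\<^sup>2)) * exp (\<Psi> ((norm z)\<^sup>2) + C5) = exp C5 * vol z"
    by (simp add: exp_add exp_minus field_simps)
  also have "ennreal (exp C5 * vol z) * (\<integral>\<^sup>+u. G (z + Tmap z u) \<partial>lborel)
      = ennreal (exp C5) * (ennreal (vol z) * (\<integral>\<^sup>+u. G (z + Tmap z u) \<partial>lborel))"
    by (simp add: ennreal_mult vol_pos less_imp_le mult.assoc)
  also have "ennreal (vol z) * (\<integral>\<^sup>+u. G (z + Tmap z u) \<partial>lborel) = (\<integral>\<^sup>+w. G w \<partial>lborel)"
    by (rule nn_integral_Tmap[symmetric]) simp
  finally show ?thesis
    by (simp add: G_def vol_pos less_imp_le algebra_simps flip: ennreal_mult)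
qed

end

section \<open>Integrals of homogeneous functions against radial weights\<close>

lemma nn_integral_exp_abs_le:
  assumes "c > (0::real)"
  shows "(\<integral>\<^sup>+x. ennreal (exp (- (c * \<bar>x\<bar>))) \<partial>lborel) \<le> ennreal (2 / c)"
proof -
  have h: "(\<integral>\<^sup>+x. ennreal (exp (- (c * x))) * indicator {0..} x \<partial>lborel) = ennreal (1 / c)"
  proof -
    have "((\<lambda>x. - exp (- (c * x)) / c) \<longlongrightarrow> 0) at_top"
    proof -
      have "filterlim (\<lambda>x. - (c * x)) at_bot at_top"
        using assms by (simp add: filterlim_uminus_at_bot filterlim_tendsto_pos_mult_at_top[OF tendsto_const] filterlim_ident)
      then have "((\<lambda>x. exp (- (c * x))) \<longlongrightarrow> 0) at_top"
        by (rule filterlim_compose[OF exp_at_bot])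
      from tendsto_divide[OF tendsto_minus[OF this] tendsto_const[of c]] show ?thesis using assms by simp
    qed
    then have "(\<integral>\<^sup>+x. ennreal (exp (- (c * x))) * indicator {0..} x \<partial>lborel) = ennreal (0 - (- exp (- (c * 0)) / c))"
      using assms by (intro nn_integral_FTC_atLeast) (auto intro!: derivative_eq_intros simp: field_simps)
    then show ?thesis by simp
  qed
  have "(\<integral>\<^sup>+x. ennreal (exp (- (c * \<bar>x\<bar>))) \<partial>lborel)
    \<le> (\<integral>\<^sup>+x. ennreal (exp (- (c * x))) * indicator {0..} x + ennreal (exp (- (c * - x))) * indicator {0..} (- x) \<partial>lborel)"
    by (rule nn_integral_mono) (auto simp: indicator_def abs_if)
  also have "\<dots> = (\<integral>\<^sup>+x. ennreal (exp (- (c * x))) * indicator {0..} x \<partial>lborel)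
     + (\<integral>\<^sup>+x. ennreal (exp (- (c * - x))) * indicator {0..} (- x) \<partial>lborel)"
    by (rule nn_integral_add) auto
  also have "(\<integral>\<^sup>+x. ennreal (exp (- (c * - x))) * indicator {0..} (- x) \<partial>lborel)
     = (\<integral>\<^sup>+x. ennreal (exp (- (c * x))) * indicator {0..} x \<partial>lborel)"
    using nn_integral_real_affine[of "\<lambda>x. ennreal (exp (- (c * x))) * indicator {0..} x" "-1" 0] by simp
  finally show ?thesis
    using assms by (simp add: h flip: ennreal_plus)
qed

lemma integrable_exp_abs:
  assumes "c > (0::real)" shows "integrable lborel (\<lambda>x. exp (- (c * \<bar>x\<bar>)))"
proof (rule integrableI_bounded)
  have "(\<integral>\<^sup>+x. ennreal (norm (exp (- (c * \<bar>x\<bar>)))) \<partial>lborel) \<le> ennreal (2 / c)"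
    using nn_integral_exp_abs_le[OF assms] by simp
  also have "\<dots> < \<infinity>" by simp
  finally show "(\<integral>\<^sup>+x. ennreal (norm (exp (- (c * \<bar>x\<bar>)))) \<partial>lborel) < \<infinity>" .
qed simp

lemma integrable_gaussian:
  assumes c: "c > (0::real)"
  shows "integrable lborel (\<lambda>z::'a::euclidean_space. exp (- (c * (norm z)\<^sup>2)))"
proof (rule integrableI_bounded)
  have 1: "(\<integral>\<^sup>+x. ennreal (exp (- (c * x\<^sup>2))) \<partial>lborel) < \<infinity>"
  proof -
    have "exp (- (c * x\<^sup>2)) \<le> exp c * exp (- (2 * c * \<bar>x\<bar>))" for x :: real
    proof -
      \<comment> \<open>Expanding the square compares the Gaussian with an exponential of
        |x|.\<close>
      have "0 \<le> c * (\<bar>x\<bar> - 1)\<^sup>2" using c by simp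
      then show ?thesis unfolding exp_add[symmetric] by (simp add: power2_diff algebra_simps)
    qed
    then have "(\<integral>\<^sup>+x. ennreal (exp (- (c * x\<^sup>2))) \<partial>lborel) \<le> (\<integral>\<^sup>+x. ennreal (exp c) * ennreal (exp (- (2 * c * \<bar>x\<bar>))) \<partial>lborel)"
      by (intro nn_integral_mono) (auto simp flip: ennreal_mult)
    also have "\<dots> = ennreal (exp c) * (\<integral>\<^sup>+x. ennreal (exp (- (2 * c * \<bar>x\<bar>))) \<partial>lborel)"
      by (rule nn_integral_cmult) simp
    also have "\<dots> \<le> ennreal (exp c) * ennreal (2 / (2 * c))"
      using nn_integral_exp_abs_le[of "2 * c"] c by (intro mult_left_mono) auto
    also have "\<dots> < \<infinity>" by (simp add: ennreal_mult_less_top)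
    finally show ?thesis .
  qed
  have eq: "exp (- (c * (norm z)\<^sup>2)) = (\<Prod>b\<in>Basis. exp (- (c * (z \<bullet> b)\<^sup>2)))" for z :: 'a
  proof -
    have "(norm z)\<^sup>2 = (\<Sum>b\<in>Basis. (z \<bullet> b)\<^sup>2)"
      unfolding power2_norm_eq_inner by (subst euclidean_inner) (simp add: power2_eq_square)
    then show ?thesis by (simp add: exp_sum sum_distrib_left flip: sum_negf)
  qed
  have "(\<integral>\<^sup>+z. ennreal (norm (exp (- (c * (norm z)\<^sup>2)))) \<partial>(lborel :: 'a measure))
     = (\<integral>\<^sup>+z. (\<Prod>b\<in>Basis. ennreal (exp (- (c * (z \<bullet> b)\<^sup>2)))) \<partial>(lborel :: 'a measure))"
    by (simp add: eq prod_ennreal abs_prod)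
  also have "\<dots> = (\<Prod>b\<in>(Basis::'a set). \<integral>\<^sup>+x. ennreal (exp (- (c * x\<^sup>2))) \<partial>lborel)"
    by (rule nn_integral_lborel_prod) auto
  also have "\<dots> < \<infinity>" using 1 by (simp add: power_less_top_ennreal)
  finally show "(\<integral>\<^sup>+z. ennreal (norm (exp (- (c * (norm z)\<^sup>2)))) \<partial>(lborel :: 'a measure)) < \<infinity>" .
qed simp

lemma power_le_fact_exp: "0 \<le> t \<Longrightarrow> t ^ j \<le> fact j * exp (t::real)"
proof -
  assume t: "0 \<le> t"
  have s: "(\<lambda>i. t ^ i /\<^sub>R fact i) sums exp t" by (rule exp_converges)
  have "(\<Sum>i\<in>{j}. t ^ i /\<^sub>R fact i) \<le> (\<Sum>i. t ^ i /\<^sub>R fact i)"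
    by (rule sum_le_suminf) (use s t in \<open>auto simp: sums_iff\<close>)
  then show ?thesis using s by (simp add: sums_iff field_simps)
qed

text \<open>The power is absorbed into \<open>exp t\<close>, which is why the square is completed
  with a + 1 in place of a.\<close>

lemma power_exp_le_gaussian:
  assumes "c > 0" "(a::real) \<ge> 0"
  obtains A where "A > 0" "\<And>t. t \<ge> 0 \<Longrightarrow> t ^ j * exp (a * t) \<le> A * exp (c * t\<^sup>2)"
proof
  show "fact j * exp ((a + 1)\<^sup>2 / (4 * c)) > 0" by simp
  fix t :: real assume t: "t \<ge> 0"
  have "0 \<le> c * (t - (a + 1) / (2 * c))\<^sup>2" using assms by simp
  also have "c * (t - (a + 1) / (2 * c))\<^sup>2 = (a + 1)\<^sup>2 / (4 * c) + c * t\<^sup>2 - (t + a * t)"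
    using assms by (simp add: power2_eq_square field_simps)
  finally have *: "t + a * t \<le> (a + 1)\<^sup>2 / (4 * c) + c * t\<^sup>2" by simp
  have "t ^ j * exp (a * t) \<le> (fact j * exp t) * exp (a * t)"
    by (intro mult_right_mono power_le_fact_exp t) auto
  also have "\<dots> = fact j * exp (t + a * t)" by (simp add: exp_add)
  also have "\<dots> \<le> fact j * exp ((a + 1)\<^sup>2 / (4 * c) + c * t\<^sup>2)" using * by simp
  finally show "t ^ j * exp (a * t) \<le> fact j * exp ((a + 1)\<^sup>2 / (4 * c)) * exp (c * t\<^sup>2)"
    by (simp add: exp_add)
qed

text \<open>With \<open>x = exp t\<close>, this is \<open>\<integral> x\<^sup>N\<^sup>-\<^sup>1 g x dx\<close> over the half line. In the variable \<open>t\<close>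
  dilations become translations.\<close>
definition mom :: "(real \<Rightarrow> real) \<Rightarrow> nat \<Rightarrow> real"
  where "mom g N = (\<integral>t. exp (t * N) * g (exp t) \<partial>lborel)"

text \<open>The Gamma function at N, in the same logarithmic variable as \<open>mom\<close>.\<close>

definition gmom :: "nat \<Rightarrow> real"
  where "gmom = mom (\<lambda>x. exp (- x))"

lemma mom_integrand_le:
  assumes "m > 0" "N \<ge> 1"
  obtains A where "A > 0" "\<And>t. exp (t * real N) * exp (- (m * exp t)) \<le> A * exp (- (1 * \<bar>t\<bar>))"
proof
  let ?A = "1 + fact (N + 1) / m ^ (N + 1)"
  show "?A > 0" using assms by (simp add: add_pos_nonneg)
  fix t :: real
  show "exp (t * real N) * exp (- (m * exp t)) \<le> ?A * exp (- (1 * \<bar>t\<bar>))"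
  proof (cases "t \<le> 0")
    case True
    have "exp (t * real N) * exp (- (m * exp t)) \<le> exp t * 1"
    proof (rule mult_mono)
      show "exp (t * real N) \<le> exp t"
        using True assms mult_left_mono_neg[of 1 "real N" t] by simp
    qed (use assms in auto)
    also have "\<dots> \<le> ?A * exp t" using assms by (simp add: algebra_simps)
    finally show ?thesis using True by simp
  next
    case False
    \<comment> \<open>One power more than N, so that a factor \<open>exp (- t)\<close> is left over
      for the decay at infinity.\<close>
    have "(m * exp t) ^ (N + 1) \<le> fact (N + 1) * exp (m * exp t)"
      by (rule power_le_fact_exp) (use assms in simp)
    moreover have "exp t ^ (N + 1) = exp t * exp (t * real N)"
      by (simp add: exp_of_nat2_mult)
    ultimately have "m ^ (N + 1) * (exp t * exp (t * real N)) \<le> fact (N + 1) * exp (m * exp t)"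
      by (simp add: power_mult_distrib mult.assoc mult.left_commute)
    then have "exp (t * real N) * exp (- (m * exp t)) \<le> fact (N + 1) / m ^ (N + 1) * exp (- t)"
      using assms by (simp add: exp_minus field_simps)
    also have "\<dots> \<le> ?A * exp (- t)" by (intro mult_right_mono) auto
    finally show ?thesis using False by simp
  qed
qed

lemma mom_integrable:
  fixes g :: "real \<Rightarrow> real"
  assumes [measurable]: "g \<in> borel_measurable borel" and "m > 0" "N \<ge> 1"
    and g: "\<And>x. x \<ge> 0 \<Longrightarrow> 0 \<le> g x" "\<And>x. x \<ge> 0 \<Longrightarrow> g x \<le> A * exp (- (m * x))"
  shows "integrable lborel (\<lambda>t. exp (t * real N) * g (exp t))"
proof -
  obtain B where B: "B > 0" "\<And>t. exp (t * real N) * exp (- (m * exp t)) \<le> B * exp (- (1 * \<bar>t\<bar>))"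
    using mom_integrand_le[OF assms(2,3)] by blast
  have A: "A \<ge> 0" using g(1)[of 0] g(2)[of 0] by simp
  show ?thesis
  proof (rule Bochner_Integration.integrable_bound)
    show "integrable lborel (\<lambda>t. A * B * exp (- (1 * \<bar>t\<bar>)))"
      by (intro integrable_mult_right integrable_exp_abs) simp
    show "AE t in lborel. norm (exp (t * real N) * g (exp t)) \<le> norm (A * B * exp (- (1 * \<bar>t\<bar>)))"
    proof (rule AE_I2)
      fix t :: real
      have "norm (exp (t * real N) * g (exp t)) = exp (t * real N) * g (exp t)" using g(1)[of "exp t"] by simp
      also have "\<dots> \<le> exp (t * real N) * (A * exp (- (m * exp t)))" by (intro mult_left_mono g) auto
      also have "\<dots> = A * (exp (t * real N) * exp (- (m * exp t)))" by simp
      also have "\<dots> \<le> A * (B * exp (- (1 * \<bar>t\<bar>)))" by (intro mult_left_mono B A)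
      finally show "norm (exp (t * real N) * g (exp t)) \<le> norm (A * B * exp (- (1 * \<bar>t\<bar>)))"
        using A B(1) by simp
    qed
  qed measurable
qed

lemma gmom_integrable: "N \<ge> 1 \<Longrightarrow> integrable lborel (\<lambda>t. exp (t * real N) * exp (- exp t))"
  by (rule mom_integrable[of "\<lambda>x. exp (- x)" 1 N 1]) auto

lemma mom_pos:
  fixes g :: "real \<Rightarrow> real"
  assumes "integrable lborel (\<lambda>t. exp (t * real N) * g (exp t))" "\<And>x. x \<ge> 0 \<Longrightarrow> g x > 0"
  shows "mom g N > 0"
proof -
  have "mom g N \<ge> 0" unfolding mom_def using assms(2) by (intro integral_nonneg_AE) (simp add: less_imp_le)
  moreover have "mom g N \<noteq> 0"
  proof
    assume "mom g N = 0"
    then have "AE t in lborel. exp (t * real N) * g (exp t) = 0"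
      using integral_nonneg_eq_0_iff_AE[OF assms(1)] assms(2) by (simp add: mom_def less_imp_le)
    then have "AE t in (lborel :: real measure). \<not> True"
    proof (rule eventually_mono)
      fix t :: real assume "exp (t * real N) * g (exp t) = 0"
      then show "\<not> True" using assms(2)[of "exp t"] by simp
    qed
    from emeasure_eq_0_AE[OF this] show False by simp
  qed
  ultimately show ?thesis by simp
qed

lemma gmom_pos: "N \<ge> 1 \<Longrightarrow> gmom N > 0"
  unfolding gmom_def by (rule mom_pos) (auto intro: gmom_integrable)

text \<open>Functional equation of the Gamma function: the derivative of F has integral zero over
  the line because F vanishes at both ends.\<close>

lemma gmom_Suc:
  assumes N: "N \<ge> 1" shows "gmom (Suc N) = N * gmom N"
proof -
  define F where "F t = exp (t * real N) * exp (- exp t)" for t :: real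
  define f where "f t = real N * (exp (t * real N) * exp (- exp t)) - exp (t * real (Suc N)) * exp (- exp t)" for t :: real
  have F': "DERIV F t :> f t" for t
    unfolding F_def f_def by (auto intro!: derivative_eq_intros simp: algebra_simps exp_add)
  have int: "integrable lborel f"
    unfolding f_def using N gmom_integrable[of N] gmom_integrable[of "Suc N"] by (intro Bochner_Integration.integrable_diff integrable_mult_right) auto
  obtain B where B: "B > 0" "\<And>t. F t \<le> B * exp (- \<bar>t\<bar>)"
    using mom_integrand_le[OF zero_less_one N] by (auto simp: F_def)
  have l1: "((\<lambda>t. B * exp (- \<bar>t\<bar>)) \<longlongrightarrow> 0) at_top" "((\<lambda>t. B * exp (- \<bar>t\<bar>)) \<longlongrightarrow> 0) at_bot"
  proof -
    have "filterlim (\<lambda>t::real. - \<bar>t\<bar>) at_bot at_top"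
      by (simp add: filterlim_uminus_at_bot) (rule filterlim_abs_real)
    then have "((\<lambda>t::real. exp (- \<bar>t\<bar>)) \<longlongrightarrow> 0) at_top"
      by (rule filterlim_compose[OF exp_at_bot])
    then show 1: "((\<lambda>t. B * exp (- \<bar>t\<bar>)) \<longlongrightarrow> 0) at_top" by (simp add: tendsto_mult_right_zero)
    then show "((\<lambda>t. B * exp (- \<bar>t\<bar>)) \<longlongrightarrow> 0) at_bot"
      by (simp add: filterlim_at_bot_mirror)
  qed
  have l2: "(F \<longlongrightarrow> 0) at_top" "(F \<longlongrightarrow> 0) at_bot"
    by (rule tendsto_sandwich[OF _ _ tendsto_const l1(1)], use B in \<open>auto simp: F_def\<close>)
      (rule tendsto_sandwich[OF _ _ tendsto_const l1(2)], use B in \<open>auto simp: F_def\<close>)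
  have "(LBINT t=-\<infinity>..\<infinity>. f t) = 0 - 0"
  proof (rule interval_integral_FTC_integrable)
    show "set_integrable lborel (einterval (-\<infinity>) \<infinity>) f" using int by (simp add: set_integrable_def)
    show "(F has_vector_derivative f t) (at t)" for t
      using F' by (simp add: has_real_derivative_iff_has_vector_derivative)
    show "isCont f t" for t unfolding f_def by (intro continuous_intros)
    show "((F \<circ> real_of_ereal) \<longlongrightarrow> 0) (at_right (-\<infinity>))" "((F \<circ> real_of_ereal) \<longlongrightarrow> 0) (at_left \<infinity>)"
      using l2 by (simp_all add: ereal_tendsto_simps)
  qed auto
  then have "integral\<^sup>L lborel f = 0"
    by (simp add: interval_lebesgue_integral_def set_lebesgue_integral_def)
  then show ?thesis
    unfolding f_def gmom_def mom_def using N gmom_integrable[of N] gmom_integrable[of "Suc N"]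
    by (subst (asm) Bochner_Integration.integral_diff) auto
qed

lemma gmom_eq: "gmom (Suc N) = fact N * gmom 1"
  by (induction N) (auto simp: gmom_Suc algebra_simps)

lemma integral_lborel_scale:
  fixes f :: "'a::euclidean_space \<Rightarrow> complex"
  assumes [measurable]: "f \<in> borel_measurable borel" and "c > 0"
  shows "(\<integral>x. f x \<partial>lborel) = (c ^ DIM('a)) *\<^sub>R (\<integral>x. f (c *\<^sub>R x) \<partial>lborel)"
proof -
  have "lborel = density (distr lborel borel (\<lambda>x::'a. 0 + c *\<^sub>R x)) (\<lambda>_. ennreal (c ^ DIM('a)))"
    using lborel_affine[of c "0::'a"] assms by simp
  note L = this
  show ?thesis
    by (subst L, subst integral_density) (use assms in \<open>auto simp: integral_distr\<close>)
qed

lemma integral_shift_real: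
  fixes F :: "real \<Rightarrow> real" and b :: complex
  assumes F: "integrable lborel F" "\<And>t. F t \<ge> 0" and s: "s \<noteq> 0" "\<bar>s\<bar> = 1"
  shows "integrable lborel (\<lambda>t. b * of_real (F (a + s * t)))"
    and "(\<integral>t. b * of_real (F (a + s * t)) \<partial>lborel) = b * of_real (integral\<^sup>L lborel F)"
    and "(\<integral>t. norm (b * of_real (F (a + s * t))) \<partial>lborel) = norm b * integral\<^sup>L lborel F"
proof -
  have i: "integrable lborel (\<lambda>t. F (a + s * t))"
    by (rule lborel_integrable_real_affine[OF F(1) s(1)])
  have e: "(\<integral>t. F (a + s * t) \<partial>lborel) = integral\<^sup>L lborel F"
    using lborel_integral_real_affine[OF s(1), of F a] s(2) by simp
  show "integrable lborel (\<lambda>t. b * of_real (F (a + s * t)))"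
    by (intro integrable_mult_right integrable_of_real i)
  show "(\<integral>t. b * of_real (F (a + s * t)) \<partial>lborel) = b * of_real (integral\<^sup>L lborel F)"
    using e by simp
  show "(\<integral>t. norm (b * of_real (F (a + s * t))) \<partial>lborel) = norm b * integral\<^sup>L lborel F"
    using e F(2) by (simp add: norm_mult)
qed

lemma integrable_gaussian_bound:
  fixes f :: "'a::euclidean_space \<Rightarrow> complex"
  assumes [measurable]: "f \<in> borel_measurable borel" and m: "m > 0" and a: "a \<ge> 0"
    and f: "\<And>z. norm (f z) \<le> B * (norm z ^ j * exp (a * norm z) * exp (- (m * (norm z)\<^sup>2)))"
  shows "integrable lborel f"
proof -
  have B: "B * (norm z ^ j * exp (a * norm z) * exp (- (m * (norm z)\<^sup>2)))
       \<le> \<bar>B\<bar> * (norm z ^ j * exp (a * norm z) * exp (- (m * (norm z)\<^sup>2)))" for z :: 'a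
    by (intro mult_right_mono) auto
  obtain A where A: "A > 0" "\<And>t. t \<ge> 0 \<Longrightarrow> t ^ j * exp (a * t) \<le> A * exp (m / 2 * t\<^sup>2)"
    using power_exp_le_gaussian[of "m / 2" a j] m a by auto
  show ?thesis
  proof (rule Bochner_Integration.integrable_bound)
    show "integrable lborel (\<lambda>z::'a. \<bar>B\<bar> * A * exp (- (m / 2 * (norm z)\<^sup>2)))"
      by (intro integrable_mult_right integrable_gaussian) (use m in simp)
    show "AE z in lborel. norm (f z) \<le> norm (\<bar>B\<bar> * A * exp (- (m / 2 * (norm z)\<^sup>2)))"
    proof (rule AE_I2)
      fix z :: 'a
      have "norm (f z) \<le> \<bar>B\<bar> * (norm z ^ j * exp (a * norm z) * exp (- (m * (norm z)\<^sup>2)))"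
        using f[of z] B[of z] by simp
      also have "\<dots> \<le> \<bar>B\<bar> * ((A * exp (m / 2 * (norm z)\<^sup>2)) * exp (- (m * (norm z)\<^sup>2)))"
        by (intro mult_left_mono mult_right_mono A) auto
      also have "\<dots> = \<bar>B\<bar> * A * exp (- (m / 2 * (norm z)\<^sup>2))"
      proof -
        have "exp (m / 2 * (norm z)\<^sup>2) * exp (- (m * (norm z)\<^sup>2)) = exp (- (m / 2 * (norm z)\<^sup>2))"
          unfolding exp_add[symmetric] by simp
        then show ?thesis by (simp add: mult.assoc)
      qed
      finally show "norm (f z) \<le> norm (\<bar>B\<bar> * A * exp (- (m / 2 * (norm z)\<^sup>2)))" using A(1) by simp
    qed
  qed measurable
qed

text \<open>Both sides arise from \<open>\<integral>\<integral> H z g(|z|\<^sup>2) \<phi>(e\<^sup>t|z|\<^sup>2) dz dt\<close> with \<open>\<phi> x = x\<^sup>N e\<^sup>-\<^sup>x\<close>: integrate first in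
  \<open>t\<close>, or first dilate \<open>z\<close> by \<open>e\<^sup>-\<^sup>t\<^sup>/\<^sup>2\<close>.\<close>
lemma radial_exchange:
  fixes H :: "complex ^ 'n \<Rightarrow> complex" and g :: "real \<Rightarrow> real"
  assumes [measurable]: "H \<in> borel_measurable borel" "g \<in> borel_measurable borel"
    and hom: "\<And>t z. t > 0 \<Longrightarrow> H (t *\<^sub>R z) = of_real (t ^ (2 * k)) * H z"
    and bnd: "\<And>z. norm (H z) \<le> M * norm z ^ (2 * k)"
    and m: "m > 0" and g: "\<And>x. x \<ge> 0 \<Longrightarrow> 0 \<le> g x" "\<And>x. x \<ge> 0 \<Longrightarrow> g x \<le> A * exp (- (m * x))"
  shows "(\<integral>z. H z * of_real (g ((norm z)\<^sup>2)) \<partial>lborel) * of_real (gmom (CARD('n) + k))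
    = (\<integral>z. H z * of_real (exp (- (norm z)\<^sup>2)) \<partial>lborel) * of_real (mom g (CARD('n) + k))"
proof -
  define N where "N = CARD('n) + k"
  have N1: "N \<ge> 1" by (simp add: N_def Suc_leI)
  define \<phi> where "\<phi> x = x ^ N * exp (- x)" for x :: real
  have [measurable]: "\<phi> \<in> borel_measurable borel" unfolding \<phi>_def by measurable
  have A: "A \<ge> 0" using g(1)[of 0] g(2)[of 0] by simp
  have bnd': "norm (H z) \<le> \<bar>M\<bar> * norm z ^ (2 * k)" for z
    by (rule order_trans[OF bnd mult_right_mono]) auto
  have iH: "integrable lborel (\<lambda>z. H z * of_real (G ((norm z)\<^sup>2)))"
    if [measurable]: "G \<in> borel_measurable borel" and "m' > 0" and G: "\<And>x. x \<ge> 0 \<Longrightarrow> 0 \<le> G x" "\<And>x. x \<ge> 0 \<Longrightarrow> G x \<le> A' * exp (- (m' * x))"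
    for G m' A'
  proof (rule integrable_gaussian_bound[where B = "\<bar>M\<bar> * A'" and j = "2 * k" and a = 0 and m = m'])
    fix z :: "complex ^ 'n"
    have "norm (H z * of_real (G ((norm z)\<^sup>2))) = norm (H z) * G ((norm z)\<^sup>2)"
      using G(1)[of "(norm z)\<^sup>2"] by (simp add: norm_mult)
    also have "\<dots> \<le> (\<bar>M\<bar> * norm z ^ (2 * k)) * (A' * exp (- (m' * (norm z)\<^sup>2)))"
      by (intro mult_mono bnd' G) auto
    finally show "norm (H z * of_real (G ((norm z)\<^sup>2)))
        \<le> \<bar>M\<bar> * A' * (norm z ^ (2 * k) * exp (0 * norm z) * exp (- (m' * (norm z)\<^sup>2)))"
      by (simp add: algebra_simps)
  qed (use that in auto)
  have iHg: "integrable lborel (\<lambda>z. H z * of_real (g ((norm z)\<^sup>2)))"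
    by (rule iH[OF _ m g]) auto
  have iHe: "integrable lborel (\<lambda>z. H z * of_real (exp (- (norm z)\<^sup>2)))"
    by (rule iH[of "\<lambda>x. exp (- x)" 1 1]) auto
  define F1 where "F1 t = exp (t * real N) * exp (- exp t)" for t
  define F2 where "F2 t = exp (t * real N) * g (exp t)" for t
  have iF1: "integrable lborel F1" "\<And>t. F1 t \<ge> 0" unfolding F1_def using gmom_integrable[OF N1] by auto
  have iF2: "integrable lborel F2" "\<And>t. F2 t \<ge> 0"
    unfolding F2_def using mom_integrable[OF assms(2) m N1 g] g(1) by auto
  have I1: "integral\<^sup>L lborel F1 = gmom N" "integral\<^sup>L lborel F2 = mom g N"
    by (auto simp: F1_def[abs_def] F2_def[abs_def] gmom_def mom_def)
  define G1 where "G1 p = H (fst p) * of_real (g ((norm (fst p))\<^sup>2) * \<phi> (exp (snd p) * (norm (fst p))\<^sup>2))" for p :: "(complex ^ 'n) \<times> real"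
  define G2 where "G2 p = H (fst p) * of_real (exp (- (snd p * real N)) * g (exp (- snd p) * (norm (fst p))\<^sup>2) * \<phi> ((norm (fst p))\<^sup>2))" for p :: "(complex ^ 'n) \<times> real"
  have m1: "G1 \<in> borel_measurable (lborel \<Otimes>\<^sub>M lborel)" unfolding G1_def by measurable
  have m2: "G2 \<in> borel_measurable (lborel \<Otimes>\<^sub>M lborel)" unfolding G2_def by measurable
  have e1: "G1 (z, t) = (H z * of_real (g ((norm z)\<^sup>2))) * of_real (F1 (ln ((norm z)\<^sup>2) + 1 * t))" if "z \<noteq> 0" for z t
  proof -
    have "exp ((ln ((norm z)\<^sup>2) + t) * real N) = (exp t * (norm z)\<^sup>2) ^ N"
      using that by (simp only: exp_of_nat2_mult) (simp add: exp_add mult.commute)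
    then show ?thesis
      using that by (simp add: G1_def F1_def \<phi>_def exp_add mult.commute)
  qed
  have e2: "G2 (z, t) = (H z * of_real (exp (- (norm z)\<^sup>2))) * of_real (F2 (ln ((norm z)\<^sup>2) + (-1) * t))" if "z \<noteq> 0" for z t
  proof -
    have 1: "exp ((ln ((norm z)\<^sup>2) - t) * real N) = exp (- (t * real N)) * ((norm z)\<^sup>2) ^ N"
    proof -
      have "exp ((ln ((norm z)\<^sup>2) - t) * real N) = exp (- (t * real N)) * exp (ln ((norm z)\<^sup>2) * real N)"
        unfolding exp_add[symmetric] by (simp add: left_diff_distrib)
      then show ?thesis using that by (simp add: exp_of_nat2_mult)
    qed
    have 2: "exp (ln ((norm z)\<^sup>2) - t) = exp (- t) * (norm z)\<^sup>2"
      using that by (simp add: exp_diff exp_minus field_simps)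
    show ?thesis
      unfolding G2_def F2_def \<phi>_def using 1 2 by (simp add: algebra_simps)
  qed
  have neg1: "(- 1 :: real) \<noteq> 0" "\<bar>- 1 :: real\<bar> = 1" by auto
  note J1 = integral_shift_real[OF iF1 one_neq_zero abs_one]
  note J2 = integral_shift_real[OF iF2 neg1]
  \<comment> \<open>The translation in t is by ln |z|^2, meaningful only away from the origin, which
    is a null set.\<close>
  have AE0: "AE z in (lborel :: (complex ^ 'n) measure). z \<noteq> 0" by (rule AE_lborel_singleton)
  have p1: "integrable (lborel \<Otimes>\<^sub>M lborel) G1"
  proof (rule lborel_pair.Fubini_integrable[OF m1])
    have "integrable lborel (\<lambda>z. norm (H z * of_real (g ((norm z)\<^sup>2))) * gmom N)"
      using iHg by (intro integrable_mult_left integrable_norm)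
    then show "integrable lborel (\<lambda>z. \<integral>t. norm (G1 (z, t)) \<partial>lborel)"
    proof (rule integrable_cong_AE_imp)
      show "AE z in lborel. norm (H z * of_real (g ((norm z)\<^sup>2))) * gmom N = (\<integral>t. norm (G1 (z, t)) \<partial>lborel)"
        using AE0 by eventually_elim (simp only: not_False_eq_True e1 J1(3) I1)
      show "(\<lambda>z. \<integral>t. norm (G1 (z, t)) \<partial>lborel) \<in> borel_measurable lborel" using m1 by measurable
    qed
    show "AE z in lborel. integrable lborel (\<lambda>t. G1 (z, t))"
      using AE0 by eventually_elim (simp only: not_False_eq_True e1 J1(1))
  qed
  have p2: "integrable (lborel \<Otimes>\<^sub>M lborel) G2"
  proof (rule lborel_pair.Fubini_integrable[OF m2])
    have "integrable lborel (\<lambda>z. norm (H z * of_real (exp (- (norm z)\<^sup>2))) * mom g N)"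
      using iHe by (intro integrable_mult_left integrable_norm)
    then show "integrable lborel (\<lambda>z. \<integral>t. norm (G2 (z, t)) \<partial>lborel)"
    proof (rule integrable_cong_AE_imp)
      show "AE z in lborel. norm (H z * of_real (exp (- (norm z)\<^sup>2))) * mom g N = (\<integral>t. norm (G2 (z, t)) \<partial>lborel)"
        using AE0 by eventually_elim (simp only: not_False_eq_True e2 J2(3) I1)
      show "(\<lambda>z. \<integral>t. norm (G2 (z, t)) \<partial>lborel) \<in> borel_measurable lborel" using m2 by measurable
    qed
    show "AE z in lborel. integrable lborel (\<lambda>t. G2 (z, t))"
      using AE0 by eventually_elim (simp only: not_False_eq_True e2 J2(1))
  qed
  have sc: "(\<integral>z. G1 (z, t) \<partial>lborel) = (\<integral>z. G2 (z, t) \<partial>lborel)" for t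
  proof -
    \<comment> \<open>The real dimension 2n and the degree 2k of H add up to 2N, so dilating by c
      produces exactly the factor exp (- t N).\<close>
    define c where "c = exp (- t / 2)"
    have c: "c > 0" "c\<^sup>2 = exp (- t)" by (auto simp: c_def power2_eq_square simp flip: exp_add)
    have [measurable]: "(\<lambda>z. G1 (z, t)) \<in> borel_measurable borel"
      unfolding G1_def fst_conv snd_conv by measurable
    have "c ^ DIM(complex ^ 'n) * c ^ (2 * k) = (c\<^sup>2) ^ N"
      by (simp add: N_def power_add flip: power_mult) (simp add: mult.commute)
    also have "\<dots> = exp (- (t * real N))" unfolding c by (simp add: exp_of_nat2_mult[symmetric])
    finally have cN: "c ^ DIM(complex ^ 'n) * c ^ (2 * k) = exp (- (t * real N))" .
    have "(\<integral>z. G1 (z, t) \<partial>lborel) = (c ^ DIM(complex ^ 'n)) *\<^sub>R (\<integral>z. G1 (c *\<^sub>R z, t) \<partial>lborel)"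
      by (rule integral_lborel_scale) (use c in auto)
    also have "\<dots> = (\<integral>z. (c ^ DIM(complex ^ 'n)) *\<^sub>R G1 (c *\<^sub>R z, t) \<partial>lborel)" by simp
    also have "(\<lambda>z. (c ^ DIM(complex ^ 'n)) *\<^sub>R G1 (c *\<^sub>R z, t)) = (\<lambda>z. G2 (z, t))"
    proof
      fix z :: "complex ^ 'n"
      have n: "(norm (c *\<^sub>R z))\<^sup>2 = exp (- t) * (norm z)\<^sup>2" using c by (simp add: power_mult_distrib)
      have n2: "exp t * (exp (- t) * (norm z)\<^sup>2) = (norm z)\<^sup>2" by (simp add: exp_minus field_simps)
      show "(c ^ DIM(complex ^ 'n)) *\<^sub>R G1 (c *\<^sub>R z, t) = G2 (z, t)"
        unfolding G1_def G2_def fst_conv snd_conv n n2 hom[OF c(1)] cN[symmetric]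
        by (simp add: scaleR_conv_of_real)
    qed
    finally show ?thesis .
  qed
  have "(\<integral>z. H z * of_real (g ((norm z)\<^sup>2)) \<partial>lborel) * of_real (gmom N)
     = (\<integral>z. H z * of_real (g ((norm z)\<^sup>2)) * of_real (gmom N) \<partial>lborel)" by simp
  also have "\<dots> = (\<integral>z. (\<integral>t. G1 (z, t) \<partial>lborel) \<partial>lborel)"
  proof (rule integral_cong_AE)
    show "(\<lambda>z. \<integral>t. G1 (z, t) \<partial>lborel) \<in> borel_measurable lborel" using m1 by measurable
    show "AE z in lborel. H z * of_real (g ((norm z)\<^sup>2)) * of_real (gmom N) = (\<integral>t. G1 (z, t) \<partial>lborel)"
      using AE0 by eventually_elim (simp only: not_False_eq_True e1 J1(2) I1)
  qed measurable
  also have "\<dots> = (\<integral>t. (\<integral>z. G1 (z, t) \<partial>lborel) \<partial>lborel)"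
    using lborel_pair.Fubini_integral[of "\<lambda>x y. G1 (x, y)"] p1 by simp
  also have "\<dots> = (\<integral>t. (\<integral>z. G2 (z, t) \<partial>lborel) \<partial>lborel)" by (simp add: sc)
  also have "\<dots> = (\<integral>z. (\<integral>t. G2 (z, t) \<partial>lborel) \<partial>lborel)"
    using lborel_pair.Fubini_integral[of "\<lambda>x y. G2 (x, y)"] p2 by simp
  also have "\<dots> = (\<integral>z. H z * of_real (exp (- (norm z)\<^sup>2)) * of_real (mom g N) \<partial>lborel)"
  proof (rule integral_cong_AE)
    show "(\<lambda>z. \<integral>t. G2 (z, t) \<partial>lborel) \<in> borel_measurable lborel" using m2 by measurable
    show "AE z in lborel. (\<integral>t. G2 (z, t) \<partial>lborel) = H z * of_real (exp (- (norm z)\<^sup>2)) * of_real (mom g N)"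
      using AE0 by eventually_elim (simp only: not_False_eq_True e2 J2(2) I1)
  qed measurable
  finally show ?thesis by (simp add: N_def)
qed

section \<open>Homogeneous polynomials\<close>

text \<open>The growth bound supplies the majorants for integrals against rapidly decaying
  weights.\<close>

definition hpoly :: "nat \<Rightarrow> (complex ^ 'n \<Rightarrow> complex) \<Rightarrow> bool"
  where "hpoly k p \<longleftrightarrow> entire p \<and> (\<forall>c z. p (c *s z) = c ^ k * p z) \<and> (\<exists>M. \<forall>z. norm (p z) \<le> M * norm z ^ k)"

lemma hpoly_monomial: "hpoly (\<Sum>j\<in>UNIV. \<alpha> j) (\<lambda>z. \<Prod>j\<in>UNIV. (z $ j) ^ \<alpha> j)"
  unfolding hpoly_def
proof (intro conjI allI exI)
  show "entire (\<lambda>z. \<Prod>j\<in>UNIV. (z $ j) ^ \<alpha> j)"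
    by (intro entire_prod entire_power entire_nth)
  show "(\<Prod>j\<in>UNIV. ((c *s z) $ j) ^ \<alpha> j) = c ^ sum \<alpha> UNIV * (\<Prod>j\<in>UNIV. (z $ j) ^ \<alpha> j)" for c z
    by (simp add: power_mult_distrib prod.distrib power_sum)
  show "norm (\<Prod>j\<in>UNIV. (z $ j) ^ \<alpha> j) \<le> 1 * norm z ^ sum \<alpha> UNIV" for z :: "complex ^ 'a"
  proof -
    have "norm (\<Prod>j\<in>UNIV. (z $ j) ^ \<alpha> j) \<le> (\<Prod>j\<in>UNIV. norm ((z $ j) ^ \<alpha> j))"
      by (rule norm_prod_le)
    also have "\<dots> \<le> (\<Prod>j\<in>UNIV. norm z ^ \<alpha> j)"
      by (intro prod_mono) (auto simp: norm_power intro!: power_mono Finite_Cartesian_Product.norm_nth_le)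
    finally show ?thesis by (simp add: power_sum)
  qed
qed

lemma hpoly_herm_power: "hpoly k (\<lambda>z. herm z w ^ k)"
  unfolding hpoly_def
proof (intro conjI allI exI)
  show "entire (\<lambda>z. herm z w ^ k)" by (intro entire_power entire_herm)
  show "herm (c *s z) w ^ k = c ^ k * herm z w ^ k" for c z
    by (simp add: herm_scale_left power_mult_distrib)
  show "norm (herm z w ^ k) \<le> norm w ^ k * norm z ^ k" for z
    using power_mono[OF norm_herm_le[of z w], of k]
    by (simp add: norm_power power_mult_distrib mult.commute)
qed

text \<open>Rotation by c multiplies the integrand by \<open>c ^ k * cnj c ^ m\<close>. As k and m
  differ, some c on the unit circle makes this factor -1, so the integral equals its own
  negative.\<close>

lemma hpoly_orthogonal:
  fixes p :: "complex ^ 'n \<Rightarrow> complex"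
  assumes p: "hpoly k p" and "m \<noteq> k" and [measurable]: "(\<lambda>z :: complex ^ 'n. g (norm z)) \<in> borel_measurable borel"
  shows "(\<integral>z. p z * cnj (herm z w) ^ m * of_real (g (norm z)) \<partial>lborel) = 0"
proof -
  have [measurable]: "p \<in> borel_measurable borel"
    using p by (auto simp: hpoly_def entire_imp_borel_measurable)
  define f where "f z = p z * cnj (herm z w) ^ m * of_real (g (norm z))" for z
  have [measurable]: "(\<lambda>z. cnj (herm z w)) \<in> borel_measurable borel"
    by (intro borel_measurable_continuous_onI continuous_intros)
  have [measurable]: "f \<in> borel_measurable borel" unfolding f_def by measurable
  obtain c where c: "norm c = 1" "c ^ k * cnj c ^ m = - 1"
  proof -
    have *: "(cis t)^a * cnj (cis t) ^ b = cis (t * (real a - real b))" for t a b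
      by (simp only: cis_cnj Complex.DeMoivre cis_mult) (rule arg_cong[where f = cis], simp add: algebra_simps)
    have "cis (pi / (real k - real m) * (real k - real m)) = - 1"
      using assms(2) by simp
    then show ?thesis
      using *[of "pi / (real k - real m)" k m] that[of "cis (pi / (real k - real m))"] by simp
  qed
  have "f (c *s z) = (c ^ k * cnj c ^ m) * f z" for z
    using p c(1) by (simp add: f_def hpoly_def herm_scale_left norm_smult power_mult_distrib)
  then have "f (c *s z) = - f z" for z using c by simp
  moreover have "(\<integral>z. f (c *s z) \<partial>lborel) = (\<integral>z. f z \<partial>lborel)"
    by (subst (2) lborel_distr_rotation[OF c(1), symmetric], subst integral_distr) auto
  ultimately have "(\<integral>z. f z \<partial>lborel) = - (\<integral>z. f z \<partial>lborel)" by simp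
  then show ?thesis by (simp add: f_def)
qed

text \<open>Equal to \<pi>^n for n = \<open>CARD('n)\<close>; kept symbolic throughout.\<close>

definition gmass :: "'n::finite itself \<Rightarrow> real"
  where "gmass _ = (\<integral>z. exp (- (norm z)\<^sup>2) \<partial>(lborel :: (complex ^ 'n) measure))"

lemma gmass_pos: "gmass TYPE('n::finite) > 0"
proof -
  have i: "integrable lborel (\<lambda>z :: complex ^ 'n. exp (- (norm z)\<^sup>2))"
    using integrable_gaussian[of 1] by simp
  have "gmass TYPE('n) \<ge> 0" by (simp add: gmass_def)
  moreover have "gmass TYPE('n) \<noteq> 0"
  proof
    assume "gmass TYPE('n) = 0"
    then have "AE z in (lborel :: (complex ^ 'n) measure). \<not> True"
      using integral_nonneg_eq_0_iff_AE[OF i] by (simp add: gmass_def)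
    from emeasure_eq_0_AE[OF this] show False by simp
  qed
  ultimately show ?thesis by simp
qed

text \<open>Completing the square turns the integrand into an entire function times a Gaussian, so that
  the integral is given by the mean value property.\<close>
lemma gaussian_reproducing_exp:
  fixes p :: "complex ^ 'n \<Rightarrow> complex"
  assumes p: "hpoly k p"
  shows "(\<integral>z. p z * exp (herm w z) * of_real (exp (- (norm z)\<^sup>2)) \<partial>lborel) = gmass TYPE('n) * p w"
    and "integrable lborel (\<lambda>z. p z * exp (herm w z) * of_real (exp (- (norm z)\<^sup>2)))"
    and "integrable lborel (\<lambda>z. norm (p z) * exp (norm z * norm w) * exp (- (norm z)\<^sup>2))"
proof -
  obtain M where M: "\<And>z. norm (p z) \<le> M * norm z ^ k" using p by (auto simp: hpoly_def)
  have ep: "entire p" using p by (simp add: hpoly_def)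
  have [measurable]: "p \<in> borel_measurable borel" by (rule entire_imp_borel_measurable[OF ep])
  have [measurable]: "(\<lambda>z. herm w z) \<in> borel_measurable borel"
    by (intro borel_measurable_continuous_onI continuous_intros)
  have "integrable lborel (\<lambda>z. complex_of_real (norm (p z) * exp (norm z * norm w) * exp (- (norm z)\<^sup>2)))"
  proof (rule integrable_gaussian_bound[where B = M and j = k and a = "norm w" and m = 1])
    fix z :: "complex ^ 'n"
    show "norm (complex_of_real (norm (p z) * exp (norm z * norm w) * exp (- (norm z)\<^sup>2)))
       \<le> M * (norm z ^ k * exp (norm w * norm z) * exp (- (1 * (norm z)\<^sup>2)))"
      using mult_right_mono[OF M[of z], of "exp (norm z * norm w) * exp (- (norm z)\<^sup>2)"]
      by (simp add: norm_mult algebra_simps)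
  qed auto
  then show i1: "integrable lborel (\<lambda>z. norm (p z) * exp (norm z * norm w) * exp (- (norm z)\<^sup>2))"
    by (simp only: complex_of_real_integrable_eq)
  show i2: "integrable lborel (\<lambda>z. p z * exp (herm w z) * of_real (exp (- (norm z)\<^sup>2)))"
  proof (rule Bochner_Integration.integrable_bound[OF i1])
    have "norm (p z) * exp (Re (herm w z)) \<le> norm (p z) * exp (norm z * norm w)" for z
      using complex_Re_le_cmod[of "herm w z"] norm_herm_le[of w z] by (intro mult_left_mono) (auto simp: mult.commute)
    then show "AE z in lborel. norm (p z * exp (herm w z) * of_real (exp (- (norm z)\<^sup>2)))
       \<le> norm (norm (p z) * exp (norm z * norm w) * exp (- (norm z)\<^sup>2))"
      by (intro AE_I2) (simp add: norm_mult mult_right_mono)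
  qed measurable
  define f where "f z = p z * exp (herm w z) * of_real (exp (- (norm z)\<^sup>2))" for z
  have [measurable]: "f \<in> borel_measurable borel" unfolding f_def by measurable
  define h where "h u = p (w + u) * exp (- 1 * herm u w)" for u
  have h: "entire h"
    unfolding h_def
    by (intro entire_mult entire_compose_affine[OF ep] entire_compose_holomorphic[of exp] entire_const entire_herm)
      (auto intro: linear_ident holomorphic_intros)
  have fh: "f (w + u) = exp (- (norm u)\<^sup>2) *\<^sub>R h u" for u
  proof -
    have "herm w u - 2 * complex_of_real (Re (herm u w)) = - herm u w"
      by (simp add: complex_eq_iff flip: cnj_herm[of u w])
    then have "herm w (w + u) - complex_of_real ((norm (w + u))\<^sup>2) = - herm u w - complex_of_real ((norm u)\<^sup>2)"
      unfolding norm_add_herm by (simp add: herm_add_right herm_self algebra_simps)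
    then have "exp (herm w (w + u) - complex_of_real ((norm (w + u))\<^sup>2)) = exp (- herm u w - complex_of_real ((norm u)\<^sup>2))"
      by simp
    then show ?thesis
      unfolding f_def h_def scaleR_conv_of_real
      by (simp add: exp_diff exp_minus field_simps exp_of_real[symmetric] del: exp_of_real)
  qed
  have "(\<integral>z. f z \<partial>lborel) = (\<integral>u. f (w + u) \<partial>lborel)"
    by (subst lborel_distr_plus[of w, symmetric], subst integral_distr) auto
  also have "\<dots> = (\<integral>u. exp (- (norm u)\<^sup>2) *\<^sub>R h u \<partial>lborel)" by (simp add: fh)
  also have "\<dots> = (\<integral>u. exp (- (norm u)\<^sup>2) \<partial>(lborel :: (complex ^ 'n) measure)) *\<^sub>R h 0"
  proof (rule entire_mean_value[OF h])
    have "integrable (distr lborel borel ((+) w)) f" using i2 by (simp add: f_def[abs_def] lborel_distr_plus)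
    then have "integrable lborel (\<lambda>u. f (w + u))" by (rule integrable_distr[rotated]) simp
    then show "integrable lborel (\<lambda>u. exp (- (norm u)\<^sup>2) *\<^sub>R h u)" by (simp add: fh)
  qed (auto simp: norm_smult)
  also have "\<dots> = gmass TYPE('n) * p w" by (simp add: h_def gmass_def scaleR_conv_of_real)
  finally show "(\<integral>z. p z * exp (herm w z) * of_real (exp (- (norm z)\<^sup>2)) \<partial>lborel) = gmass TYPE('n) * p w"
    by (simp add: f_def)
qed

text \<open>Expand the exponential in \<open>gaussian_reproducing_exp\<close> into powers of
  \<open>herm w z\<close>; orthogonality of degrees annihilates every term but the k-th. The
  majorant comes from \<open>exp (norm z * norm w)\<close>, which bounds every partial sum.\<close>

lemma gaussian_reproducing:
  fixes p :: "complex ^ 'n \<Rightarrow> complex"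
  assumes p: "hpoly k p"
  shows "(\<integral>z. p z * cnj (herm z w) ^ k * of_real (exp (- (norm z)\<^sup>2)) \<partial>lborel) = fact k * gmass TYPE('n) * p w"
proof -
  have ep: "entire p" using p by (simp add: hpoly_def)
  have [measurable]: "p \<in> borel_measurable borel" by (rule entire_imp_borel_measurable[OF ep])
  have [measurable]: "(\<lambda>z. herm w z) \<in> borel_measurable borel"
    by (intro borel_measurable_continuous_onI continuous_intros)
  define I where "I m = (\<integral>z. p z * cnj (herm z w) ^ m * of_real (exp (- (norm z)\<^sup>2)) \<partial>lborel)" for m
  define s where "s m z = p z * (\<Sum>i<m. (herm w z) ^ i / fact i) * of_real (exp (- (norm z)\<^sup>2))" for m z
  define t where "t i z = p z * cnj (herm z w) ^ i * of_real (exp (- (norm z)\<^sup>2)) / fact i" for i z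
  have nle: "norm ((herm w z) ^ i / fact i) \<le> (norm z * norm w) ^ i / fact i" for z i
    using power_mono[OF norm_herm_le[of w z], of i]
    by (simp add: norm_divide norm_power mult.commute divide_right_mono)
  have sume: "(\<Sum>i<m. (norm z * norm w) ^ i / fact i) \<le> exp (norm z * norm w)" for z :: "complex ^ 'n" and m
  proof -
    have e: "(\<lambda>i. (norm z * norm w) ^ i /\<^sub>R fact i) sums exp (norm z * norm w)" by (rule exp_converges)
    have "(\<Sum>i<m. (norm z * norm w) ^ i /\<^sub>R fact i) \<le> (\<Sum>i. (norm z * norm w) ^ i /\<^sub>R fact i)"
      by (rule sum_le_suminf) (use e in \<open>auto simp: sums_iff\<close>)
    then show ?thesis using e by (simp add: sums_iff divide_inverse mult.commute)
  qed
  have it: "integrable lborel (t i)" for i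
  proof (rule Bochner_Integration.integrable_bound[OF gaussian_reproducing_exp(3)[OF p, of w]])
    show "AE z in lborel. norm (t i z) \<le> norm (norm (p z) * exp (norm z * norm w) * exp (- (norm z)\<^sup>2))"
    proof (rule AE_I2)
      fix z :: "complex ^ 'n"
      have "norm ((herm w z) ^ i / fact i) \<le> (\<Sum>i<Suc i. (norm z * norm w) ^ i / fact i)"
        using nle[of z i] sum_nonneg[of "{..<i}" "\<lambda>i. (norm z * norm w) ^ i / fact i"] by simp
      also have "\<dots> \<le> exp (norm z * norm w)" by (rule sume)
      finally have "norm (p z) * norm ((herm w z) ^ i / fact i) * exp (- (norm z)\<^sup>2) \<le> norm (p z) * exp (norm z * norm w) * exp (- (norm z)\<^sup>2)"
        by (intro mult_right_mono mult_left_mono) auto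
      then show "norm (t i z) \<le> norm (norm (p z) * exp (norm z * norm w) * exp (- (norm z)\<^sup>2))"
        by (simp add: t_def cnj_herm norm_mult norm_divide)
    qed
  qed (simp add: t_def[abs_def] cnj_herm)
  have Is: "(\<integral>z. s m z \<partial>lborel) = I k / fact k" if "m > k" for m
  proof -
    have "s m = (\<lambda>z. \<Sum>i<m. t i z)"
      by (simp add: s_def t_def fun_eq_iff cnj_herm sum_distrib_left sum_distrib_right)
    then have "(\<integral>z. s m z \<partial>lborel) = (\<Sum>i<m. \<integral>z. t i z \<partial>lborel)" using it by simp
    also have "\<dots> = (\<Sum>i<m. I i / fact i)" by (simp add: t_def I_def)
    also have "\<dots> = (\<Sum>i\<in>{k}. I i / fact i)"
    proof (rule sum.mono_neutral_right)
      show "\<forall>i\<in>{..<m} - {k}. I i / fact i = 0"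
        using hpoly_orthogonal[OF p, of _ "\<lambda>r. exp (- r\<^sup>2)"] by (auto simp: I_def)
    qed (use that in auto)
    finally show ?thesis by simp
  qed
  have "(\<lambda>m. \<integral>z. s m z \<partial>lborel) \<longlonglongrightarrow> (\<integral>z. p z * exp (herm w z) * of_real (exp (- (norm z)\<^sup>2)) \<partial>lborel)"
  proof (rule integral_dominated_convergence[OF _ _ gaussian_reproducing_exp(3)[OF p, of w]])
    show "AE z in lborel. (\<lambda>m. s m z) \<longlonglongrightarrow> p z * exp (herm w z) * of_real (exp (- (norm z)\<^sup>2))"
    proof (rule AE_I2)
      fix z
      have "(\<lambda>i. (herm w z) ^ i / fact i) sums exp (herm w z)"
        using exp_converges[of "herm w z"] by (simp add: scaleR_conv_of_real divide_inverse mult.commute)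
      then have "(\<lambda>m. \<Sum>i<m. (herm w z) ^ i / fact i) \<longlonglongrightarrow> exp (herm w z)" by (simp add: sums_def)
      then show "(\<lambda>m. s m z) \<longlonglongrightarrow> p z * exp (herm w z) * of_real (exp (- (norm z)\<^sup>2))"
        unfolding s_def by (intro tendsto_intros)
    qed
    show "AE z in lborel. norm (s m z) \<le> norm (p z) * exp (norm z * norm w) * exp (- (norm z)\<^sup>2)" for m
    proof (rule AE_I2)
      fix z :: "complex ^ 'n"
      have "norm (\<Sum>i<m. (herm w z) ^ i / fact i) \<le> (\<Sum>i<m. (norm z * norm w) ^ i / fact i)"
        by (intro sum_norm_le nle)
      also have "\<dots> \<le> exp (norm z * norm w)" by (rule sume)
      finally show "norm (s m z) \<le> norm (p z) * exp (norm z * norm w) * exp (- (norm z)\<^sup>2)"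
        unfolding s_def norm_mult by (intro mult_mono) auto
    qed
  qed (simp_all add: s_def)
  moreover have "(\<lambda>m. \<integral>z. s m z \<partial>lborel) \<longlonglongrightarrow> I k / fact k"
    by (rule tendsto_eventually, rule eventually_mono[OF eventually_gt_at_top[of k]], rule Is)
  ultimately have "I k / fact k = gmass TYPE('n) * p w"
    using LIMSEQ_unique gaussian_reproducing_exp(1)[OF p] by metis
  then show ?thesis by (simp add: I_def field_simps)
qed

text \<open>The integrand without its weight is homogeneous of real degree 2k, so passing from the
  Gaussian to another radial weight changes the integral only by a ratio of moments. No integration
  over spheres is involved.\<close>

lemma radial_reproducing:
  fixes p :: "complex ^ 'n \<Rightarrow> complex"
  assumes p: "hpoly k p" and [measurable]: "g \<in> borel_measurable borel"
    and m: "m > 0" and g: "\<And>x. x \<ge> 0 \<Longrightarrow> 0 \<le> g x" "\<And>x. x \<ge> 0 \<Longrightarrow> g x \<le> A * exp (- (m * x))"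
  shows "(\<integral>z. p z * cnj (herm z w) ^ k * of_real (g ((norm z)\<^sup>2)) \<partial>lborel)
    = (fact k * gmass TYPE('n) * mom g (CARD('n) + k) / gmom (CARD('n) + k)) * p w"
proof -
  obtain M where M: "\<And>z. norm (p z) \<le> M * norm z ^ k" using p by (auto simp: hpoly_def)
  have ep: "entire p" using p by (simp add: hpoly_def)
  have [measurable]: "p \<in> borel_measurable borel" by (rule entire_imp_borel_measurable[OF ep])
  have [measurable]: "(\<lambda>z. cnj (herm z w)) \<in> borel_measurable borel"
    by (intro borel_measurable_continuous_onI continuous_intros)
  define H where "H z = p z * cnj (herm z w) ^ k" for z
  have "(\<integral>z. H z * of_real (g ((norm z)\<^sup>2)) \<partial>lborel) * of_real (gmom (CARD('n) + k))
    = (\<integral>z. H z * of_real (exp (- (norm z)\<^sup>2)) \<partial>lborel) * of_real (mom g (CARD('n) + k))"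
  proof (rule radial_exchange[OF _ _ _ _ m g])
    show "H \<in> borel_measurable borel" unfolding H_def by measurable
    show "H (t *\<^sub>R z) = of_real (t ^ (2 * k)) * H z" for t z
      using p by (simp add: H_def hpoly_def scaleR_eq_smult herm_scale_left power_mult_distrib mult_2 power_add)
    show "norm (H z) \<le> (M * norm w ^ k) * norm z ^ (2 * k)" for z
    proof -
      have "norm (H z) \<le> (M * norm z ^ k) * (norm z * norm w) ^ k"
        unfolding H_def norm_mult norm_power complex_mod_cnj
        by (intro mult_mono power_mono M norm_herm_le) (auto intro: order_trans[OF norm_ge_zero M])
      moreover have "norm z ^ (2 * k) = norm z ^ k * norm z ^ k" by (simp add: mult_2 power_add)
      ultimately show ?thesis by (simp only: power_mult_distrib) (simp add: mult_ac)
    qed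
  qed auto
  also have "(\<integral>z. H z * of_real (exp (- (norm z)\<^sup>2)) \<partial>lborel) = fact k * gmass TYPE('n) * p w"
    using gaussian_reproducing[OF p] by (simp add: H_def)
  finally show ?thesis
    using gmom_pos[of "CARD('n) + k"] by (simp add: H_def field_simps Suc_leI)
qed

section \<open>The reproducing kernel\<close>

definition nsq :: "'a measure \<Rightarrow> ('a \<Rightarrow> complex) \<Rightarrow> ennreal"
  where "nsq M f = (\<integral>\<^sup>+x. ennreal ((norm (f x))\<^sup>2) \<partial>M)"

lemma L2_Cauchy_Schwarz:
  assumes [measurable]: "f \<in> borel_measurable M" "g \<in> borel_measurable M"
    and fin: "nsq M f < \<infinity>" "nsq M g < \<infinity>"
  shows "integrable M (\<lambda>x. f x * cnj (g x))"
    and "ennreal ((norm (\<integral>x. f x * cnj (g x) \<partial>M))\<^sup>2) \<le> nsq M f * nsq M g"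
proof -
  have [measurable]: "(\<lambda>x. cnj (g x)) \<in> borel_measurable M"
    by (rule measurable_compose[OF assms(2)]) (intro borel_measurable_continuous_onI continuous_intros)
  let ?I = "\<integral>\<^sup>+x. ennreal (norm (f x)) * ennreal (norm (g x)) \<partial>M"
  have cs: "?I\<^sup>2 \<le> nsq M f * nsq M g"
    using Cauchy_Schwarz_nn_integral[of "\<lambda>x. ennreal (norm (f x))" M "\<lambda>x. ennreal (norm (g x))"]
    by (simp add: nsq_def ennreal_power)
  then have "?I\<^sup>2 < \<infinity>" using fin by (simp add: ennreal_mult_less_top order.strict_trans1)
  then have I: "?I < \<infinity>" by (simp add: power_less_top_ennreal)
  have e: "(\<integral>\<^sup>+x. ennreal (norm (f x * cnj (g x))) \<partial>M) = ?I"
    by (simp add: norm_mult ennreal_mult)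
  show i: "integrable M (\<lambda>x. f x * cnj (g x))"
    by (rule integrableI_bounded) (use I e in auto)
  have "ennreal (norm (\<integral>x. f x * cnj (g x) \<partial>M)) \<le> ?I"
    using integral_norm_bound_ennreal[OF i] e by simp
  then have "ennreal (norm (\<integral>x. f x * cnj (g x) \<partial>M)) ^ 2 \<le> ?I ^ 2" by (rule power_mono) simp
  with cs show "ennreal ((norm (\<integral>x. f x * cnj (g x) \<partial>M))\<^sup>2) \<le> nsq M f * nsq M g"
    by (simp add: ennreal_power)
qed

section \<open>Closure properties of holomorphic polynomials\<close>

lemma holomorphic_polynomials_add:
  assumes "p \<in> holomorphic_polynomials" "q \<in> holomorphic_polynomials"
  shows "(\<lambda>z. p z + q z) \<in> holomorphic_polynomials"
proof -
  obtain A c where p: "finite A" "p = (\<lambda>z. \<Sum>\<alpha>\<in>A. c \<alpha> * (\<Prod>j\<in>UNIV. (z $ j) ^ \<alpha> j))"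
    using assms(1) by (auto simp: holomorphic_polynomials_def)
  obtain B d where q: "finite B" "q = (\<lambda>z. \<Sum>\<alpha>\<in>B. d \<alpha> * (\<Prod>j\<in>UNIV. (z $ j) ^ \<alpha> j))"
    using assms(2) by (auto simp: holomorphic_polynomials_def)
  define e where "e \<alpha> = (if \<alpha> \<in> A then c \<alpha> else 0) + (if \<alpha> \<in> B then d \<alpha> else 0)" for \<alpha>
  have "p z + q z = (\<Sum>\<alpha>\<in>A \<union> B. e \<alpha> * (\<Prod>j\<in>UNIV. (z $ j) ^ \<alpha> j))" for z
  proof -
    have "(\<Sum>\<alpha>\<in>A \<union> B. e \<alpha> * (\<Prod>j\<in>UNIV. (z $ j) ^ \<alpha> j))
       = (\<Sum>\<alpha>\<in>A \<union> B. (if \<alpha> \<in> A then c \<alpha> else 0) * (\<Prod>j\<in>UNIV. (z $ j) ^ \<alpha> j))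
         + (\<Sum>\<alpha>\<in>A \<union> B. (if \<alpha> \<in> B then d \<alpha> else 0) * (\<Prod>j\<in>UNIV. (z $ j) ^ \<alpha> j))"
      by (simp add: e_def distrib_right sum.distrib)
    also have "(\<Sum>\<alpha>\<in>A \<union> B. (if \<alpha> \<in> A then c \<alpha> else 0) * (\<Prod>j\<in>UNIV. (z $ j) ^ \<alpha> j)) = p z"
      unfolding p(2) by (rule sum.mono_neutral_cong_right) (use p q in auto)
    also have "(\<Sum>\<alpha>\<in>A \<union> B. (if \<alpha> \<in> B then d \<alpha> else 0) * (\<Prod>j\<in>UNIV. (z $ j) ^ \<alpha> j)) = q z"
      unfolding q(2) by (rule sum.mono_neutral_cong_right) (use p q in auto)
    finally show ?thesis by simp
  qed
  then show ?thesis
    unfolding holomorphic_polynomials_def using p(1) q(1)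
    by (intro CollectI exI[of _ "A \<union> B"] exI[of _ e]) auto
qed

lemma holomorphic_polynomials_mult_monomial:
  assumes "p \<in> holomorphic_polynomials"
  shows "(\<lambda>z. (a * (\<Prod>j\<in>UNIV. (z $ j) ^ \<beta> j)) * p z) \<in> holomorphic_polynomials"
proof -
  obtain A c where p: "finite A" "p = (\<lambda>z. \<Sum>\<alpha>\<in>A. c \<alpha> * (\<Prod>j\<in>UNIV. (z $ j) ^ \<alpha> j))"
    using assms(1) by (auto simp: holomorphic_polynomials_def)
  \<comment> \<open>Multiplication by a monomial shifts exponents injectively, so the old
    coefficient is found through \<open>inv s\<close>.\<close>
  define s where "s \<alpha> = (\<lambda>j. \<beta> j + \<alpha> j)" for \<alpha> :: "'a \<Rightarrow> nat"
  have inj: "inj s" by (auto simp: s_def inj_def fun_eq_iff)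
  have iv: "inv s (\<lambda>j. \<beta> j + x j) = x" for x
    using inv_f_f[OF inj, of x] by (simp add: s_def)
  have "(a * (\<Prod>j\<in>UNIV. (z $ j) ^ \<beta> j)) * p z
     = (\<Sum>\<gamma>\<in>s ` A. (a * c (inv s \<gamma>)) * (\<Prod>j\<in>UNIV. (z $ j) ^ \<gamma> j))" for z
    unfolding p(2) using inj
    by (subst sum.reindex[OF inj_on_subset[OF inj]])
      (auto simp: sum_distrib_left s_def[symmetric] iv inv_f_f[OF inj], auto simp: s_def power_add prod.distrib mult_ac intro!: sum.cong)
  then show ?thesis
    unfolding holomorphic_polynomials_def using p(1)
    by (intro CollectI exI[of _ "s ` A"] exI[of _ "\<lambda>\<gamma>. a * c (inv s \<gamma>)"]) auto
qed

lemma holomorphic_polynomials_const: "(\<lambda>z. a) \<in> holomorphic_polynomials"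
  unfolding holomorphic_polynomials_def
  by (intro CollectI exI[of _ "{\<lambda>_. 0}"] exI[of _ "\<lambda>_. a"]) auto

lemma holomorphic_polynomials_sum:
  "(\<And>i. i \<in> I \<Longrightarrow> f i \<in> holomorphic_polynomials) \<Longrightarrow> (\<lambda>z. \<Sum>i\<in>I. f i z) \<in> holomorphic_polynomials"
  by (induction I rule: infinite_finite_induct)
    (auto intro: holomorphic_polynomials_const holomorphic_polynomials_add)

lemma holomorphic_polynomials_mult:
  assumes "p \<in> holomorphic_polynomials" "q \<in> holomorphic_polynomials"
  shows "(\<lambda>z. p z * q z) \<in> holomorphic_polynomials"
proof -
  obtain A c where p: "finite A" "p = (\<lambda>z. \<Sum>\<alpha>\<in>A. c \<alpha> * (\<Prod>j\<in>UNIV. (z $ j) ^ \<alpha> j))"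
    using assms(1) by (auto simp: holomorphic_polynomials_def)
  have "(\<lambda>z. p z * q z) = (\<lambda>z. \<Sum>\<alpha>\<in>A. (c \<alpha> * (\<Prod>j\<in>UNIV. (z $ j) ^ \<alpha> j)) * q z)"
    by (simp add: p(2) sum_distrib_right)
  then show ?thesis
    using holomorphic_polynomials_sum[of A "\<lambda>\<alpha> z. (c \<alpha> * (\<Prod>j\<in>UNIV. (z $ j) ^ \<alpha> j)) * q z"]
      holomorphic_polynomials_mult_monomial[OF assms(2)] by simp
qed

lemma holomorphic_polynomials_nth: "(\<lambda>z. z $ k) \<in> holomorphic_polynomials"
proof -
  have "z $ k = (\<Prod>j\<in>UNIV. (z $ j) ^ (if j = k then 1 else 0))" for z :: "complex ^ 'a"
  proof -
    have "(\<Prod>j\<in>UNIV. (z $ j) ^ (if j = k then 1 else 0)) = (\<Prod>j\<in>{k}. (z $ j) ^ (if j = k then 1 else 0))"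
      by (rule prod.mono_neutral_right) auto
    then show ?thesis by simp
  qed
  then show ?thesis
    unfolding holomorphic_polynomials_def
    by (intro CollectI exI[of _ "{\<lambda>j. if j = k then 1 else 0}"] exI[of _ "\<lambda>_. 1"]) auto
qed

lemma holomorphic_polynomials_herm_power: "(\<lambda>z. a * herm z w ^ k) \<in> holomorphic_polynomials"
proof -
  have h: "(\<lambda>z. herm z w) \<in> holomorphic_polynomials"
    unfolding herm_def
    by (intro holomorphic_polynomials_sum holomorphic_polynomials_mult holomorphic_polynomials_nth holomorphic_polynomials_const)
  have "(\<lambda>z. herm z w ^ k) \<in> holomorphic_polynomials"
    by (induction k) (auto intro: holomorphic_polynomials_const holomorphic_polynomials_mult[OF h])
  then show ?thesis by (intro holomorphic_polynomials_mult holomorphic_polynomials_const)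
qed

text \<open>The parameter \<open>dim\<close> only fixes the type \<open>'n\<close>, so that constants may depend on the dimension.\<close>
locale fock_growth = growth \<Psi> P R Q Q' C1 for \<Psi> P R Q Q' :: "real \<Rightarrow> real" and C1 :: real +
  fixes dim :: "'n::finite itself"
begin

abbreviation mu :: "(complex ^ 'n) measure" where "mu \<equiv> fock_measure \<Psi>"

text \<open>The absolute value makes the weight continuous on the whole line, as \<Psi> is
  controlled only on the half line.\<close>

definition g0 :: "real \<Rightarrow> real" where "g0 x = exp (- \<Psi> \<bar>x\<bar>)"

definition VV :: "real \<Rightarrow> real" where "VV x = Q x * P x ^ (CARD('n) - 1)"

lemma VV_pos: "x \<ge> 0 \<Longrightarrow> VV x > 0"
  by (simp add: VV_def Q_pos P_pos)

lemma vol_VV: "vol (z :: complex ^ 'n) = 1 / VV ((norm z)\<^sup>2)"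
  by (simp add: vol_def VV_def)

lemma g0_measurable [measurable]: "g0 \<in> borel_measurable borel"
proof -
  have "continuous_on {0..} \<Psi>"
    by (rule DERIV_continuous_on[of _ _ P]) (use Psi_deriv in auto)
  then have "continuous_on UNIV (\<lambda>x. \<Psi> \<bar>x\<bar>)"
    by (rule continuous_on_compose2) (auto intro!: continuous_intros)
  then show ?thesis
    unfolding g0_def by (intro borel_measurable_continuous_onI continuous_intros)
qed

text \<open>\<Psi>' is nondecreasing, so the weight decays at least like a Gaussian in |z|; this
  gives finite moments and square integrable polynomials.\<close>

lemma Psi_ge: "x \<ge> 0 \<Longrightarrow> \<Psi> x \<ge> \<Psi> 0 + P 0 * x"
proof -
  assume x: "x \<ge> 0"
  then obtain t where t: "0 \<le> t" "t \<le> x" "\<Psi> x - \<Psi> 0 = P t * (x - 0)"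
    using mvt_halfline[of 0 x, OF _ _ Psi_deriv] by auto
  then have "P 0 * x \<le> P t * x" using P_ge[of t] x by (intro mult_right_mono) auto
  then show ?thesis using t by simp
qed

lemma g0_pos: "g0 x > 0"
  by (simp add: g0_def)

lemma g0_le: "x \<ge> 0 \<Longrightarrow> g0 x \<le> exp (- \<Psi> 0) * exp (- (P 0 * x))"
  using Psi_ge[of x] by (simp add: g0_def flip: exp_add)

lemma g0_norm: "g0 ((norm z)\<^sup>2) = exp (- \<Psi> ((norm z)\<^sup>2))"
  by (simp add: g0_def)

lemma nn_integral_mu:
  assumes [measurable]: "f \<in> borel_measurable borel"
  shows "(\<integral>\<^sup>+z. f z \<partial>mu) = (\<integral>\<^sup>+z. ennreal (exp (- \<Psi> ((norm z)\<^sup>2))) * f z \<partial>lborel)"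
  unfolding fock_measure_def by (rule nn_integral_density) auto

lemma sets_mu [measurable_cong, simp]: "sets mu = sets borel"
  by (simp add: fock_measure_def)

lemma space_mu [simp]: "space mu = UNIV"
  by (simp add: fock_measure_def)

lemma integral_mu:
  fixes f :: "complex ^ 'n \<Rightarrow> complex"
  assumes [measurable]: "f \<in> borel_measurable borel"
  shows "(\<integral>z. f z \<partial>mu) = (\<integral>z. f z * of_real (g0 ((norm z)\<^sup>2)) \<partial>lborel)"
  unfolding fock_measure_def
  by (subst integral_density) (auto simp: g0_norm scaleR_conv_of_real mult.commute)

lemma integrable_mu:
  fixes f :: "complex ^ 'n \<Rightarrow> complex"
  assumes [measurable]: "f \<in> borel_measurable borel" and "\<And>z. norm (f z) \<le> B * norm z ^ j"
  shows "integrable mu f"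
proof -
  have "integrable lborel (\<lambda>z. f z * of_real (g0 ((norm z)\<^sup>2)))"
  proof (rule integrable_gaussian_bound[where B = "B * exp (- \<Psi> 0)" and j = j and a = 0 and m = "P 0"])
    fix z :: "complex ^ 'n"
    have "norm (f z * of_real (g0 ((norm z)\<^sup>2))) = norm (f z) * g0 ((norm z)\<^sup>2)"
      using g0_pos[of "(norm z)\<^sup>2"] by (simp add: norm_mult)
    also have "\<dots> \<le> (B * norm z ^ j) * (exp (- \<Psi> 0) * exp (- (P 0 * (norm z)\<^sup>2)))"
      by (intro mult_mono assms g0_le) (auto simp: g0_pos less_imp_le intro: order_trans[OF norm_ge_zero assms(2)])
    finally show "norm (f z * of_real (g0 ((norm z)\<^sup>2)))
      \<le> B * exp (- \<Psi> 0) * (norm z ^ j * exp (0 * norm z) * exp (- (P 0 * (norm z)\<^sup>2)))"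
      by (simp add: algebra_simps)
  qed (use P0 in auto)
  then show ?thesis
    unfolding fock_measure_def
    by (subst integrable_density) (auto simp: g0_norm scaleR_conv_of_real mult.commute)
qed

text \<open>
  By the exchange of radial weights, the reproducing property for homogeneous polynomials of degree
  \<open>k\<close> is that of the Gaussian, corrected by a quotient of moments.
\<close>
definition ck :: "nat \<Rightarrow> real"
  where "ck k = gmom (CARD('n) + k) / (fact k * gmass TYPE('n) * mom g0 (CARD('n) + k))"

lemma g0_mom_integrable: "N \<ge> 1 \<Longrightarrow> integrable lborel (\<lambda>t. exp (t * real N) * g0 (exp t))"
  by (rule mom_integrable[OF g0_measurable P0 _ _ g0_le]) (auto simp: g0_pos less_imp_le)

lemma mom_g0_pos: "N \<ge> 1 \<Longrightarrow> mom g0 N > 0"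
  by (rule mom_pos[OF g0_mom_integrable]) (auto simp: g0_pos)

lemma ck_pos: "ck k > 0"
  unfolding ck_def by (intro divide_pos_pos mult_pos_pos gmom_pos mom_g0_pos gmass_pos) (auto simp: Suc_leI)

lemma hpoly_measurable: "hpoly k p \<Longrightarrow> p \<in> borel_measurable borel"
  by (simp add: hpoly_def entire_imp_borel_measurable)

lemma cnj_herm_measurable [measurable]: "(\<lambda>z. cnj (herm z w)) \<in> borel_measurable borel"
  by (intro borel_measurable_continuous_onI continuous_intros)

lemma hpoly_integrable:
  fixes p :: "complex ^ 'n \<Rightarrow> complex"
  assumes "hpoly k p" shows "integrable mu (\<lambda>z. p z * cnj (herm z w) ^ m)"
proof -
  have [measurable]: "p \<in> borel_measurable borel" by (rule hpoly_measurable[OF assms])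
  obtain M where M: "\<And>z. norm (p z) \<le> M * norm z ^ k" using assms by (auto simp: hpoly_def)
  show ?thesis
  proof (rule integrable_mu)
    fix z :: "complex ^ 'n"
    have "norm (p z * cnj (herm z w) ^ m) \<le> (M * norm z ^ k) * (norm z * norm w) ^ m"
      unfolding norm_mult norm_power complex_mod_cnj
      by (intro mult_mono power_mono M norm_herm_le) (auto intro: order_trans[OF norm_ge_zero M])
    then show "norm (p z * cnj (herm z w) ^ m) \<le> (M * norm w ^ m) * norm z ^ (k + m)"
      by (simp add: power_mult_distrib power_add algebra_simps)
  qed measurable
qed

lemma hpoly_reproducing:
  fixes p :: "complex ^ 'n \<Rightarrow> complex"
  assumes "hpoly k p"
  shows "(\<integral>z. p z * cnj (herm z w) ^ m \<partial>mu) = (if m = k then p w / ck k else 0)"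
proof -
  have [measurable]: "p \<in> borel_measurable borel" by (rule hpoly_measurable[OF assms])
  have *: "(\<integral>z. p z * cnj (herm z w) ^ m \<partial>mu) = (\<integral>z. p z * cnj (herm z w) ^ m * of_real (g0 ((norm z)\<^sup>2)) \<partial>lborel)"
    by (rule integral_mu) measurable
  show ?thesis
  proof (cases "m = k")
    case True
    have "(\<integral>z. p z * cnj (herm z w) ^ k * of_real (g0 ((norm z)\<^sup>2)) \<partial>lborel)
      = (fact k * gmass TYPE('n) * mom g0 (CARD('n) + k) / gmom (CARD('n) + k)) * p w"
      by (rule radial_reproducing[OF assms g0_measurable P0 _ g0_le]) (auto simp: g0_pos less_imp_le)
    then show ?thesis using True * by (simp add: ck_def field_simps)
  next
    case False
    then show ?thesis
      using * hpoly_orthogonal[OF assms False, of "\<lambda>r. g0 (r\<^sup>2)"] by simp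
  qed
qed

lemma hpoly_nsq:
  fixes p :: "complex ^ 'n \<Rightarrow> complex"
  assumes "hpoly k p" shows "nsq mu p < \<infinity>"
proof -
  have [measurable]: "p \<in> borel_measurable borel" by (rule hpoly_measurable[OF assms])
  obtain M where M: "\<And>z. norm (p z) \<le> M * norm z ^ k" using assms by (auto simp: hpoly_def)
  have "integrable mu (\<lambda>z. (p z)\<^sup>2)"
  proof (rule integrable_mu)
    show "norm ((p z)\<^sup>2) \<le> M\<^sup>2 * norm z ^ (2 * k)" for z
      using power_mono[OF M[of z], of 2] by (simp add: norm_power power_mult_distrib mult.commute flip: power_mult)
  qed measurable
  then show ?thesis by (simp add: integrable_iff_bounded nsq_def norm_power)
qed

section \<open>Point evaluations\<close>

definition Cev :: real where "Cev = exp C5 / measure lborel (ball (0 :: complex ^ 'n) eps1)"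

lemma ball_measure_pos: "e > 0 \<Longrightarrow> measure lborel (ball (0 :: complex ^ 'n) e) > 0"
  by (simp add: content_ball_pos)

lemma Cev_pos: "Cev > 0"
  using ball_measure_pos[OF eps1(1)] by (simp add: Cev_def)

text \<open>The local estimate with its ellipsoid enlarged to the whole space. It bounds the kernel
  from above, transfers norm convergence to values at points, and shows that an entire function of
  norm zero vanishes everywhere.\<close>

lemma point_evaluation:
  fixes f :: "complex ^ 'n \<Rightarrow> complex"
  assumes f: "entire f"
  shows "ennreal ((norm (f z))\<^sup>2) \<le> ennreal (Cev * exp (\<Psi> ((norm z)\<^sup>2)) * VV ((norm z)\<^sup>2)) * nsq mu f"
proof -
  let ?x = "(norm z)\<^sup>2"
  let ?b = "measure lborel (ball (0 :: complex ^ 'n) eps1)"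
  have [measurable]: "f \<in> borel_measurable borel" by (rule entire_imp_borel_measurable[OF f])
  have b: "?b > 0" by (rule ball_measure_pos[OF eps1(1)])
  define aa where "aa = exp (- \<Psi> ?x) * (vol z * ?b)"
  have a: "aa > 0" using vol_pos[of z] b by (simp add: aa_def)
  have nf: "nsq mu f = (\<integral>\<^sup>+w. ennreal ((norm (f w))\<^sup>2 * exp (- \<Psi> ((norm w)\<^sup>2))) \<partial>lborel)"
    unfolding nsq_def by (subst nn_integral_mu) (auto simp: ennreal_mult mult.commute)
  have "ennreal ((norm (f z))\<^sup>2 * exp (- \<Psi> ?x) * (vol z * ?b))
    \<le> ennreal (exp C5) * (\<integral>\<^sup>+w. ennreal ((norm (f w))\<^sup>2 * exp (- \<Psi> ((norm w)\<^sup>2))) * indicator (ell z eps1) w \<partial>lborel)"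
    by (rule local_estimate[OF f eps1(1)]) simp
  also have "\<dots> \<le> ennreal (exp C5) * nsq mu f"
    unfolding nf by (intro mult_left_mono nn_integral_mono) (auto simp: indicator_def)
  finally have "ennreal (1 / aa) * ennreal ((norm (f z))\<^sup>2 * aa) \<le> ennreal (1 / aa) * (ennreal (exp C5) * nsq mu f)"
    by (intro mult_left_mono) (simp_all add: mult.assoc aa_def)
  moreover have "ennreal (1 / aa) * ennreal ((norm (f z))\<^sup>2 * aa) = ennreal ((norm (f z))\<^sup>2)"
    using a by (subst ennreal_mult[symmetric]) auto
  moreover have "ennreal (1 / aa) * (ennreal (exp C5) * nsq mu f) = ennreal (1 / aa * exp C5) * nsq mu f"
    unfolding mult.assoc[symmetric] using a by (subst ennreal_mult) auto
  moreover have "1 / aa * exp C5 = Cev * exp (\<Psi> ?x) * VV ?x"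
    using b VV_pos[of ?x] by (simp add: aa_def Cev_def vol_VV exp_minus field_simps)
  ultimately show ?thesis by simp
qed

section \<open>Partial sums of the kernel over finite sets of degrees\<close>

definition KI :: "nat set \<Rightarrow> complex ^ 'n \<Rightarrow> complex ^ 'n \<Rightarrow> complex"
  where "KI I w z = (\<Sum>k\<in>I. of_real (ck k) * herm z w ^ k)"

lemma KI_entire: "entire (KI I w)"
  unfolding KI_def by (intro entire_sum entire_mult entire_const entire_power entire_herm)

lemma KI_measurable [measurable]: "KI I w \<in> borel_measurable borel"
  by (rule entire_imp_borel_measurable[OF KI_entire])

lemma KI_poly: "KI I w \<in> holomorphic_polynomials"
  unfolding KI_def by (intro holomorphic_polynomials_sum holomorphic_polynomials_herm_power)

lemma cnj_KI: "cnj (KI I w z) = (\<Sum>k\<in>I. of_real (ck k) * cnj (herm z w) ^ k)"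
  by (simp add: KI_def)

lemma KI_diag: "KI I w w = of_real (\<Sum>k\<in>I. ck k * ((norm w)\<^sup>2) ^ k)"
  by (simp add: KI_def herm_self)

lemma hpoly_KI:
  assumes p: "hpoly k p" and I: "finite I"
  shows "integrable mu (\<lambda>z. p z * cnj (KI I w z))"
    and "(\<integral>z. p z * cnj (KI I w z) \<partial>mu) = (if k \<in> I then p w else 0)"
proof -
  have e: "(\<lambda>z. p z * cnj (KI I w z)) = (\<lambda>z. \<Sum>m\<in>I. of_real (ck m) * (p z * cnj (herm z w) ^ m))"
    by (simp add: cnj_KI sum_distrib_left mult_ac)
  show "integrable mu (\<lambda>z. p z * cnj (KI I w z))"
    unfolding e by (intro Bochner_Integration.integrable_sum integrable_mult_right hpoly_integrable[OF p])
  have "(\<integral>z. p z * cnj (KI I w z) \<partial>mu) = (\<Sum>m\<in>I. \<integral>z. of_real (ck m) * (p z * cnj (herm z w) ^ m) \<partial>mu)"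
    unfolding e by (intro Bochner_Integration.integral_sum integrable_mult_right hpoly_integrable[OF p])
  also have "\<dots> = (\<Sum>m\<in>I. of_real (ck m) * (if m = k then p w / ck k else 0))"
    by (simp add: hpoly_reproducing[OF p])
  also have "\<dots> = (\<Sum>m\<in>I. if m = k then p w else 0)"
    by (intro sum.cong) (use ck_pos[of k] in auto)
  finally show "(\<integral>z. p z * cnj (KI I w z) \<partial>mu) = (if k \<in> I then p w else 0)"
    using I by simp
qed

text \<open>The partial kernel reproduces each of its own homogeneous terms, so its squared norm is
  its value on the diagonal.\<close>

lemma KI_nsq:
  assumes I: "finite I"
  shows "nsq mu (KI I w) = ennreal (\<Sum>k\<in>I. ck k * ((norm w)\<^sup>2) ^ k)"
proof -
  have e: "(\<lambda>z. KI I w z * cnj (KI I w z)) = (\<lambda>z. \<Sum>k\<in>I. of_real (ck k) * (herm z w ^ k * cnj (KI I w z)))"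
    by (simp add: KI_def sum_distrib_right mult.assoc)
  have i: "integrable mu (\<lambda>z. KI I w z * cnj (KI I w z))"
    unfolding e by (intro Bochner_Integration.integrable_sum integrable_mult_right hpoly_KI(1)[OF hpoly_herm_power I])
  have "(\<integral>z. KI I w z * cnj (KI I w z) \<partial>mu) = (\<Sum>k\<in>I. \<integral>z. of_real (ck k) * (herm z w ^ k * cnj (KI I w z)) \<partial>mu)"
    unfolding e by (intro Bochner_Integration.integral_sum integrable_mult_right hpoly_KI(1)[OF hpoly_herm_power I])
  also have "\<dots> = (\<Sum>k\<in>I. of_real (ck k) * herm w w ^ k)"
    by (intro sum.cong) (auto simp: hpoly_KI(2)[OF hpoly_herm_power I])
  also have "\<dots> = of_real (\<Sum>k\<in>I. ck k * ((norm w)\<^sup>2) ^ k)"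
    by (simp add: herm_self)
  finally have v: "(\<integral>z. KI I w z * cnj (KI I w z) \<partial>mu) = of_real (\<Sum>k\<in>I. ck k * ((norm w)\<^sup>2) ^ k)" .
  have n: "KI I w z * cnj (KI I w z) = of_real ((norm (KI I w z))\<^sup>2)" for z
    by (rule complex_norm_square[symmetric])
  have i2: "integrable mu (\<lambda>z. (norm (KI I w z))\<^sup>2)"
    using i unfolding n by (simp only: complex_of_real_integrable_eq)
  have "(\<integral>z. (norm (KI I w z))\<^sup>2 \<partial>mu) = (\<Sum>k\<in>I. ck k * ((norm w)\<^sup>2) ^ k)"
    using v unfolding n integral_complex_of_real of_real_eq_iff .
  then show ?thesis
    unfolding nsq_def using nn_integral_eq_integral[OF i2] by simp
qed

text \<open>Point evaluation applied to the partial kernel itself reads S^2 \<le> E S with S its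
  diagonal value, whence S \<le> E. The bound does not depend on the set of degrees, so it also
  yields convergence of the full series.\<close>

lemma KI_le:
  assumes "finite I" "x \<ge> 0"
  shows "(\<Sum>k\<in>I. ck k * x ^ k) \<le> Cev * exp (\<Psi> x) * VV x"
proof -
  obtain b :: "complex ^ 'n" where b: "b \<in> Basis" using SOME_Basis by blast
  define w where "w = sqrt x *\<^sub>R b"
  have w: "(norm w)\<^sup>2 = x" using assms(2) b by (simp add: w_def)
  define S where "S = (\<Sum>k\<in>I. ck k * x ^ k)"
  have S0: "S \<ge> 0" unfolding S_def using assms(2) ck_pos by (intro sum_nonneg mult_nonneg_nonneg) (auto simp: less_imp_le)
  have "ennreal (S\<^sup>2) \<le> ennreal (Cev * exp (\<Psi> x) * VV x) * ennreal S"
    using point_evaluation[OF KI_entire[of I w], of w] KI_nsq[OF assms(1), of w] S0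
    by (simp add: KI_diag w S_def[symmetric] del: of_real_sum of_real_mult of_real_power)
  also have "\<dots> = ennreal (Cev * exp (\<Psi> x) * VV x * S)"
    using S0 Cev_pos VV_pos[OF assms(2)] by (simp add: ennreal_mult)
  finally have "S\<^sup>2 \<le> Cev * exp (\<Psi> x) * VV x * S"
    using S0 Cev_pos VV_pos[OF assms(2)] by (subst (asm) ennreal_le_iff) auto
  then show ?thesis
    using S0 Cev_pos VV_pos[OF assms(2)] by (cases "S = 0") (auto simp: S_def[symmetric] power2_eq_square)
qed

lemma ck_summable: "x \<ge> 0 \<Longrightarrow> summable (\<lambda>k. ck k * x ^ k)"
  by (rule summableI_nonneg_bounded[where x = "Cev * exp (\<Psi> x) * VV x"])
    (auto simp: ck_pos less_imp_le intro: KI_le)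

lemma ck_summable_complex: "summable (\<lambda>k. of_real (ck k) * (s :: complex) ^ k)"
proof (rule summable_norm_cancel)
  have "(\<lambda>k. norm (of_real (ck k) * s ^ k)) = (\<lambda>k. ck k * norm s ^ k)"
    using ck_pos by (auto simp: norm_mult norm_power less_imp_le)
  then show "summable (\<lambda>k. norm (of_real (ck k) * s ^ k))" using ck_summable[of "norm s"] by simp
qed

lemma ck_summable_real: "summable (\<lambda>k. ck k * (x :: real) ^ k)"
proof (rule summable_norm_cancel)
  have "(\<lambda>k. norm (ck k * x ^ k)) = (\<lambda>k. ck k * \<bar>x\<bar> ^ k)"
    using ck_pos by (auto simp: abs_mult power_abs less_imp_le)
  then show "summable (\<lambda>k. norm (ck k * x ^ k))" using ck_summable[of "\<bar>x\<bar>"] by simp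
qed

section \<open>The full kernel and its reproducing property\<close>

definition FF :: "real \<Rightarrow> real" where "FF x = (\<Sum>k. ck k * x ^ k)"
definition Fc :: "complex \<Rightarrow> complex" where "Fc s = (\<Sum>k. of_real (ck k) * s ^ k)"

lemma FF_le: "x \<ge> 0 \<Longrightarrow> FF x \<le> Cev * exp (\<Psi> x) * VV x"
  unfolding FF_def by (rule suminf_le_const[OF ck_summable]) (auto intro: KI_le)

lemma FF_ge: "x \<ge> 0 \<Longrightarrow> finite I \<Longrightarrow> (\<Sum>k\<in>I. ck k * x ^ k) \<le> FF x"
  unfolding FF_def by (rule sum_le_suminf[OF ck_summable]) (auto simp: ck_pos less_imp_le)

lemma FF_pos: "x \<ge> 0 \<Longrightarrow> FF x > 0"
  using FF_ge[of x "{0}"] ck_pos[of 0] by simp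

lemma Fc_of_real: "Fc (of_real x) = of_real (FF x)"
proof -
  have "complex_of_real (\<Sum>k. ck k * x ^ k) = (\<Sum>k. complex_of_real (ck k * x ^ k))"
    by (rule suminf_of_real[OF ck_summable_real])
  then show ?thesis by (simp add: Fc_def FF_def)
qed

lemma Fc_holomorphic: "Fc holomorphic_on UNIV"
proof -
  have "(Fc has_field_derivative (\<Sum>k. diffs (\<lambda>k. of_real (ck k)) k * s ^ k)) (at s)" for s
    unfolding Fc_def[abs_def] by (rule termdiffs_strong_converges_everywhere) (rule ck_summable_complex)
  then show ?thesis
    by (auto simp: holomorphic_on_def field_differentiable_def intro: has_field_derivative_at_within)
qed

text \<open>The centre comes first, so that \<open>kern w\<close> is the entire function of z; the
  arguments are thus exchanged in comparison with \<open>fock_kernel\<close>.\<close>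

definition kern :: "complex ^ 'n \<Rightarrow> complex ^ 'n \<Rightarrow> complex"
  where "kern w z = Fc (herm z w)"

lemma kern_entire: "entire (kern w)"
  unfolding kern_def by (rule entire_compose_holomorphic[OF Fc_holomorphic entire_herm])

lemma kern_measurable [measurable]: "kern w \<in> borel_measurable borel"
  by (rule entire_imp_borel_measurable[OF kern_entire])

lemma kern_diag: "kern w w = of_real (FF ((norm w)\<^sup>2))"
  unfolding kern_def herm_self by (rule Fc_of_real)

text \<open>Fatou's lemma along the finite blocks \<open>{m..<M}\<close>, whose norms are known
  exactly.\<close>

lemma kern_tail_nsq:
  "nsq mu (\<lambda>z. kern w z - KI {..<m} w z) \<le> ennreal (FF ((norm w)\<^sup>2) - (\<Sum>k<m. ck k * ((norm w)\<^sup>2) ^ k))"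
proof -
  let ?x = "(norm w)\<^sup>2"
  define u where "u M z = ennreal ((norm (KI {m..<M} w z))\<^sup>2)" for M z
  have lim: "(\<lambda>M. u M z) \<longlonglongrightarrow> ennreal ((norm (kern w z - KI {..<m} w z))\<^sup>2)" for z
  proof -
    have "(\<lambda>M. KI {..<M} w z) \<longlonglongrightarrow> kern w z"
      unfolding KI_def kern_def Fc_def by (rule summable_LIMSEQ[OF ck_summable_complex])
    then have "(\<lambda>M. KI {..<M} w z - KI {..<m} w z) \<longlonglongrightarrow> kern w z - KI {..<m} w z"
      by (intro tendsto_intros)
    moreover have "\<forall>\<^sub>F M in sequentially. KI {..<M} w z - KI {..<m} w z = KI {m..<M} w z"
      using eventually_ge_at_top[of m]
    proof eventually_elim
      case (elim M)
      have "{..<M} = {..<m} \<union> {m..<M}" using elim by auto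
      then have "KI {..<M} w z = KI {..<m} w z + KI {m..<M} w z"
        unfolding KI_def by (simp add: sum.union_disjoint ivl_disj_int)
      then show ?case by simp
    qed
    ultimately have "(\<lambda>M. KI {m..<M} w z) \<longlonglongrightarrow> kern w z - KI {..<m} w z"
      by (rule Lim_transform_eventually)
    then show ?thesis unfolding u_def by (intro tendsto_ennrealI tendsto_intros)
  qed
  have "nsq mu (\<lambda>z. kern w z - KI {..<m} w z) = (\<integral>\<^sup>+z. liminf (\<lambda>M. u M z) \<partial>mu)"
    unfolding nsq_def by (intro nn_integral_cong) (simp add: lim_imp_Liminf[OF _ lim])
  also have "\<dots> \<le> liminf (\<lambda>M. \<integral>\<^sup>+z. u M z \<partial>mu)"
    by (rule nn_integral_liminf) (simp add: u_def)
  also have "\<dots> \<le> ennreal (FF ?x - (\<Sum>k<m. ck k * ?x ^ k))"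
  proof (rule Liminf_le)
    show "\<forall>\<^sub>F M in sequentially. (\<integral>\<^sup>+z. u M z \<partial>mu) \<le> ennreal (FF ?x - (\<Sum>k<m. ck k * ?x ^ k))"
    proof (rule always_eventually, rule allI)
      fix M
      have "(\<integral>\<^sup>+z. u M z \<partial>mu) = ennreal (\<Sum>k\<in>{m..<M}. ck k * ?x ^ k)"
        using KI_nsq[of "{m..<M}" w] by (simp add: u_def nsq_def)
      also have "\<dots> \<le> ennreal (FF ?x - (\<Sum>k<m. ck k * ?x ^ k))"
      proof (rule ennreal_leI)
        have "(\<Sum>k\<in>{m..<M}. ck k * ?x ^ k) + (\<Sum>k<m. ck k * ?x ^ k) = (\<Sum>k\<in>{..<m} \<union> {m..<M}. ck k * ?x ^ k)"
          by (subst sum.union_disjoint) (auto simp: ivl_disj_int)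
        also have "\<dots> \<le> FF ?x" by (rule FF_ge) auto
        finally show "(\<Sum>k\<in>{m..<M}. ck k * ?x ^ k) \<le> FF ?x - (\<Sum>k<m. ck k * ?x ^ k)" by simp
      qed
      finally show "(\<integral>\<^sup>+z. u M z \<partial>mu) \<le> ennreal (FF ?x - (\<Sum>k<m. ck k * ?x ^ k))" .
    qed
  qed simp
  finally show ?thesis .
qed

lemma kern_nsq: "nsq mu (kern w) \<le> ennreal (FF ((norm w)\<^sup>2))"
  using kern_tail_nsq[of w 0] by (simp add: KI_def)

lemma kern_nsq_finite: "nsq mu (kern w) < \<infinity>"
  using kern_nsq[of w] by (rule le_less_trans) simp

lemma kern_tail_tendsto:
  "(\<lambda>m. ennreal (FF ((norm w)\<^sup>2) - (\<Sum>k<m. ck k * ((norm w)\<^sup>2) ^ k))) \<longlonglongrightarrow> 0"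
proof -
  have "(\<lambda>m. FF ((norm w)\<^sup>2) - (\<Sum>k<m. ck k * ((norm w)\<^sup>2) ^ k)) \<longlonglongrightarrow> FF ((norm w)\<^sup>2) - FF ((norm w)\<^sup>2)"
    unfolding FF_def by (intro tendsto_intros summable_LIMSEQ ck_summable_real)
  from tendsto_ennrealI[OF this] show ?thesis by simp
qed

lemma kern_in_fock: "kern w \<in> fock_space \<Psi>"
  unfolding fock_space_def L2_def
proof (intro CollectI conjI allI impI)
  show "kern w \<in> borel_measurable mu" by simp
  show "(\<integral>\<^sup>+x. ennreal ((norm (kern w x))\<^sup>2) \<partial>mu) < \<infinity>" using kern_nsq_finite[of w] by (simp add: nsq_def)
  show "entire (kern w)" by (rule kern_entire)
  fix \<epsilon> :: real assume "\<epsilon> > 0"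
  then have "\<forall>\<^sub>F m in sequentially. ennreal (FF ((norm w)\<^sup>2) - (\<Sum>k<m. ck k * ((norm w)\<^sup>2) ^ k)) < ennreal \<epsilon>"
    by (intro order_tendstoD(2)[OF kern_tail_tendsto]) simp
  then obtain m where "ennreal (FF ((norm w)\<^sup>2) - (\<Sum>k<m. ck k * ((norm w)\<^sup>2) ^ k)) < ennreal \<epsilon>"
    using eventually_happens' sequentially_bot by blast
  then have "nsq mu (\<lambda>z. kern w z - KI {..<m} w z) < ennreal \<epsilon>"
    using kern_tail_nsq[of w m] by (rule le_less_trans[rotated])
  then show "\<exists>p\<in>holomorphic_polynomials. (\<integral>\<^sup>+z. ennreal ((norm (kern w z - p z))\<^sup>2) \<partial>mu) < ennreal \<epsilon>"
    using KI_poly[of "{..<m}" w] by (auto simp: nsq_def)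
qed

text \<open>A truncation beyond degree k reproduces p exactly; by Cauchy-Schwarz the error is
  controlled by the norm of the tail, which tends to 0.\<close>

lemma hpoly_kern:
  assumes p: "hpoly k p"
  shows "integrable mu (\<lambda>z. p z * cnj (kern w z))" "(\<integral>z. p z * cnj (kern w z) \<partial>mu) = p w"
proof -
  have [measurable]: "p \<in> borel_measurable borel" by (rule hpoly_measurable[OF p])
  have pf: "nsq mu p < \<infinity>" by (rule hpoly_nsq[OF p])
  show i: "integrable mu (\<lambda>z. p z * cnj (kern w z))"
    by (rule L2_Cauchy_Schwarz(1)) (use pf kern_nsq_finite in auto)
  let ?D = "(\<integral>z. p z * cnj (kern w z) \<partial>mu) - p w"
  define r where "r m = ennreal (FF ((norm w)\<^sup>2) - (\<Sum>k<m. ck k * ((norm w)\<^sup>2) ^ k))" for m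
  have "ennreal ((norm ?D)\<^sup>2) \<le> nsq mu p * r m" if "m > k" for m
  proof -
    have "(\<integral>z. p z * cnj (kern w z - KI {..<m} w z) \<partial>mu)
      = (\<integral>z. p z * cnj (kern w z) - p z * cnj (KI {..<m} w z) \<partial>mu)"
      by (simp add: algebra_simps)
    also have "\<dots> = (\<integral>z. p z * cnj (kern w z) \<partial>mu) - (\<integral>z. p z * cnj (KI {..<m} w z) \<partial>mu)"
      by (intro Bochner_Integration.integral_diff i hpoly_KI(1)[OF p]) simp
    also have "(\<integral>z. p z * cnj (KI {..<m} w z) \<partial>mu) = p w" using that by (simp add: hpoly_KI(2)[OF p])
    finally have e: "?D = (\<integral>z. p z * cnj (kern w z - KI {..<m} w z) \<partial>mu)" by simp
    have "ennreal ((norm ?D)\<^sup>2) \<le> nsq mu p * nsq mu (\<lambda>z. kern w z - KI {..<m} w z)"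
      unfolding e by (rule L2_Cauchy_Schwarz(2)) (use pf kern_tail_nsq[of w m] in \<open>auto intro: le_less_trans\<close>)
    also have "\<dots> \<le> nsq mu p * r m" unfolding r_def by (intro mult_left_mono kern_tail_nsq) simp
    finally show ?thesis .
  qed
  moreover have "(\<lambda>m. nsq mu p * r m) \<longlonglongrightarrow> nsq mu p * 0"
    using kern_tail_tendsto[of w] pf unfolding r_def by (intro ennreal_tendsto_cmult) auto
  ultimately have "ennreal ((norm ?D)\<^sup>2) \<le> 0"
    by (intro LIMSEQ_le_const[of "\<lambda>m. nsq mu p * r m"]) (auto intro: exI[of _ "Suc k"])
  then show "(\<integral>z. p z * cnj (kern w z) \<partial>mu) = p w" by simp
qed

lemma poly_kern:
  assumes "q \<in> holomorphic_polynomials"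
  shows "integrable mu (\<lambda>z. q z * cnj (kern w z))" "(\<integral>z. q z * cnj (kern w z) \<partial>mu) = q w"
    "q \<in> borel_measurable borel" "entire q"
proof -
  obtain A c where q: "finite A" "q = (\<lambda>z. \<Sum>\<alpha>\<in>A. c \<alpha> * (\<Prod>j\<in>UNIV. (z $ j) ^ \<alpha> j))"
    using assms by (auto simp: holomorphic_polynomials_def)
  have e: "(\<lambda>z. q z * cnj (kern w z)) = (\<lambda>z. \<Sum>\<alpha>\<in>A. c \<alpha> * ((\<Prod>j\<in>UNIV. (z $ j) ^ \<alpha> j) * cnj (kern w z)))"
    by (simp add: q(2) sum_distrib_right mult.assoc)
  show "integrable mu (\<lambda>z. q z * cnj (kern w z))"
    unfolding e by (intro Bochner_Integration.integrable_sum integrable_mult_right hpoly_kern(1)[OF hpoly_monomial])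
  have "(\<integral>z. q z * cnj (kern w z) \<partial>mu) = (\<Sum>\<alpha>\<in>A. \<integral>z. c \<alpha> * ((\<Prod>j\<in>UNIV. (z $ j) ^ \<alpha> j) * cnj (kern w z)) \<partial>mu)"
    unfolding e by (intro Bochner_Integration.integral_sum integrable_mult_right hpoly_kern(1)[OF hpoly_monomial])
  also have "\<dots> = q w" by (simp add: hpoly_kern(2)[OF hpoly_monomial] q(2))
  finally show "(\<integral>z. q z * cnj (kern w z) \<partial>mu) = q w" .
  show "entire q" unfolding q(2) by (intro entire_sum entire_mult entire_const entire_prod entire_power entire_nth)
  then show "q \<in> borel_measurable borel" by (rule entire_imp_borel_measurable)
qed

text \<open>Both sides depend continuously on f in norm, the value at w by
  \<open>point_evaluation\<close> and the integral by Cauchy-Schwarz, and they agree on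
  polynomials.\<close>

lemma fock_reproducing:
  assumes f: "f \<in> fock_space \<Psi>"
  shows "f w = (\<integral>z. f z * cnj (kern w z) \<partial>mu)"
proof -
  have fe: "entire f" and fn: "nsq mu f < \<infinity>"
    and app: "\<And>\<epsilon>. \<epsilon> > 0 \<Longrightarrow> \<exists>p\<in>holomorphic_polynomials. nsq mu (\<lambda>z. f z - p z) < ennreal \<epsilon>"
    using f by (auto simp: fock_space_def L2_def nsq_def)
  have [measurable]: "f \<in> borel_measurable borel" by (rule entire_imp_borel_measurable[OF fe])
  have i: "integrable mu (\<lambda>z. f z * cnj (kern w z))"
    by (rule L2_Cauchy_Schwarz(1)) (use fn kern_nsq_finite in auto)
  define D where "D = f w - (\<integral>z. f z * cnj (kern w z) \<partial>mu)"
  define E where "E = Cev * exp (\<Psi> ((norm w)\<^sup>2)) * VV ((norm w)\<^sup>2)"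
  define G where "G = FF ((norm w)\<^sup>2)"
  have EG: "E > 0" "G > 0" using Cev_pos VV_pos FF_pos by (auto simp: E_def G_def)
  have "(norm D)\<^sup>2 \<le> 2 * (E + G) * \<epsilon>" if "\<epsilon> > 0" for \<epsilon>
  proof -
    obtain q where q: "q \<in> holomorphic_polynomials" "nsq mu (\<lambda>z. f z - q z) < ennreal \<epsilon>"
      using app[OF \<open>\<epsilon> > 0\<close>] by blast
    note [measurable] = poly_kern(3)[OF q(1)]
    let ?I = "\<integral>z. (f z - q z) * cnj (kern w z) \<partial>mu"
    have "?I = (\<integral>z. f z * cnj (kern w z) - q z * cnj (kern w z) \<partial>mu)"
      by (simp add: algebra_simps)
    also have "\<dots> = (\<integral>z. f z * cnj (kern w z) \<partial>mu) - q w"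
      using i poly_kern(1,2)[OF q(1), of w] by (simp add: Bochner_Integration.integral_diff)
    finally have De: "D = (f w - q w) - ?I" by (simp add: D_def)
    have "ennreal ((norm (f w - q w))\<^sup>2) \<le> ennreal E * nsq mu (\<lambda>z. f z - q z)"
      unfolding E_def by (rule point_evaluation) (intro entire_diff fe poly_kern(4)[OF q(1)])
    also have "\<dots> \<le> ennreal E * ennreal \<epsilon>" using q(2) by (intro mult_left_mono) auto
    also have "\<dots> = ennreal (E * \<epsilon>)" using EG that by (simp add: ennreal_mult)
    finally have 1: "(norm (f w - q w))\<^sup>2 \<le> E * \<epsilon>" using EG that by simp
    have "ennreal ((norm ?I)\<^sup>2) \<le> nsq mu (\<lambda>z. f z - q z) * nsq mu (kern w)"
      by (rule L2_Cauchy_Schwarz(2)) (use q(2) kern_nsq_finite in \<open>auto intro: less_trans\<close>)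
    also have "\<dots> \<le> ennreal \<epsilon> * ennreal G"
      using q(2) kern_nsq[of w] by (intro mult_mono) (auto simp: G_def)
    also have "\<dots> = ennreal (G * \<epsilon>)" using EG that by (simp add: ennreal_mult mult.commute)
    finally have 2: "(norm ?I)\<^sup>2 \<le> G * \<epsilon>" using EG that by simp
    have "(norm D)\<^sup>2 \<le> (norm (f w - q w) + norm ?I)\<^sup>2"
      unfolding De by (intro power_mono norm_triangle_ineq4) auto
    also have "\<dots> \<le> 2 * (norm (f w - q w))\<^sup>2 + 2 * (norm ?I)\<^sup>2"
      using sum_squares_bound[of "norm (f w - q w)" "norm ?I"] by (simp add: power2_sum)
    also have "\<dots> \<le> 2 * (E + G) * \<epsilon>" using 1 2 by (simp add: algebra_simps)
    finally show ?thesis .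
  qed
  note D = this
  have "norm D = 0"
  proof (rule ccontr)
    assume "norm D \<noteq> 0"
    then have "(norm D)\<^sup>2 > 0" by simp
    then have "(norm D)\<^sup>2 \<le> 2 * (E + G) * ((norm D)\<^sup>2 / (4 * (E + G)))" using EG by (intro D) simp
    also have "\<dots> = (norm D)\<^sup>2 / 2" using EG by (simp add: field_simps)
    finally show False using \<open>(norm D)\<^sup>2 > 0\<close> by simp
  qed
  then show ?thesis by (simp add: D_def)
qed

text \<open>For uniqueness in the definite description let h be the difference of two candidates.
  Each candidate reproduces itself and the other, so the four terms of the squared norm of h cancel,
  and point evaluation makes h vanish at every point, not just almost everywhere.\<close>

lemma fock_kernel_eq: "fock_kernel \<Psi> z w = kern w z"
proof -
  have "(THE g. g \<in> fock_space \<Psi> \<and> (\<forall>f\<in>fock_space \<Psi>. f w = (\<integral>u. f u * cnj (g u) \<partial>mu))) = kern w"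
  proof (rule the_equality)
    show "kern w \<in> fock_space \<Psi> \<and> (\<forall>f\<in>fock_space \<Psi>. f w = (\<integral>u. f u * cnj (kern w u) \<partial>mu))"
      using kern_in_fock fock_reproducing by blast
    fix g assume g: "g \<in> fock_space \<Psi> \<and> (\<forall>f\<in>fock_space \<Psi>. f w = (\<integral>u. f u * cnj (g u) \<partial>mu))"
    have ge: "entire g" and gn: "nsq mu g < \<infinity>"
      using g by (auto simp: fock_space_def L2_def nsq_def)
    have [measurable]: "g \<in> borel_measurable borel" by (rule entire_imp_borel_measurable[OF ge])
    define h where "h u = g u - kern w u" for u
    have h: "entire h" unfolding h_def by (intro entire_diff ge kern_entire)
    have [measurable]: "h \<in> borel_measurable borel" by (rule entire_imp_borel_measurable[OF h])
    have i1: "integrable mu (\<lambda>u. g u * cnj (g u))" by (rule L2_Cauchy_Schwarz(1)) (use gn in auto)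
    have i2: "integrable mu (\<lambda>u. g u * cnj (kern w u))" by (rule L2_Cauchy_Schwarz(1)) (use gn kern_nsq_finite in auto)
    have i3: "integrable mu (\<lambda>u. kern w u * cnj (g u))" by (rule L2_Cauchy_Schwarz(1)) (use gn kern_nsq_finite in auto)
    have i4: "integrable mu (\<lambda>u. kern w u * cnj (kern w u))" by (rule L2_Cauchy_Schwarz(1)) (use kern_nsq_finite in auto)
    have he: "h u * cnj (h u) = (g u * cnj (g u) - g u * cnj (kern w u)) - (kern w u * cnj (g u) - kern w u * cnj (kern w u))" for u
      by (simp add: h_def algebra_simps)
    have ih: "integrable mu (\<lambda>u. h u * cnj (h u))"
      unfolding he using i1 i2 i3 i4 by (intro Bochner_Integration.integrable_diff)
    have "(\<integral>u. h u * cnj (h u) \<partial>mu) = ((\<integral>u. g u * cnj (g u) \<partial>mu) - (\<integral>u. g u * cnj (kern w u) \<partial>mu))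
        - ((\<integral>u. kern w u * cnj (g u) \<partial>mu) - (\<integral>u. kern w u * cnj (kern w u) \<partial>mu))"
      unfolding he using i1 i2 i3 i4 by (simp add: Bochner_Integration.integral_diff Bochner_Integration.integrable_diff)
    also have "\<dots> = 0"
    proof -
      have "(\<integral>u. g u * cnj (g u) \<partial>mu) = g w" "(\<integral>u. kern w u * cnj (g u) \<partial>mu) = kern w w"
        using g kern_in_fock[of w] by auto
      moreover have "(\<integral>u. g u * cnj (kern w u) \<partial>mu) = g w" "(\<integral>u. kern w u * cnj (kern w u) \<partial>mu) = kern w w"
        using g fock_reproducing[of g w] fock_reproducing[OF kern_in_fock, of w w] by auto
      ultimately show ?thesis by simp
    qed
    finally have z: "(\<integral>u. h u * cnj (h u) \<partial>mu) = 0" .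
    have n: "h u * cnj (h u) = of_real ((norm (h u))\<^sup>2)" for u
      by (rule complex_norm_square[symmetric])
    have i5: "integrable mu (\<lambda>u. (norm (h u))\<^sup>2)"
      using ih unfolding n by (simp only: complex_of_real_integrable_eq)
    have "(\<integral>u. (norm (h u))\<^sup>2 \<partial>mu) = 0"
      using z unfolding n integral_complex_of_real by simp
    then have "nsq mu h = 0"
      unfolding nsq_def using nn_integral_eq_integral[OF i5] by simp
    then have "ennreal ((norm (h u))\<^sup>2) \<le> 0" for u
      using point_evaluation[OF h, of u] by simp
    then have "h u = 0" for u by simp
    then show "g = kern w" by (auto simp: h_def)
  qed
  then show ?thesis by (simp add: fock_kernel_def)
qed

lemma kern_Cauchy_Schwarz: "(norm (kern w z))\<^sup>2 \<le> FF ((norm w)\<^sup>2) * FF ((norm z)\<^sup>2)"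
proof -
  have "ennreal ((norm (kern w z))\<^sup>2) \<le> nsq mu (kern w) * nsq mu (kern z)"
    unfolding fock_reproducing[OF kern_in_fock, of w z]
    by (rule L2_Cauchy_Schwarz(2)) (use kern_nsq_finite in auto)
  also have "\<dots> \<le> ennreal (FF ((norm w)\<^sup>2)) * ennreal (FF ((norm z)\<^sup>2))"
    by (intro mult_mono kern_nsq) auto
  also have "\<dots> = ennreal (FF ((norm w)\<^sup>2) * FF ((norm z)\<^sup>2))"
    using FF_pos by (simp add: ennreal_mult less_imp_le)
  finally show ?thesis using FF_pos by (subst (asm) ennreal_le_iff) (auto simp: less_imp_le)
qed

end

section \<open>Size of the kernel on the diagonal and the degree distribution\<close>

text \<open>An interval of length L holds at least L - 1 integers, and L - 1 \<ge> L/2 once L \<ge>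
  2. The lower end lies to the right of n, so every such integer is n + k for a natural number
  k.\<close>

lemma card_nat_window:
  fixes A B :: real
  assumes "B - A \<ge> 2" "A \<ge> real n"
  shows "finite {k::nat. A \<le> real (n + k) \<and> real (n + k) \<le> B}"
    and "real (card {k::nat. A \<le> real (n + k) \<and> real (n + k) \<le> B}) \<ge> (B - A) / 2"
proof -
  let ?K = "{k::nat. A \<le> real (n + k) \<and> real (n + k) \<le> B}"
  have "k \<le> nat \<lceil>B\<rceil>" if "k \<in> ?K" for k
  proof -
    have "real k \<le> B" using that by auto
    then show ?thesis by linarith
  qed
  then have "?K \<subseteq> {..nat \<lceil>B\<rceil>}" by auto
  then show fin: "finite ?K" by (rule finite_subset) simp
  define a where "a = nat (\<lceil>A\<rceil> - int n)"
  define b where "b = nat (\<lfloor>B\<rfloor> - int n)"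
  have a: "real a = of_int \<lceil>A\<rceil> - real n" using assms(2) by (simp add: a_def) linarith
  have b: "real b = of_int \<lfloor>B\<rfloor> - real n" using assms by (simp add: b_def) linarith
  have "{a..b} \<subseteq> ?K"
  proof
    fix k assume "k \<in> {a..b}"
    then have "real a \<le> real k" "real k \<le> real b" by auto
    then show "k \<in> ?K" using a b by (auto; linarith)
  qed
  then have "card {a..b} \<le> card ?K" by (rule card_mono[OF fin])
  then have "real (b + 1 - a) \<le> real (card ?K)" by simp
  moreover have "real (b + 1 - a) \<ge> real b + 1 - real a" by linarith
  moreover have "B < of_int \<lfloor>B\<rfloor> + 1" "of_int \<lceil>A\<rceil> < A + 1" by linarith+
  then have "real b + 1 - real a \<ge> (B - A) / 2" unfolding a b using assms by (simp add: field_simps)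
  ultimately show "real (card ?K) \<ge> (B - A) / 2" by linarith
qed

lemma exp_minus_quadratic: "0 \<le> t \<Longrightarrow> exp (- t) \<le> 1 - t + t\<^sup>2" for t :: real
proof -
  assume t: "0 \<le> t"
  have "1 + t \<le> exp t" by simp
  then have "exp (- t) \<le> 1 / (1 + t)" using t by (simp add: exp_minus field_simps)
  also have "\<dots> \<le> 1 - t + t\<^sup>2" using t by (simp add: field_simps power2_eq_square power3_eq_cube)
  finally show ?thesis .
qed

lemma square_le_exp: "s\<^sup>2 \<le> 2 * (exp s + exp (- s))" for s :: real
proof -
  have "s\<^sup>2 \<le> 2 * exp s" if "s \<ge> 0" for s :: real
    using exp_lower_Taylor_quadratic[OF that] that by simp
  from this[of s] this[of "- s"] show ?thesis
    by (cases "s \<ge> 0") (auto simp: add_increasing2 add_increasing)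
qed

lemma fact_add_ge: "fact (m + k) \<ge> (real k + 1) ^ m * fact k"
proof (induction m)
  case (Suc m)
  have "(real k + 1) ^ Suc m * fact k = (real k + 1) * ((real k + 1) ^ m * fact k)" by simp
  also have "\<dots> \<le> (real (Suc (m + k))) * fact (m + k)"
    by (rule mult_mono[OF _ Suc]) auto
  finally show ?case by simp
qed simp

section \<open>The degree window and its scale\<close>

context fock_growth
begin

text \<open>The scale of the standard deviation of the degrees. In the variable ln x the matching
  step is 1/WW: it moves x by about \<open>hh x\<close>, by \<open>WW_hh\<close>.\<close>

definition WW :: "real \<Rightarrow> real" where "WW x = sqrt ((1 + x) * Q x)"

lemma WW_pos: "x \<ge> 0 \<Longrightarrow> WW x > 0"
  using Q_pos[of x] by (simp add: WW_def)

lemma WW_squared: "x \<ge> 0 \<Longrightarrow> (WW x)\<^sup>2 = (1 + x) * Q x"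
  using Q_pos[of x] by (simp add: WW_def)

lemma WW_hh: "x \<ge> 0 \<Longrightarrow> (1 + x) / WW x = hh x" "x \<ge> 0 \<Longrightarrow> Q x / WW x = WW x / (1 + x)"
proof -
  assume x: "x \<ge> 0"
  have q: "sqrt (1 + x) * sqrt (1 + x) = 1 + x" "sqrt (Q x) * sqrt (Q x) = Q x" "sqrt (1 + x) > 0" "sqrt (Q x) > 0"
    using x Q_pos[OF x] by auto
  show "(1 + x) / WW x = hh x"
    unfolding WW_def hh_eq real_sqrt_mult using q by (simp add: field_simps)
  show "Q x / WW x = WW x / (1 + x)"
    using WW_squared[OF x] WW_pos[OF x] x by (simp add: field_simps power2_eq_square)
qed

lemma WW_ge: "x \<ge> 0 \<Longrightarrow> WW x \<ge> sqrt (P 0)"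
  unfolding WW_def using Q_ge[of x] P0 by (intro real_sqrt_le_mono) (smt (verit) mult_le_cancel_right1)

lemma WW_ge_x: "x \<ge> 0 \<Longrightarrow> WW x \<ge> sqrt (P 0 * x)"
  unfolding WW_def using Q_ge[of x] P0 by (intro real_sqrt_le_mono) (smt (verit) mult.commute mult_mono)

text \<open>The standard deviation is at most of the order of the centre, so a narrow window
  contains only degrees comparable to \<Phi>(x). This is where \<open>Q_le_P\<close> matters
  globally.\<close>

lemma WW_le_Phi: "x \<ge> 1 \<Longrightarrow> WW x \<le> 2 * sqrt C2 * \<Phi> x"
proof -
  assume x: "x \<ge> 1"
  have "(WW x)\<^sup>2 \<le> (1 + x) * (C2 * ((1 + x) * (P x)\<^sup>2))"
    using x Q_le_P[of x] by (simp add: WW_squared mult_left_mono)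
  also have "\<dots> = C2 * ((1 + x) * P x)\<^sup>2" by (simp add: power2_eq_square)
  also have "\<dots> \<le> C2 * ((2 * x) * P x)\<^sup>2"
    using x C2_pos P_pos[of x] by (intro mult_left_mono power_mono mult_right_mono) auto
  also have "\<dots> = (2 * sqrt C2 * \<Phi> x)\<^sup>2" using C2_pos by (simp add: \<Phi>_def power_mult_distrib)
  finally show ?thesis
    by (rule power2_le_imp_le) (use x C2_pos Phi_nonneg[of x] in auto)
qed

text \<open>Bounded by \<open>sqrt (P 0)\<close> to keep the step t = dd/WW below 1, and by
  \<open>e0 / 2\<close> to keep x e^t and x e^(-t) in the window where the weight is
  controlled.\<close>

definition dd :: real where "dd = min 1 (min (sqrt (P 0)) (e0 / 2))"

lemma dd: "dd > 0" "dd \<le> 1" "dd \<le> sqrt (P 0)" "dd \<le> e0 / 2"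
  using P0 e0_pos by (auto simp: dd_def)

text \<open>The last claim bounds the second-order error that arises when x e^t - x is replaced by x
  t in the tangent of \<Psi>.\<close>

lemma dd_step:
  assumes x: "x \<ge> 0" and t: "t = dd / WW x"
  shows "0 < t" "t \<le> 1" "\<bar>x * exp t - x\<bar> \<le> e0 * hh x" "\<bar>x * exp (- t) - x\<bar> \<le> e0 * hh x"
    "x * t \<le> dd * hh x" "\<Phi> x * t\<^sup>2 \<le> 1"
proof -
  show t0: "0 < t" using dd(1) WW_pos[OF x] by (simp add: t)
  have "dd \<le> WW x" using dd(3) WW_ge[OF x] by simp
  then show t1: "t \<le> 1" using WW_pos[OF x] by (simp add: t)
  have "x * t \<le> (1 + x) * t" using t0 by simp
  also have "\<dots> = dd * ((1 + x) / WW x)" by (simp add: t)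
  finally show xt: "x * t \<le> dd * hh x" by (simp add: WW_hh[OF x])
  have "exp t \<le> 1 + t + t\<^sup>2" using exp_bound[of t] t0 t1 by simp
  then have "exp t - 1 \<le> 2 * t" using t0 t1 by (simp add: power2_eq_square) (smt (verit) mult_left_le)
  then have "x * (exp t - 1) \<le> x * (2 * t)" using x by (rule mult_left_mono)
  also have "\<dots> \<le> 2 * (dd * hh x)" using xt by simp
  also have "\<dots> \<le> e0 * hh x" using dd(4) hh_pos[OF x] by (simp add: mult_right_mono)
  finally have *: "x * (exp t - 1) \<le> e0 * hh x" .
  have "\<bar>x * exp t - x\<bar> = x * (exp t - 1)" using t0 mult_left_mono[of 1 "exp t" x] x by (simp add: algebra_simps)
  with * show "\<bar>x * exp t - x\<bar> \<le> e0 * hh x" by simp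
  have "1 - exp (- t) \<le> t" using exp_ge_add_one_self[of "- t"] by simp
  then have "x * (1 - exp (- t)) \<le> x * t" using x by (rule mult_left_mono)
  also have "\<dots> \<le> dd * hh x" by (rule xt)
  also have "\<dots> \<le> e0 * hh x" using dd(1,4) hh_pos[OF x] by (intro mult_right_mono) auto
  finally have **: "x * (1 - exp (- t)) \<le> e0 * hh x" .
  have "\<bar>x * exp (- t) - x\<bar> = x * (1 - exp (- t))" using t0 mult_left_mono[of "exp (- t)" 1 x] x by (simp add: algebra_simps)
  with ** show "\<bar>x * exp (- t) - x\<bar> \<le> e0 * hh x" by simp
  have "\<Phi> x * t\<^sup>2 = dd\<^sup>2 * (x * P x / ((1 + x) * Q x))"
    using WW_squared[OF x] by (simp add: t power_divide \<Phi>_def)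
  also have "\<dots> \<le> 1 * 1"
  proof (rule mult_mono)
    show "dd\<^sup>2 \<le> 1" using dd by (simp add: power_le_one)
    have "x * P x \<le> (1 + x) * Q x" using x Q_ge_P[OF x] P_pos[OF x] by (intro mult_mono) auto
    then show "x * P x / ((1 + x) * Q x) \<le> 1" using x Q_pos[OF x] by (simp add: divide_le_eq)
  qed (use x P_pos[OF x] Q_pos[OF x] in auto)
  finally show "\<Phi> x * t\<^sup>2 \<le> 1" by simp
qed

lemma Phi_mono: "0 \<le> x \<Longrightarrow> x \<le> y \<Longrightarrow> \<Phi> x \<le> \<Phi> y"
  using Phi_diff_ge[of x y] mult_nonneg_nonneg[of "y - x" "Q x"] Q_pos[of x] by linarith

text \<open>In the variable \<open>t = ln y\<close> the exponent \<open>N t - \<Psi> (exp t)\<close> is concave with derivative \<open>N - \<Phi> (exp t)\<close>.\<close>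
lemma mom_upper:
  assumes x: "x \<ge> 1" and N: "\<bar>real N - \<Phi> x\<bar> \<le> dd * WW x / 32"
  shows "mom g0 N \<le> 64 * exp 1 / (dd * WW x) * (x ^ N * exp (- \<Psi> x))"
proof -
  have x0: "x \<ge> 0" "x > 0" using x by auto
  define t where "t = dd / WW x"
  note st = dd_step[OF x0(1) t_def]
  have tW: "t * WW x = dd" using WW_pos[OF x0(1)] by (simp add: t_def)
  define s0 where "s0 = ln x"
  have es0: "exp s0 = x" using x0 by (simp add: s0_def)
  define H where "H s = real N * s - \<Psi> (exp s)" for s
  have H': "(H has_real_derivative (real N - \<Phi> (exp s))) (at s)" for s
  proof -
    have "(\<Psi> has_real_derivative P (exp s)) (at (exp s) within {0<..})"
      by (rule DERIV_subset[OF Psi_deriv]) auto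
    then have "(\<Psi> has_real_derivative P (exp s)) (at (exp s))"
      by (simp only: at_within_open[of "exp s" "{0<..}"] open_greaterThan greaterThan_iff exp_gt_zero)
    then have "((\<lambda>s. \<Psi> (exp s)) has_real_derivative P (exp s) * exp s) (at s)"
      by (rule DERIV_chain2) (auto intro!: derivative_eq_intros)
    then show ?thesis unfolding H_def by (auto intro!: derivative_eq_intros simp: \<Phi>_def)
  qed
  have mv: "H b - H a \<le> (real N - \<Phi> (exp a)) * (b - a)" if ab: "a \<le> b" for a b
  proof (cases "a = b")
    case False
    then obtain c where c: "a < c" "c < b" "H b - H a = (b - a) * (real N - \<Phi> (exp c))"
      using MVT2[OF _ H', of a b] ab by force
    have "\<Phi> (exp a) \<le> \<Phi> (exp c)" using c by (intro Phi_mono) auto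
    then have "(b - a) * (real N - \<Phi> (exp c)) \<le> (b - a) * (real N - \<Phi> (exp a))" using that by (intro mult_left_mono) auto
    then show ?thesis using c by (simp add: mult.commute)
  qed simp
  have mv2: "H a - H b \<le> - (real N - \<Phi> (exp b)) * (b - a)" if ab: "a \<le> b" for a b
  proof (cases "a = b")
    case False
    then obtain c where c: "a < c" "c < b" "H b - H a = (b - a) * (real N - \<Phi> (exp c))"
      using MVT2[OF _ H', of a b] ab by force
    have "\<Phi> (exp c) \<le> \<Phi> (exp b)" using c by (intro Phi_mono) auto
    then have "(b - a) * (real N - \<Phi> (exp b)) \<le> (b - a) * (real N - \<Phi> (exp c))" using that by (intro mult_left_mono) auto
    then show ?thesis using c(3) by (simp add: algebra_simps)
  qed simp
  \<comment> \<open>The order of the growth of \<Phi> over one step t in ln x; x \<ge> 1 lets x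
    replace 1 + x.\<close>
  have xQ: "x * Q x * t \<ge> dd * WW x / 2"
  proof -
    have "(WW x)\<^sup>2 \<le> 2 * (x * Q x)" using x Q_pos[of x] by (simp add: WW_squared algebra_simps)
    then have "(WW x)\<^sup>2 * t \<le> 2 * (x * Q x) * t" using st(1) by (intro mult_right_mono) auto
    moreover have "(WW x)\<^sup>2 * t = dd * WW x" using tW by (simp add: power2_eq_square mult.commute mult.left_commute)
    ultimately show ?thesis by simp
  qed
  have Na: "real N - \<Phi> x \<le> dd * WW x / 32" and Nb: "\<Phi> x - real N \<le> dd * WW x / 32"
    using N by linarith+
  have dW: "dd * WW x > 0" using dd(1) WW_pos[OF x0(1)] by simp
  have up: "real N - \<Phi> (exp (s0 + t)) \<le> - (dd * WW x / 32)"
  proof -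
    have "t \<le> exp t - 1" using exp_ge_add_one_self[of t] by linarith
    then have "x * Q x * t \<le> x * Q x * (exp t - 1)"
      using x0 Q_pos[of x] by (intro mult_left_mono) auto
    also have "\<dots> = (x * exp t - x) * Q x" by (simp add: algebra_simps)
    also have "\<dots> \<le> \<Phi> (x * exp t) - \<Phi> x" by (rule Phi_diff_ge) (use x0 st in auto)
    finally have "\<Phi> (x * exp t) \<ge> \<Phi> x + dd * WW x / 2" using xQ by simp
    moreover have "exp (s0 + t) = x * exp t" by (simp add: exp_add es0)
    ultimately show ?thesis using Na dW by simp
  qed
  have down: "real N - \<Phi> (exp (s0 - t)) \<ge> dd * WW x / 32"
  proof -
    have e: "1 - exp (- t) \<ge> t / 2"
    proof -
      have "1 + t \<le> exp t" by simp
      then have "exp (- t) \<le> 1 / (1 + t)" using st by (simp add: exp_minus field_simps)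
      also have "\<dots> \<le> 1 - t / 2" using st by (simp add: field_simps power2_eq_square)
      finally show ?thesis by simp
    qed
    \<comment> \<open>\<open>Phi_diff_ge\<close> measures the increase by Q at the left endpoint, so
      going down costs this factor 4.\<close>
    have Q4: "Q x \<le> 4 * Q (x * exp (- t))" by (rule Q_near(2)) (use x0 st in auto)
    have "dd * WW x / 16 \<le> x * Q x * t / 8" using xQ by linarith
    also have "\<dots> = x * (t / 2) * (Q x / 4)" by simp
    also have "\<dots> \<le> x * (1 - exp (- t)) * Q (x * exp (- t))"
      using e Q4 x0 st Q_pos[of x] by (intro mult_mono mult_left_mono) auto
    also have "\<dots> = (x - x * exp (- t)) * Q (x * exp (- t))" by (simp add: algebra_simps)
    also have "\<dots> \<le> \<Phi> x - \<Phi> (x * exp (- t))" by (rule Phi_diff_ge) (use x0 st in auto)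
    finally have "\<Phi> (x * exp (- t)) \<le> \<Phi> x - dd * WW x / 16" by simp
    moreover have "exp (s0 - t) = x * exp (- t)" by (simp add: exp_diff exp_minus es0 field_simps)
    ultimately show ?thesis using Nb dW by simp
  qed
  \<comment> \<open>\<Phi> changes by at least 2 cc over one step t to either side, while N is
    within cc of \<Phi>(x). Hence H has slope at most -cc at s0 + t and at least cc at s0 -
    t.\<close>
  define cc where "cc = dd * WW x / 32"
  note Na = Na[folded cc_def] and Nb = Nb[folded cc_def] and up = up[folded cc_def] and down = down[folded cc_def]
  have c0: "cc > 0" using dW by (simp add: cc_def)
  have ct: "cc * t \<le> 1 / 32"
  proof -
    have "cc * t = dd * (t * WW x) / 32" by (simp add: cc_def)
    also have "\<dots> = dd * dd / 32" by (simp add: tW)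
    also have "\<dots> \<le> 1 / 32" using dd(1,2) by (simp add: mult_le_one)
    finally show ?thesis .
  qed
  \<comment> \<open>By concavity H rises by at most cc * t \<le> 1/32 within distance t of s0 and
    falls at rate at least cc beyond it. The constant 1 absorbs these small amounts and leaves a
    tent function to integrate.\<close>
  have bound: "H s - H s0 \<le> 1 - cc * \<bar>s - s0\<bar>" for s
  proof (cases "s \<ge> s0")
    case True
    have N': "real N - \<Phi> (exp s0) \<le> cc" using Na by (simp add: es0)
    show ?thesis
    proof (cases "s \<le> s0 + t")
      case le: True
      have "H s - H s0 \<le> (real N - \<Phi> (exp s0)) * (s - s0)" by (rule mv[OF True])
      also have "\<dots> \<le> cc * (s - s0)" using N' True by (intro mult_right_mono) auto
      also have "\<dots> \<le> 1 - cc * (s - s0)"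
      proof -
        have "cc * (s - s0) \<le> cc * t" using le c0 by (intro mult_left_mono) auto
        then show ?thesis using ct by linarith
      qed
      finally show ?thesis using True by simp
    next
      case False
      have "H (s0 + t) - H s0 \<le> (real N - \<Phi> (exp s0)) * (s0 + t - s0)" by (rule mv) (use st in simp)
      also have "\<dots> \<le> cc * t" using N' st(1) by (simp add: mult_right_mono)
      finally have 1: "H (s0 + t) - H s0 \<le> 1 / 32" using ct by linarith
      have "H s - H (s0 + t) \<le> (real N - \<Phi> (exp (s0 + t))) * (s - (s0 + t))" by (rule mv) (use False in simp)
      also have "\<dots> \<le> - cc * (s - (s0 + t))" using up False by (intro mult_right_mono) auto
      also have "\<dots> = - (cc * (s - s0)) + cc * t" by (simp add: algebra_simps)
      finally have "H s - H s0 \<le> 1 - cc * (s - s0)" using 1 ct by linarith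
      then show ?thesis using True by simp
    qed
  next
    case ns: False
    have N': "- (real N - \<Phi> (exp s0)) \<le> cc" using Nb by (simp add: es0)
    have "H s - H s0 \<le> 1 - cc * (s0 - s)"
    proof (cases "s \<ge> s0 - t")
      case le: True
      have "H s - H s0 \<le> - (real N - \<Phi> (exp s0)) * (s0 - s)" by (rule mv2) (use ns in simp)
      also have "\<dots> \<le> cc * (s0 - s)" using N' ns by (intro mult_right_mono) auto
      also have "\<dots> \<le> 1 - cc * (s0 - s)"
      proof -
        have "cc * (s0 - s) \<le> cc * t" using le c0 by (intro mult_left_mono) auto
        then show ?thesis using ct by linarith
      qed
      finally show ?thesis .
    next
      case False
      have "H (s0 - t) - H s0 \<le> - (real N - \<Phi> (exp s0)) * (s0 - (s0 - t))" by (rule mv2) (use st in simp)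
      also have "\<dots> = - (real N - \<Phi> (exp s0)) * t" by simp
      also have "\<dots> \<le> cc * t" using N' st(1) by (intro mult_right_mono) auto
      finally have 1: "H (s0 - t) - H s0 \<le> 1 / 32" using ct by linarith
      have "H s - H (s0 - t) \<le> - (real N - \<Phi> (exp (s0 - t))) * ((s0 - t) - s)" by (rule mv2) (use False in simp)
      also have "\<dots> \<le> - cc * ((s0 - t) - s)" using down False by (intro mult_right_mono) auto
      also have "\<dots> = - (cc * (s0 - s)) + cc * t" by (simp add: algebra_simps)
      finally show ?thesis using 1 ct by linarith
    qed
    then show ?thesis using ns by simp
  qed
  \<comment> \<open>The slope at s0 - t is positive, so N exceeds a value of \<Phi>; integrability
    of the moment requires N to be nonzero.\<close>
  have N1: "N \<ge> 1"
  proof (rule ccontr)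
    assume "\<not> N \<ge> 1"
    then have "N = 0" by simp
    with down Phi_nonneg[of "exp (s0 - t)"] c0 show False by simp
  qed
  have eH: "exp (s * real N) * g0 (exp s) = exp (H s)" for s
    by (simp add: H_def g0_def exp_diff exp_minus field_simps)
  have "ennreal (mom g0 N) = (\<integral>\<^sup>+s. ennreal (exp (s * real N) * g0 (exp s)) \<partial>lborel)"
    unfolding mom_def by (rule nn_integral_eq_integral[symmetric]) (auto simp: g0_mom_integrable[OF N1] g0_pos less_imp_le)
  also have "\<dots> \<le> (\<integral>\<^sup>+s. ennreal (exp (H s0 + 1)) * ennreal (exp (- (cc * \<bar>s - s0\<bar>))) \<partial>lborel)"
  proof (rule nn_integral_mono)
    fix s
    have "exp (H s) \<le> exp (H s0 + 1) * exp (- (cc * \<bar>s - s0\<bar>))"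
      unfolding exp_add[symmetric] using bound[of s] by simp
    then show "ennreal (exp (s * real N) * g0 (exp s)) \<le> ennreal (exp (H s0 + 1)) * ennreal (exp (- (cc * \<bar>s - s0\<bar>)))"
      unfolding eH by (simp flip: ennreal_mult)
  qed
  also have "\<dots> = ennreal (exp (H s0 + 1)) * (\<integral>\<^sup>+s. ennreal (exp (- (cc * \<bar>s - s0\<bar>))) \<partial>lborel)"
    by (rule nn_integral_cmult) simp
  also have "(\<integral>\<^sup>+s. ennreal (exp (- (cc * \<bar>s - s0\<bar>))) \<partial>lborel) = (\<integral>\<^sup>+s. ennreal (exp (- (cc * \<bar>s\<bar>))) \<partial>lborel)"
    using nn_integral_real_affine[of "\<lambda>s. ennreal (exp (- (cc * \<bar>s\<bar>)))" 1 "- s0"] by simp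
  also have "ennreal (exp (H s0 + 1)) * \<dots> \<le> ennreal (exp (H s0 + 1)) * ennreal (2 / cc)"
    by (intro mult_left_mono nn_integral_exp_abs_le c0) simp
  also have "\<dots> = ennreal (exp (H s0 + 1) * (2 / cc))" using c0 by (subst ennreal_mult) auto
  finally have "mom g0 N \<le> exp (H s0 + 1) * (2 / cc)"
    using c0 by (subst (asm) ennreal_le_iff) auto
  also have "exp (H s0 + 1) = exp 1 * (x ^ N * exp (- \<Psi> x))"
  proof -
    have "exp (real N * s0) = x ^ N" by (simp add: exp_of_nat_mult es0)
    then show ?thesis by (simp add: H_def es0 exp_add exp_diff exp_minus field_simps)
  qed
  finally show ?thesis by (simp add: cc_def field_simps)
qed

text \<open>Small enough for \<open>mom_upper\<close> to apply on the whole window and for its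
  degrees to stay above \<Phi>(x)/2.\<close>

definition c1 :: real where "c1 = min (dd / 32) (1 / (4 * sqrt C2))"

lemma c1: "c1 > 0" "c1 \<le> dd / 32" "x \<ge> 1 \<Longrightarrow> c1 * WW x \<le> \<Phi> x / 2"
proof -
  show "c1 > 0" "c1 \<le> dd / 32" using dd(1) C2_pos by (auto simp: c1_def)
  assume x: "x \<ge> 1"
  have "c1 * WW x \<le> 1 / (4 * sqrt C2) * (2 * sqrt C2 * \<Phi> x)"
    using WW_le_Phi[OF x] WW_pos[of x] x C2_pos by (intro mult_mono) (auto simp: c1_def)
  also have "\<dots> = \<Phi> x / 2" using C2_pos by simp
  finally show "c1 * WW x \<le> \<Phi> x / 2" .
qed

definition ccoef :: real
  where "ccoef = gmom 1 * dd / (gmass TYPE('n) * (64 * exp 1) * (2 * real CARD('n)) ^ (CARD('n) - 1))"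

lemma ccoef_pos: "ccoef > 0"
  unfolding ccoef_def using gmom_pos[of 1] dd(1) gmass_pos[where 'n='n] by simp

text \<open>An upper bound for a moment is a lower bound for a coefficient. The quotient
  \<open>gmom (n + k) / fact k\<close> grows like (k + 1)^(n - 1), which is of order (x P)^(n - 1)
  in the window; the powers of x cancel against those of the moment bound and P^(n - 1) Q / WW
  remains.\<close>

lemma coeff_lower:
  assumes x: "x \<ge> 1" and k: "\<bar>real (CARD('n) + k) - \<Phi> x\<bar> \<le> c1 * WW x"
  shows "ck k * x ^ k \<ge> ccoef * (VV x / WW x) * exp (\<Psi> x)"
proof -
  let ?n = "CARD('n)"
  let ?N = "?n + k"
  have x0: "x \<ge> 0" "x > 0" using x by auto
  have W: "WW x > 0" by (rule WW_pos[OF x0(1)])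
  have n1: "?n \<ge> 1" by (simp add: Suc_leI)
  have "c1 * WW x \<le> dd * WW x / 32" using mult_right_mono[OF c1(2), of "WW x"] W by simp
  then have m: "mom g0 ?N \<le> 64 * exp 1 / (dd * WW x) * (x ^ ?N * exp (- \<Psi> x))"
    by (intro mom_upper[OF x]) (use k in linarith)
  have mp: "mom g0 ?N > 0" by (rule mom_g0_pos) (use n1 in linarith)
  have N2: "real ?N \<ge> \<Phi> x / 2" using k c1(3)[OF x] by linarith
  have g1: "gmom ?N = fact (?n - 1 + k) * gmom 1" using gmom_eq[of "?n - 1 + k"] n1 by simp
  have g2: "(\<Phi> x / (2 * real ?n)) ^ (?n - 1) \<le> (real k + 1) ^ (?n - 1)"
  proof (rule power_mono)
    have "real k * 1 \<le> real k * real ?n" using n1 by (intro mult_left_mono) auto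
    then have "real ?n * (real k + 1) \<ge> real k + real ?n" by (simp add: algebra_simps)
    then have "real ?n * (real k + 1) \<ge> \<Phi> x / 2" using N2 by simp
    then show "\<Phi> x / (2 * real ?n) \<le> real k + 1" using n1 by (simp add: field_simps)
    show "0 \<le> \<Phi> x / (2 * real ?n)" using Phi_nonneg[OF x0(1)] by simp
  qed
  have "(\<Phi> x / (2 * real ?n)) ^ (?n - 1) * fact k * gmom 1 \<le> (real k + 1) ^ (?n - 1) * fact k * gmom 1"
    using gmom_pos[of 1] by (intro mult_right_mono g2) auto
  also have "\<dots> \<le> fact (?n - 1 + k) * gmom 1"
    using gmom_pos[of 1] by (intro mult_right_mono fact_add_ge) auto
  finally have g: "gmom ?N \<ge> (\<Phi> x / (2 * real ?n)) ^ (?n - 1) * fact k * gmom 1"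
    by (simp add: g1)
  have "ccoef * (VV x / WW x) * exp (\<Psi> x)
      = ccoef * P x ^ (?n - 1) * (Q x / WW x) * exp (\<Psi> x)" by (simp add: VV_def)
  also have "\<dots> = ccoef * P x ^ (?n - 1) * (WW x / (1 + x)) * exp (\<Psi> x)" by (simp add: WW_hh(2)[OF x0(1)])
  also have "\<dots> \<le> ccoef * P x ^ (?n - 1) * (WW x / x) * exp (\<Psi> x)"
    using ccoef_pos P_pos[OF x0(1)] W x0 by (intro mult_right_mono mult_left_mono divide_left_mono) auto
  also have "\<dots> = ((\<Phi> x / (2 * real ?n)) ^ (?n - 1) * fact k * gmom 1) * x ^ k
      / (fact k * gmass TYPE('n) * (64 * exp 1 / (dd * WW x) * (x ^ ?N * exp (- \<Psi> x))))"
  proof -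
    have xn: "x ^ ?N = x ^ k * (x * x ^ (?n - 1))" using n1 by (simp add: power_add flip: power_Suc)
    show ?thesis
      unfolding xn ccoef_def \<Phi>_def power_divide power_mult_distrib
      using x0 W dd(1) gmass_pos[where 'n='n] n1 by (simp add: field_simps exp_minus)
  qed
  also have "\<dots> \<le> gmom ?N * x ^ k / (fact k * gmass TYPE('n) * mom g0 ?N)"
    using g m mp gmass_pos[where 'n='n] x0 gmom_pos[of 1] Phi_nonneg[OF x0(1)] gmom_pos[of ?N] n1
    by (intro frac_le mult_right_mono mult_left_mono) auto
  also have "\<dots> = ck k * x ^ k" by (simp add: ck_def)
  finally show ?thesis .
qed

text \<open>Beyond X the half windows have length at least 2 and begin at or after n, as the
  counting of degrees requires.\<close>

lemma large_x:
  obtains X where "X \<ge> 1" "\<And>x. x \<ge> X \<Longrightarrow> c1 * WW x \<ge> 4" "\<And>x. x \<ge> X \<Longrightarrow> \<Phi> x - c1 * WW x \<ge> real CARD('n)"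
proof
  let ?X = "max 1 (max ((4 / c1)\<^sup>2 / P 0) (2 * real CARD('n) / P 0))"
  show "?X \<ge> 1" by simp
  fix x assume x: "x \<ge> ?X"
  then have x1: "x \<ge> 1" "(4 / c1)\<^sup>2 / P 0 \<le> x" "2 * real CARD('n) / P 0 \<le> x" by auto
  have "(4 / c1)\<^sup>2 \<le> P 0 * x" using mult_right_mono[OF x1(2), of "P 0"] P0 by (simp add: mult.commute)
  then have "4 / c1 \<le> sqrt (P 0 * x)" by (rule real_le_rsqrt)
  also have "\<dots> \<le> WW x" using x1 by (intro WW_ge_x) auto
  finally show "c1 * WW x \<ge> 4" using c1(1) by (simp add: field_simps)
  have "2 * real CARD('n) \<le> P 0 * x" using x1(3) P0 by (simp add: field_simps)
  also have "\<dots> \<le> \<Phi> x" unfolding \<Phi>_def using P_ge[of x] x1 by (simp add: mult.commute mult_left_mono)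
  finally show "\<Phi> x - c1 * WW x \<ge> real CARD('n)" using c1(3)[OF x1(1)] by linarith
qed

text \<open>A window of about \<open>W\<close> degrees on the side of \<open>\<Phi> x\<close> away from \<open>a\<close>; there the coefficients
  are large and the degrees are far from \<open>a\<close>.\<close>
lemma degree_window:
  assumes "x \<ge> 1" "c1 * WW x \<ge> 4" "\<Phi> x - c1 * WW x \<ge> real CARD('n)"
  obtains I where "finite I" "real (card I) \<ge> c1 * WW x / 4"
    "\<And>k. k \<in> I \<Longrightarrow> ck k * x ^ k \<ge> ccoef * (VV x / WW x) * exp (\<Psi> x)"
    "\<And>k. k \<in> I \<Longrightarrow> (real k - a)\<^sup>2 \<ge> (c1 * WW x / 2)\<^sup>2"
proof -
  let ?n = "CARD('n)"
  define w where "w = c1 * WW x"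
  \<comment> \<open>Degree k sits at n + k, so a is compared with \<Phi>(x) after a shift by n. The
    two choices are the outer halves of the window, each at distance w/2 from \<Phi>(x).\<close>
  define A where "A = (if a + real ?n \<le> \<Phi> x then \<Phi> x + w / 2 else \<Phi> x - w)"
  define I where "I = {k::nat. A \<le> real (?n + k) \<and> real (?n + k) \<le> A + w / 2}"
  have w: "w > 0" "w \<ge> 4" "\<Phi> x - w \<ge> real ?n" using assms by (auto simp: w_def)
  have A: "A + w / 2 - A \<ge> 2" "A \<ge> real ?n" using w by (auto simp: A_def)
  show ?thesis
  proof (rule that[of I], unfold w_def[symmetric])
    show "finite I" "real (card I) \<ge> w / 4" using card_nat_window[OF A] by (auto simp: I_def)
    fix k assume "k \<in> I"
    then have k: "A \<le> real (?n + k)" "real (?n + k) \<le> A + w / 2" by (auto simp: I_def)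
    have "\<bar>real (?n + k) - \<Phi> x\<bar> \<le> w"
    proof (cases "a + real ?n \<le> \<Phi> x")
      case True
      then have "A = \<Phi> x + w / 2" by (simp add: A_def)
      then show ?thesis using k w True unfolding of_nat_add by linarith
    next
      case False
      then have "A = \<Phi> x - w" by (simp add: A_def)
      then show ?thesis using k w False unfolding of_nat_add by linarith
    qed
    then show "ck k * x ^ k \<ge> ccoef * (VV x / WW x) * exp (\<Psi> x)"
      unfolding w_def by (rule coeff_lower[OF assms(1)])
    have "\<bar>real k - a\<bar> \<ge> w / 2"
    proof (cases "a + real ?n \<le> \<Phi> x")
      case True
      then have "A = \<Phi> x + w / 2" by (simp add: A_def)
      then show ?thesis using k w True unfolding of_nat_add by linarith
    next
      case False
      then have "A = \<Phi> x - w" by (simp add: A_def)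
      then show ?thesis using k w False unfolding of_nat_add by linarith
    qed
    then have "\<bar>real k - a\<bar>\<^sup>2 \<ge> (w / 2)\<^sup>2" using w by (intro power_mono) auto
    then show "(real k - a)\<^sup>2 \<ge> (w / 2)\<^sup>2" by simp
  qed
qed

section \<open>Mean and variance of the degrees\<close>

definition dF :: "real \<Rightarrow> real" where "dF x = (\<Sum>k. diffs ck k * x ^ k)"
definition ddF :: "real \<Rightarrow> real" where "ddF x = (\<Sum>k. diffs (diffs ck) k * x ^ k)"

lemma FF_deriv: "(FF has_real_derivative dF x) (at x)"
  unfolding FF_def[abs_def] dF_def by (rule termdiffs_strong_converges_everywhere) (rule ck_summable_real)

lemma diffs_summable: "summable (\<lambda>k. diffs ck k * (x::real) ^ k)"
  by (rule termdiff_converges_all) (rule ck_summable_real)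

lemma diffs_diffs_summable: "summable (\<lambda>k. diffs (diffs ck) k * (x::real) ^ k)"
  by (rule termdiff_converges_all) (rule diffs_summable)

lemma dF_deriv: "(dF has_real_derivative ddF x) (at x)"
  unfolding dF_def[abs_def] ddF_def by (rule termdiffs_strong_converges_everywhere) (rule diffs_summable)

lemma ddF_continuous: "isCont ddF x"
proof -
  have "(ddF has_real_derivative (\<Sum>k. diffs (diffs (diffs ck)) k * x ^ k)) (at x)"
    unfolding ddF_def[abs_def] by (rule termdiffs_strong_converges_everywhere) (rule diffs_diffs_summable)
  then show ?thesis by (rule DERIV_isCont)
qed

text \<open>Second moment about an arbitrary point a, from k^2 = k (k - 1) + k and termwise
  differentiation. Keeping a free serves both the mean and the explicit centre \<Phi>(x).\<close>

lemma degree_sums: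
  "(\<lambda>k. (real k - a)\<^sup>2 * (ck k * x ^ k)) sums (x\<^sup>2 * ddF x + x * dF x - 2 * a * (x * dF x) + a\<^sup>2 * FF x)"
proof -
  have s0: "(\<lambda>k. ck k * x ^ k) sums FF x" unfolding FF_def by (rule summable_sums[OF ck_summable_real])
  have "(\<lambda>k. real k * ck k * x ^ (k - Suc 0)) sums dF x"
    unfolding dF_def by (rule diffs_equiv[OF diffs_summable])
  from sums_mult[OF this, of x] have s1: "(\<lambda>k. real k * (ck k * x ^ k)) sums (x * dF x)"
  proof (rule sums_cong[THEN iffD1, rotated])
    show "x * (real k * ck k * x ^ (k - Suc 0)) = real k * (ck k * x ^ k)" for k
      by (cases k) auto
  qed
  have "(\<lambda>k. real k * diffs ck k * x ^ (k - Suc 0)) sums ddF x"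
    unfolding ddF_def by (rule diffs_equiv[OF diffs_diffs_summable])
  from sums_mult[OF this, of "x\<^sup>2"] have "(\<lambda>k. real k * (real (Suc k) * (ck (Suc k) * x ^ Suc k))) sums (x\<^sup>2 * ddF x)"
  proof (rule sums_cong[THEN iffD1, rotated])
    show "x\<^sup>2 * (real k * diffs ck k * x ^ (k - Suc 0)) = real k * (real (Suc k) * (ck (Suc k) * x ^ Suc k))" for k
      by (cases k) (auto simp: diffs_def power2_eq_square)
  qed
  then have "(\<lambda>k. (real (Suc k) - 1) * real (Suc k) * (ck (Suc k) * x ^ Suc k)) sums (x\<^sup>2 * ddF x)"
    by (simp add: mult.assoc)
  then have s2: "(\<lambda>k. (real k - 1) * real k * (ck k * x ^ k)) sums (x\<^sup>2 * ddF x)"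
    by (subst (asm) sums_Suc_iff) simp
  have "(\<lambda>k. (real k - 1) * real k * (ck k * x ^ k) + real k * (ck k * x ^ k) - 2 * a * (real k * (ck k * x ^ k)) + a\<^sup>2 * (ck k * x ^ k))
     sums (x\<^sup>2 * ddF x + x * dF x - 2 * a * (x * dF x) + a\<^sup>2 * FF x)"
    by (intro sums_add sums_diff sums_mult s0 s1 s2)
  then show ?thesis
    by (rule sums_cong[THEN iffD1, rotated]) (simp add: power2_eq_square algebra_simps)
qed

text \<open>
  These are \<open>(ln F)'\<close>, \<open>(ln F)''\<close> and \<open>(x (ln F)')'\<close>; \<open>x * L1 x\<close> and \<open>x * N1 x\<close> are the mean and the variance of
  the distribution of degrees \<open>ck k * x ^ k / FF x\<close>.
\<close>
definition L1 :: "real \<Rightarrow> real" where "L1 x = dF x / FF x"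
definition L2' :: "real \<Rightarrow> real" where "L2' x = ddF x / FF x - (dF x / FF x)\<^sup>2"
definition N1 :: "real \<Rightarrow> real" where "N1 x = L1 x + x * L2' x"

lemma variance_sums:
  assumes "x \<ge> 0"
  shows "(\<lambda>k. (real k - x * L1 x)\<^sup>2 * (ck k * x ^ k)) sums (x * N1 x * FF x)"
proof -
  have F: "FF x > 0" by (rule FF_pos[OF assms])
  have "x\<^sup>2 * ddF x + x * dF x - 2 * (x * L1 x) * (x * dF x) + (x * L1 x)\<^sup>2 * FF x = x * N1 x * FF x"
    using F by (simp add: N1_def L1_def L2'_def power2_eq_square field_simps)
  then show ?thesis using degree_sums[of "x * L1 x" x] by simp
qed

text \<open>The second moment is smallest about the mean; the excess is the squared distance of a
  from the mean, times F.\<close>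

lemma variance_le:
  assumes "x \<ge> 0"
  shows "x * N1 x * FF x \<le> x\<^sup>2 * ddF x + x * dF x - 2 * a * (x * dF x) + a\<^sup>2 * FF x"
proof -
  have F: "FF x > 0" by (rule FF_pos[OF assms])
  have "x\<^sup>2 * ddF x + x * dF x - 2 * a * (x * dF x) + a\<^sup>2 * FF x - x * N1 x * FF x = FF x * (a - x * L1 x)\<^sup>2"
    using F by (simp add: N1_def L1_def L2'_def power2_eq_square field_simps)
  also have "\<dots> \<ge> 0" using F by simp
  finally show ?thesis by simp
qed

lemma variance_ge:
  assumes "x \<ge> 0" "finite I"
  shows "(\<Sum>k\<in>I. (real k - x * L1 x)\<^sup>2 * (ck k * x ^ k)) \<le> x * N1 x * FF x"
proof -
  note s = variance_sums[OF assms(1)]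
  have "(\<Sum>k\<in>I. (real k - x * L1 x)\<^sup>2 * (ck k * x ^ k)) \<le> (\<Sum>k. (real k - x * L1 x)\<^sup>2 * (ck k * x ^ k))"
    by (rule sum_le_suminf) (use s assms ck_pos in \<open>auto simp: sums_iff less_imp_le\<close>)
  then show ?thesis using s by (simp add: sums_iff)
qed

text \<open>Degrees 0 and 1 both carry positive mass for x > 0, so the distribution is not
  concentrated at one point. At x = 0 the variance vanishes and \<open>N1 0\<close> is computed
  directly.\<close>

lemma N1_pos: assumes "x \<ge> 0" shows "N1 x > 0"
proof (cases "x = 0")
  case True
  have "(\<lambda>k. diffs ck k * 0 ^ k) sums (diffs ck 0)" by (rule powser_sums_zero)
  then have "dF 0 = ck 1" by (simp add: dF_def sums_iff diffs_def)
  then show ?thesis using True ck_pos[of 1] FF_pos[of 0] by (simp add: N1_def L1_def)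
next
  case False
  then have x: "x > 0" using assms by simp
  let ?a = "x * L1 x"
  have "0 < (\<Sum>k\<in>{0, 1}. (real k - ?a)\<^sup>2 * (ck k * x ^ k))"
  proof (cases "?a = 0")
    case True
    then show ?thesis using ck_pos[of 1] x by simp
  next
    case False
    then have "?a\<^sup>2 * ck 0 > 0" using ck_pos[of 0] by simp
    then show ?thesis using ck_pos[of 1] x by (simp add: add_pos_nonneg)
  qed
  also have "\<dots> \<le> x * N1 x * FF x" by (rule variance_ge[OF assms]) simp
  finally show ?thesis using x FF_pos[OF assms] by (simp add: zero_less_mult_iff)
qed

lemma FF_continuous: "isCont FF x" and dF_continuous: "isCont dF x"
  using FF_deriv dF_deriv DERIV_isCont by blast+

lemma N1_continuous: "continuous_on {0..} N1"
proof -
  have "isCont N1 x" if "x \<ge> 0" for x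
    unfolding N1_def L1_def L2'_def using FF_pos[OF that]
    by (intro continuous_intros FF_continuous dF_continuous ddF_continuous) auto
  then show ?thesis by (simp add: continuous_at_imp_continuous_on)
qed

lemma P_continuous: "continuous_on {0..} P"
  by (rule DERIV_continuous_on[of _ _ R]) (use P_deriv in auto)

lemma Q_continuous: "continuous_on {0..} Q"
  by (rule DERIV_continuous_on[of _ _ Q']) (use Q_deriv in auto)

lemma Psi_continuous_halfline: "continuous_on {0..} \<Psi>"
  by (rule DERIV_continuous_on[of _ _ P]) (use Psi_deriv in auto)

section \<open>Comparability of F and its logarithmic derivatives with the weight\<close>

lemma compact_lower:
  fixes f :: "real \<Rightarrow> real"
  assumes "continuous_on {0..} f" "\<And>x. x \<ge> 0 \<Longrightarrow> f x > 0"
  obtains c where "c > 0" "\<And>x. 0 \<le> x \<Longrightarrow> x \<le> X \<Longrightarrow> c \<le> f x"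
proof (cases "X \<ge> 0")
  case True
  have "continuous_on {0..X} f" using assms(1) by (rule continuous_on_subset) auto
  then obtain y where y: "y \<in> {0..X}" "\<forall>x\<in>{0..X}. f y \<le> f x"
    using continuous_attains_inf[of "{0..X}" f] True by auto
  then show ?thesis using that[of "f y"] assms(2)[of y] by auto
next
  case False
  then show ?thesis using that[of 1] by simp
qed

text \<open>For large x the window contributes about WW terms, each of order VV e^\<Psi> / WW;
  compactness covers bounded x.\<close>

lemma FF_lower: obtains c where "c > 0" "\<And>x. x \<ge> 0 \<Longrightarrow> c * VV x * exp (\<Psi> x) \<le> FF x"
proof -
  obtain X where X: "X \<ge> 1" "\<And>x. x \<ge> X \<Longrightarrow> c1 * WW x \<ge> 4" "\<And>x. x \<ge> X \<Longrightarrow> \<Phi> x - c1 * WW x \<ge> real CARD('n)"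
    using large_x by blast
  have contV: "continuous_on {0..} VV"
    unfolding VV_def by (intro continuous_intros P_continuous Q_continuous)
  have contF: "continuous_on {0..} FF"
    using FF_continuous by (simp add: continuous_at_imp_continuous_on)
  have "continuous_on {0..} (\<lambda>x. FF x / (VV x * exp (\<Psi> x)))"
    using VV_pos by (intro continuous_intros contV contF Psi_continuous_halfline) (auto simp: less_le)
  then obtain c where c: "c > 0" "\<And>x. 0 \<le> x \<Longrightarrow> x \<le> X \<Longrightarrow> c \<le> FF x / (VV x * exp (\<Psi> x))"
    using compact_lower[of "\<lambda>x. FF x / (VV x * exp (\<Psi> x))" X] FF_pos VV_pos by auto
  define c' where "c' = c1 * ccoef / 4"
  have c'0: "c' > 0" using c1(1) ccoef_pos by (simp add: c'_def)
  show ?thesis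
  proof (rule that[of "min c c'"])
    show "min c c' > 0" using c(1) c'0 by simp
    fix x :: real assume x: "x \<ge> 0"
    have V: "VV x * exp (\<Psi> x) > 0" using VV_pos[OF x] by simp
    show "min c c' * VV x * exp (\<Psi> x) \<le> FF x"
    proof (cases "x \<le> X")
      case True
      have "min c c' * (VV x * exp (\<Psi> x)) \<le> c * (VV x * exp (\<Psi> x))" using V by (intro mult_right_mono) auto
      also have "\<dots> \<le> FF x" using c(2)[OF x True] V by (simp add: field_simps)
      finally show ?thesis by (simp add: mult.assoc)
    next
      case False
      then have x1: "x \<ge> 1" "x \<ge> X" using X(1) by auto
      obtain I where I: "finite I" "real (card I) \<ge> c1 * WW x / 4"
        "\<And>k. k \<in> I \<Longrightarrow> ck k * x ^ k \<ge> ccoef * (VV x / WW x) * exp (\<Psi> x)"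
        \<comment> \<open>Only the size of the coefficients matters here, so any centre will
          do.\<close>
        by (rule degree_window[OF x1(1) X(2)[OF x1(2)] X(3)[OF x1(2)], of 0]) auto
      have W: "WW x > 0" by (rule WW_pos[OF x])
      have "min c c' * (VV x * exp (\<Psi> x)) \<le> c' * (VV x * exp (\<Psi> x))" using V by (intro mult_right_mono) auto
      also have "\<dots> = (c1 * WW x / 4) * (ccoef * (VV x / WW x) * exp (\<Psi> x))" using W by (simp add: c'_def)
      also have "\<dots> \<le> real (card I) * (ccoef * (VV x / WW x) * exp (\<Psi> x))"
        using I(2) ccoef_pos VV_pos[OF x] W by (intro mult_right_mono) auto
      also have "\<dots> \<le> (\<Sum>k\<in>I. ck k * x ^ k)"
        using sum_mono[of I "\<lambda>_. ccoef * (VV x / WW x) * exp (\<Psi> x)" "\<lambda>k. ck k * x ^ k"] I(3) by simp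
      also have "\<dots> \<le> FF x" by (rule FF_ge[OF x I(1)])
      finally show ?thesis by (simp add: mult.assoc)
    qed
  qed
qed

lemma VV_near:
  assumes "x \<ge> 0" "y \<ge> 0" "\<bar>y - x\<bar> \<le> e0 * hh x"
  shows "VV y \<le> 4 * 2 ^ (CARD('n) - 1) * VV x" "VV x \<le> 4 * 2 ^ (CARD('n) - 1) * VV y"
proof -
  have "VV y \<le> (4 * Q x) * (2 * P x) ^ (CARD('n) - 1)"
    unfolding VV_def using Q_near[OF assms] P_near[OF assms] Q_pos assms P_pos
    by (intro mult_mono power_mono) (auto simp: less_imp_le)
  then show "VV y \<le> 4 * 2 ^ (CARD('n) - 1) * VV x" by (simp add: VV_def power_mult_distrib mult_ac)
  have "VV x \<le> (4 * Q y) * (2 * P y) ^ (CARD('n) - 1)"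
    unfolding VV_def using Q_near[OF assms] P_near[OF assms] Q_pos assms P_pos
    by (intro mult_mono power_mono) (auto simp: less_imp_le)
  then show "VV x \<le> 4 * 2 ^ (CARD('n) - 1) * VV y" by (simp add: VV_def power_mult_distrib mult_ac)
qed

text \<open>(k - \<Phi>)^2 is dominated by t^(-2) times the sum of exp (t (k - \<Phi>)) and exp (- t
  (k - \<Phi>)). Summed over the distribution these are values of F at x e^t and x e^(-t), which the
  upper bound for F compares with F(x) when t = dd/WW.\<close>

lemma variance_upper: obtains C where "C > 0" "\<And>x. x \<ge> 0 \<Longrightarrow> x * N1 x \<le> C * ((1 + x) * Q x)"
proof -
  obtain c where c: "c > 0" "\<And>x. x \<ge> 0 \<Longrightarrow> c * VV x * exp (\<Psi> x) \<le> FF x" using FF_lower by blast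
  define D where "D = Cev * (4 * 2 ^ (CARD('n) - 1)) * exp (1 + 4 * C4 * e0\<^sup>2)"
  have D0: "D > 0" using Cev_pos by (simp add: D_def)
  define C where "C = 4 / dd\<^sup>2 * (D / c)"
  show ?thesis
  proof (rule that[of C])
    show "C > 0" using D0 c(1) dd(1) by (simp add: C_def)
    fix x :: real assume x: "x \<ge> 0"
    define t where "t = dd / WW x"
    note st = dd_step[OF x t_def]
    have W: "WW x > 0" by (rule WW_pos[OF x])
    \<comment> \<open>The prefactor cancels the part of the tangent of \<Psi> that is linear in s.
      What remains is at most \<Phi>(x) t^2 \<le> 1 plus the Taylor error of
      \<open>Psi_near\<close>.\<close>
    have key: "exp (- (s * \<Phi> x)) * FF (x * exp s) \<le> D * (VV x * exp (\<Psi> x))"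
      if s: "\<bar>x * exp s - x\<bar> \<le> e0 * hh x" "exp s - 1 - s \<le> t\<^sup>2" for s
    proof -
      let ?y = "x * exp s"
      have y: "?y \<ge> 0" using x by simp
      have "\<Psi> ?y \<le> \<Psi> x + P x * (?y - x) + 4 * C4 * e0\<^sup>2" by (rule Psi_near[OF x y s(1)])
      also have "P x * (?y - x) = \<Phi> x * (exp s - 1 - s) + s * \<Phi> x" by (simp add: \<Phi>_def algebra_simps)
      also have "\<Phi> x * (exp s - 1 - s) \<le> \<Phi> x * t\<^sup>2" using s(2) Phi_nonneg[OF x] by (rule mult_left_mono)
      also have "\<dots> \<le> 1" by (rule st(6))
      finally have Py: "- (s * \<Phi> x) + \<Psi> ?y \<le> \<Psi> x + (1 + 4 * C4 * e0\<^sup>2)" by simp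
      have "exp (- (s * \<Phi> x)) * FF ?y \<le> exp (- (s * \<Phi> x)) * (Cev * exp (\<Psi> ?y) * VV ?y)"
        by (intro mult_left_mono FF_le y) simp
      also have "\<dots> = Cev * VV ?y * exp (- (s * \<Phi> x) + \<Psi> ?y)" by (simp only: exp_add mult_ac)
      also have "\<dots> \<le> Cev * (4 * 2 ^ (CARD('n) - 1) * VV x) * exp (\<Psi> x + (1 + 4 * C4 * e0\<^sup>2))"
        using Py Cev_pos VV_near[OF x y s(1)] VV_pos[OF y] VV_pos[OF x] by (intro mult_mono mult_left_mono) auto
      also have "\<dots> = D * (VV x * exp (\<Psi> x))" by (simp add: D_def exp_add algebra_simps)
      finally show ?thesis .
    qed
    have k1: "exp (- (t * \<Phi> x)) * FF (x * exp t) \<le> D * (VV x * exp (\<Psi> x))"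
      by (rule key[OF st(3)]) (use exp_bound[of t] st in auto)
    have k2: "exp (- (- t * \<Phi> x)) * FF (x * exp (- t)) \<le> D * (VV x * exp (\<Psi> x))"
      by (rule key[OF st(4)]) (use exp_minus_quadratic[of t] st in auto)
    have pt: "(x * exp s) ^ k = exp (s * real k) * x ^ k" for s k
      by (simp add: power_mult_distrib exp_of_nat2_mult)
    have ser: "(\<lambda>k. exp (- (s * \<Phi> x)) * (ck k * (x * exp s) ^ k)) sums (exp (- (s * \<Phi> x)) * FF (x * exp s))" for s
      unfolding FF_def by (intro sums_mult summable_sums ck_summable_real)
    have "x\<^sup>2 * ddF x + x * dF x - 2 * \<Phi> x * (x * dF x) + (\<Phi> x)\<^sup>2 * FF x
        \<le> (2 / t\<^sup>2) * (exp (- (t * \<Phi> x)) * FF (x * exp t) + exp (- (- t * \<Phi> x)) * FF (x * exp (- t)))"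
    proof (rule sums_le[OF _ degree_sums sums_mult[OF sums_add[OF ser ser]]])
      fix k
      have "(real k - \<Phi> x)\<^sup>2 = (1 / t\<^sup>2) * (t * (real k - \<Phi> x))\<^sup>2" using st(1) by (simp add: power_mult_distrib)
      also have "\<dots> \<le> (1 / t\<^sup>2) * (2 * (exp (t * (real k - \<Phi> x)) + exp (- (t * (real k - \<Phi> x)))))"
        by (intro mult_left_mono square_le_exp) auto
      finally have "(real k - \<Phi> x)\<^sup>2 * (ck k * x ^ k)
         \<le> ((1 / t\<^sup>2) * (2 * (exp (t * (real k - \<Phi> x)) + exp (- (t * (real k - \<Phi> x)))))) * (ck k * x ^ k)"
        using ck_pos[of k] x by (intro mult_right_mono) (auto simp: less_imp_le)
      also have "\<dots> = (2 / t\<^sup>2) * (exp (- (t * \<Phi> x)) * (ck k * (x * exp t) ^ k) + exp (- (- t * \<Phi> x)) * (ck k * (x * exp (- t)) ^ k))"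
      proof -
        have e1: "exp (t * (real k - \<Phi> x)) = exp (- (t * \<Phi> x)) * exp (t * real k)"
          unfolding exp_add[symmetric] by (simp add: algebra_simps)
        have e2: "exp (- (t * (real k - \<Phi> x))) = exp (- (- t * \<Phi> x)) * exp (- t * real k)"
          unfolding exp_add[symmetric] by (simp add: algebra_simps)
        show ?thesis unfolding pt e1 e2 by (simp add: algebra_simps)
      qed
      finally show "(real k - \<Phi> x)\<^sup>2 * (ck k * x ^ k)
         \<le> (2 / t\<^sup>2) * (exp (- (t * \<Phi> x)) * (ck k * (x * exp t) ^ k) + exp (- (- t * \<Phi> x)) * (ck k * (x * exp (- t)) ^ k))" .
    qed
    also have "\<dots> \<le> (2 / t\<^sup>2) * (D * (VV x * exp (\<Psi> x)) + D * (VV x * exp (\<Psi> x)))"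
      by (intro mult_left_mono add_mono k1 k2) auto
    also have "\<dots> = 4 / t\<^sup>2 * (D / c) * (c * VV x * exp (\<Psi> x))" using c(1) by simp
    also have "\<dots> \<le> 4 / t\<^sup>2 * (D / c) * FF x"
      using c D0 x by (intro mult_left_mono) auto
    finally have "x * N1 x * FF x \<le> 4 / t\<^sup>2 * (D / c) * FF x"
      using variance_le[OF x, of "\<Phi> x"] by simp
    then have "x * N1 x \<le> 4 / t\<^sup>2 * (D / c)" using FF_pos[OF x] by (rule mult_right_le_imp_le)
    also have "\<dots> = C * (WW x)\<^sup>2" using W by (simp add: t_def C_def power_divide)
    finally show "x * N1 x \<le> C * ((1 + x) * Q x)" by (simp add: WW_squared[OF x])
  qed
qed

text \<open>The window is taken on the side away from the mean: about WW degrees, each at distance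
  of order WW and each of weight VV e^\<Psi> / WW. Their contribution is WW^2 times the upper bound
  for F.\<close>

lemma variance_lower:
  obtains c X where "c > 0" "X \<ge> 1" "\<And>x. x \<ge> X \<Longrightarrow> x * N1 x \<ge> c * ((1 + x) * Q x)"
proof -
  obtain X where X: "X \<ge> 1" "\<And>x. x \<ge> X \<Longrightarrow> c1 * WW x \<ge> 4" "\<And>x. x \<ge> X \<Longrightarrow> \<Phi> x - c1 * WW x \<ge> real CARD('n)"
    using large_x by blast
  define c where "c = c1 * (c1 / 2)\<^sup>2 * ccoef / (4 * Cev)"
  show ?thesis
  proof (rule that[of c X])
    show "c > 0" using c1(1) ccoef_pos Cev_pos by (simp add: c_def)
    show "X \<ge> 1" by (rule X(1))
    fix x assume xX: "x \<ge> X"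
    then have x: "x \<ge> 1" "x \<ge> 0" using X(1) by auto
    have W: "WW x > 0" by (rule WW_pos[OF x(2)])
    obtain I where I: "finite I" "real (card I) \<ge> c1 * WW x / 4"
        "\<And>k. k \<in> I \<Longrightarrow> ck k * x ^ k \<ge> ccoef * (VV x / WW x) * exp (\<Psi> x)"
        "\<And>k. k \<in> I \<Longrightarrow> (real k - x * L1 x)\<^sup>2 \<ge> (c1 * WW x / 2)\<^sup>2"
      by (rule degree_window[OF x(1) X(2)[OF xX] X(3)[OF xX], of "x * L1 x"]) auto
    let ?b = "(c1 * WW x / 2)\<^sup>2 * (ccoef * (VV x / WW x) * exp (\<Psi> x))"
    have b0: "?b \<ge> 0" using ccoef_pos VV_pos[OF x(2)] W by simp
    have "c * (WW x)\<^sup>2 * FF x \<le> c * (WW x)\<^sup>2 * (Cev * exp (\<Psi> x) * VV x)"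
      using \<open>c > 0\<close> by (intro mult_left_mono FF_le x) auto
    also have "\<dots> = (c1 * WW x / 4) * ?b" using W Cev_pos by (simp add: c_def power2_eq_square)
    also have "\<dots> \<le> real (card I) * ?b" using I(2) b0 by (rule mult_right_mono)
    also have "\<dots> = (\<Sum>k\<in>I. ?b)" by simp
    also have "\<dots> \<le> (\<Sum>k\<in>I. (real k - x * L1 x)\<^sup>2 * (ck k * x ^ k))"
      using ccoef_pos VV_pos[OF x(2)] W by (intro sum_mono mult_mono I) auto
    also have "\<dots> \<le> x * N1 x * FF x" by (rule variance_ge[OF x(2) I(1)])
    finally have "c * (WW x)\<^sup>2 \<le> x * N1 x" using FF_pos[OF x(2)] by (rule mult_right_le_imp_le)
    then show "x * N1 x \<ge> c * ((1 + x) * Q x)" by (simp add: WW_squared[OF x(2)])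
  qed
qed

text \<open>The variance is x N1 and carries no information on N1 at x = 0; on bounded intervals
  continuity and positivity of N1 and Q are used instead.\<close>

lemma N1_comparable:
  obtains c C where "c > 0" "C > 0" "\<And>x. x \<ge> 0 \<Longrightarrow> c * Q x \<le> N1 x" "\<And>x. x \<ge> 0 \<Longrightarrow> N1 x \<le> C * Q x"
proof -
  obtain C where C: "C > 0" "\<And>x. x \<ge> 0 \<Longrightarrow> x * N1 x \<le> C * ((1 + x) * Q x)" using variance_upper by blast
  obtain c X where c: "c > 0" "X \<ge> 1" "\<And>x. x \<ge> X \<Longrightarrow> x * N1 x \<ge> c * ((1 + x) * Q x)"
    using variance_lower by blast
  have "continuous_on {0..} (\<lambda>x. N1 x / Q x)" "continuous_on {0..} (\<lambda>x. Q x / N1 x)"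
    using Q_pos N1_pos by (auto intro!: continuous_intros N1_continuous Q_continuous simp: less_le)
  then obtain a b where ab: "a > 0" "\<And>x. 0 \<le> x \<Longrightarrow> x \<le> X \<Longrightarrow> a \<le> N1 x / Q x"
    "b > 0" "\<And>x. 0 \<le> x \<Longrightarrow> x \<le> X \<Longrightarrow> b \<le> Q x / N1 x"
    using compact_lower[of "\<lambda>x. N1 x / Q x" X] compact_lower[of "\<lambda>x. Q x / N1 x" X] Q_pos N1_pos
    by (metis (no_types, lifting) divide_pos_pos)
  show ?thesis
  proof (rule that[of "min a c" "max (1 / b) (2 * C)"])
    show "min a c > 0" "max (1 / b) (2 * C) > 0" using ab c C by auto
    fix x :: real assume x: "x \<ge> 0"
    have Q: "Q x > 0" and N: "N1 x > 0" using Q_pos[OF x] N1_pos[OF x] by auto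
    show "min a c * Q x \<le> N1 x"
    proof (cases "x \<le> X")
      case True
      have "min a c * Q x \<le> a * Q x" using Q by (intro mult_right_mono) auto
      also have "\<dots> \<le> N1 x" using ab(2)[OF x True] Q by (simp add: field_simps)
      finally show ?thesis .
    next
      case False
      then have x1: "x > 0" "x \<ge> X" using c(2) by auto
      have "x * (c * Q x) \<le> c * ((1 + x) * Q x)" using c(1) Q by (simp add: algebra_simps)
      also have "\<dots> \<le> x * N1 x" by (rule c(3)[OF x1(2)])
      finally have "c * Q x \<le> N1 x" using x1(1) by (simp add: mult_le_cancel_left)
      moreover have "min a c * Q x \<le> c * Q x" using Q by (intro mult_right_mono) auto
      ultimately show ?thesis by simp
    qed
    show "N1 x \<le> max (1 / b) (2 * C) * Q x"
    proof (cases "x \<le> X")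
      case True
      have "N1 x \<le> 1 / b * Q x" using ab(4)[OF x True] ab(3) N by (simp add: field_simps)
      also have "\<dots> \<le> max (1 / b) (2 * C) * Q x" using Q by (intro mult_right_mono) auto
      finally show ?thesis .
    next
      case False
      then have x1: "x \<ge> 1" using c(2) by auto
      have "x * N1 x \<le> C * ((1 + x) * Q x)" by (rule C(2)[OF x])
      also have "\<dots> \<le> C * ((2 * x) * Q x)" using x1 C(1) Q by (intro mult_left_mono mult_right_mono) auto
      also have "\<dots> = x * (2 * C * Q x)" by simp
      finally have "N1 x \<le> 2 * C * Q x" using x1 by (simp add: mult_le_cancel_left)
      also have "\<dots> \<le> max (1 / b) (2 * C) * Q x" using Q by (intro mult_right_mono) auto
      finally show ?thesis .
    qed
  qed
qed

lemma L1_deriv: "x \<ge> 0 \<Longrightarrow> (L1 has_real_derivative L2' x) (at x)"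
  unfolding L1_def L2'_def[abs_def] using FF_pos[of x]
  by (auto intro!: derivative_eq_intros FF_deriv dF_deriv simp: field_simps power2_eq_square)

text \<open>N1 is the derivative of x L1 and Q that of \<Phi> = x P, and both functions vanish at 0,
  so the bounds integrate and can be divided by x.\<close>

lemma L1_comparable:
  assumes "c > 0" "C > 0" "\<And>x. x \<ge> 0 \<Longrightarrow> c * Q x \<le> N1 x" "\<And>x. x \<ge> 0 \<Longrightarrow> N1 x \<le> C * Q x" "x \<ge> 0"
  shows "c * P x \<le> L1 x" "L1 x \<le> C * P x"
proof -
  have N: "((\<lambda>x. x * L1 x) has_real_derivative N1 y) (at y within {0..})" if "y \<ge> 0" for y
    by (rule has_field_derivative_at_within) (use L1_deriv[OF that] in \<open>auto intro!: derivative_eq_intros simp: N1_def\<close>)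
  show "c * P x \<le> L1 x"
  proof (cases "x = 0")
    case True
    then show ?thesis using assms(3)[of 0] by (simp add: N1_def Q_eq)
  next
    case False
    have d: "((\<lambda>x. x * L1 x - c * \<Phi> x) has_real_derivative (N1 t - c * Q t)) (at t within {0..})" if "t \<ge> 0" for t
      by (rule DERIV_diff[OF N[OF that] DERIV_cmult[OF Phi_deriv[OF that]]])
    obtain t where t: "0 \<le> t" "(x * L1 x - c * \<Phi> x) - (0 * L1 0 - c * \<Phi> 0) = (N1 t - c * Q t) * (x - 0)"
      using mvt_halfline[OF order_refl assms(5) d] by blast
    then have "x * L1 x - c * \<Phi> x \<ge> 0" using assms(3)[of t] assms(5) by (simp add: \<Phi>_def)
    then have "x * (c * P x) \<le> x * L1 x" by (simp add: \<Phi>_def algebra_simps)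
    then show ?thesis using False assms(5) by (simp add: mult_le_cancel_left)
  qed
  show "L1 x \<le> C * P x"
  proof (cases "x = 0")
    case True
    then show ?thesis using assms(4)[of 0] by (simp add: N1_def Q_eq)
  next
    case False
    have d: "((\<lambda>x. C * \<Phi> x - x * L1 x) has_real_derivative (C * Q t - N1 t)) (at t within {0..})" if "t \<ge> 0" for t
      by (rule DERIV_diff[OF DERIV_cmult[OF Phi_deriv[OF that]] N[OF that]])
    obtain t where t: "0 \<le> t" "(C * \<Phi> x - x * L1 x) - (C * \<Phi> 0 - 0 * L1 0) = (C * Q t - N1 t) * (x - 0)"
      using mvt_halfline[OF order_refl assms(5) d] by blast
    then have "C * \<Phi> x - x * L1 x \<ge> 0" using assms(4)[of t] assms(5) by (simp add: \<Phi>_def)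
    then have "x * L1 x \<le> x * (C * P x)" by (simp add: \<Phi>_def algebra_simps)
    then show ?thesis using False assms(5) by (simp add: mult_le_cancel_left)
  qed
qed

end

section \<open>The Bergman metric\<close>

lemma has_vector_derivative_norm_squared_line:
  fixes z v :: "complex ^ 'n"
  shows "((\<lambda>t. (norm (z + t *\<^sub>R v))\<^sup>2) has_real_derivative (2 * Re (herm v z))) (at 0)"
proof -
  have "(\<lambda>t. (norm (z + t *\<^sub>R v))\<^sup>2) = (\<lambda>t. (norm z)\<^sup>2 + 2 * (t * Re (herm v z)) + t\<^sup>2 * (norm v)\<^sup>2)"
    by (simp add: norm_add_herm herm_scaleR_left power_mult_distrib fun_eq_iff)
  then show ?thesis
    by (auto intro!: derivative_eq_intros)
qed

lemma radial_line_derivative: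
  fixes z v :: "complex ^ 'n"
  assumes "(G has_real_derivative g) (at ((norm z)\<^sup>2))"
  shows "((\<lambda>t. G ((norm (z + t *\<^sub>R v))\<^sup>2)) has_real_derivative (g * (2 * Re (herm v z)))) (at 0)"
  by (rule DERIV_chain2[OF _ has_vector_derivative_norm_squared_line]) (use assms in simp)

lemma radial_line_derivative_complex:
  fixes z v :: "complex ^ 'n"
  assumes "(G has_real_derivative g) (at ((norm z)\<^sup>2))"
  shows "((\<lambda>t. complex_of_real (G ((norm (z + t *\<^sub>R v))\<^sup>2))) has_vector_derivative
    complex_of_real (g * (2 * Re (herm v z)))) (at 0)"
  by (rule has_vector_derivative_of_real[OF radial_line_derivative[OF assms]])

lemma herm_axis: "herm (axis k a) z = a * cnj (z $ k)"
proof -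
  have "herm (axis k a) z = (\<Sum>j\<in>UNIV. if j = k then a * cnj (z $ k) else 0)"
    unfolding herm_def by (intro sum.cong) (auto simp: axis_def)
  then show ?thesis by simp
qed

lemma wirtinger_bar_radial:
  fixes z :: "complex ^ 'n"
  assumes "(G has_real_derivative g) (at ((norm z)\<^sup>2))"
  shows "wirtinger_bar k (\<lambda>w. complex_of_real (G ((norm w)\<^sup>2))) z = complex_of_real g * z $ k"
proof -
  have rp: "real_partial v (\<lambda>w. complex_of_real (G ((norm w)\<^sup>2))) z = complex_of_real (g * (2 * Re (herm v z)))" for v
    unfolding real_partial_def by (rule vector_derivative_at[OF radial_line_derivative_complex[OF assms]])
  show ?thesis
    unfolding wirtinger_bar_def rp herm_axis by (simp add: complex_eq_iff)
qed

lemma wirtinger_radial: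
  fixes z :: "complex ^ 'n"
  assumes "(G has_real_derivative g) (at ((norm z)\<^sup>2))"
  shows "wirtinger j (\<lambda>w. complex_of_real (G ((norm w)\<^sup>2)) * w $ k) z
    = complex_of_real g * (cnj (z $ j) * z $ k) + (if j = k then complex_of_real (G ((norm z)\<^sup>2)) else 0)"
proof -
  have rp: "real_partial v (\<lambda>w. complex_of_real (G ((norm w)\<^sup>2)) * w $ k) z
     = complex_of_real (G ((norm z)\<^sup>2)) * v $ k + complex_of_real (g * (2 * Re (herm v z))) * z $ k" for v
  proof -
    have "((\<lambda>t. (z + t *\<^sub>R v) $ k) has_vector_derivative v $ k) (at 0)"
      by (auto intro!: derivative_eq_intros simp: vector_add_component vector_scaleR_component)
    from has_vector_derivative_mult[OF radial_line_derivative_complex[OF assms, of v] this]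
    show ?thesis
      unfolding real_partial_def by (intro vector_derivative_at) simp
  qed
  show ?thesis
    unfolding wirtinger_def rp herm_axis by (auto simp: complex_eq_iff axis_def field_simps)
qed

section \<open>Lengths of curves\<close>

text \<open>The derivative may be unbounded near the exceptional points, so the fundamental theorem
  is used for the gauge integral, and that integral is compared with the Lebesgue integral of the
  nonnegative majorant \<phi>.\<close>

lemma curve_bound:
  fixes f :: "real \<Rightarrow> 'a::euclidean_space" and \<phi> :: "real \<Rightarrow> real"
  assumes "finite S" "0 \<le> T" "T \<le> 1" "continuous_on {0..T} f"
    and f': "\<And>t. t \<in> {0<..<T} - S \<Longrightarrow> (f has_vector_derivative f' t) (at t)"
    and [measurable]: "\<phi> \<in> borel_measurable borel" and \<phi>0: "\<And>t. \<phi> t \<ge> 0"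
    and K: "K \<ge> 0" and le: "\<And>t. t \<in> {0<..<T} - S \<Longrightarrow> norm (f' t) \<le> K * \<phi> t"
    and int: "(\<integral>\<^sup>+t. ennreal (\<phi> t) \<partial>lborel) \<le> ennreal A" and A: "A \<ge> 0"
  shows "norm (f T - f 0) \<le> K * A"
proof -
  obtain r where r: "(\<integral>\<^sup>+t. ennreal (\<phi> t) \<partial>lborel) = ennreal r" "r \<ge> 0" "r \<le> A"
  proof -
    have "(\<integral>\<^sup>+t. ennreal (\<phi> t) \<partial>lborel) < \<infinity>" using int by (rule le_less_trans) simp
    then obtain r where "(\<integral>\<^sup>+t. ennreal (\<phi> t) \<partial>lborel) = ennreal r" "r \<ge> 0"
      by (cases "\<integral>\<^sup>+t. ennreal (\<phi> t) \<partial>lborel") auto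
    then show ?thesis using that[of r] int A by simp
  qed
  have hi: "(\<phi> has_integral r) UNIV"
    by (rule nn_integral_has_integral) (use r \<phi>0 in auto)
  have io: "\<phi> integrable_on {0..T}"
    using integrable_on_superset[of \<phi>] hi
    by (meson absolutely_integrable_on_def absolutely_integrable_on_subinterval has_integral_integrable integrable_on_subinterval subset_UNIV)
  have il: "integral {0..T} \<phi> \<le> r"
    using integral_subset_le[of "{0..T}" UNIV \<phi>] io hi \<phi>0 by (auto simp: integral_unique has_integral_integrable)
  define g where "g t = (if t \<in> {0<..<T} - S then f' t else 0)" for t
  have "(g has_integral (f T - f 0)) {0..T}"
    by (rule fundamental_theorem_of_calculus_interior_strong[OF assms(1,2)])
      (use f' assms(4) in \<open>auto simp: g_def\<close>)
  then have "norm (f T - f 0) = norm (integral {0..T} g)" "g integrable_on {0..T}"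
    by (auto simp: integral_unique)
  moreover have "norm (integral {0..T} g) \<le> integral {0..T} (\<lambda>t. K * \<phi> t)"
  proof (rule integral_norm_bound_integral)
    show "g integrable_on {0..T}" by fact
    show "(\<lambda>t. K * \<phi> t) integrable_on {0..T}" using io by (rule integrable_on_mult_right)
    show "norm (g t) \<le> K * \<phi> t" if "t \<in> {0..T}" for t
      using le K \<phi>0 by (auto simp: g_def)
  qed
  moreover have "integral {0..T} (\<lambda>t. K * \<phi> t) = K * integral {0..T} \<phi>" by simp
  moreover have "K * integral {0..T} \<phi> \<le> K * A" using il r K by (intro mult_left_mono) auto
  ultimately show ?thesis by simp
qed

lemma norm_squared_curve_derivative:
  fixes \<gamma> :: "real \<Rightarrow> complex ^ 'n"
  assumes "(\<gamma> has_vector_derivative v) (at t)"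
  shows "((\<lambda>s. (norm (\<gamma> s))\<^sup>2) has_real_derivative (2 * Re (herm v (\<gamma> t)))) (at t)"
proof -
  have "((\<lambda>s. \<gamma> s \<bullet> \<gamma> s) has_derivative (\<lambda>h. \<gamma> t \<bullet> (h *\<^sub>R v) + (h *\<^sub>R v) \<bullet> \<gamma> t)) (at t)"
    using assms unfolding has_vector_derivative_def by (intro has_derivative_inner)
  then have "((\<lambda>s. (norm (\<gamma> s))\<^sup>2) has_derivative (\<lambda>h. (2 * Re (herm v (\<gamma> t))) * h)) (at t)"
    by (simp add: power2_norm_eq_inner Re_herm inner_commute algebra_simps)
  then show ?thesis by (simp add: has_field_derivative_def)
qed

lemma radial_curve_derivative:
  fixes \<gamma> :: "real \<Rightarrow> complex ^ 'n"
  assumes "(\<gamma> has_vector_derivative v) (at t)" "(G has_real_derivative g) (at ((norm (\<gamma> t))\<^sup>2) within {0..})"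
  shows "((\<lambda>s. G ((norm (\<gamma> s))\<^sup>2)) has_vector_derivative (g * (2 * Re (herm v (\<gamma> t))))) (at t)"
proof -
  have "(G has_real_derivative g) (at ((norm (\<gamma> t))\<^sup>2) within (\<lambda>s. (norm (\<gamma> s))\<^sup>2) ` UNIV)"
    by (rule DERIV_subset[OF assms(2)]) auto
  from DERIV_image_chain[OF this norm_squared_curve_derivative[OF assms(1)]]
  show ?thesis by (simp add: has_real_derivative_iff_has_vector_derivative o_def)
qed

text \<open>Fixes the constants obtained in \<open>N1_comparable\<close> and
  \<open>FF_lower\<close>, so that all further constants can be explicit definitions.\<close>

locale fock_metric = fock_growth \<Psi> P R Q Q' C1 dim
  for \<Psi> P R Q Q' :: "real \<Rightarrow> real" and C1 :: real and dim :: "'n::finite itself" +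
  fixes cm CM cF :: real
  assumes cm: "cm > 0" and CM: "CM > 0" and cF: "cF > 0"
    and N1_lower: "\<And>x. x \<ge> 0 \<Longrightarrow> cm * Q x \<le> N1 x"
    and N1_upper: "\<And>x. x \<ge> 0 \<Longrightarrow> N1 x \<le> CM * Q x"
    and FF_lower_bound: "\<And>x. x \<ge> 0 \<Longrightarrow> cF * VV x * exp (\<Psi> x) \<le> FF x"
begin

abbreviation bm :: "complex ^ 'n \<Rightarrow> complex ^ 'n \<Rightarrow> real" where "bm \<equiv> bergman_metric \<Psi>"
abbreviation bd :: "complex ^ 'n \<Rightarrow> complex ^ 'n \<Rightarrow> ennreal" where "bd \<equiv> bergman_dist \<Psi>"
abbreviation bb :: "complex ^ 'n \<Rightarrow> real \<Rightarrow> (complex ^ 'n) set" where "bb \<equiv> bergman_ball \<Psi>"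

text \<open>The Levi form of a radial function G(|z|^2) is G' times the identity plus G'' times the
  rank one form of z; here G = log F.\<close>

lemma bm_eq: "bm z \<xi> = sqrt (L1 ((norm z)\<^sup>2) * (norm \<xi>)\<^sup>2 + L2' ((norm z)\<^sup>2) * (norm (herm \<xi> z))\<^sup>2)"
proof -
  let ?x = "(norm z)\<^sup>2"
  have "(\<lambda>w :: complex ^ 'n. complex_of_real (ln (Re (fock_kernel \<Psi> w w)))) = (\<lambda>w. complex_of_real ((\<lambda>x. ln (FF x)) ((norm w)\<^sup>2)))"
    by (simp add: fock_kernel_eq kern_diag)
  moreover have "wirtinger_bar k (\<lambda>w. complex_of_real ((\<lambda>x. ln (FF x)) ((norm w)\<^sup>2))) = (\<lambda>w :: complex ^ 'n. complex_of_real (L1 ((norm w)\<^sup>2)) * w $ k)" for k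
  proof
    fix w :: "complex ^ 'n"
    have "((\<lambda>x. ln (FF x)) has_real_derivative L1 ((norm w)\<^sup>2)) (at ((norm w)\<^sup>2))"
      using FF_pos[of "(norm w)\<^sup>2"] by (auto intro!: derivative_eq_intros FF_deriv simp: L1_def)
    then show "wirtinger_bar k (\<lambda>w. complex_of_real ((\<lambda>x. ln (FF x)) ((norm w)\<^sup>2))) w = complex_of_real (L1 ((norm w)\<^sup>2)) * w $ k"
      by (rule wirtinger_bar_radial)
  qed
  ultimately have w: "wirtinger j (wirtinger_bar k (\<lambda>w. complex_of_real (ln (Re (fock_kernel \<Psi> w w))))) z
    = complex_of_real (L2' ?x) * (cnj (z $ j) * z $ k) + (if j = k then complex_of_real (L1 ?x) else 0)" for j k
    using wirtinger_radial[OF L1_deriv, of z j k] by simp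
  have s: "(\<Sum>j\<in>UNIV. \<Sum>k\<in>UNIV. (complex_of_real (L2' ?x) * (cnj (z $ j) * z $ k) + (if j = k then complex_of_real (L1 ?x) else 0))
        * \<xi> $ j * cnj (\<xi> $ k))
     = complex_of_real (L1 ?x * (norm \<xi>)\<^sup>2 + L2' ?x * (norm (herm \<xi> z))\<^sup>2)"
  proof -
    have "(\<Sum>j\<in>UNIV. \<Sum>k\<in>UNIV. (complex_of_real (L2' ?x) * (cnj (z $ j) * z $ k) + (if j = k then complex_of_real (L1 ?x) else 0))
        * \<xi> $ j * cnj (\<xi> $ k))
      = (\<Sum>j\<in>UNIV. \<Sum>k\<in>UNIV. complex_of_real (L2' ?x) * ((\<xi> $ j * cnj (z $ j)) * (z $ k * cnj (\<xi> $ k))))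
        + (\<Sum>j\<in>UNIV. \<Sum>k\<in>UNIV. if j = k then complex_of_real (L1 ?x) * (\<xi> $ j * cnj (\<xi> $ k)) else 0)"
      unfolding sum.distrib[symmetric] by (intro sum.cong) (auto simp: algebra_simps)
    also have "(\<Sum>j\<in>UNIV. \<Sum>k\<in>UNIV. complex_of_real (L2' ?x) * ((\<xi> $ j * cnj (z $ j)) * (z $ k * cnj (\<xi> $ k))))
        = complex_of_real (L2' ?x) * (herm \<xi> z * herm z \<xi>)"
      unfolding herm_def sum_product by (simp add: sum_distrib_left)
    also have "herm \<xi> z * herm z \<xi> = complex_of_real ((norm (herm \<xi> z))\<^sup>2)"
      unfolding complex_norm_square by (simp add: cnj_herm)
    also have "(\<Sum>j\<in>UNIV. \<Sum>k\<in>UNIV. if j = k then complex_of_real (L1 ?x) * (\<xi> $ j * cnj (\<xi> $ k)) else 0)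
        = complex_of_real (L1 ?x) * herm \<xi> \<xi>"
      by (simp add: herm_def sum_distrib_left)
    finally show ?thesis by (simp add: herm_self)
  qed
  show ?thesis
    unfolding bergman_metric_def w s by simp
qed

section \<open>The model metric\<close>

definition gm :: "complex ^ 'n \<Rightarrow> complex ^ 'n \<Rightarrow> real"
  where "gm z \<xi> = sqrt (P ((norm z)\<^sup>2) * (norm \<xi>)\<^sup>2 + R ((norm z)\<^sup>2) * (norm (herm \<xi> z))\<^sup>2)"

lemma gm_squared: "(gm z \<xi>)\<^sup>2 = P ((norm z)\<^sup>2) * (norm \<xi>)\<^sup>2 + R ((norm z)\<^sup>2) * (norm (herm \<xi> z))\<^sup>2"
  unfolding gm_def using P_pos[of "(norm z)\<^sup>2"] R_nonneg[of "(norm z)\<^sup>2"] by (simp add: less_imp_le)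

lemma gm_nonneg: "gm z \<xi> \<ge> 0"
  unfolding gm_def using P_pos[of "(norm z)\<^sup>2"] R_nonneg[of "(norm z)\<^sup>2"] by (simp add: less_imp_le)

text \<open>Diagonalises the form: a is the eigenvalue orthogonal to z and b the one along z. The
  eigenvalues L1 and N1 are comparable with P and Q, whereas no direct comparison of L2' with R is
  available.\<close>

lemma metric_radial_split:
  fixes z \<xi> :: "complex ^ 'n"
  assumes "z \<noteq> 0" and a: "b = a + (norm z)\<^sup>2 * a'"
  shows "a * (norm \<xi>)\<^sup>2 + a' * (norm (herm \<xi> z))\<^sup>2
    = a * ((norm \<xi>)\<^sup>2 - (norm (herm \<xi> z))\<^sup>2 / (norm z)\<^sup>2) + b * ((norm (herm \<xi> z))\<^sup>2 / (norm z)\<^sup>2)"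
  using assms(1) unfolding a by (simp add: field_simps)

lemma herm_squared_le: "(norm (herm \<xi> z))\<^sup>2 / (norm z)\<^sup>2 \<le> (norm \<xi>)\<^sup>2" for z \<xi> :: "complex ^ 'n"
proof (cases "z = 0")
  case False
  have "(norm (herm \<xi> z))\<^sup>2 \<le> (norm \<xi> * norm z)\<^sup>2" by (intro power_mono norm_herm_le) auto
  then show ?thesis using False by (simp add: power_mult_distrib divide_le_eq)
qed auto

lemma metric_comparable:
  "cm * (gm z \<xi>)\<^sup>2 \<le> L1 ((norm z)\<^sup>2) * (norm \<xi>)\<^sup>2 + L2' ((norm z)\<^sup>2) * (norm (herm \<xi> z))\<^sup>2"
  "L1 ((norm z)\<^sup>2) * (norm \<xi>)\<^sup>2 + L2' ((norm z)\<^sup>2) * (norm (herm \<xi> z))\<^sup>2 \<le> CM * (gm z \<xi>)\<^sup>2"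
proof -
  let ?x = "(norm z)\<^sup>2"
  note L = L1_comparable[OF cm CM N1_lower N1_upper, of ?x]
  have N: "cm * Q ?x \<le> N1 ?x" "N1 ?x \<le> CM * Q ?x" using N1_lower[of ?x] N1_upper[of ?x] by auto
  let ?r = "(norm (herm \<xi> z))\<^sup>2 / ?x"
  have r: "?r \<ge> 0" "(norm \<xi>)\<^sup>2 - ?r \<ge> 0" using herm_squared_le[of \<xi> z] by auto
  have "cm * (gm z \<xi>)\<^sup>2 \<le> L1 ?x * (norm \<xi>)\<^sup>2 + L2' ?x * (norm (herm \<xi> z))\<^sup>2 \<and>
    L1 ?x * (norm \<xi>)\<^sup>2 + L2' ?x * (norm (herm \<xi> z))\<^sup>2 \<le> CM * (gm z \<xi>)\<^sup>2"
  proof (cases "z = 0")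
    case True
    have "cm * P 0 * (norm \<xi>)\<^sup>2 \<le> L1 0 * (norm \<xi>)\<^sup>2" "L1 0 * (norm \<xi>)\<^sup>2 \<le> CM * P 0 * (norm \<xi>)\<^sup>2"
      using L True by (auto intro!: mult_right_mono)
    then show ?thesis using True by (simp add: gm_squared mult.assoc)
  next
    case False
    have g: "(gm z \<xi>)\<^sup>2 = P ?x * ((norm \<xi>)\<^sup>2 - ?r) + Q ?x * ?r"
      unfolding gm_squared by (rule metric_radial_split[OF False]) (simp add: Q_eq)
    have l: "L1 ?x * (norm \<xi>)\<^sup>2 + L2' ?x * (norm (herm \<xi> z))\<^sup>2 = L1 ?x * ((norm \<xi>)\<^sup>2 - ?r) + N1 ?x * ?r"
      by (rule metric_radial_split[OF False]) (simp add: N1_def)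
    have "(cm * P ?x) * ((norm \<xi>)\<^sup>2 - ?r) + (cm * Q ?x) * ?r \<le> L1 ?x * ((norm \<xi>)\<^sup>2 - ?r) + N1 ?x * ?r"
      using L N r by (intro add_mono mult_right_mono) auto
    moreover have "L1 ?x * ((norm \<xi>)\<^sup>2 - ?r) + N1 ?x * ?r \<le> (CM * P ?x) * ((norm \<xi>)\<^sup>2 - ?r) + (CM * Q ?x) * ?r"
      using L N r by (intro add_mono mult_right_mono) auto
    ultimately show ?thesis unfolding g l by (simp add: distrib_left mult.assoc)
  qed
  then show "cm * (gm z \<xi>)\<^sup>2 \<le> L1 ?x * (norm \<xi>)\<^sup>2 + L2' ?x * (norm (herm \<xi> z))\<^sup>2"
     "L1 ?x * (norm \<xi>)\<^sup>2 + L2' ?x * (norm (herm \<xi> z))\<^sup>2 \<le> CM * (gm z \<xi>)\<^sup>2" by auto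
qed

lemma gm_le_bm: "gm z \<xi> \<le> bm z \<xi> / sqrt cm"
proof -
  have "sqrt (cm * (gm z \<xi>)\<^sup>2) \<le> bm z \<xi>" unfolding bm_eq by (intro real_sqrt_le_mono metric_comparable)
  then show ?thesis using cm gm_nonneg[of z \<xi>] by (simp add: real_sqrt_mult field_simps)
qed

lemma bm_le_gm: "bm z \<xi> \<le> sqrt CM * gm z \<xi>"
proof -
  have "bm z \<xi> \<le> sqrt (CM * (gm z \<xi>)\<^sup>2)" unfolding bm_eq by (intro real_sqrt_le_mono metric_comparable)
  then show ?thesis using CM gm_nonneg[of z \<xi>] by (simp add: real_sqrt_mult)
qed

lemma bm_nonneg: "bm z \<xi> \<ge> 0"
proof -
  have "0 \<le> cm * (gm z \<xi>)\<^sup>2" using cm by simp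
  then show ?thesis unfolding bm_eq using metric_comparable(1)[of z \<xi>] by simp
qed

lemma bm_scale: "bm z (r *\<^sub>R \<xi>) = \<bar>r\<bar> * bm z \<xi>"
proof -
  have "L1 ((norm z)\<^sup>2) * (norm (r *\<^sub>R \<xi>))\<^sup>2 + L2' ((norm z)\<^sup>2) * (norm (herm (r *\<^sub>R \<xi>) z))\<^sup>2
    = r\<^sup>2 * (L1 ((norm z)\<^sup>2) * (norm \<xi>)\<^sup>2 + L2' ((norm z)\<^sup>2) * (norm (herm \<xi> z))\<^sup>2)"
    by (simp add: herm_scaleR_left norm_mult power_mult_distrib algebra_simps)
  then show ?thesis unfolding bm_eq by (simp add: real_sqrt_mult)
qed

lemma norm_le_gm: "norm \<xi> \<le> gm z \<xi> / sqrt (P ((norm z)\<^sup>2))"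
proof -
  have "P ((norm z)\<^sup>2) * (norm \<xi>)\<^sup>2 \<le> (gm z \<xi>)\<^sup>2"
    unfolding gm_squared using R_nonneg[of "(norm z)\<^sup>2"] by simp
  then have "sqrt (P ((norm z)\<^sup>2) * (norm \<xi>)\<^sup>2) \<le> gm z \<xi>"
    using gm_nonneg by (simp add: real_le_lsqrt)
  then show ?thesis using P_pos[of "(norm z)\<^sup>2"] by (simp add: real_sqrt_mult field_simps)
qed

text \<open>In Q = P + x R the second part is already in the metric, and the first is controlled by
  Cauchy-Schwarz. Unit speed thus moves |z|^2 at a rate of at most twice \<open>hh\<close>.\<close>

lemma herm_le_gm: "norm (herm \<xi> z) \<le> hh ((norm z)\<^sup>2) * gm z \<xi>"
proof -
  let ?x = "(norm z)\<^sup>2"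
  have h: "(norm (herm \<xi> z))\<^sup>2 \<le> ?x * (norm \<xi>)\<^sup>2"
    using power_mono[OF norm_herm_le[of \<xi> z], of 2] by (simp add: power_mult_distrib mult.commute)
  have "Q ?x * (norm (herm \<xi> z))\<^sup>2 = P ?x * (norm (herm \<xi> z))\<^sup>2 + ?x * (R ?x * (norm (herm \<xi> z))\<^sup>2)"
    by (simp add: Q_eq algebra_simps)
  also have "\<dots> \<le> P ?x * (?x * (norm \<xi>)\<^sup>2) + ?x * (R ?x * (norm (herm \<xi> z))\<^sup>2)"
    using h P_pos[of ?x] R_nonneg[of ?x] by (intro add_mono mult_left_mono) auto
  also have "\<dots> = ?x * (gm z \<xi>)\<^sup>2" by (simp add: gm_squared algebra_simps)
  also have "\<dots> \<le> (1 + ?x) * (gm z \<xi>)\<^sup>2" by (intro mult_right_mono) auto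
  finally have "(norm (herm \<xi> z))\<^sup>2 \<le> (1 + ?x) / Q ?x * (gm z \<xi>)\<^sup>2"
    using Q_pos[of ?x] by (simp add: field_simps)
  also have "\<dots> = (hh ?x * gm z \<xi>)\<^sup>2" by (simp add: hh_squared power_mult_distrib)
  finally show ?thesis
    by (rule power2_le_imp_le) (use hh_pos[of ?x] gm_nonneg in \<open>simp add: less_imp_le\<close>)
qed

text \<open>Replaces the speed, whose values at the exceptional points are arbitrary, by a Borel
  function that differs from it on a null set and vanishes off the open set where it is
  continuous.\<close>

lemma curve_speed:
  fixes \<gamma> :: "real \<Rightarrow> complex ^ 'n"
  assumes \<gamma>: "\<gamma> piecewise_C1_differentiable_on {0..1}"
  obtains S \<phi> where "finite S" "continuous_on {0..1} \<gamma>"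
    "\<And>t. t \<in> {0<..<1} - S \<Longrightarrow> (\<gamma> has_vector_derivative vector_derivative \<gamma> (at t)) (at t)"
    "\<phi> \<in> borel_measurable borel" "\<And>t. \<phi> t \<ge> 0"
    "\<And>t. t \<in> {0<..<1} - S \<Longrightarrow> \<phi> t = bm (\<gamma> t) (vector_derivative \<gamma> (at t))"
    "\<And>t. t \<notin> {0<..<1} - S \<Longrightarrow> \<phi> t = 0"
    "(\<integral>\<^sup>+t\<in>{0..1}. ennreal (bm (\<gamma> t) (vector_derivative \<gamma> (at t))) \<partial>lborel) = (\<integral>\<^sup>+t. ennreal (\<phi> t) \<partial>lborel)"
proof -
  obtain S where S: "finite S" "\<gamma> C1_differentiable_on ({0..1} - S)" and c: "continuous_on {0..1} \<gamma>"
    using \<gamma> by (auto simp: piecewise_C1_differentiable_on_def)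
  obtain D where D: "\<And>t. t \<in> {0..1} - S \<Longrightarrow> (\<gamma> has_vector_derivative D t) (at t)" "continuous_on ({0..1} - S) D"
    using S(2) unfolding C1_differentiable_on_def by blast
  define U where "U = {0<..<1::real} - S"
  have U: "open U" unfolding U_def using S(1) by (intro open_Diff finite_imp_closed) auto
  have vd: "vector_derivative \<gamma> (at t) = D t" if "t \<in> U" for t
    using D(1)[of t] that by (intro vector_derivative_at) (auto simp: U_def)
  define \<phi> where "\<phi> t = (if t \<in> U then bm (\<gamma> t) (vector_derivative \<gamma> (at t)) else 0)" for t
  have L1c: "continuous_on {0..} L1" "continuous_on {0..} L2'"
    unfolding L1_def[abs_def] L2'_def[abs_def] using FF_pos
    by (intro continuous_at_imp_continuous_on ballI continuous_intros FF_continuous dF_continuous ddF_continuous; force)+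
  have cU: "continuous_on U \<gamma>" "continuous_on U D"
    using c D(2) by (auto simp: U_def intro: continuous_on_subset)
  have "continuous_on U (\<lambda>t. bm (\<gamma> t) (D t))"
    unfolding bm_eq
    by (intro continuous_intros cU continuous_on_compose2[OF L1c(1)] continuous_on_compose2[OF L1c(2)]) auto
  then have "continuous_on U (\<lambda>t. bm (\<gamma> t) (vector_derivative \<gamma> (at t)))"
    by (rule continuous_on_eq) (simp add: vd)
  then have m: "\<phi> \<in> borel_measurable borel"
    unfolding \<phi>_def using U by (intro borel_measurable_continuous_on_if) auto
  show ?thesis
  proof (rule that[OF S(1) c _ m])
    show "(\<gamma> has_vector_derivative vector_derivative \<gamma> (at t)) (at t)" if "t \<in> {0<..<1} - S" for t
      using D(1)[of t] vd[of t] that by (auto simp: U_def)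
    show "\<phi> t \<ge> 0" for t by (simp add: \<phi>_def bm_nonneg)
    show "\<phi> t = bm (\<gamma> t) (vector_derivative \<gamma> (at t))" if "t \<in> {0<..<1} - S" for t
      using that by (simp add: \<phi>_def U_def)
    show "\<phi> t = 0" if "t \<notin> {0<..<1} - S" for t using that by (auto simp: \<phi>_def U_def)
    have "finite (insert 0 (insert 1 S))" using S(1) by simp
    then have "AE t in lborel. t \<notin> insert 0 (insert 1 S)"
      by (intro AE_not_in finite_imp_null_set_lborel)
    then have "AE t in lborel. ennreal (bm (\<gamma> t) (vector_derivative \<gamma> (at t))) * indicator {0..1} t = ennreal (\<phi> t)"
      by eventually_elim (auto simp: \<phi>_def U_def indicator_def less_le)
    then show "(\<integral>\<^sup>+t\<in>{0..1}. ennreal (bm (\<gamma> t) (vector_derivative \<gamma> (at t))) \<partial>lborel) = (\<integral>\<^sup>+t. ennreal (\<phi> t) \<partial>lborel)"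
      by (rule nn_integral_cong_AE)
  qed
qed

section \<open>Bergman balls and ellipsoids\<close>

text \<open>One summand for each logarithmic derivative in \<open>log_derivative_bounds\<close>,
  divided by the constant that passes from \<open>gm\<close> to the Bergman metric.\<close>

definition KL :: real where "KL = (2 * C1 + 2 * C4 * sqrt C2 + 2 / sqrt (P 0)) / sqrt cm"

definition EE :: "real \<Rightarrow> real" where "EE A = exp (KL * A)"

lemma KL_pos: "KL > 0"
  unfolding KL_def using C1 C4_pos C2_pos P0 cm by (intro divide_pos_pos add_pos_pos) auto

lemma EE_ge_1: "A \<ge> 0 \<Longrightarrow> EE A \<ge> 1"
  using KL_pos by (simp add: EE_def)

text \<open>Along a curve ln Q, ln P and ln (1 + |z|^2) are Lipschitz for Bergman length: Q'/Q, R/P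
  and 1/(1 + x) are all O(1/hh), and |z|^2 moves at a rate of order hh.\<close>

lemma log_derivative_bounds:
  fixes z v :: "complex ^ 'n"
  defines "x \<equiv> (norm z)\<^sup>2"
  shows "\<bar>Q' x / Q x * (2 * Re (herm v z))\<bar> \<le> KL * bm z v"
    and "\<bar>R x / P x * (2 * Re (herm v z))\<bar> \<le> KL * bm z v"
    and "\<bar>1 / (1 + x) * (2 * Re (herm v z))\<bar> \<le> KL * bm z v"
proof -
  have x: "x \<ge> 0" by (simp add: x_def)
  let ?g = "gm z v"
  have re: "\<bar>2 * Re (herm v z)\<bar> \<le> 2 * (hh x * ?g)"
    using abs_Re_le_cmod[of "herm v z"] herm_le_gm[of v z] by (simp add: x_def)
  have s: "sqrt (1 + x) * sqrt (1 + x) = 1 + x" "sqrt (Q x) * sqrt (Q x) = Q x" "sqrt (1 + x) > 0" "sqrt (Q x) > 0"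
    using x Q_pos[OF x] by auto
  have g: "?g \<ge> 0" by (rule gm_nonneg)
  have gb: "k * ?g \<le> KL * bm z v" if "0 \<le> k" "k \<le> 2 * C1 + 2 * C4 * sqrt C2 + 2 / sqrt (P 0)" for k
  proof -
    have "k * ?g \<le> k * (bm z v / sqrt cm)" using that by (intro mult_left_mono gm_le_bm)
    also have "\<dots> \<le> (2 * C1 + 2 * C4 * sqrt C2 + 2 / sqrt (P 0)) * (bm z v / sqrt cm)"
      using that bm_nonneg cm by (intro mult_right_mono) auto
    also have "\<dots> = KL * bm z v" by (simp add: KL_def)
    finally show ?thesis .
  qed
  have nn: "C1 > 0" "C4 * sqrt C2 > 0" "1 / sqrt (P 0) > 0" using C1 C4_pos C2_pos P0 by auto
  have "\<bar>Q' x / Q x * (2 * Re (herm v z))\<bar> = Q' x / Q x * \<bar>2 * Re (herm v z)\<bar>"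
    using Q'_nonneg[OF x] Q_pos[OF x] by (simp add: abs_mult)
  also have "\<dots> \<le> Q' x / Q x * (2 * (hh x * ?g))"
    using re Q'_nonneg[OF x] Q_pos[OF x] by (intro mult_left_mono) auto
  also have "\<dots> = 2 * (sqrt (1 + x) * Q' x / (Q x * sqrt (Q x))) * ?g" by (simp add: hh_eq)
  also have "\<dots> \<le> 2 * C1 * ?g"
  proof (intro mult_right_mono mult_left_mono g)
    show "sqrt (1 + x) * Q' x / (Q x * sqrt (Q x)) \<le> C1"
      using Q'_le[OF x] Q_pos[OF x] s(4) by (simp add: divide_le_eq)
  qed auto
  also have "\<dots> \<le> KL * bm z v" using nn by (intro gb) auto
  finally show "\<bar>Q' x / Q x * (2 * Re (herm v z))\<bar> \<le> KL * bm z v" .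
  have RP: "R x / P x * hh x \<le> C4 * sqrt C2"
  proof -
    have "R x * hh x \<le> (C4 * Q x / (1 + x)) * hh x"
      using R_le_Q[OF x] x hh_pos[OF x] by (intro mult_right_mono) (auto simp: field_simps)
    also have "\<dots> = C4 * (Q x / (1 + x)) * hh x" by simp
    also have "Q x / (1 + x) = 1 / (hh x)\<^sup>2" by (simp add: hh_squared[OF x])
    also have "C4 * (1 / (hh x)\<^sup>2) * hh x = C4 * (1 / hh x)" by (simp add: power2_eq_square)
    also have "\<dots> \<le> C4 * (sqrt C2 * P x)"
      using inverse_P_le[OF x] P_pos[OF x] hh_pos[OF x] C4_pos by (intro mult_left_mono) (auto simp: field_simps)
    finally show ?thesis using P_pos[OF x] by (simp add: field_simps)
  qed
  have "\<bar>R x / P x * (2 * Re (herm v z))\<bar> = R x / P x * \<bar>2 * Re (herm v z)\<bar>"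
    using R_nonneg[OF x] P_pos[OF x] by (simp add: abs_mult)
  also have "\<dots> \<le> R x / P x * (2 * (hh x * ?g))"
    using re R_nonneg[OF x] P_pos[OF x] by (intro mult_left_mono) auto
  also have "\<dots> = 2 * (R x / P x * hh x) * ?g" by simp
  also have "\<dots> \<le> 2 * (C4 * sqrt C2) * ?g" by (intro mult_right_mono mult_left_mono RP g) simp
  also have "\<dots> \<le> KL * bm z v" using nn by (intro gb) auto
  finally show "\<bar>R x / P x * (2 * Re (herm v z))\<bar> \<le> KL * bm z v" .
  have h1: "1 / (1 + x) * hh x \<le> 1 / sqrt (P 0)"
  proof -
    have "1 / (1 + x) * hh x = 1 / WW x" unfolding WW_hh(1)[OF x, symmetric] using x by simp
    also have "\<dots> \<le> 1 / sqrt (P 0)" using WW_ge[OF x] P0 WW_pos[OF x] by (intro divide_left_mono) auto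
    finally show ?thesis by simp
  qed
  have "\<bar>1 / (1 + x) * (2 * Re (herm v z))\<bar> = 1 / (1 + x) * \<bar>2 * Re (herm v z)\<bar>"
    using x by (simp add: abs_mult)
  also have "\<dots> \<le> 1 / (1 + x) * (2 * (hh x * ?g))"
    using re x by (intro mult_left_mono) auto
  also have "\<dots> = 2 * (1 / (1 + x) * hh x) * ?g" by simp
  also have "\<dots> \<le> 2 * (1 / sqrt (P 0)) * ?g" by (intro mult_right_mono mult_left_mono h1 g) simp
  also have "\<dots> \<le> KL * bm z v" using nn by (intro gb) auto
  finally show "\<bar>1 / (1 + x) * (2 * Re (herm v z))\<bar> \<le> KL * bm z v" .
qed

lemma log_ratio_bound: "a > 0 \<Longrightarrow> b > 0 \<Longrightarrow> \<bar>ln a - ln b\<bar> \<le> KL * A \<Longrightarrow> a \<le> EE A * b \<and> b \<le> EE A * a"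
proof -
  assume a: "a > 0" and b: "b > 0" and l: "\<bar>ln a - ln b\<bar> \<le> KL * A"
  have "exp (ln a) \<le> exp (KL * A + ln b)" "exp (ln b) \<le> exp (KL * A + ln a)" using l by auto
  then show ?thesis using a b by (simp add: exp_add EE_def)
qed

definition curve_data :: "(real \<Rightarrow> complex ^ 'n) \<Rightarrow> real set \<Rightarrow> (real \<Rightarrow> real) \<Rightarrow> real \<Rightarrow> bool"
  where "curve_data \<gamma> S \<phi> A \<longleftrightarrow> finite S \<and> continuous_on {0..1} \<gamma> \<and>
    (\<forall>t\<in>{0<..<1} - S. (\<gamma> has_vector_derivative vector_derivative \<gamma> (at t)) (at t)) \<and>
    \<phi> \<in> borel_measurable borel \<and> (\<forall>t. \<phi> t \<ge> 0) \<and>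
    (\<forall>t\<in>{0<..<1} - S. \<phi> t = bm (\<gamma> t) (vector_derivative \<gamma> (at t))) \<and>
    (\<integral>\<^sup>+t. ennreal (\<phi> t) \<partial>lborel) \<le> ennreal A \<and> A \<ge> 0"

lemma curve_dataD:
  assumes "curve_data \<gamma> S \<phi> A"
  shows "finite S" "continuous_on {0..1} \<gamma>"
    "\<And>t. t \<in> {0<..<1} - S \<Longrightarrow> (\<gamma> has_vector_derivative vector_derivative \<gamma> (at t)) (at t)"
    "\<phi> \<in> borel_measurable borel" "\<And>t. \<phi> t \<ge> 0"
    "\<And>t. t \<in> {0<..<1} - S \<Longrightarrow> \<phi> t = bm (\<gamma> t) (vector_derivative \<gamma> (at t))"
    "(\<integral>\<^sup>+t. ennreal (\<phi> t) \<partial>lborel) \<le> ennreal A" "A \<ge> 0"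
  using assms unfolding curve_data_def by blast+

text \<open>Integrating the logarithmic derivatives gives comparability along curves of any bounded
  length, unlike the local windows, where the step had to be small.\<close>

lemma curve_comparable:
  fixes \<gamma> :: "real \<Rightarrow> complex ^ 'n"
  assumes cd: "curve_data \<gamma> S \<phi> A" and T: "0 \<le> T" "T \<le> 1"
  defines "x \<equiv> (norm (\<gamma> 0))\<^sup>2" and "y \<equiv> (norm (\<gamma> T))\<^sup>2"
  shows "Q y \<le> EE A * Q x \<and> Q x \<le> EE A * Q y" "P y \<le> EE A * P x \<and> P x \<le> EE A * P y"
    "1 + y \<le> EE A * (1 + x) \<and> 1 + x \<le> EE A * (1 + y)"
proof -
  note S = curve_dataD(1)[OF cd] and c = curve_dataD(2)[OF cd] and d = curve_dataD(3)[OF cd]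
    and m = curve_dataD(4)[OF cd] and \<phi>0 = curve_dataD(5)[OF cd] and \<phi> = curve_dataD(6)[OF cd]
    and int = curve_dataD(7)[OF cd] and A = curve_dataD(8)[OF cd]
  have x: "x \<ge> 0" and y: "y \<ge> 0" by (auto simp: x_def y_def)
  have gen: "\<bar>ln (G y) - ln (G x)\<bar> \<le> KL * A"
    if G: "\<And>s. s \<ge> 0 \<Longrightarrow> G s > 0" "\<And>s. s \<ge> 0 \<Longrightarrow> (G has_real_derivative G' s) (at s within {0..})"
      and b: "\<And>z v :: complex ^ 'n. \<bar>G' ((norm z)\<^sup>2) / G ((norm z)\<^sup>2) * (2 * Re (herm v z))\<bar> \<le> KL * bm z v" for G G'
  proof -
    let ?f = "\<lambda>t. ln (G ((norm (\<gamma> t))\<^sup>2))"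
    have lnG: "((\<lambda>s. ln (G s)) has_real_derivative G' s / G s) (at s within {0..})" if "s \<ge> 0" for s
      using G(1)[OF that] G(2)[OF that] by (auto intro!: derivative_eq_intros)
    have cG: "continuous_on {0..} (\<lambda>s. ln (G s))"
      by (rule DERIV_continuous_on) (use lnG in auto)
    have "norm (?f T - ?f 0) \<le> KL * A"
    proof (rule curve_bound[OF S T _ _ m \<phi>0 _ _ int A])
      show "continuous_on {0..T} ?f"
        by (intro continuous_on_compose2[OF cG] continuous_intros continuous_on_subset[OF c]) (use T in auto)
      fix t assume t: "t \<in> {0<..<T} - S"
      then have t': "t \<in> {0<..<1} - S" using T by auto
      let ?v = "vector_derivative \<gamma> (at t)"
      show "(?f has_vector_derivative (G' ((norm (\<gamma> t))\<^sup>2) / G ((norm (\<gamma> t))\<^sup>2) * (2 * Re (herm ?v (\<gamma> t))))) (at t)"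
        by (rule radial_curve_derivative[OF d[OF t'] lnG]) simp
      show "norm (G' ((norm (\<gamma> t))\<^sup>2) / G ((norm (\<gamma> t))\<^sup>2) * (2 * Re (herm ?v (\<gamma> t)))) \<le> KL * \<phi> t"
        using b[of "\<gamma> t" ?v] by (simp add: \<phi>[OF t'])
    qed (use KL_pos in simp)
    then show ?thesis by (simp add: x_def y_def)
  qed
  have "\<bar>ln (Q y) - ln (Q x)\<bar> \<le> KL * A"
    by (rule gen[OF Q_pos Q_deriv log_derivative_bounds(1)])
  then show "Q y \<le> EE A * Q x \<and> Q x \<le> EE A * Q y" by (intro log_ratio_bound Q_pos x y)
  have "\<bar>ln (P y) - ln (P x)\<bar> \<le> KL * A"
    by (rule gen[OF P_pos P_deriv log_derivative_bounds(2)])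
  then show "P y \<le> EE A * P x \<and> P x \<le> EE A * P y" by (intro log_ratio_bound P_pos x y)
  have "\<bar>ln (1 + y) - ln (1 + x)\<bar> \<le> KL * A"
    by (rule gen[of "\<lambda>s. 1 + s" "\<lambda>_. 1", OF _ _ log_derivative_bounds(3)]) (auto intro!: derivative_eq_intros)
  then show "1 + y \<le> EE A * (1 + x) \<and> 1 + x \<le> EE A * (1 + y)" using x y by (intro log_ratio_bound) auto
qed

text \<open>Size of the displacement along a curve of length A, relative to the ellipsoid at its
  start. The second summand pays for replacing the moving point in \<open>herm\<close> by the
  starting point.\<close>

definition tt :: "real \<Rightarrow> real"
  where "tt A = A / sqrt cm * (EE A + (EE A)\<^sup>2 * A * sqrt C2 / sqrt cm)"

lemma curve_displacement:
  fixes \<gamma> :: "real \<Rightarrow> complex ^ 'n"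
  assumes cd: "curve_data \<gamma> S \<phi> A"
  shows "norm (\<gamma> 1 - \<gamma> 0) \<le> tt A / sqrt (P ((norm (\<gamma> 0))\<^sup>2))"
    and "norm (herm (\<gamma> 1 - \<gamma> 0) (\<gamma> 0)) \<le> tt A * hh ((norm (\<gamma> 0))\<^sup>2)"
proof -
  let ?x = "(norm (\<gamma> 0))\<^sup>2"
  note S = curve_dataD(1)[OF cd] and c = curve_dataD(2)[OF cd] and d = curve_dataD(3)[OF cd]
    and m = curve_dataD(4)[OF cd] and \<phi>0 = curve_dataD(5)[OF cd] and \<phi> = curve_dataD(6)[OF cd]
    and int = curve_dataD(7)[OF cd] and A = curve_dataD(8)[OF cd]
  note comp = curve_comparable[OF cd]
  have E1: "EE A \<ge> 1" by (rule EE_ge_1[OF A])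
  have sc: "sqrt cm > 0" using cm by simp
  have Px: "P ?x > 0" "Q ?x > 0" by (auto simp: P_pos Q_pos)
  have EE2: "sqrt (EE A) \<le> EE A" using E1 by (simp add: real_le_lsqrt power2_eq_square)
  have Pt: "1 / sqrt (P ((norm (\<gamma> t))\<^sup>2)) \<le> EE A / sqrt (P ?x)" if "0 \<le> t" "t \<le> 1" for t
  proof -
    have "sqrt (P ?x) \<le> sqrt (EE A * P ((norm (\<gamma> t))\<^sup>2))" using comp(2)[OF that] by simp
    also have "\<dots> = sqrt (EE A) * sqrt (P ((norm (\<gamma> t))\<^sup>2))" by (simp add: real_sqrt_mult)
    also have "\<dots> \<le> EE A * sqrt (P ((norm (\<gamma> t))\<^sup>2))" using EE2 P_pos[of "(norm (\<gamma> t))\<^sup>2"] by (intro mult_right_mono) auto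
    finally show ?thesis using P_pos[of "(norm (\<gamma> t))\<^sup>2"] Px by (simp add: field_simps)
  qed
  have ht: "hh ((norm (\<gamma> t))\<^sup>2) \<le> EE A * hh ?x" if "0 \<le> t" "t \<le> 1" for t
  proof -
    let ?y = "(norm (\<gamma> t))\<^sup>2"
    have Qy: "Q ?y > 0" by (simp add: Q_pos)
    have "(1 + ?y) / Q ?y \<le> (EE A * (1 + ?x)) / (Q ?x / EE A)"
      using comp(1,3)[OF that] E1 Px Qy by (intro frac_le) (auto simp: field_simps)
    also have "\<dots> = (EE A)\<^sup>2 * ((1 + ?x) / Q ?x)" by (simp add: power2_eq_square)
    finally have "hh ?y \<le> sqrt ((EE A)\<^sup>2 * ((1 + ?x) / Q ?x))" unfolding hh_def by (rule real_sqrt_le_mono)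
    also have "\<dots> = EE A * hh ?x"
      unfolding real_sqrt_mult hh_def real_sqrt_abs using E1 by simp
    finally show ?thesis .
  qed
  have v: "norm (vector_derivative \<gamma> (at t)) \<le> (EE A / sqrt (P ?x) / sqrt cm) * \<phi> t" if "t \<in> {0<..<1} - S" for t
  proof -
    let ?v = "vector_derivative \<gamma> (at t)"
    have "norm ?v \<le> gm (\<gamma> t) ?v * (1 / sqrt (P ((norm (\<gamma> t))\<^sup>2)))" using norm_le_gm[of ?v "\<gamma> t"] by simp
    also have "\<dots> \<le> (bm (\<gamma> t) ?v / sqrt cm) * (EE A / sqrt (P ?x))"
      using that P_pos[of "(norm (\<gamma> t))\<^sup>2"] gm_nonneg sc bm_nonneg
      by (intro mult_mono gm_le_bm Pt) (auto simp: less_imp_le)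
    finally show ?thesis by (simp add: \<phi>[OF that] mult.commute)
  qed
  have K0: "EE A / sqrt (P ?x) / sqrt cm \<ge> 0" using E1 Px sc by auto
  have disp: "norm (\<gamma> T - \<gamma> 0) \<le> (EE A / sqrt (P ?x) / sqrt cm) * A" if T: "0 \<le> T" "T \<le> 1" for T
    by (rule curve_bound[OF S T _ _ m \<phi>0 K0 _ int A, of \<gamma> "\<lambda>t. vector_derivative \<gamma> (at t)"])
      (use c d v T in \<open>auto intro: continuous_on_subset\<close>)
  have tt1: "A / sqrt cm * EE A \<le> tt A"
    unfolding tt_def using A sc E1 C2_pos by (intro mult_left_mono) auto
  have "norm (\<gamma> 1 - \<gamma> 0) \<le> (A / sqrt cm * EE A) / sqrt (P ?x)" using disp[of 1] by (simp add: field_simps)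
  also have "\<dots> \<le> tt A / sqrt (P ?x)" using tt1 Px by (intro divide_right_mono) auto
  finally show "norm (\<gamma> 1 - \<gamma> 0) \<le> tt A / sqrt (P ?x)" .
  define Kh where "Kh = (EE A + (EE A)\<^sup>2 * A * sqrt C2 / sqrt cm) * hh ?x / sqrt cm"
  have Kh0: "Kh \<ge> 0" unfolding Kh_def using E1 A sc C2_pos hh_pos[of ?x] by (intro divide_nonneg_nonneg mult_nonneg_nonneg add_nonneg_nonneg) auto
  have "norm (herm (\<gamma> 1 - \<gamma> 0) (\<gamma> 0) - herm (\<gamma> 0 - \<gamma> 0) (\<gamma> 0)) \<le> Kh * A"
  proof (rule curve_bound[OF S _ _ _ _ m \<phi>0 Kh0 _ int A, of 1 "\<lambda>t. herm (\<gamma> t - \<gamma> 0) (\<gamma> 0)" "\<lambda>t. herm (vector_derivative \<gamma> (at t)) (\<gamma> 0)"])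
    show "continuous_on {0..1} (\<lambda>t. herm (\<gamma> t - \<gamma> 0) (\<gamma> 0))" by (intro continuous_intros c)
    fix t :: real assume t: "t \<in> {0<..<1} - S"
    let ?v = "vector_derivative \<gamma> (at t)"
    have "((\<lambda>t. \<gamma> t - \<gamma> 0) has_vector_derivative ?v) (at t)"
      using d[OF t] by (auto intro!: derivative_eq_intros)
    then show "((\<lambda>t. herm (\<gamma> t - \<gamma> 0) (\<gamma> 0)) has_vector_derivative herm ?v (\<gamma> 0)) (at t)"
      by (rule bounded_linear.has_vector_derivative[OF bounded_linear_herm])
    have t1: "0 \<le> t" "t \<le> 1" using t by auto
    \<comment> \<open>The metric controls the product with the current point only; the correction is
      second order and is absorbed by \<open>inverse_P_le\<close>.\<close>
    have "herm ?v (\<gamma> 0) = herm ?v (\<gamma> t) - herm ?v (\<gamma> t - \<gamma> 0)" by (simp add: herm_diff_right)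
    then have "norm (herm ?v (\<gamma> 0)) \<le> norm (herm ?v (\<gamma> t)) + norm (herm ?v (\<gamma> t - \<gamma> 0))"
      by (simp add: norm_triangle_ineq4)
    also have "\<dots> \<le> (EE A * hh ?x) * (\<phi> t / sqrt cm) + ((EE A / sqrt (P ?x) / sqrt cm) * \<phi> t) * ((EE A / sqrt (P ?x) / sqrt cm) * A)"
    proof (rule add_mono)
      have "norm (herm ?v (\<gamma> t)) \<le> hh ((norm (\<gamma> t))\<^sup>2) * gm (\<gamma> t) ?v" by (rule herm_le_gm)
      also have "\<dots> \<le> (EE A * hh ?x) * (bm (\<gamma> t) ?v / sqrt cm)"
        using E1 hh_pos[of ?x] by (intro mult_mono ht t1 gm_le_bm gm_nonneg) auto
      finally show "norm (herm ?v (\<gamma> t)) \<le> (EE A * hh ?x) * (\<phi> t / sqrt cm)" by (simp add: \<phi>[OF t])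
      have "norm (herm ?v (\<gamma> t - \<gamma> 0)) \<le> norm ?v * norm (\<gamma> t - \<gamma> 0)" by (rule norm_herm_le)
      also have "\<dots> \<le> ((EE A / sqrt (P ?x) / sqrt cm) * \<phi> t) * ((EE A / sqrt (P ?x) / sqrt cm) * A)"
        by (intro mult_mono v[OF t] disp t1 mult_nonneg_nonneg K0 \<phi>0) simp
      finally show "norm (herm ?v (\<gamma> t - \<gamma> 0)) \<le> ((EE A / sqrt (P ?x) / sqrt cm) * \<phi> t) * ((EE A / sqrt (P ?x) / sqrt cm) * A)" .
    qed
    also have "\<dots> = (EE A * hh ?x + (EE A)\<^sup>2 * A / sqrt cm * (1 / P ?x)) * (\<phi> t / sqrt cm)"
    proof -
      have "sqrt (P ?x) * sqrt (P ?x) = P ?x" using Px by simp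
      then have "1 / P ?x = 1 / sqrt (P ?x) * (1 / sqrt (P ?x))" by simp
      then show ?thesis by (simp add: power2_eq_square algebra_simps)
    qed
    also have "\<dots> \<le> (EE A * hh ?x + (EE A)\<^sup>2 * A / sqrt cm * (sqrt C2 * hh ?x)) * (\<phi> t / sqrt cm)"
      using \<phi>0 sc A by (intro mult_right_mono add_left_mono mult_left_mono inverse_P_le) auto
    also have "EE A * hh ?x + (EE A)\<^sup>2 * A / sqrt cm * (sqrt C2 * hh ?x) = (EE A + (EE A)\<^sup>2 * A * sqrt C2 / sqrt cm) * hh ?x"
      by (simp add: distrib_right)
    also have "\<dots> * (\<phi> t / sqrt cm) = Kh * \<phi> t" by (simp add: Kh_def)
    finally show "norm (herm ?v (\<gamma> 0)) \<le> Kh * \<phi> t" .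
  qed auto
  then show "norm (herm (\<gamma> 1 - \<gamma> 0) (\<gamma> 0)) \<le> tt A * hh ?x"
    by (simp add: Kh_def tt_def mult.commute mult.left_commute)
qed

lemma bd_less_curve:
  assumes "bd z w < ennreal A"
  obtains \<gamma> S \<phi> where "\<gamma> 0 = z" "\<gamma> 1 = w" "curve_data \<gamma> S \<phi> A"
proof -
  obtain \<gamma> where g: "\<gamma> piecewise_C1_differentiable_on {0..1}" "\<gamma> 0 = z" "\<gamma> 1 = w"
    "(\<integral>\<^sup>+t\<in>{0..1}. ennreal (bm (\<gamma> t) (vector_derivative \<gamma> (at t))) \<partial>lborel) < ennreal A"
    using assms unfolding bergman_dist_def INF_less_iff by auto
  have A: "A > 0" using assms by (metis ennreal_less_zero_iff le_less_trans zero_le)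
  show ?thesis
  proof (rule curve_speed[OF g(1)])
    fix S \<phi>
    assume "finite S" "continuous_on {0..1} \<gamma>"
      "\<And>t. t \<in> {0<..<1} - S \<Longrightarrow> (\<gamma> has_vector_derivative vector_derivative \<gamma> (at t)) (at t)"
      "\<phi> \<in> borel_measurable borel" "\<And>t. \<phi> t \<ge> 0"
      "\<And>t. t \<in> {0<..<1} - S \<Longrightarrow> \<phi> t = bm (\<gamma> t) (vector_derivative \<gamma> (at t))"
      "(\<integral>\<^sup>+t\<in>{0..1}. ennreal (bm (\<gamma> t) (vector_derivative \<gamma> (at t))) \<partial>lborel) = (\<integral>\<^sup>+t. ennreal (\<phi> t) \<partial>lborel)"
    then have "curve_data \<gamma> S \<phi> A" using g(4) A unfolding curve_data_def by (auto simp: less_imp_le)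
    then show ?thesis using that g(2,3) by blast
  qed
qed

lemma bb_comparable:
  assumes "w \<in> bb z A"
  defines "x \<equiv> (norm z)\<^sup>2" and "y \<equiv> (norm w)\<^sup>2"
  shows "Q y \<le> EE A * Q x \<and> Q x \<le> EE A * Q y" "P y \<le> EE A * P x \<and> P x \<le> EE A * P y"
proof -
  have "bd z w < ennreal A" using assms(1) by (simp add: bergman_ball_def)
  then obtain \<gamma> S \<phi> where g: "\<gamma> 0 = z" "\<gamma> 1 = w" "curve_data \<gamma> S \<phi> A"
    by (rule bd_less_curve)
  show "Q y \<le> EE A * Q x \<and> Q x \<le> EE A * Q y" "P y \<le> EE A * P x \<and> P x \<le> EE A * P y"
    using curve_comparable(1,2)[OF g(3), of 1] g(1,2) by (auto simp: x_def y_def)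
qed

lemma bb_subset_ell:
  assumes "A > 0" shows "bb z A \<subseteq> ell z (Kell * tt A)"
proof
  fix w assume "w \<in> bb z A"
  then have "bd z w < ennreal A" by (simp add: bergman_ball_def)
  then obtain \<gamma> S \<phi> where g: "\<gamma> 0 = z" "\<gamma> 1 = w" "curve_data \<gamma> S \<phi> A"
    by (rule bd_less_curve)
  have t0: "tt A > 0"
    unfolding tt_def using assms cm C2_pos EE_ge_1[of A] by (intro mult_pos_pos divide_pos_pos add_pos_nonneg) auto
  have "norm (w - z) \<le> tt A / sqrt (P ((norm z)\<^sup>2))" "norm (herm (w - z) z) \<le> tt A * hh ((norm z)\<^sup>2)"
    using curve_displacement[OF g(3)] g(1,2) by auto
  then obtain u where "w - z = Tmap z u" "norm u < Kell * tt A"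
    using Tmap_surj_bound[OF _ _ t0, of "w - z" z] by blast
  then have "w = z + Tmap z u" "norm u < Kell * tt A" by (auto simp: algebra_simps)
  then show "w \<in> ell z (Kell * tt A)" using ell_iff by blast
qed

section \<open>Ellipsoids inside Bergman balls\<close>

definition Kb :: real where "Kb = sqrt CM * sqrt (2 + 8 * C4 * (1 + sqrt C2)\<^sup>2)"

lemma Kb_pos: "Kb > 0"
  unfolding Kb_def using CM C4_pos by (intro mult_pos_pos) (auto simp: add_pos_nonneg)

lemma bd_le_segment:
  fixes z d :: "complex ^ 'n"
  assumes "\<And>t. 0 \<le> t \<Longrightarrow> t \<le> 1 \<Longrightarrow> bm (z + t *\<^sub>R d) d \<le> B"
  shows "bd z (z + d) \<le> ennreal B"
proof -
  define \<gamma> where "\<gamma> t = z + t *\<^sub>R d" for t :: real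
  have d: "(\<gamma> has_vector_derivative d) (at t)" for t
    unfolding \<gamma>_def by (auto intro!: derivative_eq_intros)
  have g01: "\<gamma> 0 = z" "\<gamma> 1 = z + d" by (auto simp: \<gamma>_def)
  from d have C1: "\<gamma> C1_differentiable_on {0..1}"
    unfolding C1_differentiable_on_def by (intro exI[of _ "\<lambda>_. d"]) auto
  have "bd z (z + d) \<le> (\<integral>\<^sup>+t\<in>{0..1}. ennreal (bm (\<gamma> t) (vector_derivative \<gamma> (at t))) \<partial>lborel)"
    unfolding bergman_dist_def
    by (rule INF_lower) (simp add: C1_differentiable_imp_piecewise[OF C1] g01)
  also have "\<dots> \<le> (\<integral>\<^sup>+t. ennreal B * indicator {0..1::real} t \<partial>lborel)"
    using assms vector_derivative_at[OF d]
    by (intro nn_integral_mono) (auto simp: \<gamma>_def indicator_def intro!: ennreal_leI)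
  also have "\<dots> = ennreal B" by (subst nn_integral_cmult_indicator) auto
  finally show ?thesis .
qed

text \<open>The straight segment stays in the ellipsoid, where P, Q and 1 + x have changed by
  bounded factors, so its speed in the model metric is O(|u|).\<close>

lemma bd_Tmap_le:
  assumes u: "norm u \<le> eps1"
  shows "bd z (z + Tmap z u) \<le> ennreal (Kb * norm u)"
proof (rule bd_le_segment)
  fix t :: real assume t: "0 \<le> t" "t \<le> 1"
  let ?x = "(norm z)\<^sup>2" and ?d = "Tmap z u"
  let ?y = "(norm (z + t *\<^sub>R ?d))\<^sup>2"
  have td: "t *\<^sub>R ?d = Tmap z (t *\<^sub>R u)" by (simp add: linear_cmul[OF linear_Tmap])
  have tu: "norm (t *\<^sub>R u) \<le> eps1"
    using u t eps1(1) mult_mono[of t 1 "norm u" eps1] by simp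
  have near: "\<bar>?y - ?x\<bar> \<le> e0 * hh ?x" unfolding td by (rule norm_squared_ell(2)[OF tu])
  have x: "?x \<ge> 0" and y: "?y \<ge> 0" by auto
  have h: "hh ?x > 0" by (rule hh_pos[OF x])
  have u1: "norm u \<le> 1" using u eps1(2) by simp
  have 1: "P ?y * (norm ?d)\<^sup>2 \<le> 2 * (norm u)\<^sup>2"
  proof -
    have "P ?y * (norm ?d)\<^sup>2 \<le> (2 * P ?x) * ((norm u)\<^sup>2 / P ?x)"
      using P_near[OF x y near] P_pos[OF x] P_pos[OF y] by (intro mult_mono norm_Tmap_squared_le) auto
    then show ?thesis using P_pos[OF x] by simp
  qed
  have Ry: "R ?y \<le> 8 * C4 / (hh ?x)\<^sup>2"
  proof -
    have "R ?y \<le> C4 * Q ?y / (1 + ?y)" 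
      using R_le_Q[OF y] add_pos_nonneg[OF zero_less_one y] by (simp add: pos_le_divide_eq mult.commute)
    also have "\<dots> \<le> (C4 * (4 * Q ?x)) / ((1 + ?x) / 2)"
      using Q_near[OF x y near] one_plus_near[OF x y near] C4_pos Q_pos[OF x] x
      by (intro frac_le mult_left_mono) (auto simp: add_pos_nonneg)
    also have "\<dots> = 8 * C4 / (hh ?x)\<^sup>2" using Q_pos[OF x] by (simp add: hh_squared)
    finally show ?thesis .
  qed
  have hz: "norm (herm ?d (z + t *\<^sub>R ?d)) \<le> (1 + sqrt C2) * hh ?x * norm u"
  proof -
    have "norm (herm ?d (z + t *\<^sub>R ?d)) \<le> norm (herm ?d z) + norm (herm ?d (t *\<^sub>R ?d))"
      unfolding herm_add_right by (rule norm_triangle_ineq)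
    also have "norm (herm ?d (t *\<^sub>R ?d)) = t * (norm ?d)\<^sup>2"
      using t by (simp add: herm_scaleR_right herm_self norm_mult norm_power)
    also have "\<dots> \<le> 1 * ((norm u)\<^sup>2 / P ?x)" using t by (intro mult_mono norm_Tmap_squared_le) auto
    also have "\<dots> = (norm u * norm u) * (1 / P ?x)" by (simp add: power2_eq_square)
    also have "\<dots> \<le> (norm u * 1) * (sqrt C2 * hh ?x)"
      using u1 P_pos[OF x] by (intro mult_mono mult_left_mono inverse_P_le x) (auto simp: less_imp_le)
    finally show ?thesis using norm_herm_Tmap_le[of z u] by (simp add: algebra_simps)
  qed
  have 2: "R ?y * (norm (herm ?d (z + t *\<^sub>R ?d)))\<^sup>2 \<le> 8 * C4 * (1 + sqrt C2)\<^sup>2 * (norm u)\<^sup>2"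
  proof -
    have "R ?y * (norm (herm ?d (z + t *\<^sub>R ?d)))\<^sup>2 \<le> (8 * C4 / (hh ?x)\<^sup>2) * ((1 + sqrt C2) * hh ?x * norm u)\<^sup>2"
      using Ry R_nonneg[OF y] C4_pos by (intro mult_mono power_mono hz) auto
    then show ?thesis using h by (simp add: power_mult_distrib)
  qed
  have "(gm (z + t *\<^sub>R ?d) ?d)\<^sup>2 \<le> (2 + 8 * C4 * (1 + sqrt C2)\<^sup>2) * (norm u)\<^sup>2"
    unfolding gm_squared using 1 2 by (simp add: algebra_simps)
  then have "gm (z + t *\<^sub>R ?d) ?d \<le> sqrt ((2 + 8 * C4 * (1 + sqrt C2)\<^sup>2) * (norm u)\<^sup>2)"
    by (rule real_le_rsqrt)
  also have "\<dots> = sqrt (2 + 8 * C4 * (1 + sqrt C2)\<^sup>2) * norm u" by (simp add: real_sqrt_mult)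
  finally have "sqrt CM * gm (z + t *\<^sub>R ?d) ?d \<le> Kb * norm u"
    unfolding Kb_def using CM by (simp add: mult.assoc mult_left_mono)
  then show "bm (z + t *\<^sub>R ?d) ?d \<le> Kb * norm u" using bm_le_gm[of "z + t *\<^sub>R ?d" ?d] by simp
qed

lemma ell_subset_bb:
  assumes "0 < e" "e \<le> eps1" "Kb * e \<le> A" shows "ell z e \<subseteq> bb z A"
proof
  fix w assume "w \<in> ell z e"
  then obtain u where u: "w = z + Tmap z u" "norm u < e" by (auto simp: ell_def)
  have "bd z w \<le> ennreal (Kb * norm u)" unfolding u(1) by (rule bd_Tmap_le) (use u(2) assms in simp)
  also have "\<dots> < ennreal A"
  proof (rule ennreal_lessI)
    have "Kb * norm u < Kb * e" using u(2) Kb_pos by simp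
    then show "Kb * norm u < A" using assms(3) by simp
    show "A > 0" using assms Kb_pos by (smt (verit) mult_pos_pos)
  qed
  finally show "w \<in> bb z A" by (simp add: bergman_ball_def)
qed

lemma bd_finite: "bd z w < \<infinity>"
proof -
  let ?d = "w - z" and ?M = "(norm z + norm (w - z))\<^sup>2"
  define B where "B = sqrt CM * sqrt (P ?M * (norm ?d)\<^sup>2 + R ?M * (norm ?d * (norm z + norm ?d))\<^sup>2)"
  have "bd z (z + ?d) \<le> ennreal B"
  proof (rule bd_le_segment)
    fix t :: real assume t: "0 \<le> t" "t \<le> 1"
    have n: "norm (z + t *\<^sub>R ?d) \<le> norm z + norm ?d"
      using norm_triangle_ineq[of z "t *\<^sub>R ?d"] t mult_right_mono[of t 1 "norm ?d"] by simp
    then have n2: "(norm (z + t *\<^sub>R ?d))\<^sup>2 \<le> ?M" by (rule power_mono) simp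
    have "gm (z + t *\<^sub>R ?d) ?d \<le> sqrt (P ?M * (norm ?d)\<^sup>2 + R ?M * (norm ?d * (norm z + norm ?d))\<^sup>2)"
      unfolding gm_def
    proof (intro real_sqrt_le_mono add_mono mult_mono power_mono)
      show "P ((norm (z + t *\<^sub>R ?d))\<^sup>2) \<le> P ?M" by (rule P_mono[OF _ n2]) simp
      show "R ((norm (z + t *\<^sub>R ?d))\<^sup>2) \<le> R ?M" by (rule R_mono[OF _ n2]) simp
      show "norm (herm ?d (z + t *\<^sub>R ?d)) \<le> norm ?d * (norm z + norm ?d)"
        using norm_herm_le[of ?d "z + t *\<^sub>R ?d"] mult_left_mono[OF n, of "norm ?d"] by simp
    qed (use P_pos[of ?M] R_nonneg[of ?M] in \<open>auto simp: less_imp_le\<close>)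
    then have "sqrt CM * gm (z + t *\<^sub>R ?d) ?d \<le> B" unfolding B_def using CM by (intro mult_left_mono) auto
    then show "bm (z + t *\<^sub>R ?d) ?d \<le> B" using bm_le_gm[of "z + t *\<^sub>R ?d" ?d] by simp
  qed
  then show ?thesis using le_less_trans[of "bd z w" "ennreal B" \<infinity>] by simp
qed

section \<open>Metric properties of Bergman balls\<close>

definition len :: "(real \<Rightarrow> complex ^ 'n) \<Rightarrow> ennreal"
  where "len \<gamma> = (\<integral>\<^sup>+t\<in>{0..1}. ennreal (bm (\<gamma> t) (vector_derivative \<gamma> (at t))) \<partial>lborel)"

lemma len_reverse_le:
  assumes g: "\<gamma> piecewise_C1_differentiable_on {0..1}"
  shows "len (reversepath \<gamma>) \<le> len \<gamma>"
proof (rule curve_speed[OF g])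
  fix S \<phi>
  assume S: "finite S"
    "\<And>t. t \<in> {0<..<1} - S \<Longrightarrow> (\<gamma> has_vector_derivative vector_derivative \<gamma> (at t)) (at t)"
    "\<phi> \<in> borel_measurable borel" "\<And>t. \<phi> t \<ge> 0"
    "\<And>t. t \<in> {0<..<1} - S \<Longrightarrow> \<phi> t = bm (\<gamma> t) (vector_derivative \<gamma> (at t))"
    "(\<integral>\<^sup>+t\<in>{0..1}. ennreal (bm (\<gamma> t) (vector_derivative \<gamma> (at t))) \<partial>lborel) = (\<integral>\<^sup>+t. ennreal (\<phi> t) \<partial>lborel)"
  note [measurable] = S(3)
  have "finite (insert 0 (insert 1 ((\<lambda>s. 1 - s) ` S)))" using S(1) by simp
  then have AE: "AE t in lborel. t \<notin> insert 0 (insert 1 ((\<lambda>s. 1 - s) ` S))"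
    by (intro AE_not_in finite_imp_null_set_lborel)
  have "len (reversepath \<gamma>) \<le> (\<integral>\<^sup>+t. ennreal (\<phi> (1 + (-1) * t)) \<partial>lborel)"
    unfolding len_def
  proof (rule nn_integral_mono_AE)
    show "AE t in lborel. ennreal (bm (reversepath \<gamma> t) (vector_derivative (reversepath \<gamma>) (at t))) * indicator {0..1} t
      \<le> ennreal (\<phi> (1 + (-1) * t))"
      using AE
    proof eventually_elim
      case (elim t)
      show ?case
      proof (cases "t \<in> {0..1}")
        case True
        have "1 - t \<notin> S"
        proof
          assume "1 - t \<in> S"
          then have "1 - (1 - t) \<in> (\<lambda>s. 1 - s) ` S" by (rule imageI)
          then show False using elim by simp
        qed
        then have t: "1 - t \<in> {0<..<1} - S" using elim True by auto
        have d1: "((\<lambda>t. 1 - t) has_vector_derivative (- 1)) (at t)" by (auto intro!: derivative_eq_intros)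
        have "((\<lambda>t. \<gamma> (1 - t)) has_vector_derivative (- 1) *\<^sub>R vector_derivative \<gamma> (at (1 - t))) (at t)"
          using vector_diff_chain_at[OF d1 S(2)[OF t]] by (simp add: o_def)
        then have "vector_derivative (reversepath \<gamma>) (at t) = (- 1) *\<^sub>R vector_derivative \<gamma> (at (1 - t))"
          unfolding reversepath_def by (rule vector_derivative_at)
        then have "bm (reversepath \<gamma> t) (vector_derivative (reversepath \<gamma>) (at t)) = \<phi> (1 - t)"
          using S(5)[OF t] by (simp only: bm_scale) (simp add: reversepath_def)
        then show ?thesis using True by simp
      qed simp
    qed
  qed
  also have "\<dots> = (\<integral>\<^sup>+t. ennreal (\<phi> t) \<partial>lborel)"
    using nn_integral_real_affine[of "\<lambda>t. ennreal (\<phi> t)" "-1" 1] by simp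
  also have "\<dots> = len \<gamma>" using S(6) by (simp add: len_def)
  finally show ?thesis .
qed

lemma len_join_le:
  assumes g1: "\<gamma>1 piecewise_C1_differentiable_on {0..1}" and g2: "\<gamma>2 piecewise_C1_differentiable_on {0..1}"
  shows "len (\<gamma>1 +++ \<gamma>2) \<le> len \<gamma>1 + len \<gamma>2"
proof (rule curve_speed[OF g1], rule curve_speed[OF g2])
  fix S1 S2 \<phi>1 \<phi>2
  assume S: "finite S1"
    "\<And>t. t \<in> {0<..<1} - S1 \<Longrightarrow> (\<gamma>1 has_vector_derivative vector_derivative \<gamma>1 (at t)) (at t)"
    "\<phi>1 \<in> borel_measurable borel" "\<And>t. \<phi>1 t \<ge> 0"
    "\<And>t. t \<in> {0<..<1} - S1 \<Longrightarrow> \<phi>1 t = bm (\<gamma>1 t) (vector_derivative \<gamma>1 (at t))"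
    "(\<integral>\<^sup>+t\<in>{0..1}. ennreal (bm (\<gamma>1 t) (vector_derivative \<gamma>1 (at t))) \<partial>lborel) = (\<integral>\<^sup>+t. ennreal (\<phi>1 t) \<partial>lborel)"
    and S': "finite S2"
    "\<And>t. t \<in> {0<..<1} - S2 \<Longrightarrow> (\<gamma>2 has_vector_derivative vector_derivative \<gamma>2 (at t)) (at t)"
    "\<phi>2 \<in> borel_measurable borel" "\<And>t. \<phi>2 t \<ge> 0"
    "\<And>t. t \<in> {0<..<1} - S2 \<Longrightarrow> \<phi>2 t = bm (\<gamma>2 t) (vector_derivative \<gamma>2 (at t))"
    "(\<integral>\<^sup>+t\<in>{0..1}. ennreal (bm (\<gamma>2 t) (vector_derivative \<gamma>2 (at t))) \<partial>lborel) = (\<integral>\<^sup>+t. ennreal (\<phi>2 t) \<partial>lborel)"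
  note [measurable] = S(3) S'(3)
  \<comment> \<open>The endpoints, the junction and the reparametrised exceptional points;
    discarding them costs only a null set.\<close>
  let ?E = "{0, 1/2, 1} \<union> (\<lambda>s. s / 2) ` S1 \<union> (\<lambda>s. (s + 1) / 2) ` S2"
  have "finite ?E" using S(1) S'(1) by simp
  then have AE: "AE t in lborel. t \<notin> ?E"
    by (intro AE_not_in finite_imp_null_set_lborel)
  let ?g = "\<gamma>1 +++ \<gamma>2"
  have "len ?g \<le> (\<integral>\<^sup>+t. 2 * ennreal (\<phi>1 (0 + 2 * t)) + 2 * ennreal (\<phi>2 (- 1 + 2 * t)) \<partial>lborel)"
    unfolding len_def
  proof (rule nn_integral_mono_AE)
    show "AE t in lborel. ennreal (bm (?g t) (vector_derivative ?g (at t))) * indicator {0..1} t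
      \<le> 2 * ennreal (\<phi>1 (0 + 2 * t)) + 2 * ennreal (\<phi>2 (- 1 + 2 * t))"
      using AE
    proof eventually_elim
      case (elim t)
      consider "t \<notin> {0..1}" | "t \<in> {0..1}" "t < 1/2" | "t \<in> {0..1}" "t > 1/2" using elim by force
      then show ?case
      proof cases
        case 1
        then show ?thesis by simp
      next
        case 2
        have "2 * t \<notin> S1"
        proof
          assume "2 * t \<in> S1"
          then have "2 * t / 2 \<in> (\<lambda>s. s / 2) ` S1" by (rule imageI)
          then show False using elim by simp
        qed
        then have t: "2 * t \<in> {0<..<1} - S1" using elim 2 by auto
        have d1: "((\<lambda>t. 2 * t) has_vector_derivative (2)) (at t)" by (auto intro!: derivative_eq_intros)
        have "((\<lambda>t. \<gamma>1 (2 * t)) has_vector_derivative 2 *\<^sub>R vector_derivative \<gamma>1 (at (2 * t))) (at t)"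
          using vector_diff_chain_at[OF d1 S(2)[OF t]] by (simp add: o_def)
        then have "(?g has_vector_derivative 2 *\<^sub>R vector_derivative \<gamma>1 (at (2 * t))) (at t)"
          by (rule has_vector_derivative_transform_within_open[where S = "{..<1/2}"]) (use 2 in \<open>auto simp: joinpaths_def\<close>)
        then have vd: "vector_derivative ?g (at t) = 2 *\<^sub>R vector_derivative \<gamma>1 (at (2 * t))" by (rule vector_derivative_at)
        have "?g t = \<gamma>1 (2 * t)" using 2 by (simp add: joinpaths_def)
        then have "bm (?g t) (vector_derivative ?g (at t)) = 2 * \<phi>1 (2 * t)"
          unfolding vd bm_scale S(5)[OF t] by simp
        then have "ennreal (bm (?g t) (vector_derivative ?g (at t))) * indicator {0..1} t = 2 * ennreal (\<phi>1 (0 + 2 * t))"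
          using 2 S(4) by (simp add: ennreal_mult)
        then show ?thesis by simp
      next
        case 3
        have "2 * t - 1 \<notin> S2"
        proof
          assume "2 * t - 1 \<in> S2"
          then have "(2 * t - 1 + 1) / 2 \<in> (\<lambda>s. (s + 1) / 2) ` S2" by (rule imageI)
          then show False using elim by simp
        qed
        then have t: "2 * t - 1 \<in> {0<..<1} - S2" using elim 3 by auto
        have d1: "((\<lambda>t. 2 * t - 1) has_vector_derivative (2)) (at t)" by (auto intro!: derivative_eq_intros)
        have "((\<lambda>t. \<gamma>2 (2 * t - 1)) has_vector_derivative 2 *\<^sub>R vector_derivative \<gamma>2 (at (2 * t - 1))) (at t)"
          using vector_diff_chain_at[OF d1 S'(2)[OF t]] by (simp add: o_def)
        then have "(?g has_vector_derivative 2 *\<^sub>R vector_derivative \<gamma>2 (at (2 * t - 1))) (at t)"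
          by (rule has_vector_derivative_transform_within_open[where S = "{1/2<..}"]) (use 3 in \<open>auto simp: joinpaths_def\<close>)
        then have vd: "vector_derivative ?g (at t) = 2 *\<^sub>R vector_derivative \<gamma>2 (at (2 * t - 1))" by (rule vector_derivative_at)
        have "?g t = \<gamma>2 (2 * t - 1)" using 3 by (simp add: joinpaths_def)
        then have "bm (?g t) (vector_derivative ?g (at t)) = 2 * \<phi>2 (2 * t - 1)"
          unfolding vd bm_scale S'(5)[OF t] by simp
        then have "ennreal (bm (?g t) (vector_derivative ?g (at t))) * indicator {0..1} t = 2 * ennreal (\<phi>2 (- 1 + 2 * t))"
          using 3 S'(4) by (simp add: ennreal_mult)
        then show ?thesis by simp
      qed
    qed
  qed
  also have "\<dots> = (\<integral>\<^sup>+t. 2 * ennreal (\<phi>1 (0 + 2 * t)) \<partial>lborel) + (\<integral>\<^sup>+t. 2 * ennreal (\<phi>2 (- 1 + 2 * t)) \<partial>lborel)"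
    by (rule nn_integral_add) auto
  also have "(\<integral>\<^sup>+t. 2 * ennreal (\<phi>1 (0 + 2 * t)) \<partial>lborel) = (\<integral>\<^sup>+t. ennreal (\<phi>1 t) \<partial>lborel)"
    using nn_integral_real_affine[of "\<lambda>t. ennreal (\<phi>1 t)" 2 0] by (simp add: nn_integral_cmult)
  also have "(\<integral>\<^sup>+t. 2 * ennreal (\<phi>2 (- 1 + 2 * t)) \<partial>lborel) = (\<integral>\<^sup>+t. ennreal (\<phi>2 t) \<partial>lborel)"
    using nn_integral_real_affine[of "\<lambda>t. ennreal (\<phi>2 t)" 2 "- 1"] by (simp add: nn_integral_cmult)
  finally show ?thesis using S(6) S'(6) by (simp add: len_def)
qed

lemma bb_iff_curve:
  "w \<in> bb z a \<longleftrightarrow> (\<exists>\<gamma>. \<gamma> piecewise_C1_differentiable_on {0..1} \<and> \<gamma> 0 = z \<and> \<gamma> 1 = w \<and> len \<gamma> < ennreal a)"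
  unfolding bergman_ball_def bergman_dist_def len_def[symmetric] by (auto simp: INF_less_iff)

lemma bb_sym: "w \<in> bb z a \<Longrightarrow> z \<in> bb w a"
proof -
  assume "w \<in> bb z a"
  then obtain \<gamma> where g: "\<gamma> piecewise_C1_differentiable_on {0..1}" "\<gamma> 0 = z" "\<gamma> 1 = w" "len \<gamma> < ennreal a"
    unfolding bb_iff_curve by blast
  have "reversepath \<gamma> piecewise_C1_differentiable_on {0..1}"
    using valid_path_imp_reverse[of \<gamma>] g(1) by (simp add: valid_path_def)
  moreover have "reversepath \<gamma> 0 = w" "reversepath \<gamma> 1 = z" using g by (auto simp: reversepath_def)
  moreover have "len (reversepath \<gamma>) < ennreal a" using len_reverse_le[OF g(1)] g(4) by (rule le_less_trans)
  ultimately show ?thesis unfolding bb_iff_curve by blast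
qed

lemma bb_triangle: "w \<in> bb z a \<Longrightarrow> v \<in> bb w b \<Longrightarrow> v \<in> bb z (a + b)"
proof -
  assume "w \<in> bb z a" "v \<in> bb w b"
  then obtain \<gamma> \<delta> where g: "\<gamma> piecewise_C1_differentiable_on {0..1}" "\<gamma> 0 = z" "\<gamma> 1 = w" "len \<gamma> < ennreal a"
    and d: "\<delta> piecewise_C1_differentiable_on {0..1}" "\<delta> 0 = w" "\<delta> 1 = v" "len \<delta> < ennreal b"
    unfolding bb_iff_curve by blast
  have "(\<gamma> +++ \<delta>) piecewise_C1_differentiable_on {0..1}"
    using valid_path_join[of \<gamma> \<delta>] g d by (simp add: valid_path_def pathfinish_def pathstart_def)
  moreover have "(\<gamma> +++ \<delta>) 0 = z" "(\<gamma> +++ \<delta>) 1 = v" using g d by (auto simp: joinpaths_def)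
  moreover have "len (\<gamma> +++ \<delta>) < ennreal (a + b)"
  proof -
    obtain r where r: "len \<gamma> = ennreal r" "r \<ge> 0" using g(4) by (cases "len \<gamma>") auto
    obtain s where s: "len \<delta> = ennreal s" "s \<ge> 0" using d(4) by (cases "len \<delta>") auto
    have "r < a" "s < b" using g(4) d(4) r s by (auto simp: ennreal_less_iff)
    then have "ennreal r + ennreal s < ennreal (a + b)"
      using r(2) s(2) by (simp add: ennreal_less_iff flip: ennreal_plus)
    then show ?thesis using len_join_le[OF g(1) d(1)] r s by (simp add: le_less_trans)
  qed
  ultimately show ?thesis unfolding bb_iff_curve by blast
qed

lemma bb_mono: "a \<le> b \<Longrightarrow> bb z a \<subseteq> bb z b"
  by (auto simp: bergman_ball_def intro: order.strict_trans2 ennreal_leI)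

lemma bb_center: "a > 0 \<Longrightarrow> z \<in> bb z a"
proof -
  assume a: "a > 0"
  have "bd z (z + Tmap z 0) \<le> ennreal (Kb * norm (0 :: complex ^ 'n))"
    by (rule bd_Tmap_le) (use eps1 in simp)
  then show ?thesis using a by (simp add: bergman_ball_def)
qed

lemma bb_shrink: assumes "w \<in> bb z a" obtains d where "d > 0" "w \<in> bb z (a - d)"
proof -
  have w: "bd z w < ennreal a" using assms by (simp add: bergman_ball_def)
  obtain r where r: "bd z w = ennreal r" "r \<ge> 0"
    using bd_finite[of z w] by (cases "bd z w") auto
  then have "r < a" using w by (simp add: ennreal_less_iff)
  then show ?thesis
    using that[of "(a - r) / 2"] r by (simp add: bergman_ball_def ennreal_less_iff field_simps)
qed

text \<open>Each point of the ball has some room left, by finiteness of the distance and strictness,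
  and a small ellipsoid, open in the Euclidean topology, fits into it.\<close>

lemma open_bb: "open (bb z a)"
proof (rule openI)
  fix w assume "w \<in> bb z a"
  then obtain d where d: "d > 0" "w \<in> bb z (a - d)" by (rule bb_shrink)
  define e where "e = min eps1 (d / Kb)"
  have e: "0 < e" "e \<le> eps1" "Kb * e \<le> d"
    using eps1(1) d(1) Kb_pos by (auto simp: e_def min_def field_simps)
  have "ell w e \<subseteq> bb w d" by (rule ell_subset_bb[OF e])
  also have "\<dots> \<subseteq> bb z a" using bb_triangle[OF d(2), of _ d] by auto
  finally have "ell w e \<subseteq> bb z a" .
  moreover have "w \<in> ell w e" using ell_iff[of w 0 e] e by simp
  ultimately show "\<exists>e>0. ball w e \<subseteq> bb z a"
    using open_ell[of w e] by (meson openE order_trans)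
qed

lemma bb_sets [measurable]: "bb z a \<in> sets borel"
  by (simp add: open_bb)

section \<open>Volumes and packing of Bergman balls\<close>

lemma vol_comparable:
  assumes "w \<in> bb z A" "A \<ge> 0"
  shows "vol w \<le> EE A ^ CARD('n) * vol z" "vol z \<le> EE A ^ CARD('n) * vol w"
proof -
  let ?x = "(norm z)\<^sup>2" and ?y = "(norm w)\<^sup>2"
  have E: "EE A \<ge> 1" by (rule EE_ge_1[OF assms(2)])
  have n: "EE A ^ CARD('n) = EE A * EE A ^ (CARD('n) - 1)"
    by (metis One_nat_def Suc_pred power_Suc zero_less_card_finite)
  have *: "VV u \<le> EE A ^ CARD('n) * VV v" if "Q u \<le> EE A * Q v" "P u \<le> EE A * P v" "u \<ge> 0" "v \<ge> 0" for u v
  proof -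
    have "VV u \<le> (EE A * Q v) * (EE A * P v) ^ (CARD('n) - 1)"
      unfolding VV_def using that E Q_pos[OF that(3)] Q_pos[OF that(4)] P_pos[OF that(3)] by (intro mult_mono power_mono) auto
    then show ?thesis unfolding n by (simp add: VV_def power_mult_distrib mult_ac)
  qed
  have a: "VV ?x \<le> EE A ^ CARD('n) * VV ?y" "VV ?y \<le> EE A ^ CARD('n) * VV ?x"
    using bb_comparable[OF assms(1)] by (auto intro!: *)
  show "vol w \<le> EE A ^ CARD('n) * vol z" "vol z \<le> EE A ^ CARD('n) * vol w"
    using a VV_pos[of ?x] VV_pos[of ?y] by (auto simp: vol_VV field_simps)
qed

definition mball :: "real \<Rightarrow> real" where "mball e = measure lborel (ball (0 :: complex ^ 'n) e)"

lemma mball_pos: "e > 0 \<Longrightarrow> mball e > 0"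
  unfolding mball_def by (rule ball_measure_pos)

text \<open>Radius of an ellipsoid that fits into the Bergman ball of radius A with the same
  centre.\<close>

definition ein :: "real \<Rightarrow> real" where "ein A = min eps1 (A / Kb)"

lemma ein: "A > 0 \<Longrightarrow> 0 < ein A" "A > 0 \<Longrightarrow> ein A \<le> eps1" "A > 0 \<Longrightarrow> Kb * ein A \<le> A"
  using eps1(1) Kb_pos by (auto simp: ein_def min_def field_simps)

lemma bb_volume_lower:
  assumes A: "A > 0"
  shows "ennreal (vol z * mball (ein A)) \<le> emeasure lborel (bb z A)"
proof -
  have "ell z (ein A) \<subseteq> bb z A" by (rule ell_subset_bb[OF ein[OF A]])
  then have "emeasure lborel (ell z (ein A)) \<le> emeasure lborel (bb z A)" by (rule emeasure_mono) simp
  then show ?thesis using emeasure_ell[of z "ein A"] by (simp add: mball_def)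
qed

lemma bb_volume_upper:
  assumes A: "A > 0"
  shows "emeasure lborel (bb z A) \<le> ennreal (vol z * mball (Kell * tt A))"
proof -
  have "emeasure lborel (bb z A) \<le> emeasure lborel (ell z (Kell * tt A))"
    by (rule emeasure_mono[OF bb_subset_ell[OF A]]) (simp add: open_ell)
  then show ?thesis using emeasure_ell[of z "Kell * tt A"] by (simp add: mball_def)
qed

lemma tt_pos: "A > 0 \<Longrightarrow> tt A > 0"
  unfolding tt_def using cm C2_pos EE_ge_1[of A] by (intro mult_pos_pos divide_pos_pos add_pos_nonneg) auto

text \<open>An upper bound for the volume of a ball of radius r + d divided by a lower bound for the
  volumes of balls of radius d centred within distance r.\<close>

definition count_bound :: "real \<Rightarrow> real \<Rightarrow> real"
  where "count_bound r d = EE r ^ CARD('n) * mball (Kell * tt (r + d)) / mball (ein d)"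

lemma disjoint_balls_count:
  assumes "S \<subseteq> bb z r" "r > 0" "d > 0" "disjoint_family_on (\<lambda>s. bb s d) S"
  shows "finite S" "real (card S) \<le> count_bound r d"
proof -
  \<comment> \<open>Finite subsets come first: their uniform bound then forces S itself to be
    finite.\<close>
  have fin: "real (card F) \<le> count_bound r d" if F: "finite F" "F \<subseteq> S" for F
  proof -
    let ?m = "mball (ein d)" and ?E = "EE r ^ CARD('n)"
    have m: "?m > 0" using mball_pos ein(1)[OF assms(3)] by simp
    have E: "?E > 0" by (simp add: EE_def)
    have "(\<Union>s\<in>F. bb s d) \<subseteq> bb z (r + d)" using F assms(1) bb_triangle by blast
    then have "emeasure lborel (\<Union>s\<in>F. bb s d) \<le> emeasure lborel (bb z (r + d))"
      by (rule emeasure_mono) simp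
    also have "\<dots> \<le> ennreal (vol z * mball (Kell * tt (r + d)))" by (rule bb_volume_upper) (use assms in simp)
    finally have 1: "emeasure lborel (\<Union>s\<in>F. bb s d) \<le> ennreal (vol z * mball (Kell * tt (r + d)))" .
    have "(\<Sum>s\<in>F. ennreal (vol z / ?E * ?m)) \<le> (\<Sum>s\<in>F. emeasure lborel (bb s d))"
    proof (rule sum_mono)
      fix s assume "s \<in> F"
      then have "vol z \<le> ?E * vol s" using F assms(1,2) by (intro vol_comparable(2)) auto
      then have "vol z / ?E * ?m \<le> vol s * ?m" using E m by (intro mult_right_mono) (auto simp: field_simps)
      then show "ennreal (vol z / ?E * ?m) \<le> emeasure lborel (bb s d)"
        using bb_volume_lower[OF assms(3), of s] by (meson ennreal_leI order_trans)
    qed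
    also have "\<dots> = emeasure lborel (\<Union>s\<in>F. bb s d)"
      by (rule sum_emeasure) (use F assms(4) in \<open>auto intro: disjoint_family_on_mono\<close>)
    also note 1
    finally have "ennreal (real (card F) * (vol z / ?E * ?m)) \<le> ennreal (vol z * mball (Kell * tt (r + d)))"
      using vol_pos[of z] E m by (simp add: ennreal_of_nat_eq_real_of_nat ennreal_mult[symmetric] less_imp_le)
    then have "real (card F) * (vol z / ?E * ?m) \<le> vol z * mball (Kell * tt (r + d))"
      using vol_pos[of z] by (subst (asm) ennreal_le_iff) (auto simp: mball_def less_imp_le)
    then have "vol z * (real (card F) * (?m / ?E)) \<le> vol z * mball (Kell * tt (r + d))" by (simp add: mult_ac)
    then have "real (card F) * (?m / ?E) \<le> mball (Kell * tt (r + d))"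
      using vol_pos[of z] by (rule mult_left_le_imp_le)
    then show ?thesis using m E by (simp add: count_bound_def field_simps)
  qed
  show f: "finite S"
  proof (rule ccontr)
    assume "infinite S"
    then obtain F where "finite F" "card F = nat \<lceil>count_bound r d\<rceil> + 1" "F \<subseteq> S"
      using infinite_arbitrarily_large by blast
    with fin[of F] show False by linarith
  qed
  show "real (card S) \<le> count_bound r d" by (rule fin[OF f]) simp
qed

lemma maximal_separated:
  assumes d: "d > 0"
  obtains S where "S \<subseteq> G" "disjoint_family_on (\<lambda>s. bb s (d / 2)) S" "G \<subseteq> (\<Union>s\<in>S. bb s d)"
proof -
  define AA where "AA = {S. S \<subseteq> G \<and> disjoint_family_on (\<lambda>s. bb s (d / 2)) S}"
  have "\<exists>M\<in>AA. \<forall>X\<in>AA. M \<subseteq> X \<longrightarrow> X = M"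
  proof (rule subset_Zorn')
    fix C assume C: "subset.chain AA C"
    then have CA: "C \<subseteq> AA" and ch: "\<And>X Y. X \<in> C \<Longrightarrow> Y \<in> C \<Longrightarrow> X \<subseteq> Y \<or> Y \<subseteq> X"
      by (auto simp: subset_chain_def)
    have "\<Union> C \<subseteq> G" using CA by (auto simp: AA_def)
    moreover have "bb s (d / 2) \<inter> bb t (d / 2) = {}" if st: "s \<in> \<Union> C" "t \<in> \<Union> C" "s \<noteq> t" for s t
    proof -
      obtain X where "X \<in> C" "s \<in> X" "t \<in> X" using st(1,2) ch by blast
      then have "disjoint_family_on (\<lambda>s. bb s (d / 2)) X" using CA by (auto simp: AA_def)
      then show ?thesis using \<open>s \<in> X\<close> \<open>t \<in> X\<close> st(3) by (rule disjoint_family_onD)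
    qed
    ultimately show "\<Union> C \<in> AA" by (auto simp: AA_def disjoint_family_on_def)
  qed
  then obtain M where M: "M \<in> AA" "\<And>X. X \<in> AA \<Longrightarrow> M \<subseteq> X \<Longrightarrow> X = M" by blast
  have "w \<in> (\<Union>s\<in>M. bb s d)" if w: "w \<in> G" for w
  proof (cases "w \<in> M")
    case True
    then show ?thesis using bb_center[OF d] by blast
  next
    case False
    then have "insert w M \<notin> AA" using M(2)[of "insert w M"] by blast
    then obtain s where s: "s \<in> M" "bb w (d / 2) \<inter> bb s (d / 2) \<noteq> {}"
      using M(1) w False unfolding AA_def disjoint_family_on_def by blast
    then obtain v where "v \<in> bb w (d / 2)" "v \<in> bb s (d / 2)" by blast
    \<comment> \<open>Two balls of radius d/2 that meet have centres at distance less than d;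
      maximality thus turns separation into covering.\<close>
    then have "w \<in> bb s (d / 2 + d / 2)" using bb_triangle bb_sym by blast
    then show ?thesis using s by auto
  qed
  then show ?thesis using that[of M] M(1) by (auto simp: AA_def)
qed

section \<open>Lower bound for the kernel near the diagonal\<close>

definition Mk :: real where "Mk = sqrt (exp C5 * Cev * (4 * 2 ^ (CARD('n) - 1)) / cF)"

lemma Mk_pos: "Mk > 0"
  unfolding Mk_def using Cev_pos cF by simp

text \<open>Cauchy-Schwarz bounds |K|^2 by the two diagonal values, and the upper and lower bounds
  of F turn them into F(x)^2, the square of the value at the centre.\<close>

lemma twist_kern_le:
  assumes u: "norm u \<le> eps1"
  shows "norm (twist z (kern z) u) \<le> Mk * FF ((norm z)\<^sup>2)"
proof -
  let ?w = "z + Tmap z u"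
  let ?x = "(norm z)\<^sup>2" and ?y = "(norm ?w)\<^sup>2"
  let ?k = "4 * 2 ^ (CARD('n) - 1) :: real"
  have x: "?x \<ge> 0" and y: "?y \<ge> 0" by auto
  have "(norm (kern z ?w))\<^sup>2 * exp (- \<Psi> ?y) \<le> (FF ?x * (Cev * exp (\<Psi> ?y) * VV ?y)) * exp (- \<Psi> ?y)"
    using kern_Cauchy_Schwarz[of z ?w] FF_le[OF y] FF_pos[OF x]
    by (intro mult_right_mono) (auto intro: order_trans mult_left_mono)
  also have "\<dots> = Cev * FF ?x * VV ?y" by (simp add: exp_minus field_simps)
  also have "\<dots> \<le> Cev * FF ?x * (?k * VV ?x)"
    using VV_near(1)[OF x y norm_squared_ell(2)[OF u]] Cev_pos FF_pos[OF x] by (intro mult_left_mono) auto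
  finally have 1: "(norm (kern z ?w))\<^sup>2 * exp (- \<Psi> ?y) \<le> Cev * FF ?x * (?k * VV ?x)" .
  have "(norm (twist z (kern z) u))\<^sup>2 \<le> exp (\<Psi> ?x + C5) * (Cev * FF ?x * (?k * VV ?x))"
    by (rule order_trans[OF norm_twist_le[OF u, of z "kern z"] mult_left_mono[OF 1]]) simp
  also have "\<dots> = exp C5 * Cev * ?k * FF ?x * (VV ?x * exp (\<Psi> ?x))" by (simp add: exp_add mult_ac)
  also have "\<dots> \<le> exp C5 * Cev * ?k * FF ?x * (FF ?x / cF)"
    using FF_lower_bound[OF x] cF Cev_pos FF_pos[OF x] by (intro mult_left_mono) (auto simp: field_simps)
  also have "\<dots> = (exp C5 * Cev * ?k / cF) * (FF ?x)\<^sup>2" by (simp add: power2_eq_square)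
  also have "\<dots> = (Mk * FF ?x)\<^sup>2"
    unfolding Mk_def power_mult_distrib using cF Cev_pos by (subst real_sqrt_pow2) auto
  finally show ?thesis
    by (rule power2_le_imp_le) (use Mk_pos FF_pos[OF x] in simp)
qed

text \<open>Cauchy's estimate for the derivative on the complex line through u, integrated from 0 to
  1.\<close>

lemma entire_Lipschitz_at_0:
  fixes g :: "complex ^ 'n \<Rightarrow> complex"
  assumes g: "entire g" and B: "\<And>u. norm u \<le> e \<Longrightarrow> norm (g u) \<le> B" and u: "norm u \<le> e / 2" and e: "e > 0"
  shows "norm (g u - g 0) \<le> 2 * B * norm u / e"
proof (cases "u = 0")
  case False
  define h where "h c = g (c *s u)" for c :: complex
  define r where "r = e / norm u / 2"
  have nu: "norm u > 0" using False by simp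
  \<comment> \<open>Discs of radius r about points of the unit disc stay within |c| \<le> 2r =
    e/|u|, where the bound B holds.\<close>
  have r: "r \<ge> 1" using u nu by (simp add: r_def field_simps)
  have hol: "h holomorphic_on UNIV" unfolding h_def by (rule entire_slice_holomorphic[OF g])
  have d: "norm (deriv h c) \<le> 2 * B * norm u / e" if c: "c \<in> cball 0 1" for c
  proof -
    have "norm ((deriv ^^ 1) h c) \<le> fact 1 * B / r ^ 1"
    proof (rule Cauchy_inequality)
      show "h holomorphic_on ball c r" "continuous_on (cball c r) h"
        using hol by (auto intro: holomorphic_on_subset holomorphic_on_imp_continuous_on)
      show "r > 0" using r by simp
      fix x assume x: "norm (c - x) = r"
      have "norm x \<le> norm c + norm (c - x)" using norm_triangle_ineq4[of c "c - x"] by simp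
      also have "\<dots> \<le> 2 * r" using c x r by simp
      finally have "norm (x *s u) \<le> e"
        using nu mult_right_mono[of "norm x" "2 * r" "norm u"] by (simp add: norm_smult r_def)
      then show "norm (h x) \<le> B" unfolding h_def by (rule B)
    qed
    then show ?thesis using nu by (simp add: r_def mult_ac)
  qed
  have "norm (h 1 - h 0) \<le> 2 * B * norm u / e * norm (1 - 0 :: complex)"
  proof (rule field_differentiable_bound[of "cball 0 1" h "deriv h"])
    fix c :: complex
    show "(h has_field_derivative deriv h c) (at c within cball 0 1)"
      using holomorphic_derivI[OF hol open_UNIV UNIV_I] by (rule has_field_derivative_at_within)
  qed (use d in auto)
  then show ?thesis by (simp add: h_def)
qed simp

text \<open>Chosen so that the twisted kernel loses at most half of its central value.\<close>

definition e2 :: real where "e2 = min (eps1 / 2) (eps1 / (4 * Mk))"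

lemma e2: "e2 > 0" "e2 \<le> eps1 / 2" "Mk * e2 \<le> eps1 / 4"
proof -
  show "e2 > 0" "e2 \<le> eps1 / 2" using eps1(1) Mk_pos by (auto simp: e2_def)
  have "e2 \<le> eps1 / (4 * Mk)" by (simp add: e2_def)
  then show "Mk * e2 \<le> eps1 / 4" using Mk_pos by (simp add: field_simps)
qed

definition ckl :: real where "ckl = cF * exp (- C5) / 4"

lemma ckl_pos: "ckl > 0" using cF by (simp add: ckl_def)

text \<open>The twisted kernel equals F(x) at the centre and keeps half of it. Undoing the twist and
  using the lower bound for F once turns F^2 e^(-\<Psi>(x)) into F/vol.\<close>

lemma kern_lower:
  assumes w: "w \<in> ell z e2"
  shows "ckl / vol z * FF ((norm z)\<^sup>2) \<le> (norm (kern z w))\<^sup>2 * exp (- \<Psi> ((norm w)\<^sup>2))"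
proof -
  let ?x = "(norm z)\<^sup>2" and ?y = "(norm w)\<^sup>2"
  obtain u where u: "w = z + Tmap z u" "norm u < e2" using w by (auto simp: ell_def)
  have x: "?x \<ge> 0" by simp
  note F = FF_pos[OF x]
  let ?g = "twist z (kern z)"
  have ue: "norm u \<le> eps1 / 2" using u(2) e2(2) by simp
  have "norm (?g u - ?g 0) \<le> 2 * (Mk * FF ?x) * norm u / eps1"
    by (rule entire_Lipschitz_at_0[OF entire_twist[OF kern_entire] twist_kern_le ue eps1(1)])
  also have "\<dots> = FF ?x * (2 * (Mk * norm u) / eps1)" by simp
  also have "\<dots> \<le> FF ?x * (1 / 2)"
  proof (rule mult_left_mono)
    have "Mk * norm u \<le> Mk * e2" using u(2) Mk_pos by simp
    then show "2 * (Mk * norm u) / eps1 \<le> 1 / 2" using e2(3) eps1(1) by (simp add: field_simps)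
  qed (use F in simp)
  finally have d: "norm (?g u - ?g 0) \<le> FF ?x / 2" by simp
  have "norm (?g 0) = FF ?x" using F by (simp add: kern_diag)
  then have "FF ?x / 2 \<le> norm (?g u)" using d norm_triangle_ineq2[of "?g 0" "?g u"] by (simp add: norm_minus_commute)
  then have "(FF ?x / 2)\<^sup>2 \<le> (norm (?g u))\<^sup>2" using F by (intro power_mono) auto
  also have "\<dots> \<le> exp (\<Psi> ?x + C5) * ((norm (kern z w))\<^sup>2 * exp (- \<Psi> ?y))"
    unfolding u(1) by (rule norm_twist_le) (use ue eps1(1) in simp)
  finally have 1: "(FF ?x / 2)\<^sup>2 \<le> exp (\<Psi> ?x + C5) * ((norm (kern z w))\<^sup>2 * exp (- \<Psi> ?y))" .
  have "cF * VV ?x * exp (\<Psi> ?x) * FF ?x \<le> FF ?x * FF ?x"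
    using FF_lower_bound[OF x] F by (intro mult_right_mono) auto
  then have "exp (\<Psi> ?x) * (exp C5 * (ckl / vol z * FF ?x)) \<le> (FF ?x / 2)\<^sup>2"
    using VV_pos[OF x] by (simp add: vol_VV ckl_def power2_eq_square exp_minus field_simps)
  then have "exp (\<Psi> ?x + C5) * (ckl / vol z * FF ?x) \<le> exp (\<Psi> ?x + C5) * ((norm (kern z w))\<^sup>2 * exp (- \<Psi> ?y))"
    using 1 by (simp add: exp_add mult.assoc)
  then show ?thesis by (rule mult_left_le_imp_le) simp
qed

section \<open>Carleson measures\<close>

text \<open>The displacement is at most linear in the length for short curves, so a sufficiently
  small Bergman ball fits into any prescribed ellipsoid.\<close>

lemma tt_le: assumes "0 < A" "A \<le> 1" shows "tt A \<le> A * tt 1"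
proof -
  have E: "EE A \<le> EE 1" using assms KL_pos by (simp add: EE_def)
  have "(EE A)\<^sup>2 * A * sqrt C2 / sqrt cm \<le> (EE 1)\<^sup>2 * 1 * sqrt C2 / sqrt cm"
    using E assms C2_pos cm by (intro divide_right_mono mult_right_mono mult_mono power_mono) (auto simp: EE_def)
  then have "A / sqrt cm * (EE A + (EE A)\<^sup>2 * A * sqrt C2 / sqrt cm) \<le> A / sqrt cm * (EE 1 + (EE 1)\<^sup>2 * 1 * sqrt C2 / sqrt cm)"
    using E assms cm by (intro mult_left_mono add_mono) auto
  then show ?thesis by (simp add: tt_def)
qed

definition d2 :: real where "d2 = min 1 (e2 / (Kell * tt 1))"

lemma d2_pos: "d2 > 0"
  using e2(1) Kell_pos tt_pos[of 1] by (simp add: d2_def)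

lemma bb_d2_subset: "bb z d2 \<subseteq> ell z e2"
proof -
  have "d2 \<le> e2 / (Kell * tt 1)" by (simp add: d2_def)
  then have "Kell * (d2 * tt 1) \<le> e2" using Kell_pos tt_pos[of 1] by (simp add: field_simps)
  moreover have "Kell * tt d2 \<le> Kell * (d2 * tt 1)"
    using Kell_pos tt_le[OF d2_pos] by (intro mult_left_mono) (auto simp: d2_def)
  ultimately have "ell z (Kell * tt d2) \<subseteq> ell z e2" by (auto simp: ell_def)
  then show ?thesis using bb_subset_ell[OF d2_pos, of z] by blast
qed

section \<open>The implications between the four conditions\<close>

lemma carleson_imp_kernel_bound:
  assumes [measurable_cong]: "sets \<nu> = sets borel" and "carleson_measure \<Psi> \<nu>"
  shows "\<exists>C>0. \<forall>z. (\<integral>\<^sup>+w. ennreal ((norm (kern z w))\<^sup>2 / FF ((norm z)\<^sup>2) * exp (- \<Psi> ((norm w)\<^sup>2))) \<partial>\<nu>) \<le> ennreal C"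
proof -
  obtain C where C: "C > 0" "\<And>f :: complex ^ 'n \<Rightarrow> complex. f \<in> fock_space \<Psi> \<Longrightarrow>
    (\<integral>\<^sup>+z. ennreal ((norm (f z))\<^sup>2 * exp (- \<Psi> ((norm z)\<^sup>2))) \<partial>\<nu>) \<le> ennreal C * (\<integral>\<^sup>+z. ennreal ((norm (f z))\<^sup>2) \<partial>mu)"
    using assms(2) unfolding carleson_measure_def by blast
  have "(\<integral>\<^sup>+w. ennreal ((norm (kern z w))\<^sup>2 / FF ((norm z)\<^sup>2) * exp (- \<Psi> ((norm w)\<^sup>2))) \<partial>\<nu>) \<le> ennreal C" for z
  proof -
    let ?F = "FF ((norm z)\<^sup>2)"
    have F: "?F > 0" by (rule FF_pos) simp
    have "(\<integral>\<^sup>+w. ennreal ((norm (kern z w))\<^sup>2 / ?F * exp (- \<Psi> ((norm w)\<^sup>2))) \<partial>\<nu>)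
      = (\<integral>\<^sup>+w. ennreal (1 / ?F) * ennreal ((norm (kern z w))\<^sup>2 * exp (- \<Psi> ((norm w)\<^sup>2))) \<partial>\<nu>)"
      using F by (intro nn_integral_cong) (simp add: ennreal_mult[symmetric])
    also have "\<dots> = ennreal (1 / ?F) * (\<integral>\<^sup>+w. ennreal ((norm (kern z w))\<^sup>2 * exp (- \<Psi> ((norm w)\<^sup>2))) \<partial>\<nu>)"
      by (rule nn_integral_cmult) measurable
    also have "\<dots> \<le> ennreal (1 / ?F) * (ennreal C * ennreal ?F)"
      by (intro mult_left_mono order_trans[OF C(2)[OF kern_in_fock[of z]]] kern_nsq[of z, unfolded nsq_def]) auto
    also have "\<dots> = ennreal C" using F C(1) by (simp add: ennreal_mult[symmetric])
    finally show ?thesis .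
  qed
  then show ?thesis using C(1) by blast
qed

lemma kernel_bound_imp_small_balls:
  assumes sets [measurable_cong]: "sets \<nu> = sets borel" and C: "C > 0"
    and "(\<integral>\<^sup>+w. ennreal ((norm (kern z w))\<^sup>2 / FF ((norm z)\<^sup>2) * exp (- \<Psi> ((norm w)\<^sup>2))) \<partial>\<nu>) \<le> ennreal C"
  shows "emeasure \<nu> (bb z d2) \<le> ennreal (C / ckl * vol z)"
proof -
  let ?F = "FF ((norm z)\<^sup>2)"
  have F: "?F > 0" by (rule FF_pos) simp
  have v: "vol z > 0" by (rule vol_pos)
  have "ennreal (ckl / vol z) * emeasure \<nu> (bb z d2) = (\<integral>\<^sup>+w. ennreal (ckl / vol z) * indicator (bb z d2) w \<partial>\<nu>)"
    by (rule nn_integral_cmult_indicator[symmetric]) (simp add: sets)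
  also have "\<dots> \<le> (\<integral>\<^sup>+w. ennreal ((norm (kern z w))\<^sup>2 / ?F * exp (- \<Psi> ((norm w)\<^sup>2))) \<partial>\<nu>)"
  proof (rule nn_integral_mono)
    fix w
    have "ckl / vol z \<le> (norm (kern z w))\<^sup>2 / ?F * exp (- \<Psi> ((norm w)\<^sup>2))" if "w \<in> bb z d2"
      using kern_lower[of w z] that bb_d2_subset F by (auto simp: field_simps)
    then show "ennreal (ckl / vol z) * indicator (bb z d2) w \<le> ennreal ((norm (kern z w))\<^sup>2 / ?F * exp (- \<Psi> ((norm w)\<^sup>2)))"
      by (auto simp: indicator_def intro: ennreal_leI)
  qed
  also note assms(3)
  finally have 1: "ennreal (ckl / vol z) * emeasure \<nu> (bb z d2) \<le> ennreal C" .
  have "emeasure \<nu> (bb z d2) = ennreal (vol z / ckl) * (ennreal (ckl / vol z) * emeasure \<nu> (bb z d2))"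
    using v ckl_pos by (simp add: mult.assoc[symmetric] ennreal_mult[symmetric])
  also have "\<dots> \<le> ennreal (vol z / ckl) * ennreal C" using 1 by (rule mult_left_mono) simp
  also have "\<dots> = ennreal (C / ckl * vol z)" using v ckl_pos C by (simp add: ennreal_mult[symmetric] mult.commute)
  finally show ?thesis .
qed

text \<open>A maximal separated subset of the large ball has boundedly many points, its small balls
  cover, and all volumes inside the large ball are comparable.\<close>

lemma small_balls_imp_all_balls:
  assumes sets: "sets \<nu> = sets borel" and C: "C > 0" and d: "d > 0" and r: "r > 0"
    and small: "\<And>z. emeasure \<nu> (bb z d) \<le> ennreal (C * vol z)"
  shows "\<exists>C'>0. \<forall>z. emeasure \<nu> (bb z r) \<le> ennreal C' * emeasure lborel (bb z r)"
proof -
  let ?E = "EE r ^ CARD('n)" and ?N = "count_bound r (d / 2)" and ?m = "mball (ein r)"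
  have E: "?E > 0" by (simp add: EE_def)
  have m: "?m > 0" by (rule mball_pos[OF ein(1)[OF r]])
  define C' where "C' = \<bar>?N\<bar> * (C * ?E) / ?m + 1"
  have C': "C' > 0" unfolding C'_def using E C m by (intro add_nonneg_pos) auto
  have "emeasure \<nu> (bb z r) \<le> ennreal C' * emeasure lborel (bb z r)" for z
  proof -
    obtain S where S: "S \<subseteq> bb z r" "disjoint_family_on (\<lambda>s. bb s (d / 2)) S" "bb z r \<subseteq> (\<Union>s\<in>S. bb s d)"
      using maximal_separated[OF d] by blast
    note cnt = disjoint_balls_count[OF S(1) r _ S(2)]
    have fin: "finite S" and N: "real (card S) \<le> ?N" using cnt d by auto
    have v: "vol z > 0" by (rule vol_pos)
    have "emeasure \<nu> (bb z r) \<le> emeasure \<nu> (\<Union>s\<in>S. bb s d)"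
      by (rule emeasure_mono[OF S(3)]) (use fin in \<open>auto simp: sets intro!: sets.finite_UN\<close>)
    also have "\<dots> \<le> (\<Sum>s\<in>S. emeasure \<nu> (bb s d))"
      by (rule emeasure_subadditive_finite[OF fin]) (auto simp: sets)
    also have "\<dots> \<le> (\<Sum>s\<in>S. ennreal (C * (?E * vol z)))"
    proof (rule sum_mono)
      fix s assume "s \<in> S"
      then have "vol s \<le> ?E * vol z" using S(1) r by (intro vol_comparable(1)) auto
      then show "emeasure \<nu> (bb s d) \<le> ennreal (C * (?E * vol z))"
        using C by (intro order_trans[OF small] ennreal_leI mult_left_mono) auto
    qed
    also have "\<dots> = ennreal (real (card S) * (C * (?E * vol z)))"
      using v E C by (simp add: ennreal_of_nat_eq_real_of_nat ennreal_mult[symmetric] less_imp_le)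
    also have "\<dots> \<le> ennreal (C' * (vol z * ?m))"
    proof (rule ennreal_leI)
      have "real (card S) * (C * (?E * vol z)) \<le> \<bar>?N\<bar> * (C * (?E * vol z))"
        using N v E C by (intro mult_right_mono) auto
      also have "\<dots> = \<bar>?N\<bar> * (C * ?E) / ?m * (vol z * ?m)" using m by simp
      also have "\<dots> \<le> C' * (vol z * ?m)"
        unfolding C'_def using v m by (intro mult_right_mono) auto
      finally show "real (card S) * (C * (?E * vol z)) \<le> C' * (vol z * ?m)" .
    qed
    also have "\<dots> = ennreal C' * ennreal (vol z * ?m)" using C' v m by (intro ennreal_mult) auto
    also have "\<dots> \<le> ennreal C' * emeasure lborel (bb z r)"
      by (rule mult_left_mono[OF bb_volume_lower[OF r]]) simp
    finally show ?thesis .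
  qed
  then show ?thesis using C' by blast
qed

text \<open>The supremum is taken over a bounded set: a covering radius above twice the distance of
  the first two points would make their half balls overlap. Balls of the maximal radius therefore
  still cover.\<close>

lemma covering_radius_le_max:
  fixes a :: "nat \<Rightarrow> complex ^ 'n"
  assumes "inj a" "covering_radius \<Psi> a r"
  shows "r \<le> max_covering_radius \<Psi> a"
  unfolding max_covering_radius_def
proof (rule cSup_upper)
  show "r \<in> {r. covering_radius \<Psi> a r}" using assms(2) by simp
  obtain D where D: "bd (a 0) (a 1) = ennreal D" "D \<ge> 0"
    using bd_finite[of "a 0" "a 1"] by (cases "bd (a 0) (a 1)") auto
  have "s \<le> 2 * D" if s: "covering_radius \<Psi> a s" for s
  proof (rule ccontr)
    assume "\<not> s \<le> 2 * D"
    then have "a 1 \<in> bb (a 0) (s / 2)" using D by (simp add: bergman_ball_def ennreal_less_iff)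
    moreover have "a 1 \<in> bb (a 1) (s / 2)" using s by (intro bb_center) (simp add: covering_radius_def)
    moreover have "bb (a 0) (s / 2) \<inter> bb (a 1) (s / 2) = {}"
      using s unfolding covering_radius_def disjoint_family_on_def by simp
    ultimately show False by blast
  qed
  then show "bdd_above {r. covering_radius \<Psi> a r}" by (intro bdd_aboveI) auto
qed

text \<open>A sequence needs a countably infinite set of centres: disjoint nonempty open sets are
  countable in number, and finitely many balls of finite volume cannot cover the space.\<close>

lemma lattice_exists: "\<exists>a :: nat \<Rightarrow> complex ^ 'n. lattice_seq \<Psi> a"
proof -
  obtain S :: "(complex ^ 'n) set" where S: "disjoint_family_on (\<lambda>s. bb s (1 / 2)) S" "UNIV \<subseteq> (\<Union>s\<in>S. bb s 1)"
    using maximal_separated[of 1 UNIV] by auto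
  have inj: "inj_on (\<lambda>s. bb s (1 / 2)) S"
  proof (rule inj_onI, rule ccontr)
    fix s t assume st: "s \<in> S" "t \<in> S" "bb s (1 / 2) = bb t (1 / 2)" "s \<noteq> t"
    then have "bb s (1 / 2) \<inter> bb t (1 / 2) = {}" using S(1) by (auto dest: disjoint_family_onD)
    then show False using st(3) bb_center[of "1 / 2" s] by auto
  qed
  have "countable ((\<lambda>s. bb s (1 / 2)) ` S)"
  proof (rule countable_disjoint_open_subsets)
    show "pairwise disjnt ((\<lambda>s. bb s (1 / 2)) ` S)"
    proof (rule pairwiseI)
      fix U V assume "U \<in> (\<lambda>s. bb s (1 / 2)) ` S" "V \<in> (\<lambda>s. bb s (1 / 2)) ` S" "U \<noteq> V"
      then obtain s t where "s \<in> S" "t \<in> S" "U = bb s (1 / 2)" "V = bb t (1 / 2)" "s \<noteq> t" by blast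
      then show "disjnt U V" using disjoint_family_onD[OF S(1)] by (simp add: disjnt_def)
    qed
  qed (auto simp: open_bb)
  then have cnt: "countable S" using inj by (rule countable_image_inj_on)
  have inf: "infinite S"
  proof
    assume f: "finite S"
    have "emeasure lborel (\<Union>s\<in>S. bb s 1) \<le> (\<Sum>s\<in>S. emeasure lborel (bb s 1))"
      by (rule emeasure_subadditive_finite[OF f]) auto
    also have "\<dots> < \<infinity>"
    proof -
      have "emeasure lborel (bb s 1) < \<infinity>" for s
        using bb_volume_upper[of 1 s] by (simp add: le_less_trans)
      then show ?thesis using f by (simp add: less_top)
    qed
    finally show False using S(2) by (simp add: top.extremum_unique emeasure_lborel_UNIV)
  qed
  define a where "a = from_nat_into S"
  have bij: "bij_betw a UNIV S" unfolding a_def by (rule bij_betw_from_nat_into[OF cnt inf])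
  have aS: "range a = S" "inj a" using bij by (auto simp: bij_betw_def)
  have "(\<Union>k. bb (a k) 1) = UNIV" using S(2) aS(1) by auto
  moreover have "disjoint_family (\<lambda>k. bb (a k) (1 / 2))"
    unfolding disjoint_family_on_def
  proof (intro ballI impI)
    fix m n :: nat assume "m \<noteq> n"
    then have "a m \<noteq> a n" using aS(2) by (simp add: inj_eq)
    then show "bb (a m) (1 / 2) \<inter> bb (a n) (1 / 2) = {}" using aS(1) by (intro disjoint_family_onD[OF S(1)]) auto
  qed
  ultimately have "covering_radius \<Psi> a 1" unfolding covering_radius_def by simp
  then show ?thesis using aS(2) unfolding lattice_seq_def by blast
qed

text \<open>On each covering ball the integrand is dominated by its mean over the ball enlarged by
  1; the measure bound converts this into a Lebesgue integral, and summation costs the overlap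
  number of the enlarged balls.\<close>

lemma lattice_bound_imp_carleson:
  fixes a :: "nat \<Rightarrow> complex ^ 'n"
  defines "\<rho> \<equiv> max_covering_radius \<Psi> a"
  assumes sets [measurable_cong]: "sets \<nu> = sets borel" and lat: "lattice_seq \<Psi> a" and C: "C > 0"
    and bound: "\<And>k. emeasure \<nu> (bb (a k) \<rho>) \<le> ennreal C * emeasure lborel (bb (a k) \<rho>)"
  shows "carleson_measure \<Psi> \<nu>"
proof -
  obtain r0 where inj: "inj a" and cov: "covering_radius \<Psi> a r0" using lat unfolding lattice_seq_def by blast
  have r0: "r0 > 0" "(\<Union>k. bb (a k) r0) = UNIV" "disjoint_family (\<lambda>k. bb (a k) (r0 / 2))"
    using cov unfolding covering_radius_def by auto
  have le: "r0 \<le> \<rho>" unfolding \<rho>_def by (rule covering_radius_le_max[OF inj cov])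
  then have R: "\<rho> > 0" using r0(1) by simp
  have cover: "\<exists>k. w \<in> bb (a k) \<rho>" for w
    using r0(2) bb_mono[OF le] by blast
  let ?E = "EE \<rho> ^ CARD('n)" and ?e = "ein 1" and ?m = "mball (Kell * tt \<rho>)"
  have E: "?E > 0" by (simp add: EE_def)
  have e: "0 < ?e" "?e \<le> eps1" "Kb * ?e \<le> 1" using ein[of 1] by auto
  have me: "mball ?e > 0" by (rule mball_pos[OF e(1)])
  have m: "?m > 0" by (rule mball_pos) (simp add: Kell_pos tt_pos[OF R])
  define K1 where "K1 = ?E * exp C5 / mball ?e"
  have K1: "K1 > 0" using E me by (simp add: K1_def)
  define K2 where "K2 = K1 * (C * ?m)"
  have K2: "K2 > 0" using K1 C m by (simp add: K2_def)
  define N where "N = \<bar>count_bound (\<rho> + 1) (r0 / 2)\<bar> + 1"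
  have N: "N > 0" by (simp add: N_def)
  \<comment> \<open>The centres whose enlarged balls contain w lie in one ball about w. They are
    counted by their disjoint half balls, for which a genuine covering radius r0 is used in place of
    the supremum.\<close>
  have overlap: "(\<Sum>k. indicator (bb (a k) (\<rho> + 1)) w) \<le> ennreal N" for w
  proof (rule suminf_le_const[OF summableI])
    fix n :: nat
    let ?I = "{k \<in> {..<n}. w \<in> bb (a k) (\<rho> + 1)}"
    have "(\<Sum>k<n. indicator (bb (a k) (\<rho> + 1)) w :: ennreal) = of_nat (card ?I)"
      by (simp add: indicator_def sum.If_cases Int_def)
    also have "\<dots> = ennreal (real (card (a ` ?I)))"
      using inj by (simp add: ennreal_of_nat_eq_real_of_nat card_image inj_on_subset)
    also have "\<dots> \<le> ennreal N"
    proof (rule ennreal_leI)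
      have "real (card (a ` ?I)) \<le> count_bound (\<rho> + 1) (r0 / 2)"
      proof (rule disjoint_balls_count(2))
        show "a ` ?I \<subseteq> bb w (\<rho> + 1)" using bb_sym by auto
        show "disjoint_family_on (\<lambda>s. bb s (r0 / 2)) (a ` ?I)"
          using r0(3) unfolding disjoint_family_on_def by (intro ballI impI) (elim imageE, simp, metis)
      qed (use R r0 in auto)
      then show "real (card (a ` ?I)) \<le> N" by (simp add: N_def)
    qed
    finally show "(\<Sum>k<n. indicator (bb (a k) (\<rho> + 1)) w) \<le> ennreal N" .
  qed
  show ?thesis
    unfolding carleson_measure_def
  proof (intro exI conjI ballI)
    show "K2 * N > 0" using K2 N by simp
    fix f :: "complex ^ 'n \<Rightarrow> complex" assume "f \<in> fock_space \<Psi>"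
    then have f: "entire f" by (simp add: fock_space_def)
    have [measurable]: "f \<in> borel_measurable borel" by (rule entire_imp_borel_measurable[OF f])
    define F where "F w = ennreal ((norm (f w))\<^sup>2 * exp (- \<Psi> ((norm w)\<^sup>2)))" for w
    have [measurable]: "F \<in> borel_measurable borel" unfolding F_def by measurable
    define J where "J k = (\<integral>\<^sup>+w. F w * indicator (bb (a k) (\<rho> + 1)) w \<partial>lborel)" for k
    have pt: "F w \<le> ennreal (K1 / vol (a k)) * J k" if w: "w \<in> bb (a k) \<rho>" for w k
    proof -
      have v: "vol w > 0" "vol (a k) > 0" by (auto simp: vol_pos)
      have vc: "vol (a k) \<le> ?E * vol w" by (rule vol_comparable(2)[OF w]) (use R in simp)
      \<comment> \<open>The ellipsoid of radius \<open>ein 1\<close> lies in the unit Bergman ball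
        about w, which is why the lattice balls are enlarged by exactly 1.\<close>
      have sub: "ell w ?e \<subseteq> bb (a k) (\<rho> + 1)" using ell_subset_bb[OF e, of w] bb_triangle[OF w] by blast
      have "F w * ennreal (vol w * mball ?e) = ennreal ((norm (f w))\<^sup>2 * exp (- \<Psi> ((norm w)\<^sup>2)) * (vol w * mball ?e))"
        unfolding F_def using v me by (intro ennreal_mult[symmetric]) auto
      also have "\<dots> \<le> ennreal (exp C5) * (\<integral>\<^sup>+w'. F w' * indicator (ell w ?e) w' \<partial>lborel)"
        unfolding F_def mball_def by (rule local_estimate[OF f e(1,2)])
      also have "\<dots> \<le> ennreal (exp C5) * J k"
        unfolding J_def using sub by (intro mult_left_mono nn_integral_mono) (auto simp: indicator_def)
      finally have 1: "F w * ennreal (vol w * mball ?e) \<le> ennreal (exp C5) * J k" .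
      have "F w = ennreal (1 / (vol w * mball ?e)) * (F w * ennreal (vol w * mball ?e))"
        using v me by (simp add: mult.left_commute[of _ "F w"] ennreal_mult[symmetric])
      also have "\<dots> \<le> ennreal (1 / (vol w * mball ?e)) * (ennreal (exp C5) * J k)"
        using 1 by (rule mult_left_mono) simp
      also have "\<dots> = ennreal (exp C5 / mball ?e / vol w) * J k"
      proof -
        have "ennreal (1 / (vol w * mball ?e)) * ennreal (exp C5) = ennreal (exp C5 / mball ?e / vol w)"
          using v me by (subst ennreal_mult[symmetric]) (auto simp: field_simps)
        then show ?thesis by (simp only: mult.assoc[symmetric])
      qed
      also have "\<dots> \<le> ennreal (K1 / vol (a k)) * J k"
      proof (intro mult_right_mono ennreal_leI)
        show "exp C5 / mball ?e / vol w \<le> K1 / vol (a k)" using v me vc by (simp add: K1_def field_simps)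
      qed simp
      finally show ?thesis .
    qed
    have ball: "(\<integral>\<^sup>+w. F w * indicator (bb (a k) \<rho>) w \<partial>\<nu>) \<le> ennreal K2 * J k" for k
    proof -
      have v: "vol (a k) > 0" by (rule vol_pos)
      have "(\<integral>\<^sup>+w. F w * indicator (bb (a k) \<rho>) w \<partial>\<nu>) \<le> (\<integral>\<^sup>+w. (ennreal (K1 / vol (a k)) * J k) * indicator (bb (a k) \<rho>) w \<partial>\<nu>)"
        using pt by (intro nn_integral_mono) (auto simp: indicator_def)
      also have "\<dots> = (ennreal (K1 / vol (a k)) * J k) * emeasure \<nu> (bb (a k) \<rho>)"
        by (rule nn_integral_cmult_indicator) (simp add: sets)
      also have "\<dots> \<le> (ennreal (K1 / vol (a k)) * J k) * (ennreal C * ennreal (vol (a k) * ?m))"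
        by (intro mult_left_mono order_trans[OF bound] bb_volume_upper[OF R]) auto
      also have "\<dots> = (ennreal (K1 / vol (a k)) * (ennreal C * ennreal (vol (a k) * ?m))) * J k" by (simp add: mult_ac)
      also have "ennreal (K1 / vol (a k)) * (ennreal C * ennreal (vol (a k) * ?m)) = ennreal K2"
        using v K1 C m by (simp add: ennreal_mult[symmetric] K2_def)
      finally show ?thesis .
    qed
    have "(\<integral>\<^sup>+w. F w \<partial>\<nu>) \<le> (\<integral>\<^sup>+w. (\<Sum>k. F w * indicator (bb (a k) \<rho>) w) \<partial>\<nu>)"
    proof (rule nn_integral_mono)
      fix w
      obtain k where k: "w \<in> bb (a k) \<rho>" using cover by blast
      have "(\<Sum>k\<in>{k}. F w * indicator (bb (a k) \<rho>) w) \<le> (\<Sum>k. F w * indicator (bb (a k) \<rho>) w)"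
        by (rule sum_le_suminf[OF summableI]) auto
      then show "F w \<le> (\<Sum>k. F w * indicator (bb (a k) \<rho>) w)" using k by simp
    qed
    also have "\<dots> = (\<Sum>k. \<integral>\<^sup>+w. F w * indicator (bb (a k) \<rho>) w \<partial>\<nu>)"
      by (rule nn_integral_suminf) measurable
    also have "\<dots> \<le> (\<Sum>k. ennreal K2 * J k)" by (intro suminf_le ball summableI)
    also have "\<dots> = ennreal K2 * (\<Sum>k. J k)" by simp
    also have "(\<Sum>k. J k) = (\<integral>\<^sup>+w. (\<Sum>k. F w * indicator (bb (a k) (\<rho> + 1)) w) \<partial>lborel)"
      unfolding J_def by (rule nn_integral_suminf[symmetric]) measurable
    also have "\<dots> \<le> (\<integral>\<^sup>+w. F w * ennreal N \<partial>lborel)"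
      unfolding ennreal_suminf_cmult by (intro nn_integral_mono mult_left_mono overlap) simp
    also have "\<dots> = (\<integral>\<^sup>+w. F w \<partial>lborel) * ennreal N" by (rule nn_integral_multc) measurable
    also have "(\<integral>\<^sup>+w. F w \<partial>lborel) = (\<integral>\<^sup>+w. ennreal ((norm (f w))\<^sup>2) \<partial>mu)"
      unfolding F_def by (subst nn_integral_mu) (auto simp: ennreal_mult mult.commute)
    finally have "(\<integral>\<^sup>+w. F w \<partial>\<nu>) \<le> ennreal K2 * ((\<integral>\<^sup>+w. ennreal ((norm (f w))\<^sup>2) \<partial>mu) * ennreal N)"
      by (simp add: mult_left_mono)
    also have "\<dots> = ennreal (K2 * N) * (\<integral>\<^sup>+w. ennreal ((norm (f w))\<^sup>2) \<partial>mu)"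
      using K2 N by (simp add: ennreal_mult mult_ac)
    finally show "(\<integral>\<^sup>+z. ennreal ((norm (f z))\<^sup>2 * exp (- \<Psi> ((norm z)\<^sup>2))) \<partial>\<nu>)
      \<le> ennreal (K2 * N) * (\<integral>\<^sup>+z. ennreal ((norm (f z))\<^sup>2) \<partial>mu)" unfolding F_def .
  qed
qed

theorem carleson_characterisation:
  fixes \<nu> :: "(complex ^ 'n) measure"
  assumes sets: "sets \<nu> = sets borel"
  shows "(carleson_measure \<Psi> \<nu> \<longleftrightarrow>
      (\<exists>C>0. \<forall>z. (\<integral>\<^sup>+w. ennreal ((norm (fock_kernel \<Psi> w z))\<^sup>2 / Re (fock_kernel \<Psi> z z)
                              * exp (- \<Psi> ((norm w)\<^sup>2))) \<partial>\<nu>) \<le> ennreal C))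
    \<and> (carleson_measure \<Psi> \<nu> \<longleftrightarrow>
      (\<forall>r>0. \<exists>C>0. \<forall>z. emeasure \<nu> (bb z r) \<le> ennreal C * emeasure lborel (bb z r)))
    \<and> (carleson_measure \<Psi> \<nu> \<longleftrightarrow>
      (\<exists>a. lattice_seq \<Psi> a \<and>
        (\<exists>C>0. \<forall>k. emeasure \<nu> (bb (a k) (max_covering_radius \<Psi> a))
                \<le> ennreal C * emeasure lborel (bb (a k) (max_covering_radius \<Psi> a)))))"
    (is "(?i \<longleftrightarrow> ?ii) \<and> (?i \<longleftrightarrow> ?iii) \<and> (?i \<longleftrightarrow> ?iv)")
proof -
  have 1: "?ii" if "?i"
    using carleson_imp_kernel_bound[OF sets that] unfolding fock_kernel_eq kern_diag by simp
  have 2: "?iii" if ii: "?ii"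
  proof (intro allI impI)
    fix r :: real assume r: "r > 0"
    obtain C where C: "C > 0"
      "\<And>z. (\<integral>\<^sup>+w. ennreal ((norm (kern z w))\<^sup>2 / FF ((norm z)\<^sup>2) * exp (- \<Psi> ((norm w)\<^sup>2))) \<partial>\<nu>) \<le> ennreal C"
      using ii unfolding fock_kernel_eq kern_diag by auto
    have "C / ckl > 0" using C(1) ckl_pos by simp
    then show "\<exists>C>0. \<forall>z. emeasure \<nu> (bb z r) \<le> ennreal C * emeasure lborel (bb z r)"
      by (rule small_balls_imp_all_balls[OF sets _ d2_pos r]) (rule kernel_bound_imp_small_balls[OF sets C])
  qed
  have 3: "?iv" if iii: "?iii"
  proof -
    obtain a :: "nat \<Rightarrow> complex ^ 'n" where a: "lattice_seq \<Psi> a" using lattice_exists by blast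
    then obtain r where r: "inj a" "covering_radius \<Psi> a r" unfolding lattice_seq_def by blast
    have "r > 0" using r(2) by (simp add: covering_radius_def)
    then have "max_covering_radius \<Psi> a > 0" using covering_radius_le_max[OF r] by simp
    then show ?thesis using iii a by blast
  qed
  have 4: "?i" if "?iv"
    using that lattice_bound_imp_carleson[OF sets] by blast
  show ?thesis using 1 2 3 4 by blast
qed

end

section \<open>Logarithmic growth functions\<close>

text \<open>The filter at x within the half line is nontrivial even at 0, so one-sided derivatives
  are unique there too.\<close>

lemma deriv0_eqI:
  assumes "x \<ge> 0" "(f has_real_derivative d) (at x within {0..})"
  shows "deriv0 f x = d"
  unfolding deriv0_def
proof (rule vector_derivative_within)
  have "at_right x \<le> at x within {0..}" using assms(1) by (intro at_le) auto
  then show "at x within {0..} \<noteq> bot" using trivial_limit_at_right_real[of x] by (auto simp: bot_unique)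
  show "(f has_vector_derivative d) (at x within {0..})"
    using assms(2) by (simp add: has_real_derivative_iff_has_vector_derivative)
qed

lemma has_real_derivative_deriv0:
  assumes "f differentiable_on {0..}" "x \<ge> 0"
  shows "(f has_real_derivative deriv0 f x) (at x within {0..})"
proof -
  have "f differentiable (at x within {0..})" using assms by (simp add: differentiable_on_def)
  then obtain d where "(f has_real_derivative d) (at x within {0..})" by (auto simp: real_differentiable_def)
  then show ?thesis using deriv0_eqI[OF assms(2)] by simp
qed

text \<open>The growth condition speaks only about large t. On the remaining compact interval
  \<Phi>'' is bounded, because \<Psi> is C^3, and \<Phi>' is bounded below by \<Psi>'(0).\<close>

lemma log_growth_imp_growth:
  assumes lg: "log_growth \<Psi>" and \<eta>: "\<eta> < 1 / 2"
    and O: "deriv0 (deriv0 (Phi \<Psi>)) \<in> O[at_top](\<lambda>t. t powr (-1/2) * (deriv0 (Phi \<Psi>) t) powr (1 + \<eta>))"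
  obtains P R Q Q' C1 where "growth \<Psi> P R Q Q' C1"
proof -
  define P where "P = deriv0 \<Psi>"
  define R where "R = deriv0 P"
  define T where "T = deriv0 R"
  define Q where "Q x = P x + x * R x" for x
  define Q' where "Q' x = 2 * R x + x * T x" for x
  have dPsi: "(\<Psi> has_real_derivative P x) (at x within {0..})" if "x \<ge> 0" for x
    using lg that unfolding P_def log_growth_def by (intro has_real_derivative_deriv0) auto
  have dP: "(P has_real_derivative R x) (at x within {0..})" if "x \<ge> 0" for x
    using lg that unfolding R_def P_def log_growth_def by (intro has_real_derivative_deriv0) auto
  have dR: "(R has_real_derivative T x) (at x within {0..})" if "x \<ge> 0" for x
    using lg that unfolding T_def R_def P_def log_growth_def by (intro has_real_derivative_deriv0) auto
  have cT: "continuous_on {0..} T" using lg by (simp add: log_growth_def T_def R_def P_def)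
  have P_pos: "P x > 0" and R_nn: "R x \<ge> 0" and T_nn: "T x \<ge> 0" if "x \<ge> 0" for x
    using lg that by (auto simp: log_growth_def T_def R_def P_def)
  have dQ: "(Q has_real_derivative Q' x) (at x within {0..})" if "x \<ge> 0" for x
    unfolding Q_def Q'_def using dP[OF that] dR[OF that] by (auto intro!: derivative_eq_intros)
  have Phi1: "deriv0 (Phi \<Psi>) x = Q x" if x: "x \<ge> 0" for x
  proof (rule deriv0_eqI[OF x])
    have "Phi \<Psi> = (\<lambda>x. x * P x)" by (auto simp: Phi_def P_def)
    then show "(Phi \<Psi> has_real_derivative Q x) (at x within {0..})"
      using dP[OF x] by (auto simp: Q_def intro!: derivative_eq_intros)
  qed
  have Phi2: "deriv0 (deriv0 (Phi \<Psi>)) x = Q' x" if x: "x \<ge> 0" for x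
    by (rule deriv0_eqI[OF x], rule has_field_derivative_transform_within[OF dQ[OF x], of 1]) (use x Phi1 in auto)
  have R_mono: "R x \<le> R y" if xy: "0 \<le> x" "x \<le> y" for x y
  proof -
    obtain t where t: "x \<le> t" "t \<le> y" "R y - R x = T t * (y - x)" using mvt_halfline[OF xy dR] by blast
    have "T t * (y - x) \<ge> 0" using t xy T_nn[of t] by simp
    then show ?thesis using t by simp
  qed
  have Q_ge: "Q x \<ge> P 0" if x: "x \<ge> 0" for x
  proof -
    obtain t where t: "0 \<le> t" "t \<le> x" "P x - P 0 = R t * (x - 0)" using mvt_halfline[OF order_refl x dP] by blast
    have "R t * (x - 0) \<ge> 0" using t x R_nn[of t] by simp
    then have "P 0 \<le> P x" using t by simp
    then show ?thesis using x R_nn[OF x] by (simp add: Q_def add_increasing2)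
  qed
  define q where "q = P 0"
  have q: "q > 0" by (simp add: q_def P_pos)
  obtain c where c: "c > 0" and ev: "eventually (\<lambda>t. norm (deriv0 (deriv0 (Phi \<Psi>)) t)
      \<le> c * norm (t powr (-1/2) * (deriv0 (Phi \<Psi>) t) powr (1 + \<eta>))) at_top"
    using O by (rule landau_o.bigE)
  obtain T0 where T0: "\<And>t. t \<ge> T0 \<Longrightarrow> norm (deriv0 (deriv0 (Phi \<Psi>)) t)
      \<le> c * norm (t powr (-1/2) * (deriv0 (Phi \<Psi>) t) powr (1 + \<eta>))"
    using ev unfolding eventually_at_top_linorder by blast
  define X where "X = max T0 1"
  \<comment> \<open>The factor 2 comes from sqrt (1 + t) \<le> 2 sqrt t; the power of q bounds
    Q^(\<eta> - 1/2), whose exponent is negative.\<close>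
  define c' where "c' = 2 * c * q powr (\<eta> - 1 / 2)"
  have large: "sqrt (1 + t) * Q' t \<le> c' * (Q t * sqrt (Q t))" if t: "t \<ge> X" for t
  proof -
    have t1: "t \<ge> 1" "t \<ge> T0" using t by (auto simp: X_def)
    have Qt: "Q t \<ge> q" "Q t > 0" using Q_ge[of t] q t1 by (auto simp: q_def)
    have "Q t powr (1 + \<eta>) = Q t powr (1 + 1 / 2 + (\<eta> - 1 / 2))" by (simp add: algebra_simps)
    also have "\<dots> = Q t * sqrt (Q t) * Q t powr (\<eta> - 1 / 2)"
      unfolding powr_add using Qt by (simp add: powr_half_sqrt)
    also have "\<dots> \<le> Q t * sqrt (Q t) * q powr (\<eta> - 1 / 2)"
      using Qt q \<eta> by (intro mult_left_mono powr_mono2') auto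
    finally have A: "Q t powr (1 + \<eta>) \<le> Q t * sqrt (Q t) * q powr (\<eta> - 1 / 2)" .
    have "sqrt (1 + t) \<le> sqrt (4 * t)" using t1 by (intro real_sqrt_le_mono) simp
    also have "\<dots> = 2 * sqrt t" by (simp add: real_sqrt_mult)
    finally have "sqrt (1 + t) / sqrt t \<le> 2" using t1 by (simp add: divide_le_eq)
    moreover have "t powr (-1/2) = 1 / sqrt t"
      using t1 powr_minus_divide[of t "1 / 2"] by (simp add: powr_half_sqrt)
    ultimately have s: "sqrt (1 + t) * t powr (-1/2) \<le> 2" by simp
    have "Q' t \<le> c * (t powr (-1/2) * Q t powr (1 + \<eta>))"
      using T0[OF t1(2)] Phi1[of t] Phi2[of t] t1 by simp
    then have "sqrt (1 + t) * Q' t \<le> sqrt (1 + t) * (c * (t powr (-1/2) * Q t powr (1 + \<eta>)))"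
      using t1 by (intro mult_left_mono) auto
    also have "\<dots> = c * (sqrt (1 + t) * t powr (-1/2)) * Q t powr (1 + \<eta>)" by simp
    also have "\<dots> \<le> c * 2 * (Q t * sqrt (Q t) * q powr (\<eta> - 1 / 2))"
      using s A c t1 by (intro mult_mono) auto
    also have "\<dots> = c' * (Q t * sqrt (Q t))" by (simp add: c'_def)
    finally show ?thesis .
  qed
  have "continuous_on {0..X} (\<lambda>t. sqrt (1 + t) * Q' t)"
    unfolding Q'_def
    by (intro continuous_intros continuous_on_subset[OF cT] continuous_on_subset[OF DERIV_continuous_on[of "{0..}" R T]])
      (use dR in auto)
  then have "compact ((\<lambda>t. sqrt (1 + t) * Q' t) ` {0..X})" by (rule compact_continuous_image) simp
  then have "bounded ((\<lambda>t. sqrt (1 + t) * Q' t) ` {0..X})" by (rule compact_imp_bounded)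
  then obtain M where "\<forall>y\<in>(\<lambda>t. sqrt (1 + t) * Q' t) ` {0..X}. norm y \<le> M" unfolding bounded_iff by blast
  then have M: "norm (sqrt (1 + t) * Q' t) \<le> M" if "t \<in> {0..X}" for t using that by blast
  define M' where "M' = \<bar>M\<bar> / (q * sqrt q)"
  have small: "sqrt (1 + t) * Q' t \<le> M' * (Q t * sqrt (Q t))" if t: "0 \<le> t" "t \<le> X" for t
  proof -
    have Qt: "Q t \<ge> q" using Q_ge[of t] t by (simp add: q_def)
    have "sqrt (1 + t) * Q' t \<le> \<bar>M\<bar>" using M[of t] t by auto
    also have "\<dots> = M' * (q * sqrt q)" using q by (simp add: M'_def)
    also have "\<dots> \<le> M' * (Q t * sqrt (Q t))"
    proof (rule mult_left_mono)
      show "q * sqrt q \<le> Q t * sqrt (Q t)" using Qt q by (intro mult_mono) auto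
    qed (use q in \<open>simp add: M'_def\<close>)
    finally show ?thesis .
  qed
  have nn: "c' \<ge> 0" "M' \<ge> 0" using c q by (auto simp: c'_def M'_def)
  have "growth \<Psi> P R Q Q' (c' + M' + 1)"
  proof
    show "0 < c' + M' + 1" using nn by simp
    fix x :: real assume x: "x \<ge> 0"
    show "Q' x \<ge> 0" using x R_nn T_nn by (simp add: Q'_def)
    have QQ: "Q x * sqrt (Q x) \<ge> 0" using Q_ge[OF x] q by (simp add: q_def)
    have "sqrt (1 + x) * Q' x \<le> max c' M' * (Q x * sqrt (Q x))"
    proof (cases "x \<ge> X")
      case True
      then show ?thesis using large[OF True] mult_right_mono[OF max.cobounded1 QQ, of c' M'] by linarith
    next
      case False
      then show ?thesis using small[of x] x mult_right_mono[OF max.cobounded2 QQ, of M' c'] by linarith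
    qed
    also have "\<dots> \<le> (c' + M' + 1) * (Q x * sqrt (Q x))" using nn QQ by (intro mult_right_mono) auto
    finally show "sqrt (1 + x) * Q' x \<le> (c' + M' + 1) * (Q x * sqrt (Q x))" .
  qed (use dPsi dP dQ R_nn R_mono P_pos in \<open>auto simp: Q_def[abs_def]\<close>)
  then show ?thesis by (rule that)
qed

theorem theoremD:
  fixes \<Psi> :: "real \<Rightarrow> real" and \<nu> :: "(complex ^ 'n) measure"
  assumes "log_growth \<Psi>"
    and "\<exists>\<eta><1/2.
      deriv0 (deriv0 (Phi \<Psi>))
        \<in> O[at_top](\<lambda>t. t powr (-1/2) * (deriv0 (Phi \<Psi>) t) powr (1 + \<eta>)) \<and>
      (CARD('n) > 1 \<longrightarrow>
        deriv0 (deriv0 \<Psi>)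
          \<in> O[at_top](\<lambda>t. t powr (-1/2) * (deriv0 \<Psi> t) powr (1 + \<eta>)))"
    and "sets \<nu> = sets borel"
  shows "(carleson_measure \<Psi> \<nu> \<longleftrightarrow>
      (\<exists>C>0. \<forall>z. (\<integral>\<^sup>+w. ennreal ((norm (fock_kernel \<Psi> w z))\<^sup>2 / Re (fock_kernel \<Psi> z z)
                              * exp (- \<Psi> ((norm w)\<^sup>2))) \<partial>\<nu>) \<le> ennreal C))
    \<and> (carleson_measure \<Psi> \<nu> \<longleftrightarrow>
      (\<forall>r>0. \<exists>C>0. \<forall>z. emeasure \<nu> (bergman_ball \<Psi> z r)
                          \<le> ennreal C * emeasure lborel (bergman_ball \<Psi> z r)))
    \<and> (carleson_measure \<Psi> \<nu> \<longleftrightarrow>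
      (\<exists>a. lattice_seq \<Psi> a \<and>
        (\<exists>C>0. \<forall>k. emeasure \<nu> (bergman_ball \<Psi> (a k) (max_covering_radius \<Psi> a))
                \<le> ennreal C * emeasure lborel (bergman_ball \<Psi> (a k) (max_covering_radius \<Psi> a)))))"
proof -
  obtain \<eta> where \<eta>: "\<eta> < 1 / 2"
    "deriv0 (deriv0 (Phi \<Psi>)) \<in> O[at_top](\<lambda>t. t powr (-1/2) * (deriv0 (Phi \<Psi>) t) powr (1 + \<eta>))"
    using assms(2) by blast
  obtain P R Q Q' C1 where "growth \<Psi> P R Q Q' C1"
    using log_growth_imp_growth[OF assms(1) \<eta>] by blast
  then interpret fock_growth \<Psi> P R Q Q' C1 "TYPE('n)" by (simp add: fock_growth_def)
  obtain cm CM where c: "cm > 0" "CM > 0" "\<And>x. x \<ge> 0 \<Longrightarrow> cm * Q x \<le> N1 x" "\<And>x. x \<ge> 0 \<Longrightarrow> N1 x \<le> CM * Q x"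
    using N1_comparable by blast
  obtain cF where cF: "cF > 0" "\<And>x. x \<ge> 0 \<Longrightarrow> cF * VV x * exp (\<Psi> x) \<le> FF x"
    using FF_lower by blast
  interpret fock_metric \<Psi> P R Q Q' C1 "TYPE('n)" cm CM cF
    by unfold_locales (use c cF in auto)
  show ?thesis by (rule carleson_characterisation[OF assms(3)])
qed

end
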